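(* Let $(w_n)_{n\ge 0}$ be a sequence of positive integers and $(a_{n,i})_{n\ge 0,\,1\le i\le w_n-1}$ a family of positive integers. Define $h_0=1$ and $h_{n+1}=w_nh_n+\sum_{j=1}^{w_n-1}a_{n,j}$, assume $\sum_{n\ge 1}\frac{1}{w_nh_n}\sum_{j=1}^{w_n-1}a_{n,j}<\infty$, and define words on the alphabet $\{0,1\}$ by $B_0=0$ and $$B_{n+1}=B_n1^{a_{n,1}}B_n1^{a_{n,2}}\cdots B_n1^{a_{n,w_n-1}}B_n,$$ where $1^{a}$ denotes the word consisting of $a$ ones. Let $X\subset\{0,1\}^{\mathbb Z_+}$ be the set of sequences $(x_m)$ such that for every $s<t$ the block $(x_s,\dots,x_t)$ is a subword of some $B_n$, and let $T$ be the shift on $X$. Assume there is a constant $C$ with $w_n<C$ and $a_{n,j}<C$ for all $n,j$. Then $(X,T)$ has the Moebius orthogonality property: for every continuous function $\varphi$ on $X$ and every $x\in X$, $$\lim_{N\to\infty}\frac1N\sum_{n=1}^N\mu(n)\varphi(T^nx)=0,$$ where $\mu$ is the Moebius function.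
   Context: $(X,T)$ is the standard symbolic model of a rank-one system with cutting parameters $w_n$ and spacer parameters $a_{n,i}$. $\mathbb Z_+$ denotes the positive integers. *)

theory Defs
  imports
    "HOL-Analysis.Analysis"
    "HOL-Library.Sublist"
    "HOL-Computational_Algebra.Squarefree"
begin

definition moebius_mu :: "nat \<Rightarrow> int" where
  "moebius_mu n = (if squarefree n then (-1) ^ card (prime_factors n) else 0)"

text \<open>
  Throughout, \<open>w n\<close> is the number of copies of the \<open>n\<close>-th word used at step \<open>n\<close>, and \<open>a n j\<close>
  is the number of spacers placed after the \<open>j\<close>-th copy; only the indices \<open>1 \<le> j \<le> w n - 1\<close> are
  ever used, the values of \<open>a n\<close> elsewhere being junk.
\<close>

primrec rank_one_height :: "(nat \<Rightarrow> nat) \<Rightarrow> (nat \<Rightarrow> nat \<Rightarrow> nat) \<Rightarrow> nat \<Rightarrow> nat" where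
  "rank_one_height w a 0 = 1"
| "rank_one_height w a (Suc n) = w n * rank_one_height w a n + (\<Sum>j=1..w n - 1. a n j)"

primrec rank_one_word :: "(nat \<Rightarrow> nat) \<Rightarrow> (nat \<Rightarrow> nat \<Rightarrow> nat) \<Rightarrow> nat \<Rightarrow> nat list" where
  "rank_one_word w a 0 = [0]"
| "rank_one_word w a (Suc n) =
     concat (map (\<lambda>j. rank_one_word w a n @ replicate (a n j) 1) [1..<w n]) @ rank_one_word w a n"

text \<open>
  Sequences indexed by the positive integers are functions on \<^typ>\<open>nat\<close> that are extensional on
  \<open>{1..}\<close>, i.e. points of the library's product topology over that index set.
\<close>

definition rank_one_space :: "(nat \<Rightarrow> nat) \<Rightarrow> (nat \<Rightarrow> nat \<Rightarrow> nat) \<Rightarrow> (nat \<Rightarrow> nat) set" where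
  "rank_one_space w a =
     {x \<in> {1..} \<rightarrow>\<^sub>E {0, 1}.
        \<forall>s t. 1 \<le> s \<and> s < t \<longrightarrow> (\<exists>n. sublist (map x [s..<Suc t]) (rank_one_word w a n))}"

definition rank_one_topology :: "(nat \<Rightarrow> nat) \<Rightarrow> (nat \<Rightarrow> nat \<Rightarrow> nat) \<Rightarrow> (nat \<Rightarrow> nat) topology" where
  "rank_one_topology w a =
     subtopology (product_topology (\<lambda>_. discrete_topology {0, 1}) {1..}) (rank_one_space w a)"

definition shift :: "(nat \<Rightarrow> nat) \<Rightarrow> nat \<Rightarrow> nat" where
  "shift x = (\<lambda>m\<in>{1..}. x (m + 1))"

definition moebius_orthogonal :: "'a topology \<Rightarrow> ('a \<Rightarrow> 'a) \<Rightarrow> bool" where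
  "moebius_orthogonal X T \<longleftrightarrow>
     (\<forall>\<phi> :: 'a \<Rightarrow> complex. continuous_map X euclidean \<phi> \<longrightarrow>
        (\<forall>x \<in> topspace X.
           (\<lambda>N. 1 / of_nat N * (\<Sum>n=1..N. of_int (moebius_mu n) * \<phi> ((T ^^ n) x)))
             \<longlonglongrightarrow> 0))"

lemma topspace_rank_one_topology: "topspace (rank_one_topology w a) = rank_one_space w a"
  by (auto simp: rank_one_topology_def rank_one_space_def)

lemma length_rank_one_word:
  assumes "\<And>n. w n > 0"
  shows "length (rank_one_word w a n) = rank_one_height w a n"
proof (induction n)
  case (Suc n)
  have set_eq: "{1..<w n} = {1..w n - 1}"
    using assms[of n] by auto
  obtain k where k: "w n = Suc k"
    using assms[of n] gr0_implies_Suc by blast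
  have "length (rank_one_word w a (Suc n)) =
      (\<Sum>j\<in>{1..<w n}. rank_one_height w a n + a n j) + rank_one_height w a n"
    by (simp add: length_concat comp_def Suc sum_set_upt_conv_sum_list_nat [symmetric] del: upt_Suc)
  also have "\<dots> = rank_one_height w a (Suc n)"
    unfolding set_eq by (simp add: sum.distrib k)
  finally show ?case .
qed simp

lemma shift_rank_one_space:
  assumes "x \<in> rank_one_space w a"
  shows "shift x \<in> rank_one_space w a"
proof -
  have block: "map (shift x) [s..<Suc t] = map x [Suc s..<Suc (Suc t)]" if "1 \<le> s" for s t
    using that by (intro nth_equalityI) (auto simp: shift_def simp del: upt_Suc)
  have "x (m + 1) \<in> {0, 1}" for m
    using assms PiE_mem[of x "{1..}" "\<lambda>_. {0, 1}" "m + 1"] by (simp add: rank_one_space_def)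
  then have "shift x \<in> {1..} \<rightarrow>\<^sub>E {0, 1}"
    unfolding shift_def by (intro restrict_PiE_iff[THEN iffD2] ballI)
  moreover have "\<exists>n. sublist (map (shift x) [s..<Suc t]) (rank_one_word w a n)"
    if "1 \<le> s" "s < t" for s t
  proof -
    have "1 \<le> Suc s" "Suc s < Suc t"
      using that by auto
    then show ?thesis
      using assms unfolding rank_one_space_def block[OF that(1)] by blast
  qed
  ultimately show ?thesis
    unfolding rank_one_space_def by blast
qed

end

theory Submission
  imports Defs "HOL-Number_Theory.Number_Theory" "HOL-Complex_Analysis.Complex_Analysis"
    "HOL-Computational_Algebra.Fundamental_Theorem_Algebra" "HOL-Real_Asymp.Real_Asymp"
begin

text \<open>
  By compactness it suffices to treat \<open>f n = F (x\<^sub>n\<^sub>+\<^sub>1 \<dots> x\<^sub>n\<^sub>+\<^sub>L)\<close>. If the numbers of spacers between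
  consecutive copies of \<open>B\<^sub>n\<close> are eventually constant, the rank-one word is periodic and the claim is the
  prime number theorem in arithmetic progressions (in the form that the Moebius function is orthogonal to
  periodic sequences).

  Otherwise let \<open>C(t)\<close> be a limit of the correlations \<open>1/N \<Sum> f(pm + a) cnj f(qm + b)\<close>, which
  only depend on \<open>t = qa - pb\<close>. Shifting \<open>f\<close> by \<open>r\<close> copies of \<open>B\<^sub>n\<close> amounts, on average, to shifting it
  by the random number of spacers met on the way; comparing the shift by \<open>p\<close> copies in one factor with the
  shift by \<open>q\<close> copies in the other yields a linear recurrence for \<open>C\<close> with constant coefficients. It is
  nontrivial because the spacers are not constant and \<open>p\<close> exceeds their bound \<open>G\<close>. A bounded solution of such
  a recurrence is a combination of exponentials \<open>z\<^sup>t\<close>. The shift by a single copy writes a unimodular number as a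
  convex combination of the \<open>z\<^sup>-\<^sup>q\<^sup>s\<close> with at least two positive weights, so \<open>z\<^sup>q\<^sup>d = 1\<close> for some
  \<open>1 \<le> d \<le> G\<close>, and \<open>C\<close> has period \<open>qM\<close>, \<open>M = G!\<close>; so the correlations of \<open>f(n) - f(n + M)\<close> vanish.
  Hence Katai's criterion applies to \<open>f(n) - f(n + M)\<close>. Finally, the averages of \<open>f\<close> over long progressions
  of difference \<open>M\<close> are uniformly close to an \<open>M\<close>-periodic sequence, as the means of \<open>f(n) \<zeta>\<^sup>n\<close>,
  \<open>\<zeta>\<^sup>M = 1\<close>, converge uniformly over windows.
\<close>

section \<open>Katai's criterion\<close>

text \<open>Katai's criterion cannot be applied to \<open>f\<close> itself: if all spacer numbers
  are odd, the zeros of the infinite word occupy positions of one parity, and correlations along p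
  and q caused by such a periodic factor persist. Subtracting the shift by M removes this
  obstruction. It matters that M depends on G only, since the criterion needs one function for all
  pairs of primes; the period qM of \<open>C\<close> is exactly the effect on qa - pb of shifting a
  by M.

  The averaging over spacers requires no genericity of the point: for a fixed offset inside a copy,
  the letter found r copies later depends on the index of the copy only through the number of
  spacers in between, so the sum over the copies factorises. This concerns autocorrelations of
  \<open>f\<close>. A Bessel inequality carries it over to correlations with any bounded sequence,
  in particular with f(qm + b) placed on the multiples of p.

  Limits are taken first in the length N, then along levels where the spacers vary. The weights
  survive the second limit because their lower bounds are uniform: the decisive patterns recur with
  a period at most G^J, where J depends on p alone.\<close>

lemma moebius_mu_1 [simp]: "moebius_mu (Suc 0) = 1"
  by (simp add: moebius_mu_def)

lemma abs_moebius_mu_le: "\<bar>moebius_mu n\<bar> \<le> 1"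
  by (simp add: moebius_mu_def)

lemma norm_moebius_mu_le: "norm (of_int (moebius_mu n) :: complex) \<le> 1"
  using abs_moebius_mu_le[of n] by (metis norm_of_int of_int_1 of_int_le_iff of_int_abs)

lemma moebius_mu_prime_mult:
  assumes p: "prime p" and n: "\<not> p dvd n"
  shows "moebius_mu (p * n) = - moebius_mu n"
proof -
  have n0: "n \<noteq> 0" using n by (metis dvd_0_right)
  have cop: "coprime p n" using p n by (simp add: prime_imp_coprime)
  have sq: "squarefree (p * n) \<longleftrightarrow> squarefree n"
    using cop p squarefree_prime squarefree_mult_coprime squarefree_multD(2) by blast
  have pf: "prime_factors (p * n) = insert p (prime_factors n)"
    using p n0 by (subst prime_factors_product) (auto simp: prime_factorization_prime)
  have "p \<notin> prime_factors n" using n by auto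
  then show ?thesis unfolding moebius_mu_def sq pf by simp
qed

lemma moebius_mu_prime_mult_dvd:
  assumes p: "prime p" and n: "p dvd n"
  shows "moebius_mu (p * n) = 0"
proof -
  have "p^2 dvd p * n" using n by (simp add: power2_eq_square)
  then have "\<not> squarefree (p * n)" using p
    by (meson not_prime_unit squarefreeD)
  then show ?thesis by (simp add: moebius_mu_def)
qed

section \<open>Divergence of the sum of prime reciprocals\<close>

text \<open>Euler's product, truncated at \<open>N\<close> to stay with finite sums. A number with
  prime factors in \<open>insert p P\<close> either is free of \<open>p\<close> or is
  \<open>p\<close> times a number of the same kind; hence S <= T + S / p, which is solved for
  S.\<close>

lemma prime_reciprocal_euler_bound:
  assumes "finite P" "\<And>p. p \<in> P \<Longrightarrow> prime p"
  shows "(\<Sum>n | n \<in> {1..N} \<and> prime_factors n \<subseteq> P. 1 / real n) \<le> (\<Prod>p\<in>P. 1 / (1 - 1 / real p))"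
  using assms
proof (induction P rule: finite_induct)
  case empty
  have "{n. n \<in> {1..N} \<and> prime_factors n \<subseteq> {}} \<subseteq> {1}"
  proof
    fix n assume "n \<in> {n. n \<in> {1..N} \<and> prime_factors n \<subseteq> {}}"
    then have "n \<ge> 1" "prime_factors n = {}" by auto
    then have "n = 1"
      by (metis in_prime_factors_iff empty_iff less_one not_less prime_factor_nat not_one_le_zero)
    then show "n \<in> {1}" by simp
  qed
  then have "(\<Sum>n | n \<in> {1..N} \<and> prime_factors n \<subseteq> {}. 1 / real n) \<le> (\<Sum>n\<in>{1}. 1 / real n)"
    by (intro sum_mono2) auto
  then show ?case by simp
next
  case (insert p P)
  let ?S = "{n. n \<in> {1..N} \<and> prime_factors n \<subseteq> insert p P}"
  let ?T = "{n. n \<in> {1..N} \<and> prime_factors n \<subseteq> P}"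
  have p: "prime p" using insert by auto
  have p2: "real p \<ge> 2" using prime_ge_2_nat[OF p] by simp
  have sub: "?S \<subseteq> ?T \<union> (\<lambda>n. p * n) ` ?S"
  proof
    fix n assume n: "n \<in> ?S"
    show "n \<in> ?T \<union> (\<lambda>n. p * n) ` ?S"
    proof (cases "p dvd n")
      case True
      then obtain m where m: "n = p * m" by auto
      then have "m \<noteq> 0" "m \<le> n" using n p prime_gt_0_nat[OF p] by auto
      moreover have "prime_factors m \<subseteq> prime_factors n"
        using m n by (intro dvd_prime_factors) auto
      ultimately have "m \<in> ?S" using n by auto
      then show ?thesis using m by blast
    next
      case False
      then have "p \<notin> prime_factors n" by auto
      then show ?thesis using n by auto
    qed
  qed
  have "(\<Sum>n\<in>?S. 1 / real n) \<le> (\<Sum>n\<in>?T \<union> (\<lambda>n. p * n) ` ?S. 1 / real n)"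
    by (intro sum_mono2 sub) auto
  also have "\<dots> \<le> (\<Sum>n\<in>?T. 1 / real n) + (\<Sum>n\<in>(\<lambda>n. p * n) ` ?S. 1 / real n)"
    by (subst sum_Un) (auto intro!: sum_nonneg)
  also have "(\<Sum>n\<in>(\<lambda>n. p * n) ` ?S. 1 / real n) = (1 / p) * (\<Sum>n\<in>?S. 1 / real n)"
    using prime_gt_0_nat[OF p]
    by (subst sum.reindex) (auto simp: inj_on_def sum_distrib_left)
  finally have "(\<Sum>n\<in>?S. 1 / real n) * (1 - 1 / p) \<le> (\<Sum>n\<in>?T. 1 / real n)"
    by (simp add: algebra_simps)
  also have "\<dots> \<le> (\<Prod>p\<in>P. 1 / (1 - 1 / real p))" using insert by auto
  finally have "(\<Sum>n\<in>?S. 1 / real n) \<le> (\<Prod>p\<in>P. 1 / (1 - 1 / real p)) / (1 - 1 / p)"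
    using p2 by (subst pos_le_divide_eq) auto
  then show ?case using insert by simp
qed

text \<open>All prime factors of n <= N are at most N, so the Euler product over these primes
  dominates the harmonic sum. The factor 2 comes from 1 / (1 - x) <= 1 + 2 x <= exp (2 x) for 0 < x
  <= 1/2.\<close>

lemma harm_le_exp_sum_prime_reciprocals:
  "(\<Sum>n=1..N. 1 / real n) \<le> exp (2 * (\<Sum>p | prime p \<and> p \<le> N. 1 / real p))"
proof -
  let ?P = "{p. prime p \<and> p \<le> N}"
  have fin: "finite ?P" by (rule finite_subset[of _ "{..N}"]) auto
  have eq: "{n. n \<in> {1..N} \<and> prime_factors n \<subseteq> ?P} = {1..N}"
    by (auto simp: in_prime_factors_iff dest!: dvd_imp_le)
  have "(\<Sum>n=1..N. 1 / real n) \<le> (\<Prod>p\<in>?P. 1 / (1 - 1 / real p))"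
    using prime_reciprocal_euler_bound[OF fin, of N] unfolding eq by auto
  also have "\<dots> \<le> (\<Prod>p\<in>?P. exp (2 * (1 / real p)))"
  proof (intro prod_mono conjI)
    fix p assume "p \<in> ?P"
    then have p2: "real p \<ge> 2" using prime_ge_2_nat[of p] by simp
    define x where "x = 1 / real p"
    have x: "0 < x" "x \<le> 1/2" using p2 by (auto simp: x_def field_simps)
    show "0 \<le> 1 / (1 - 1 / real p)" using p2 by auto
    have "1 / (1 - x) \<le> 1 + 2 * x"
    proof -
      have "x * (1 - 2 * x) \<ge> 0" using x by auto
      then have "1 \<le> (1 + 2 * x) * (1 - x)" by (simp add: algebra_simps)
      then show ?thesis using x by (simp add: divide_le_eq)
    qed
    also have "\<dots> \<le> exp (2 * x)" by (rule exp_ge_add_one_self)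
    finally show "1 / (1 - 1 / real p) \<le> exp (2 * (1 / real p))" by (simp add: x_def)
  qed
  also have "\<dots> = exp (2 * (\<Sum>p | prime p \<and> p \<le> N. 1 / real p))"
    using fin by (simp add: exp_sum sum_distrib_left)
  finally show ?thesis .
qed

text \<open>Divergence of the harmonic series forces divergence over the primes. The primes up to
  \<open>c\<close> contribute a bounded amount, which \<open>B'\<close> adds to the target
  beforehand.\<close>

lemma prime_reciprocals_unbounded:
  obtains P where "finite P" "\<And>p. p \<in> P \<Longrightarrow> prime p \<and> p > c" "(\<Sum>p\<in>P. 1 / real p) \<ge> B"
proof -
  define B' where "B' = B + (\<Sum>p\<in>{..c}. 1 / real p)"
  have "filterlim (\<lambda>N. harm N :: real) at_top sequentially" by (rule harm_at_top)
  then obtain N where N: "harm N \<ge> exp (2 * B')"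
    unfolding filterlim_at_top eventually_sequentially by blast
  have "harm N = (\<Sum>n=1..N. 1 / real n)" by (simp add: harm_def divide_inverse)
  with N harm_le_exp_sum_prime_reciprocals[of N]
  have "exp (2 * B') \<le> exp (2 * (\<Sum>p | prime p \<and> p \<le> N. 1 / real p))" by (metis order_trans)
  then have 1: "B' \<le> (\<Sum>p | prime p \<and> p \<le> N. 1 / real p)" by simp
  let ?P = "{p. prime p \<and> p \<le> N \<and> p > c}"
  have fin: "finite {p. prime p \<and> p \<le> N}" by (rule finite_subset[of _ "{..N}"]) auto
  have fin2: "finite ?P" by (rule finite_subset[OF _ fin]) auto
  have "(\<Sum>p | prime p \<and> p \<le> N. 1 / real p) \<le> (\<Sum>p\<in>?P \<union> {..c}. 1 / real p)"
    using fin2 by (intro sum_mono2) auto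
  also have "\<dots> \<le> (\<Sum>p\<in>?P. 1 / real p) + (\<Sum>p\<in>{..c}. 1 / real p)"
    using fin2 by (subst sum_Un) (auto intro!: sum_nonneg)
  finally have ge: "(\<Sum>p\<in>?P. 1 / real p) \<ge> B" using 1 by (simp add: B'_def)
  show ?thesis by (rule that[OF fin2 _ ge]) simp
qed

section \<open>The variance of the number of prime divisors\<close>

lemma card_multiples_le:
  assumes "d > 0"
  shows "card {n \<in> {1..N}. d dvd n} = N div d"
proof -
  have "{n \<in> {1..N}. d dvd n} = (\<lambda>m. d * m) ` {1..N div d}"
    using assms by (auto simp: image_iff less_eq_div_iff_mult_less_eq mult.commute elim!: dvdE)
  moreover have "inj_on (\<lambda>m. d * m) {1..N div d}" using assms by (auto simp: inj_on_def)
  ultimately show ?thesis by (simp add: card_image)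
qed

text \<open>Expanding the square needs only a lower bound of the first moment and an upper bound of
  the second. Distinct primes p and q both divide n iff p q does, so the off-diagonal terms give N
  A^2, which cancels against the first moment; there remain the diagonal N A and the rounding error
  of the first moment.\<close>

lemma turan_kubilius:
  fixes P :: "nat set"
  assumes fin: "finite P" and P: "\<And>p. p \<in> P \<Longrightarrow> prime p"
  defines "A \<equiv> (\<Sum>p\<in>P. 1 / real p)"
  shows "(\<Sum>n=1..N. ((\<Sum>p\<in>P. of_bool (p dvd n)) - A)\<^sup>2) \<le> real N * A + 2 * A * card P"
proof -
  let ?\<omega> = "\<lambda>n. \<Sum>p\<in>P. of_bool (p dvd n) :: real"
  have cnt: "(\<Sum>n=1..N. of_bool (d dvd n) :: real) = N div d" if "d > 0" for d :: nat
    using card_multiples_le[OF that, of N] by (simp add: Int_def of_bool_def sum.If_cases)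
  have le: "real (N div d) \<le> N / d" if "d > 0" for d :: nat
    by (rule of_nat_div_le_of_nat)
  have A0: "A \<ge> 0" unfolding A_def by (intro sum_nonneg) auto
  have 1: "(\<Sum>n=1..N. ?\<omega> n) \<ge> N * A - card P"
  proof -
    have "(\<Sum>n=1..N. ?\<omega> n) = (\<Sum>p\<in>P. real (N div p))"
      by (subst sum.swap, intro sum.cong refl, subst cnt) (auto dest: P prime_gt_0_nat)
    also have "\<dots> \<ge> (\<Sum>p\<in>P. real N / p - 1)"
    proof (intro sum_mono)
      fix p assume "p \<in> P"
      then have p: "p > 0" using P prime_gt_0_nat by blast
      have "real N = p * real (N div p) + real (N mod p)" by (metis mult_div_mod_eq of_nat_add of_nat_mult)
      moreover have "real (N mod p) \<le> p" using p by (simp add: less_imp_le)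
      ultimately show "real N / p - 1 \<le> real (N div p)" using p by (simp add: field_simps)
    qed
    finally show ?thesis by (simp add: A_def sum_subtractf sum_distrib_left)
  qed
  have 2: "(\<Sum>n=1..N. (?\<omega> n)\<^sup>2) \<le> N * A\<^sup>2 + N * A"
  proof -
    have "(\<Sum>n=1..N. (?\<omega> n)\<^sup>2) = (\<Sum>n=1..N. \<Sum>p\<in>P. \<Sum>q\<in>P. of_bool (p dvd n) * of_bool (q dvd n))"
      by (simp add: power2_eq_square sum_product)
    also have "\<dots> = (\<Sum>p\<in>P. \<Sum>q\<in>P. \<Sum>n=1..N. of_bool (p dvd n) * of_bool (q dvd n))"
      by (subst sum.swap, rule sum.cong[OF refl], rule sum.swap)
    also have "\<dots> \<le> (\<Sum>p\<in>P. \<Sum>q\<in>P. N / (p * q) + of_bool (p = q) * (N / p))"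
    proof (intro sum_mono)
      fix p q assume pq: "p \<in> P" "q \<in> P"
      have pos: "p > 0" "q > 0" using pq P prime_gt_0_nat by blast+
      show "(\<Sum>n=1..N. of_bool (p dvd n) * of_bool (q dvd n) :: real) \<le> N / (p * q) + of_bool (p = q) * (N / p)"
      proof (cases "p = q")
        case True
        have "(\<Sum>n=1..N. of_bool (p dvd n) * of_bool (q dvd n) :: real) = (\<Sum>n=1..N. of_bool (p dvd n))"
          using True by (intro sum.cong) auto
        also have "\<dots> \<le> N / p" using cnt[OF pos(1)] le[OF pos(1)] by simp
        finally show ?thesis using True by (simp add: add_increasing)
      next
        case False
        then have "coprime p q" using pq P primes_coprime by blast
        then have "(\<Sum>n=1..N. of_bool (p dvd n) * of_bool (q dvd n) :: real) = (\<Sum>n=1..N. of_bool (p * q dvd n))"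
          by (intro sum.cong refl) (auto simp: divides_mult dest: dvd_mult_left dvd_mult_right)
        also have "\<dots> \<le> N / (p * q)" using cnt[of "p*q"] le[of "p*q"] pos by simp
        finally show ?thesis using False by simp
      qed
    qed
    also have "\<dots> = N * A\<^sup>2 + N * A"
    proof -
      have "(\<Sum>p\<in>P. \<Sum>q\<in>P. real N / (p * q)) = N * A\<^sup>2"
        unfolding A_def power2_eq_square sum_product by (simp add: sum_distrib_left)
      moreover have "(\<Sum>p\<in>P. \<Sum>q\<in>P. of_bool (p = q) * (real N / p)) = N * A"
      proof -
        have "(\<Sum>p\<in>P. \<Sum>q\<in>P. of_bool (p = q) * (real N / p)) = (\<Sum>p\<in>P. \<Sum>q\<in>P. if p = q then real N / p else 0)"
          by (intro sum.cong refl) auto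
        then show ?thesis using fin by (simp add: A_def sum_distrib_left)
      qed
      ultimately show ?thesis by (simp add: sum.distrib)
    qed
    finally show ?thesis .
  qed
  have "(\<Sum>n=1..N. (?\<omega> n - A)\<^sup>2) = (\<Sum>n=1..N. (?\<omega> n)\<^sup>2) - 2 * A * (\<Sum>n=1..N. ?\<omega> n) + N * A\<^sup>2"
    by (simp add: power2_diff sum.distrib sum_subtractf sum_distrib_left algebra_simps)
  also have "\<dots> \<le> (N * A\<^sup>2 + N * A) - 2 * A * (N * A - card P) + N * A\<^sup>2"
    using 1 2 A0 by (intro add_mono diff_mono mult_left_mono) auto
  also have "\<dots> = N * A + 2 * A * card P" by (simp add: algebra_simps power2_eq_square)
  finally show ?thesis .
qed

text \<open>The correlation sums in Katai's criterion stop at N div r and must be small relative to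
  N. Where N div r stays below the threshold \<open>K\<close>, the constant \<open>B\<close> bounds
  the sum.\<close>

lemma average_div_small:
  fixes u :: "nat \<Rightarrow> complex"
  assumes u: "(\<lambda>N. 1 / of_nat N * u N) \<longlonglongrightarrow> 0" and "\<delta> > 0"
  shows "eventually (\<lambda>N. norm (u (N div r)) \<le> \<delta> * real N) sequentially"
proof -
  from tendstoD[OF u \<open>\<delta> > 0\<close>] obtain K where K: "\<And>N. N \<ge> K \<Longrightarrow> norm (1 / of_nat N * u N) < \<delta>"
    unfolding eventually_sequentially by auto
  define B where "B = (\<Sum>i\<le>K. norm (u i))"
  have B: "norm (u i) \<le> B" if "i \<le> K" for i
    unfolding B_def using that by (intro member_le_sum) auto
  obtain N0 where N0: "B / \<delta> \<le> real N0" using real_arch_simple by blast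
  show ?thesis unfolding eventually_sequentially
  proof (intro exI[of _ N0] allI impI)
    fix N assume N: "N \<ge> N0"
    show "norm (u (N div r)) \<le> \<delta> * real N"
    proof (cases "N div r \<le> K")
      case True
      have "B \<le> \<delta> * real N0" using N0 \<open>\<delta> > 0\<close> by (simp add: field_simps)
      also have "\<dots> \<le> \<delta> * N" using N \<open>\<delta> > 0\<close> by simp
      finally show ?thesis using B[OF True] by simp
    next
      case False
      then have "norm (u (N div r)) < \<delta> * real (N div r)" using K[of "N div r"]
        by (simp add: norm_mult norm_divide field_simps split: if_splits)
      also have "\<dots> \<le> \<delta> * real N" using \<open>\<delta> > 0\<close> by simp
      finally show ?thesis by simp
    qed
  qed
qed

lemma norm_sum_le_sqrt:
  fixes g :: "'a \<Rightarrow> complex"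
  assumes "\<And>m. m \<in> S \<Longrightarrow> norm (u m) \<le> (1::real)"
  shows "norm (\<Sum>m\<in>S. u m * g m) \<le> sqrt (real (card S) * (\<Sum>m\<in>S. (norm (g m))\<^sup>2))"
proof -
  have "norm (\<Sum>m\<in>S. u m * g m) \<le> (\<Sum>m\<in>S. norm (g m))"
  proof (rule order_trans[OF norm_sum], rule sum_mono)
    fix m assume "m \<in> S"
    then show "norm (u m * g m) \<le> norm (g m)"
      using assms mult_right_mono[of "norm (u m)" 1 "norm (g m)"] by (simp add: norm_mult)
  qed
  also have "\<dots> \<le> sqrt (real (card S) * (\<Sum>m\<in>S. (norm (g m))\<^sup>2))"
    using sum_squared_le_sum_of_squares[of "\<lambda>m. norm (g m)" S]
    by (intro real_le_rsqrt) (simp add: mult.commute)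
  finally show ?thesis .
qed

text \<open>Weight n by the number of its prime divisors in \<open>P\<close>. By Turan-Kubilius this
  weight is nearly the constant \<open>A\<close>, and by multiplicativity the weighted sum is, up to
  sign and a small error, the sum of mu(m) f(p m) over p and m. With m as outer variable,
  Cauchy-Schwarz eliminates mu and leaves the correlations of f(p m) and f(q m).\<close>

theorem katai_criterion:
  fixes f :: "nat \<Rightarrow> complex"
  assumes bound: "\<And>n. norm (f n) \<le> 1"
    and corr: "\<And>p q. prime p \<Longrightarrow> prime q \<Longrightarrow> p > c \<Longrightarrow> q > c \<Longrightarrow> p \<noteq> q \<Longrightarrow>
      (\<lambda>N. 1 / of_nat N * (\<Sum>n=1..N. f (p * n) * cnj (f (q * n)))) \<longlonglongrightarrow> 0"
  shows "(\<lambda>N. 1 / of_nat N * (\<Sum>n=1..N. of_int (moebius_mu n) * f n)) \<longlonglongrightarrow> 0"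
proof (rule tendstoI)
  fix e :: real assume e: "e > 0"
  \<comment> \<open>With p > 4 / e the terms with \<open>p dvd m\<close>, where mu (p m) differs
    from - mu m, cost at most N / p * e / 4 for each p.\<close>
  define c' where "c' = max c (nat \<lceil>4 / e\<rceil>)"
  \<comment> \<open>The lower bound 2 (8 / e)^2 for \<open>A\<close> gives 2 sqrt (2 A) <= A e / 4,
    so the two Cauchy-Schwarz errors N sqrt (2 A) become small after division by A.\<close>
  obtain P where fin: "finite P" and P: "\<And>p. p \<in> P \<Longrightarrow> prime p \<and> p > c'"
    and PB: "(\<Sum>p\<in>P. 1 / real p) \<ge> max 1 (2 * (8 / e)\<^sup>2)"
    using prime_reciprocals_unbounded[of c' "max 1 (2 * (8 / e)\<^sup>2)"] by blast
  define A where "A = (\<Sum>p\<in>P. 1 / real p)"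
  have A1: "A \<ge> 1" and A2: "A \<ge> 2 * (8 / e)\<^sup>2" using PB by (auto simp: A_def)
  have pos: "p > 0" if "p \<in> P" for p using P[OF that] by auto
  define \<mu> :: "nat \<Rightarrow> complex" where "\<mu> = (\<lambda>n. of_int (moebius_mu n))"
  have \<mu>: "norm (\<mu> n) \<le> 1" for n unfolding \<mu>_def by (rule norm_moebius_mu_le)
  define \<omega> where "\<omega> = (\<lambda>n. \<Sum>p\<in>P. of_bool (p dvd n) :: real)"
  define E where "E = (\<lambda>p q K. \<Sum>n=1..K. f (p * n) * cnj (f (q * n)))"
  \<comment> \<open>There are at most (card P)^2 pairs, so all off-diagonal correlations together
    contribute at most N.\<close>
  have "eventually (\<lambda>N. \<forall>p\<in>P. \<forall>q\<in>P. p \<noteq> q \<longrightarrow>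
      norm (E p q (N div max p q)) \<le> (1 / (card P)\<^sup>2) * real N) sequentially"
  proof (intro eventually_ball_finite fin ballI)
    fix p q assume pq: "p \<in> P" "q \<in> P"
    then have cP: "card P > 0" using fin card_gt_0_iff by blast
    show "\<forall>\<^sub>F N in sequentially. p \<noteq> q \<longrightarrow> norm (E p q (N div max p q)) \<le> (1 / (card P)\<^sup>2) * real N"
    proof (cases "p = q")
      case False
      then have "(\<lambda>N. 1 / of_nat N * E p q N) \<longlonglongrightarrow> 0"
        unfolding E_def using P[OF pq(1)] P[OF pq(2)] by (intro corr) (auto simp: c'_def)
      from average_div_small[OF this, of "1 / (card P)\<^sup>2" "max p q"]
      show ?thesis using cP by (auto elim: eventually_mono)
    qed auto
  qed
  \<comment> \<open>This absorbs the rounding error 2 A card P of Turan-Kubilius into N A.\<close>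
  moreover have "eventually (\<lambda>N. N \<ge> 2 * card P + 1) sequentially" by (rule eventually_ge_at_top)
  ultimately show "\<forall>\<^sub>F N in sequentially. dist (1 / of_nat N * (\<Sum>n=1..N. of_int (moebius_mu n) * f n)) 0 < e"
  proof eventually_elim
    case (elim N)
    have N0: "real N > 0" using elim by simp
    define S where "S = (\<Sum>n=1..N. \<mu> n * f n)"
    have tk: "(\<Sum>n=1..N. (\<omega> n - A)\<^sup>2) \<le> 2 * N * A"
    proof -
      have "(\<Sum>n=1..N. (\<omega> n - A)\<^sup>2) \<le> real N * A + 2 * A * card P"
        unfolding \<omega>_def A_def using P fin by (intro turan_kubilius) auto
      also have "\<dots> \<le> real N * A + A * N"
      proof -
        have "2 * real (card P) \<le> N" using elim by linarith
        then have "A * (2 * real (card P)) \<le> A * N" using A1 by (intro mult_left_mono) auto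
        then show ?thesis by (simp add: algebra_simps)
      qed
      finally show ?thesis by (simp add: algebra_simps)
    qed
    have part1: "norm (A * S - (\<Sum>n=1..N. \<mu> n * f n * \<omega> n)) \<le> N * sqrt (2 * A)"
    proof -
      have "A * S - (\<Sum>n=1..N. \<mu> n * f n * \<omega> n) = (\<Sum>n=1..N. (\<mu> n * f n) * of_real (A - \<omega> n))"
        by (simp add: S_def sum_distrib_left sum_subtractf algebra_simps)
      also have "norm \<dots> \<le> sqrt (real (card {1..N}) * (\<Sum>n=1..N. (norm (of_real (A - \<omega> n) :: complex))\<^sup>2))"
        by (rule norm_sum_le_sqrt) (simp add: norm_mult mult_le_one \<mu> bound)
      also have "(\<Sum>n=1..N. (norm (of_real (A - \<omega> n) :: complex))\<^sup>2) = (\<Sum>n=1..N. (\<omega> n - A)\<^sup>2)"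
        by (simp only: norm_of_real power2_abs power2_commute)
      also have "sqrt (real (card {1..N}) * \<dots>) \<le> sqrt (real N * (2 * N * A))"
        using tk by (intro real_sqrt_le_mono mult_mono) (auto intro: sum_nonneg)
      also have "real N * (2 * N * A) = N\<^sup>2 * (2 * A)" by (simp add: power2_eq_square)
      also have "sqrt \<dots> = N * sqrt (2 * A)" by (simp only: real_sqrt_mult real_sqrt_abs) simp
      finally show ?thesis .
    qed
    have eqw: "(\<Sum>n=1..N. \<mu> n * f n * \<omega> n) = (\<Sum>p\<in>P. \<Sum>m=1..N div p. \<mu> (p * m) * f (p * m))"
    proof -
      have "(\<Sum>n=1..N. \<mu> n * f n * \<omega> n) = (\<Sum>n=1..N. \<Sum>p\<in>P. if p dvd n then \<mu> n * f n else 0)"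
        unfolding \<omega>_def of_real_sum sum_distrib_left by (intro sum.cong) auto
      also have "\<dots> = (\<Sum>p\<in>P. \<Sum>n=1..N. if p dvd n then \<mu> n * f n else 0)" by (rule sum.swap)
      also have "\<dots> = (\<Sum>p\<in>P. \<Sum>m=1..N div p. \<mu> (p * m) * f (p * m))"
      proof (rule sum.cong[OF refl])
        fix p assume p: "p \<in> P"
        have "(\<Sum>n=1..N. if p dvd n then \<mu> n * f n else 0) = (\<Sum>n\<in>{n\<in>{1..N}. p dvd n}. \<mu> n * f n)"
          by (rule sum.inter_filter[symmetric]) simp
        also have "{n \<in> {1..N}. p dvd n} = (\<lambda>m. p * m) ` {1..N div p}"
          using pos[OF p] by (auto simp: image_iff less_eq_div_iff_mult_less_eq mult.commute elim!: dvdE)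
        also have "(\<Sum>n\<in>\<dots>. \<mu> n * f n) = (\<Sum>m=1..N div p. \<mu> (p * m) * f (p * m))"
          using pos[OF p] by (subst sum.reindex) (auto simp: inj_on_def)
        finally show "(\<Sum>n=1..N. if p dvd n then \<mu> n * f n else 0) = (\<Sum>m=1..N div p. \<mu> (p * m) * f (p * m))" .
      qed
      finally show ?thesis .
    qed
    define U where "U = (\<Sum>p\<in>P. \<Sum>m=1..N div p. \<mu> m * f (p * m))"
    have part2: "norm ((\<Sum>n=1..N. \<mu> n * f n * \<omega> n) + U) \<le> N * A * (e / 4)"
    proof -
      have "(\<Sum>n=1..N. \<mu> n * f n * \<omega> n) + U = (\<Sum>p\<in>P. \<Sum>m=1..N div p. (\<mu> (p * m) + \<mu> m) * f (p * m))"
        unfolding eqw U_def by (simp add: sum.distrib algebra_simps)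
      also have "norm \<dots> \<le> (\<Sum>p\<in>P. N / p * (e / 4))"
      proof (rule order_trans[OF norm_sum], rule sum_mono)
        fix p assume p: "p \<in> P"
        have pr: "prime p" and pc: "p > c'" using P[OF p] by auto
        have "norm (\<Sum>m=1..N div p. (\<mu> (p * m) + \<mu> m) * f (p * m)) \<le> (\<Sum>m=1..N div p. of_bool (p dvd m))"
        proof (rule order_trans[OF norm_sum], rule sum_mono)
          fix m assume "m \<in> {1..N div p}"
          show "norm ((\<mu> (p * m) + \<mu> m) * f (p * m)) \<le> of_bool (p dvd m)"
            using moebius_mu_prime_mult[OF pr, of m] moebius_mu_prime_mult_dvd[OF pr, of m] \<mu>[of m] bound[of "p * m"]
            by (cases "p dvd m") (auto simp: \<mu>_def norm_mult intro: mult_le_one)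
        qed
        also have "\<dots> = real ((N div p) div p)"
          using card_multiples_le[of p "N div p"] pos[OF p] by (simp add: Int_def of_bool_def sum.If_cases del: div_mult2_eq)
        also have "\<dots> \<le> real (N div p) / p" by (rule of_nat_div_le_of_nat)
        also have "\<dots> \<le> N / p / p" by (intro divide_right_mono of_nat_div_le_of_nat) auto
        also have "\<dots> \<le> N / p * (e / 4)"
        proof -
          have "4 / e \<le> real p" using pc unfolding c'_def by linarith
          then have "1 / p \<le> e / 4" using e pos[OF p] by (simp add: field_simps)
          then have "(N / p) * (1 / p) \<le> N / p * (e / 4)" by (intro mult_left_mono) auto
          then show ?thesis by simp
        qed
        finally show "norm (\<Sum>m=1..N div p. (\<mu> (p * m) + \<mu> m) * f (p * m)) \<le> N / p * (e / 4)" .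
      qed
      also have "\<dots> = N * A * (e / 4)" by (simp add: A_def sum_distrib_left sum_distrib_right)
      finally show ?thesis .
    qed
    have part3: "norm U \<le> N * sqrt (2 * A)"
    proof -
      \<comment> \<open>For fixed m only the primes with p m <= N remain; in the expanded square the
        pair (p, q) is therefore summed up to N div max p q.\<close>
      define g where "g = (\<lambda>m. \<Sum>p\<in>P. if p * m \<le> N then f (p * m) else 0)"
      have dv: "{m \<in> {1..N}. p * m \<le> N} = {1..N div p}" if "p \<in> P" for p
      proof -
        have "m \<le> N" if "p * m \<le> N" for m using that pos[OF \<open>p \<in> P\<close>] by (cases p) auto
        then show ?thesis
          using pos[OF that] by (auto simp: less_eq_div_iff_mult_less_eq mult.commute)
      qed
      have "U = (\<Sum>p\<in>P. \<Sum>m=1..N. \<mu> m * (if p * m \<le> N then f (p * m) else 0))"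
        unfolding U_def
      proof (rule sum.cong[OF refl])
        fix p assume p: "p \<in> P"
        have "(\<Sum>m=1..N. \<mu> m * (if p * m \<le> N then f (p * m) else 0)) = (\<Sum>m\<in>{m \<in> {1..N}. p * m \<le> N}. \<mu> m * f (p * m))"
          by (subst sum.inter_filter) (auto intro: sum.cong)
        then show "(\<Sum>m=1..N div p. \<mu> m * f (p * m)) = (\<Sum>m=1..N. \<mu> m * (if p * m \<le> N then f (p * m) else 0))"
          using dv[OF p] by simp
      qed
      also have "\<dots> = (\<Sum>m=1..N. \<mu> m * g m)"
        unfolding g_def sum_distrib_left by (rule sum.swap)
      finally have U: "U = (\<Sum>m=1..N. \<mu> m * g m)" .
      have "complex_of_real (\<Sum>m=1..N. (norm (g m))\<^sup>2) = (\<Sum>m=1..N. g m * cnj (g m))"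
        by (simp only: of_real_sum complex_norm_square)
      also have "\<dots> = (\<Sum>m=1..N. \<Sum>p\<in>P. \<Sum>q\<in>P. if p * m \<le> N \<and> q * m \<le> N then f (p * m) * cnj (f (q * m)) else 0)"
        unfolding g_def cnj_sum sum_product by (intro sum.cong refl) auto
      also have "\<dots> = (\<Sum>p\<in>P. \<Sum>q\<in>P. \<Sum>m=1..N. if p * m \<le> N \<and> q * m \<le> N then f (p * m) * cnj (f (q * m)) else 0)"
        by (subst sum.swap, rule sum.cong[OF refl], rule sum.swap)
      also have "\<dots> = (\<Sum>p\<in>P. \<Sum>q\<in>P. E p q (N div max p q))"
      proof (intro sum.cong refl)
        fix p q assume pq: "p \<in> P" "q \<in> P"
        have "max p q \<in> P" using pq by (simp add: max_def)
        note dv' = dv[OF this]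
        have "{m \<in> {1..N}. p * m \<le> N \<and> q * m \<le> N} = {m \<in> {1..N}. max p q * m \<le> N}"
          by (simp add: nat_mult_max_left)
        with dv' have "{m \<in> {1..N}. p * m \<le> N \<and> q * m \<le> N} = {1..N div max p q}" by simp
        then show "(\<Sum>m=1..N. if p * m \<le> N \<and> q * m \<le> N then f (p * m) * cnj (f (q * m)) else 0) = E p q (N div max p q)"
          unfolding E_def by (subst sum.inter_filter [symmetric]) simp_all
      qed
      finally have eq: "complex_of_real (\<Sum>m=1..N. (norm (g m))\<^sup>2) = (\<Sum>p\<in>P. \<Sum>q\<in>P. E p q (N div max p q))" .
      have "(\<Sum>m=1..N. (norm (g m))\<^sup>2) \<le> norm (complex_of_real (\<Sum>m=1..N. (norm (g m))\<^sup>2))"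
        by (simp only: norm_of_real)
      also have "\<dots> = norm (\<Sum>p\<in>P. \<Sum>q\<in>P. E p q (N div max p q))" by (simp only: eq)
      also have "\<dots> \<le> (\<Sum>p\<in>P. \<Sum>q\<in>P. of_bool (p = q) * (N / p) + (1 / (card P)\<^sup>2) * real N)"
      proof (rule order_trans[OF norm_sum], rule sum_mono, rule order_trans[OF norm_sum], rule sum_mono)
        fix p q assume pq: "p \<in> P" "q \<in> P"
        show "norm (E p q (N div max p q)) \<le> of_bool (p = q) * (N / p) + (1 / (card P)\<^sup>2) * real N"
        proof (cases "p = q")
          case True
          have "norm (E p q (N div max p q)) \<le> (\<Sum>m=1..N div p. 1)"
            unfolding E_def True max.idem
            by (rule order_trans[OF norm_sum], rule sum_mono) (simp add: norm_mult bound mult_le_one)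
          also have "\<dots> \<le> N / p" using of_nat_div_le_of_nat[of N p] by simp
          finally show ?thesis using True by (simp add: add_increasing2)
        next
          case False
          then show ?thesis using elim(1) pq by simp
        qed
      qed
      also have "\<dots> = N * A + N * ((card P)\<^sup>2 * (1 / (card P)\<^sup>2))"
      proof -
        have "(\<Sum>p\<in>P. \<Sum>q\<in>P. of_bool (p = q) * (real N / p)) = N * A"
        proof -
          have "(\<Sum>p\<in>P. \<Sum>q\<in>P. of_bool (p = q) * (real N / p)) = (\<Sum>p\<in>P. \<Sum>q\<in>P. if p = q then real N / p else 0)"
            by (intro sum.cong refl) auto
          then show ?thesis using fin by (simp add: A_def sum_distrib_left)
        qed
        then show ?thesis by (simp add: sum.distrib power2_eq_square)
      qed
      also have "\<dots> \<le> N * (2 * A)"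
      proof -
        have "((card P)\<^sup>2 * (1 / (card P)\<^sup>2)) \<le> (1 :: real)" by auto
        then have "N * ((card P)\<^sup>2 * (1 / (card P)\<^sup>2)) \<le> N * (1::real)" by (intro mult_left_mono) auto
        also have "\<dots> \<le> N * A" using A1 by (intro mult_left_mono) auto
        finally show ?thesis by (simp add: algebra_simps)
      qed
      finally have sq: "(\<Sum>m=1..N. (norm (g m))\<^sup>2) \<le> N * (2 * A)" .
      have "norm U \<le> sqrt (real (card {1..N}) * (\<Sum>m=1..N. (norm (g m))\<^sup>2))"
        unfolding U by (rule norm_sum_le_sqrt) (rule \<mu>)
      also have "\<dots> \<le> sqrt (real N * (N * (2 * A)))"
        using sq by (intro real_sqrt_le_mono mult_mono) (auto intro: sum_nonneg)
      also have "real N * (N * (2 * A)) = N\<^sup>2 * (2 * A)" by (simp add: power2_eq_square)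
      also have "sqrt \<dots> = N * sqrt (2 * A)" by (simp only: real_sqrt_mult real_sqrt_abs) simp
      finally show ?thesis .
    qed
    have "norm (A * S) \<le> norm (A * S - (\<Sum>n=1..N. \<mu> n * f n * \<omega> n))
        + norm ((\<Sum>n=1..N. \<mu> n * f n * \<omega> n) + U) + norm U"
    proof -
      define V where "V = (\<Sum>n=1..N. \<mu> n * f n * \<omega> n)"
      have "A * S = ((A * S - V) + (V + U)) - U" by simp
      then have "norm (A * S) \<le> norm ((A * S - V) + (V + U)) + norm U"
        by (metis norm_triangle_ineq4)
      then show ?thesis using norm_triangle_ineq[of "A * S - V" "V + U"] unfolding V_def by linarith
    qed
    also have "\<dots> \<le> N * sqrt (2 * A) + N * A * (e / 4) + N * sqrt (2 * A)"
      using part1 part2 part3 by linarith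
    also have "\<dots> \<le> N * (A * (e / 4)) + N * A * (e / 4)"
    proof -
      have "(sqrt (2 * A) * (8 / e))\<^sup>2 \<le> A\<^sup>2"
      proof -
        have "(sqrt (2 * A) * (8 / e))\<^sup>2 = A * (2 * (8 / e)\<^sup>2)" using A1 by (simp add: power_mult_distrib power_divide)
        also have "\<dots> \<le> A * A" using A1 A2 by (intro mult_left_mono) auto
        finally show ?thesis by (simp add: power2_eq_square)
      qed
      then have "sqrt (2 * A) * (8 / e) \<le> A" by (rule power2_le_imp_le) (use A1 in simp)
      then have "2 * sqrt (2 * A) \<le> A * (e / 4)" using e by (simp add: field_simps)
      then have "N * (2 * sqrt (2 * A)) \<le> N * (A * (e / 4))" by (intro mult_left_mono) auto
      moreover have "N * (2 * sqrt (2 * A)) = N * sqrt (2 * A) + N * sqrt (2 * A)"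
        by (simp only: mult_2 distrib_left)
      ultimately show ?thesis by linarith
    qed
    also have "\<dots> = N * A * (e / 2)" by (simp add: algebra_simps)
    finally have "A * norm S \<le> A * (N * (e / 2))" using A1 by (simp add: norm_mult algebra_simps)
    then have "norm S \<le> N * (e / 2)" using A1 by simp
    then have "norm S / N \<le> e / 2" using N0 by (simp add: field_simps)
    then have "norm S / N < e" using e by linarith
    then show ?case unfolding S_def \<mu>_def by (simp add: norm_mult norm_divide)
  qed
qed

section \<open>Dirichlet series\<close>

text \<open>Since \<open>0 powr z = 0\<close>, the sum over all natural numbers is the usual
  Dirichlet series starting at 1.\<close>

definition dirichlet_sum :: "(nat \<Rightarrow> complex) \<Rightarrow> complex \<Rightarrow> complex" where
  "dirichlet_sum a s = (\<Sum>n. a n * of_nat n powr (-s))"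

lemma norm_nat_powr: "norm (of_nat n powr (z::complex)) = real n powr Re z"
  by (cases "n = 0") (simp_all add: norm_powr_real powr_def)

lemma summable_dirichlet_iff:
  "summable (\<lambda>n. norm (a n * of_nat n powr (-s :: complex))) \<longleftrightarrow>
   summable (\<lambda>n. norm (a n) * real n powr (- Re s))"
  by (simp add: norm_mult norm_nat_powr)

lemma summable_bounded_dirichlet:
  assumes "\<And>n. norm (a n :: complex) \<le> B" "\<sigma> > 1"
  shows "summable (\<lambda>n. norm (a n) * real n powr (- \<sigma>))"
proof (rule summable_comparison_test')
  show "summable (\<lambda>n. B * real n powr (- \<sigma>))"
    using assms(2) by (intro summable_mult) (simp add: summable_real_powr_iff)
  show "norm (norm (a n) * real n powr (- \<sigma>)) \<le> B * real n powr (- \<sigma>)" if "n \<ge> 0" for n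
    using assms(1)[of n] by (simp add: mult_right_mono)
qed

lemma dirichlet_sums:
  assumes "summable (\<lambda>n. norm (a n) * real n powr (- Re s))"
  shows "(\<lambda>n. a n * of_nat n powr (-s)) sums dirichlet_sum a s"
  unfolding dirichlet_sum_def
  by (rule summable_sums, rule summable_norm_cancel) (use assms in \<open>simp add: summable_dirichlet_iff\<close>)

lemma dirichlet_has_sum:
  assumes "summable (\<lambda>n. norm (a n) * real n powr (- Re s))"
  shows "((\<lambda>n. a n * of_nat n powr (-s)) has_sum dirichlet_sum a s) {1..}"
proof -
  have "((\<lambda>n. a n * of_nat n powr (-s)) has_sum dirichlet_sum a s) UNIV"
    by (rule norm_summable_imp_has_sum[OF _ dirichlet_sums[OF assms]]) (use assms in \<open>simp add: summable_dirichlet_iff\<close>)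
  then show ?thesis
    by (rule has_sum_cong_neutral[THEN iffD1, rotated -1]) (auto simp: not_le)
qed

text \<open>Absolute convergence permits summing over all pairs (d, e) of positive integers at once;
  the bijection (n, d) -> (d, n div d) regroups them by the product n = d e. Index 0 is kept out
  because every d divides 0.\<close>

lemma dirichlet_sum_product:
  fixes a b :: "nat \<Rightarrow> complex"
  assumes a: "summable (\<lambda>n. norm (a n) * real n powr (- Re s))"
    and b: "summable (\<lambda>n. norm (b n) * real n powr (- Re s))"
  shows "dirichlet_sum (\<lambda>n. \<Sum>d | d dvd n. a d * b (n div d)) s = dirichlet_sum a s * dirichlet_sum b s"
proof -
  define F where "F = (\<lambda>d. a d * of_nat d powr (-s))"
  define G where "G = (\<lambda>d. b d * of_nat d powr (-s))"
  have F: "(F has_sum dirichlet_sum a s) {1..}" unfolding F_def by (rule dirichlet_has_sum[OF a])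
  have G: "(G has_sum dirichlet_sum b s) {1..}" unfolding G_def by (rule dirichlet_has_sum[OF b])
  have Fa: "(\<lambda>x. norm (F x)) summable_on {1..}" unfolding F_def
    by (rule summable_on_subset_banach[OF norm_summable_imp_summable_on]) (use a in \<open>simp_all add: summable_dirichlet_iff\<close>)
  have Ga: "(\<lambda>x. norm (G x)) summable_on {1..}" unfolding G_def
    by (rule summable_on_subset_banach[OF norm_summable_imp_summable_on]) (use b in \<open>simp_all add: summable_dirichlet_iff\<close>)
  define H where "H = (\<lambda>(d, e). F d * G e)"
  have "(\<lambda>x. norm (H x)) summable_on ({1..} \<times> {1..})"
    unfolding Infinite_Sum.abs_summable_on_Sigma_iff
  proof (intro conjI ballI)
    show "(\<lambda>e. norm (H (d, e))) summable_on {1..}" for d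
      unfolding H_def using Ga by (auto simp: norm_mult intro!: summable_on_cmult_right)
    have eq: "infsum (\<lambda>e. norm (H (d, e))) {1..} = norm (F d) * infsum (\<lambda>e. norm (G e)) {1..}" for d
      unfolding H_def by (simp add: norm_mult infsum_cmult_right')
    have "(\<lambda>d. norm (norm (F d) * infsum (\<lambda>e. norm (G e)) {1..})) summable_on {1..}"
      unfolding real_norm_def abs_mult abs_norm_cancel by (rule summable_on_cmult_left[OF Fa])
    then show "(\<lambda>d. norm (infsum (\<lambda>e. norm (H (d, e))) {1..})) summable_on {1..}"
      by (simp only: eq)
  qed
  then have "H summable_on ({1..} \<times> {1..})" by (rule abs_summable_summable)
  then obtain S where S: "(H has_sum S) ({1..} \<times> {1..})" by (auto simp: summable_on_def)
  have "((\<lambda>d. F d * dirichlet_sum b s) has_sum S) {1..}"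
    by (rule has_sum_SigmaD[OF S]) (use G in \<open>auto simp: H_def intro: has_sum_cmult_right\<close>)
  moreover have "((\<lambda>d. F d * dirichlet_sum b s) has_sum (dirichlet_sum a s * dirichlet_sum b s)) {1..}"
    by (rule has_sum_cmult_left[OF F])
  ultimately have SS: "S = dirichlet_sum a s * dirichlet_sum b s" by (rule has_sum_unique)
  have bij: "bij_betw (\<lambda>(n :: nat, d). (d, n div d)) (SIGMA n:{1..}. {d. d dvd n}) ({1..} \<times> {1..})"
    by (rule bij_betwI[where g = "\<lambda>(d, e). (d * e, d)"])
      (auto simp: Suc_le_eq dvd_imp_le div_greater_zero_iff intro: Nat.gr0I)
  have "((\<lambda>x. H (case x of (n, d) \<Rightarrow> (d, n div d))) has_sum S) (SIGMA n:{1..}. {d. d dvd n})"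
    using has_sum_reindex_bij_betw[OF bij, of H S] S by (simp add: case_prod_unfold)
  then have "((\<lambda>n. \<Sum>d | d dvd n. H (d, n div d)) has_sum S) {1..}"
    by (rule has_sum_SigmaD) (auto intro!: has_sum_finite)
  then have "((\<lambda>n. (\<Sum>d | d dvd n. a d * b (n div d)) * of_nat n powr (-s)) has_sum S) {1..}"
  proof (rule has_sum_cong[THEN iffD1, rotated])
    fix n :: nat assume n: "n \<in> {1..}"
    have "H (d, n div d) = a d * b (n div d) * of_nat n powr (-s)" if dn: "d dvd n" for d
    proof -
      obtain e where e: "n = d * e" using dn by (elim dvdE)
      have "d > 0" "e > 0" using n e by (auto intro!: Nat.gr0I)
      then have "complex_of_nat n powr (-s) = of_nat d powr (-s) * of_nat e powr (-s)"
        unfolding e of_nat_mult by (intro powr_times_real) auto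
      then show ?thesis using e \<open>d > 0\<close> by (simp add: H_def F_def G_def)
    qed
    then show "(\<Sum>d | d dvd n. H (d, n div d)) = (\<Sum>d | d dvd n. a d * b (n div d)) * of_nat n powr (-s)"
      by (simp add: sum_distrib_right)
  qed
  then have "((\<lambda>n. (\<Sum>d | d dvd n. a d * b (n div d)) * of_nat n powr (-s)) has_sum S) UNIV"
    by (rule has_sum_cong_neutral[THEN iffD1, rotated -1]) (auto simp: not_le)
  then have "(\<lambda>n. (\<Sum>d | d dvd n. a d * b (n div d)) * of_nat n powr (-s)) sums S"
    by (rule has_sum_imp_sums)
  then have "dirichlet_sum (\<lambda>n. \<Sum>d | d dvd n. a d * b (n div d)) s = S"
    unfolding dirichlet_sum_def by (rule sums_unique[symmetric])
  then show ?thesis using SS by simp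
qed

section \<open>Holomorphy of series and Abel summation\<close>

lemma holomorphic_on_suminf:
  fixes u :: "nat \<Rightarrow> complex \<Rightarrow> complex"
  assumes S: "open S" and hol: "\<And>n. u n holomorphic_on S"
    and bd: "\<And>z. z \<in> S \<Longrightarrow> \<exists>d>0. \<exists>m. cball z d \<subseteq> S \<and> summable m \<and> (\<forall>n. \<forall>w\<in>cball z d. norm (u n w) \<le> m n)"
  shows "(\<lambda>z. \<Sum>n. u n z) holomorphic_on S"
proof (rule holomorphic_uniform_sequence[OF S])
  show "(\<lambda>z. \<Sum>i<n. u i z) holomorphic_on S" for n
    by (intro holomorphic_intros hol)
  fix z assume zS: "z \<in> S"
  from bd[OF zS] obtain d m where "d > 0 \<and> cball z d \<subseteq> S \<and> summable m \<and> (\<forall>n. \<forall>w\<in>cball z d. norm (u n w) \<le> m n)"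
    by blast
  then have d: "d > 0" "cball z d \<subseteq> S" "summable m" "\<And>n w. w \<in> cball z d \<Longrightarrow> norm (u n w) \<le> m n"
    by auto
  have "uniform_limit (cball z d) (\<lambda>n z. \<Sum>i<n. u i z) (\<lambda>z. \<Sum>n. u n z) sequentially"
    by (rule Weierstrass_m_test[OF _ d(3)]) (use d in auto)
  then show "\<exists>d>0. cball z d \<subseteq> S \<and> uniform_limit (cball z d) (\<lambda>n z. \<Sum>i<n. u i z) (\<lambda>z. \<Sum>n. u n z) sequentially"
    using d by blast
qed

lemma has_field_derivative_suminf:
  fixes u :: "nat \<Rightarrow> complex \<Rightarrow> complex"
  assumes S: "open S" and der: "\<And>n z. z \<in> S \<Longrightarrow> (u n has_field_derivative u' n z) (at z)"
    and bd: "\<And>z. z \<in> S \<Longrightarrow> \<exists>d>0. \<exists>m. cball z d \<subseteq> S \<and> summable m \<and> (\<forall>n. \<forall>w\<in>cball z d. norm (u n w) \<le> m n)"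
    and z: "z \<in> S"
  shows "(\<lambda>n. u' n z) sums deriv (\<lambda>z. \<Sum>n. u n z) z"
proof -
  have "\<exists>g'. \<forall>x\<in>S. ((\<lambda>z. \<Sum>n. u n z) has_field_derivative g' x) (at x) \<and> (\<lambda>n. \<Sum>i<n. u' i x) \<longlonglongrightarrow> g' x"
  proof (rule has_complex_derivative_uniform_sequence[OF S])
    show "((\<lambda>z. \<Sum>i<n. u i z) has_field_derivative (\<Sum>i<n. u' i x)) (at x)" if "x \<in> S" for n x
      by (intro DERIV_sum der that)
    fix z assume zS: "z \<in> S"
    from bd[OF zS] obtain d m where "d > 0 \<and> cball z d \<subseteq> S \<and> summable m \<and> (\<forall>n. \<forall>w\<in>cball z d. norm (u n w) \<le> m n)"
      by blast
    then have d: "d > 0" "cball z d \<subseteq> S" "summable m" "\<And>n w. w \<in> cball z d \<Longrightarrow> norm (u n w) \<le> m n"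
      by auto
    have "uniform_limit (cball z d) (\<lambda>n z. \<Sum>i<n. u i z) (\<lambda>z. \<Sum>n. u n z) sequentially"
      by (rule Weierstrass_m_test[OF _ d(3)]) (use d in auto)
    then show "\<exists>d>0. cball z d \<subseteq> S \<and> uniform_limit (cball z d) (\<lambda>n z. \<Sum>i<n. u i z) (\<lambda>z. \<Sum>n. u n z) sequentially"
      using d by blast
  qed
  then show ?thesis using z by (auto simp: sums_def dest!: DERIV_imp_deriv)
qed

text \<open>The radius is half the distance to the boundary line, so real parts stay above the
  midpoint: one majorant then serves on the whole ball in the M-tests.\<close>

lemma half_plane_cball:
  assumes "Re z > c"
  obtains d where "d > 0" "cball z d \<subseteq> {s. Re s > c}" "\<And>w. w \<in> cball z d \<Longrightarrow> Re w \<ge> (Re z + c) / 2"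
    "\<And>w. w \<in> cball z d \<Longrightarrow> norm w \<le> norm z + d"
proof -
  define d where "d = (Re z - c) / 2"
  have d: "d > 0" using assms by (simp add: d_def)
  have *: "Re w \<ge> (Re z + c) / 2" if "w \<in> cball z d" for w
  proof -
    have "Re (z - w) \<le> d" using that complex_Re_le_cmod[of "z - w"] by (simp add: dist_norm)
    then show ?thesis unfolding d_def by (simp add: field_simps)
  qed
  have **: "norm w \<le> norm z + d" if "w \<in> cball z d" for w
    using that norm_triangle_ineq2[of w z] by (simp add: dist_norm norm_minus_commute)
  have "cball z d \<subseteq> {s. Re s > c}"
  proof
    fix w assume "w \<in> cball z d"
    from *[OF this] have "Re w \<ge> (Re z + c) / 2" .
    moreover have "(Re z + c) / 2 > c" using assms by (simp add: field_simps)
    ultimately show "w \<in> {s. Re s > c}" by simp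
  qed
  then show ?thesis using that[of d] d * ** by blast
qed

lemma open_Re_gt [simp]: "open {s. Re s > c}"
  by (simp add: open_halfspace_Re_gt)

lemma norm_of_real_powr_le:
  assumes "0 < c" "c \<le> x" "Re s \<ge> 0"
  shows "norm (of_real x powr (-s)) \<le> c powr (- Re s)"
proof -
  have "norm (of_real x powr (-s)) = x powr (- Re s)" using assms by (simp add: norm_powr_real powr_def)
  also have "\<dots> \<le> c powr (- Re s)" using assms by (intro powr_mono2') auto
  finally show ?thesis .
qed

text \<open>Mean value inequality on a real segment; the condition on Re s makes the norm of the
  derivative largest at the left end \<open>c\<close>.\<close>

lemma powr_diff_bound:
  fixes s :: complex and x y c :: real
  assumes c: "0 < c" "c \<le> x" "c \<le> y" and s: "Re s \<ge> -1"
  shows "norm (of_real x powr (-s) - of_real y powr (-s)) \<le> norm s * c powr (- Re s - 1) * \<bar>x - y\<bar>"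
proof -
  have seg: "\<exists>u\<ge>c. z = of_real u" if "z \<in> closed_segment (complex_of_real x) (of_real y)" for z
    using that c by (auto simp: closed_segment_of_real closed_segment_eq_real_ivl split: if_splits)
  have "norm (of_real x powr (-s) - of_real y powr (-s)) \<le> (norm s * c powr (- Re s - 1)) * norm (complex_of_real x - of_real y)"
  proof (rule field_differentiable_bound[OF convex_closed_segment[of "complex_of_real x" "of_real y"]])
    fix z assume "z \<in> closed_segment (complex_of_real x) (of_real y)"
    then obtain u where u: "u \<ge> c" "z = of_real u" using seg by blast
    then have "z \<notin> \<real>\<^sub>\<le>\<^sub>0" using c by (auto simp: complex_nonpos_Reals_iff)
    then show "((\<lambda>z. z powr (-s)) has_field_derivative (-s * z powr (-s - 1)))
        (at z within closed_segment (complex_of_real x) (of_real y))"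
      by (rule has_field_derivative_at_within[OF has_field_derivative_powr])
    have "norm (z powr (-(s + 1))) \<le> c powr (- Re (s + 1))" unfolding u(2)
      by (rule norm_of_real_powr_le) (use u c s in auto)
    then show "norm (-s * z powr (-s - 1)) \<le> norm s * c powr (- Re s - 1)"
      by (simp add: norm_mult mult_left_mono)
  qed auto
  then show ?thesis by (metis norm_of_real of_real_diff)
qed

text \<open>After subtraction of the linear term the derivative of \<open>h\<close> is itself a
  difference of powers, to which \<open>powr_diff_bound\<close> applies with s + 1. This gains one
  more power of c.\<close>

lemma powr_diff_bound2:
  fixes s :: complex and c :: real
  assumes c: "0 < c" and s: "Re s \<ge> -1"
  shows "norm (of_real (c + 1) powr (-s) - of_real c powr (-s) + s * of_real c powr (-s - 1))
           \<le> norm s * norm (s + 1) * c powr (- Re s - 2)"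
proof -
  define h where "h = (\<lambda>z. z powr (-s) + s * of_real c powr (-s - 1) * z)"
  let ?S = "closed_segment (complex_of_real (c + 1)) (of_real c)"
  have seg: "\<exists>u\<ge>c. u \<le> c + 1 \<and> z = of_real u" if "z \<in> ?S" for z
  proof -
    from that obtain u where "z = of_real u" "u \<in> closed_segment (c + 1) c"
      unfolding closed_segment_of_real by auto
    then show ?thesis by (auto simp: closed_segment_eq_real_ivl split: if_splits)
  qed
  have "norm (h (of_real (c + 1)) - h (of_real c)) \<le> (norm s * norm (s + 1) * c powr (- Re s - 2)) * norm (complex_of_real (c + 1) - of_real c)"
  proof (rule field_differentiable_bound[OF convex_closed_segment[of "complex_of_real (c + 1)" "of_real c"]])
    fix z assume "z \<in> ?S"
    then obtain u where u: "u \<ge> c" "u \<le> c + 1" "z = of_real u" using seg by blast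
    then have "z \<notin> \<real>\<^sub>\<le>\<^sub>0" using c by (auto simp: complex_nonpos_Reals_iff)
    then have "(h has_field_derivative (-s * z powr (-s - 1) + s * of_real c powr (-s - 1))) (at z)"
      unfolding h_def by (auto intro!: derivative_eq_intros has_field_derivative_powr)
    then show "(h has_field_derivative (-s * z powr (-s - 1) + s * of_real c powr (-s - 1))) (at z within ?S)"
      by (rule has_field_derivative_at_within)
    have "norm (of_real u powr (-(s + 1)) - of_real c powr (-(s + 1))) \<le> norm (s + 1) * c powr (- Re (s + 1) - 1) * \<bar>u - c\<bar>"
      by (rule powr_diff_bound) (use u c s in auto)
    also have "\<dots> \<le> norm (s + 1) * c powr (- Re (s + 1) - 1) * 1"
      using u by (intro mult_left_mono) auto
    also have "- Re (s + 1) - 1 = - Re s - 2" by simp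
    finally have "norm (z powr (-s - 1) - of_real c powr (-s - 1)) \<le> norm (s + 1) * c powr (- Re s - 2)"
      by (simp add: u(3))
    then have "norm s * norm (z powr (-s - 1) - of_real c powr (-s - 1)) \<le> norm s * (norm (s + 1) * c powr (- Re s - 2))"
      by (intro mult_left_mono) auto
    moreover have "-s * z powr (-s - 1) + s * of_real c powr (-s - 1) = -s * (z powr (-s - 1) - of_real c powr (-s - 1))"
      by (simp add: algebra_simps)
    ultimately show "norm (-s * z powr (-s - 1) + s * of_real c powr (-s - 1)) \<le> norm s * norm (s + 1) * c powr (- Re s - 2)"
      by (simp only: norm_mult norm_minus_cancel mult.assoc)
  qed auto
  moreover have "h (of_real (c + 1)) - h (of_real c) = of_real (c + 1) powr (-s) - of_real c powr (-s) + s * of_real c powr (-s - 1)"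
    by (simp add: h_def algebra_simps)
  ultimately show ?thesis by simp
qed

lemma dirichlet_abel_summation:
  fixes a :: "nat \<Rightarrow> complex"
  assumes a: "\<And>n. norm (a n) \<le> 1" and s: "Re s > 1"
  shows "(\<lambda>n. (\<Sum>m=1..n. a m) * (of_nat n powr (-s) - of_nat (Suc n) powr (-s))) sums dirichlet_sum a s"
proof -
  let ?X = "\<lambda>n. (\<Sum>m=1..n. a m)"
  let ?p = "\<lambda>n. of_nat n powr (-s)"
  have id: "(\<Sum>n<N. ?X n * (?p n - ?p (Suc n))) = (\<Sum>n<Suc N. a n * ?p n) - ?X N * ?p N" for N
    by (induction N) (simp_all add: algebra_simps)
  have "(\<lambda>n. a n * ?p n) sums dirichlet_sum a s"
    by (rule dirichlet_sums[OF summable_bounded_dirichlet[of _ 1]]) (use a s in auto)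
  then have 1: "(\<lambda>N. \<Sum>n<Suc N. a n * ?p n) \<longlonglongrightarrow> dirichlet_sum a s"
    unfolding sums_def by (rule LIMSEQ_Suc)
  have 2: "(\<lambda>N. ?X N * ?p N) \<longlonglongrightarrow> 0"
  proof (rule Lim_null_comparison)
    have "norm (?X N * ?p N) \<le> real N powr (1 - Re s)" for N
    proof (cases "N = 0")
      case False
      have "norm (?X N) \<le> (\<Sum>m=1..N. 1)" by (rule sum_norm_le) (use a in auto)
      then have "norm (?X N * ?p N) \<le> real N * real N powr (- Re s)"
        by (simp add: norm_mult norm_nat_powr mult_right_mono)
      also have "\<dots> = real N powr (1 - Re s)" using False by (simp add: powr_diff powr_minus field_simps)
      finally show ?thesis .
    qed auto
    then show "\<forall>\<^sub>F N in sequentially. norm (?X N * ?p N) \<le> real N powr (1 - Re s)" by simp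
    have "((\<lambda>x. x powr (1 - Re s)) \<longlongrightarrow> 0) at_top" using s by (intro tendsto_neg_powr filterlim_ident) auto
    then show "(\<lambda>N. real N powr (1 - Re s)) \<longlonglongrightarrow> 0"
      by (rule filterlim_compose) (rule filterlim_real_sequentially)
  qed
  show ?thesis unfolding sums_def id using tendsto_diff[OF 1 2] by simp
qed

lemma holomorphic_on_nat_powr [holomorphic_intros]:
  "f holomorphic_on A \<Longrightarrow> (\<lambda>s. of_nat n powr (f s)) holomorphic_on A"
  by (cases "n = 0") (auto simp: powr_def intro!: holomorphic_intros)

lemma summable_powr_minus_offset:
  assumes "\<delta> > 0"
  shows "summable (\<lambda>n. B * real n powr (- 1 - \<delta>))"
  using assms by (intro summable_mult) (simp add: summable_real_powr_iff)

text \<open>Abel summation continues a Dirichlet series with bounded partial sums past the line of absolute convergence.\<close>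
lemma holomorphic_bounded_partial_sums:
  fixes D :: "nat \<Rightarrow> complex"
  assumes D: "\<And>n. norm (D n) \<le> B"
  shows "(\<lambda>s. \<Sum>n. D n * (of_nat n powr (-s) - of_nat (Suc n) powr (-s))) holomorphic_on {s. Re s > 0}"
    and "Re s > 0 \<Longrightarrow> summable (\<lambda>n. norm (D n * (of_nat n powr (-s) - of_nat (Suc n) powr (-s))))"
proof -
  have B0: "B \<ge> 0" using D[of 0] norm_ge_zero order_trans by blast
  \<comment> \<open>At n = 0 the bracket is -1, because \<open>0 powr z = 0\<close> and
    \<open>1 powr z = 1\<close>; the summand supported at 0 pays for it.\<close>
  have bd: "norm (D n * (of_nat n powr (-s) - of_nat (Suc n) powr (-s))) \<le> B * norm s * real n powr (- 1 - Re s) + (if n = 0 then B else 0)"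
    if "Re s > 0" for s n
  proof (cases "n = 0")
    case True
    then show ?thesis using D[of 0] by simp
  next
    case False
    have "norm (of_real (real n) powr (-s) - of_real (real n + 1) powr (-s)) \<le> norm s * real n powr (- Re s - 1) * \<bar>real n - (real n + 1)\<bar>"
      by (rule powr_diff_bound) (use False that in auto)
    moreover have "- Re s - 1 = - 1 - Re s" by simp
    ultimately have "norm (of_nat n powr (-s) - of_nat (Suc n) powr (-s)) \<le> norm s * real n powr (- 1 - Re s)"
      by (simp add: add.commute)
    then have "norm (D n) * norm (of_nat n powr (-s) - of_nat (Suc n) powr (-s)) \<le> B * (norm s * real n powr (- 1 - Re s))"
      using D B0 by (intro mult_mono) auto
    then show ?thesis using False by (simp add: norm_mult)
  qed
  have sm: "summable (\<lambda>n. B' * real n powr (- 1 - \<delta>) + (if n = 0 then B else 0))" if "\<delta> > 0" for B' \<delta>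
    using that by (intro summable_add summable_powr_minus_offset summable_single) auto
  show "Re s > 0 \<Longrightarrow> summable (\<lambda>n. norm (D n * (of_nat n powr (-s) - of_nat (Suc n) powr (-s))))"
    by (rule summable_comparison_test'[OF sm[of "Re s" "B * norm s"], of 0]) (use bd[of s] in auto)
  show "(\<lambda>s. \<Sum>n. D n * (of_nat n powr (-s) - of_nat (Suc n) powr (-s))) holomorphic_on {s. Re s > 0}"
  proof (rule holomorphic_on_suminf)
    show "(\<lambda>s. D n * (of_nat n powr (-s) - of_nat (Suc n) powr (-s))) holomorphic_on {s. Re s > 0}" for n
      by (intro holomorphic_intros)
    fix z assume "z \<in> {s. Re s > 0}"
    then have z: "Re z > 0" by simp
    obtain d where d: "d > 0" "cball z d \<subseteq> {s. Re s > 0}" "\<And>w. w \<in> cball z d \<Longrightarrow> Re w \<ge> (Re z + 0) / 2"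
      "\<And>w. w \<in> cball z d \<Longrightarrow> norm w \<le> norm z + d"
      using half_plane_cball[OF z] by blast
    have "norm (D n * (of_nat n powr (-w) - of_nat (Suc n) powr (-w))) \<le> B * (norm z + d) * real n powr (- 1 - Re z / 2) + (if n = 0 then B else 0)"
      if w: "w \<in> cball z d" for n w
    proof -
      have "real n powr (- 1 - Re w) \<le> real n powr (- 1 - Re z / 2)"
        using d(3)[OF w] by (cases "n = 0") (auto intro!: powr_mono)
      then have "B * norm w * real n powr (- 1 - Re w) \<le> B * (norm z + d) * real n powr (- 1 - Re z / 2)"
        using d(1) d(4)[OF w] B0 by (intro mult_mono) auto
      moreover have "Re w > 0" using w d(2) by auto
      ultimately show ?thesis using bd[of w n] by linarith
    qed
    then show "\<exists>d>0. \<exists>m. cball z d \<subseteq> {s. Re s > 0} \<and> summable m \<and>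
        (\<forall>n. \<forall>w\<in>cball z d. norm (D n * (of_nat n powr (-w) - of_nat (Suc n) powr (-w))) \<le> m n)"
      using d(1,2) sm[of "Re z / 2" "B * (norm z + d)"] z by (intro exI[of _ d] conjI exI) auto
  qed auto
qed

text \<open>The terms have size n powr (k - Re s - 2), which is summable for Re s > k - 1. Used with
  k = 0 for the zeta function and with k = 1 for the summatory function of mu times a
  character.\<close>

lemma holomorphic_second_difference:
  fixes D :: "nat \<Rightarrow> complex" and c :: real
  assumes D: "\<And>n. norm (D n) \<le> real n powr k" and k: "0 \<le> k" "k \<le> c + 1" "c \<ge> -1"
  shows "(\<lambda>s. \<Sum>n. D n * (of_nat (Suc n) powr (-s) - of_nat n powr (-s) + s * of_nat n powr (-s - 1))) holomorphic_on {s. Re s > c}"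
    and "Re s > c \<Longrightarrow> summable (\<lambda>n. norm (D n * (of_nat (Suc n) powr (-s) - of_nat n powr (-s) + s * of_nat n powr (-s - 1))))"
proof -
  let ?u = "\<lambda>s n. D n * (of_nat (Suc n) powr (-s) - of_nat n powr (-s) + s * of_nat n powr (-s - 1))"
  have bd: "norm (?u s n) \<le> norm s * norm (s + 1) * real n powr (- 1 - (Re s + 1 - k)) + (if n = 0 then 1 else 0)"
    if "Re s > c" for s n
  proof (cases "n = 0")
    case True
    then show ?thesis using D[of 0] by simp
  next
    case False
    have "norm (of_real (real n + 1) powr (-s) - of_real (real n) powr (-s) + s * of_real (real n) powr (-s - 1))
        \<le> norm s * norm (s + 1) * real n powr (- Re s - 2)"
      by (rule powr_diff_bound2) (use False that k in auto)
    then have "norm (of_nat (Suc n) powr (-s) - of_nat n powr (-s) + s * of_nat n powr (-s - 1)) \<le> norm s * norm (s + 1) * real n powr (- Re s - 2)"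
      by (simp add: algebra_simps)
    then have "norm (?u s n) \<le> real n powr k * (norm s * norm (s + 1) * real n powr (- Re s - 2))"
      unfolding norm_mult[of "D n"] using D by (intro mult_mono) auto
    also have "\<dots> = norm s * norm (s + 1) * (real n powr k * real n powr (- Re s - 2))" by simp
    also have "real n powr k * real n powr (- Re s - 2) = real n powr (- 1 - (Re s + 1 - k))"
      by (simp add: powr_add[symmetric] algebra_simps)
    finally show ?thesis using False by simp
  qed
  have sm: "summable (\<lambda>n. B' * real n powr (- 1 - \<delta>) + (if n = 0 then 1 else 0))" if "\<delta> > 0" for B' \<delta> :: real
    using that by (intro summable_add summable_powr_minus_offset summable_single) auto
  show "Re s > c \<Longrightarrow> summable (\<lambda>n. norm (?u s n))"
    by (rule summable_comparison_test'[OF sm[of "Re s + 1 - k" "norm s * norm (s + 1)"], of 0])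
      (use bd[of s] k in \<open>auto simp del: of_nat_Suc\<close>)
  show "(\<lambda>s. \<Sum>n. ?u s n) holomorphic_on {s. Re s > c}"
  proof (rule holomorphic_on_suminf)
    show "(\<lambda>s. ?u s n) holomorphic_on {s. Re s > c}" for n
      by (intro holomorphic_intros)
    fix z assume "z \<in> {s. Re s > c}"
    then have z: "Re z > c" by simp
    obtain d where d: "d > 0" "cball z d \<subseteq> {s. Re s > c}" "\<And>w. w \<in> cball z d \<Longrightarrow> Re w \<ge> (Re z + c) / 2"
      "\<And>w. w \<in> cball z d \<Longrightarrow> norm w \<le> norm z + d"
      using half_plane_cball[OF z] by blast
    have "norm (?u w n) \<le> (norm z + d) * (norm z + d + 1) * real n powr (- 1 - ((Re z + c) / 2 + 1 - k)) + (if n = 0 then 1 else 0)"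
      if w: "w \<in> cball z d" for n w
    proof -
      have 1: "real n powr (- 1 - (Re w + 1 - k)) \<le> real n powr (- 1 - ((Re z + c) / 2 + 1 - k))"
        using d(3)[OF w] by (cases "n = 0") (auto intro!: powr_mono)
      have 2: "norm w \<le> norm z + d" using d(4)[OF w] .
      have 3: "norm (w + 1) \<le> norm z + d + 1" using norm_triangle_ineq[of w 1] 2 by simp
      have "norm w * norm (w + 1) * real n powr (- 1 - (Re w + 1 - k))
          \<le> (norm z + d) * (norm z + d + 1) * real n powr (- 1 - ((Re z + c) / 2 + 1 - k))"
        using 1 2 3 d(1) by (intro mult_mono) auto
      moreover have "Re w > c" using w d(2) by auto
      ultimately show ?thesis using bd[of w n] by linarith
    qed
    moreover have "(Re z + c) / 2 + 1 - k > 0" using z k by (simp add: field_simps)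
    ultimately show "\<exists>d>0. \<exists>m. cball z d \<subseteq> {s. Re s > c} \<and> summable m \<and> (\<forall>n. \<forall>w\<in>cball z d. norm (?u w n) \<le> m n)"
      using d(1,2) sm[of "(Re z + c) / 2 + 1 - k" "(norm z + d) * (norm z + d + 1)"] by (intro exI[of _ d] conjI exI) auto
  qed auto
qed

section \<open>L-functions of Dirichlet characters\<close>

definition dirichlet_character :: "nat \<Rightarrow> (nat \<Rightarrow> complex) \<Rightarrow> bool" where
  "dirichlet_character M \<psi> \<longleftrightarrow> M > 0 \<and> (\<forall>m n. \<psi> (m * n) = \<psi> m * \<psi> n) \<and>
     (\<forall>n. \<psi> (n + M) = \<psi> n) \<and> (\<forall>n. \<psi> n \<noteq> 0 \<longleftrightarrow> coprime n M)"

lemma dirichlet_character_1: "dirichlet_character M \<psi> \<Longrightarrow> \<psi> (Suc 0) = 1"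
proof -
  assume *: "dirichlet_character M \<psi>"
  then have "\<psi> (1 * 1) = \<psi> 1 * \<psi> 1" "\<psi> 1 \<noteq> 0" unfolding dirichlet_character_def by (blast, simp)
  then show ?thesis by simp
qed

lemma dirichlet_character_mult:
  "dirichlet_character M \<psi> \<Longrightarrow> \<psi> (m * n) = \<psi> m * \<psi> n"
  by (simp add: dirichlet_character_def)

lemma periodic_add_mult:
  fixes f :: "nat \<Rightarrow> 'a"
  assumes "\<And>n. f (n + M) = f n"
  shows "f (n + k * M) = f n"
proof (induction k)
  case (Suc k)
  have "n + Suc k * M = (n + k * M) + M" by simp
  then show ?case by (simp only: assms Suc)
qed auto

lemma periodic_mod:
  fixes f :: "nat \<Rightarrow> 'a"
  assumes "\<And>n. f (n + M) = f n"
  shows "f n = f (n mod M)"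
  using periodic_add_mult[of f M "n mod M" "n div M", OF assms] by simp

lemma periodic_cong:
  fixes f :: "nat \<Rightarrow> 'a"
  assumes "\<And>n. f (n + M) = f n" "[m = n] (mod M)"
  shows "f m = f n"
  using periodic_mod[of f M, OF assms(1)] assms(2) unfolding cong_def by metis

lemma dirichlet_character_cong:
  "dirichlet_character M \<psi> \<Longrightarrow> [m = n] (mod M) \<Longrightarrow> \<psi> m = \<psi> n"
  by (rule periodic_cong) (simp_all add: dirichlet_character_def)

lemma dirichlet_character_power:
  "dirichlet_character M \<psi> \<Longrightarrow> \<psi> (n ^ k) = \<psi> n ^ k"
  by (induction k) (simp_all add: dirichlet_character_1 dirichlet_character_mult)

lemma dirichlet_character_norm:
  assumes "dirichlet_character M \<psi>" "coprime n M"
  shows "norm (\<psi> n) = 1"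
proof -
  have M: "M > 0" using assms by (simp add: dirichlet_character_def)
  have "[n ^ totient M = 1] (mod M)" using assms(2) by (rule euler_theorem)
  from dirichlet_character_cong[OF assms(1) this]
  have "\<psi> n ^ totient M = 1" by (simp add: dirichlet_character_power[OF assms(1)] dirichlet_character_1[OF assms(1)])
  then have "norm (\<psi> n) ^ totient M = 1" by (metis norm_one norm_power)
  moreover have "totient M > 0" using M by simp
  ultimately show ?thesis by (metis norm_ge_zero power_eq_1_iff real_norm_def abs_norm_cancel less_numeral_extra(3))
qed

lemma dirichlet_character_norm_le:
  assumes "dirichlet_character M \<psi>"
  shows "norm (\<psi> n) \<le> 1"
proof (cases "coprime n M")
  case True then show ?thesis using dirichlet_character_norm[OF assms] by simp
next
  case False
  then have "\<psi> n = 0" using assms unfolding dirichlet_character_def by blast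
  then show ?thesis by simp
qed

lemma dirichlet_character_square:
  "dirichlet_character M \<psi> \<Longrightarrow> dirichlet_character M (\<lambda>n. \<psi> n ^ 2)"
  by (simp add: dirichlet_character_def power_mult_distrib)

lemma dirichlet_character_principal:
  "M > 0 \<Longrightarrow> dirichlet_character M (\<lambda>n. of_bool (coprime n M))"
proof -
  assume "M > 0"
  have "coprime (n + M) M \<longleftrightarrow> coprime n M" for n
    by (metis add.commute coprime_iff_gcd_eq_1 gcd_add2 gcd.commute)
  then show ?thesis using \<open>M > 0\<close> unfolding dirichlet_character_def by auto
qed

section \<open>Continuation of L-functions to Re s > 0\<close>

text \<open>The residue of the L-function at s = 1; its vanishing serves as the criterion for a
  non-principal character.\<close>

definition char_mean :: "nat \<Rightarrow> (nat \<Rightarrow> complex) \<Rightarrow> complex" where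
  "char_mean M \<psi> = (\<Sum>m=1..M. \<psi> m) / of_nat M"

lemma sum_periodic_shift:
  fixes f :: "nat \<Rightarrow> complex"
  assumes "\<And>n. f (n + M) = f n"
  shows "(\<Sum>m=1..n+M. f m) = (\<Sum>m=1..n. f m) + (\<Sum>m=1..M. f m)"
proof (induction n)
  case (Suc n)
  have "f (Suc (n + M)) = f (Suc n)" using assms[of "Suc n"] by simp
  then show ?case using Suc by simp
qed simp

lemma periodic_bounded:
  fixes D :: "nat \<Rightarrow> complex"
  assumes "\<And>n. D (n + M) = D n" "M > 0"
  obtains B where "\<And>n. norm (D n) \<le> B"
proof -
  have "norm (D n) \<le> (\<Sum>i<M. norm (D i))" for n
  proof -
    have "D n = D (n mod M)" by (rule periodic_mod) (rule assms)
    moreover have "norm (D (n mod M)) \<le> (\<Sum>i<M. norm (D i))"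
      using assms(2) by (intro member_le_sum) auto
    ultimately show ?thesis by simp
  qed
  then show ?thesis using that by blast
qed

text \<open>The summatory function without its linear trend: what is left is M-periodic, hence
  bounded.\<close>

definition char_disc :: "nat \<Rightarrow> (nat \<Rightarrow> complex) \<Rightarrow> nat \<Rightarrow> complex" where
  "char_disc M \<psi> n = (\<Sum>m=1..n. \<psi> m) - char_mean M \<psi> * of_nat n"

lemma char_disc_bounded:
  assumes "dirichlet_character M \<psi>"
  shows "\<exists>B. \<forall>n. norm (char_disc M \<psi> n) \<le> B"
proof -
  have M: "M > 0" and per: "\<And>n. \<psi> (n + M) = \<psi> n" using assms by (auto simp: dirichlet_character_def)
  have "char_disc M \<psi> (n + M) = char_disc M \<psi> n" for n
    unfolding char_disc_def sum_periodic_shift[of \<psi>, OF per] using M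
    by (simp add: char_mean_def field_simps)
  from periodic_bounded[of "char_disc M \<psi>", OF this M] show ?thesis by metis
qed

text \<open>This is (s - 1) zeta(s), continued to Re s > 0. Telescoping n powr (1 - s) over n >= 1
  gives -1, compensated by the leading 1, and leaves (s - 1) times the sum of n powr (-s).\<close>

definition zeta_reg :: "complex \<Rightarrow> complex" where
  "zeta_reg s = 1 + (\<Sum>n. of_bool (n > 0) * (of_nat (Suc n) powr (-(s - 1)) - of_nat n powr (-(s - 1))
      + (s - 1) * of_nat n powr (-(s - 1) - 1)))"

lemma zeta_reg_holomorphic: "zeta_reg holomorphic_on {s. Re s > 0}"
proof -
  let ?g = "\<lambda>s. \<Sum>n. of_bool (n > 0) * (of_nat (Suc n) powr (-s) - of_nat n powr (-s) + s * of_nat n powr (-s - 1))"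
  have h: "?g holomorphic_on {s. Re s > -1}"
    by (rule holomorphic_second_difference(1)[where k = 0]) auto
  have "(?g \<circ> (\<lambda>s. s - 1)) holomorphic_on {s. Re s > 0}"
    by (rule holomorphic_on_compose_gen[OF _ h]) (auto intro!: holomorphic_intros)
  then have "(\<lambda>s. 1 + (?g \<circ> (\<lambda>s. s - 1)) s) holomorphic_on {s. Re s > 0}"
    by (intro holomorphic_intros)
  then show ?thesis unfolding zeta_reg_def o_def .
qed

lemma zeta_reg_1: "zeta_reg 1 = 1"
proof -
  have "of_bool (n > 0) * (of_nat (Suc n) powr (-(1 - 1)) - of_nat n powr (-(1 - 1))
      + (1 - 1) * of_nat n powr (-(1 - 1) - 1)) = (0 :: complex)" for n
    by (cases "n = 0") (simp_all add: powr_def del: of_nat_Suc)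
  then show ?thesis unfolding zeta_reg_def by (simp only: suminf_zero) simp
qed

lemma zeta_reg_eq:
  assumes s: "Re s > 1"
  shows "zeta_reg s = (s - 1) * dirichlet_sum (\<lambda>_. 1) s"
proof -
  let ?u = "\<lambda>n. of_bool (n > 0) * (of_nat (Suc n) powr (-(s - 1)) - of_nat n powr (-(s - 1))
      + (s - 1) * of_nat n powr (-(s - 1) - 1))"
  have id: "(\<Sum>n<Suc N. ?u n) = of_nat (Suc N) powr (-(s-1)) - 1 + (s - 1) * (\<Sum>n<Suc N. 1 * of_nat n powr (-s))" for N
    by (induction N) (simp_all add: algebra_simps)
  have 1: "(\<lambda>N. of_nat (Suc N) powr (-(s-1)) :: complex) \<longlonglongrightarrow> 0"
  proof (rule LIMSEQ_Suc, rule tendsto_norm_zero_cancel)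
    have "((\<lambda>x. x powr (1 - Re s)) \<longlongrightarrow> 0) at_top" using s by (intro tendsto_neg_powr filterlim_ident) auto
    then have "(\<lambda>N. real N powr (1 - Re s)) \<longlonglongrightarrow> 0"
      by (rule filterlim_compose) (rule filterlim_real_sequentially)
    then show "(\<lambda>N. norm (of_nat N powr (-(s-1)) :: complex)) \<longlonglongrightarrow> 0"
      by (simp add: norm_nat_powr)
  qed
  have "(\<lambda>n. 1 * of_nat n powr (-s)) sums dirichlet_sum (\<lambda>_. 1) s"
    by (rule dirichlet_sums[OF summable_bounded_dirichlet[of _ 1]]) (use s in auto)
  then have 2: "(\<lambda>N. \<Sum>n<Suc N. 1 * of_nat n powr (-s)) \<longlonglongrightarrow> dirichlet_sum (\<lambda>_. 1) s"
    unfolding sums_def by (rule LIMSEQ_Suc)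
  have "(\<lambda>N. \<Sum>n<Suc N. ?u n) \<longlonglongrightarrow> 0 - 1 + (s - 1) * dirichlet_sum (\<lambda>_. 1) s"
    unfolding id by (intro tendsto_intros 1 2)
  then have "?u sums (0 - 1 + (s - 1) * dirichlet_sum (\<lambda>_. 1) s)"
    unfolding sums_def by (subst filterlim_sequentially_Suc[symmetric])
  then have "(\<Sum>n. ?u n) = 0 - 1 + (s - 1) * dirichlet_sum (\<lambda>_. 1) s" by (rule sums_unique[symmetric])
  then show ?thesis unfolding zeta_reg_def by simp
qed

definition char_reg :: "nat \<Rightarrow> (nat \<Rightarrow> complex) \<Rightarrow> complex \<Rightarrow> complex" where
  "char_reg M \<psi> s = (\<Sum>n. char_disc M \<psi> n * (of_nat n powr (-s) - of_nat (Suc n) powr (-s)))"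

text \<open>At \<open>s = 1\<close> the second summand is \<open>0\<close>, which is the correct value for a non-principal character.\<close>
definition L_cont :: "nat \<Rightarrow> (nat \<Rightarrow> complex) \<Rightarrow> complex \<Rightarrow> complex" where
  "L_cont M \<psi> s = char_reg M \<psi> s + char_mean M \<psi> * zeta_reg s / (s - 1)"

lemma char_reg_holomorphic:
  assumes "dirichlet_character M \<psi>"
  shows "char_reg M \<psi> holomorphic_on {s. Re s > 0}"
proof -
  obtain B where "\<And>n. norm (char_disc M \<psi> n) \<le> B" using char_disc_bounded[OF assms] by auto
  then show ?thesis unfolding char_reg_def by (rule holomorphic_bounded_partial_sums)
qed

text \<open>Abel summation is linear in the summatory function, and that of \<psi> is the
  discrepancy plus \<open>char_mean\<close> times that of the constant 1.\<close>

lemma L_cont_eq: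
  assumes \<psi>: "dirichlet_character M \<psi>" and s: "Re s > 1"
  shows "L_cont M \<psi> s = dirichlet_sum \<psi> s"
proof -
  let ?\<Delta> = "\<lambda>n. of_nat n powr (-s) - of_nat (Suc n) powr (-s)"
  obtain B where B: "\<And>n. norm (char_disc M \<psi> n) \<le> B" using char_disc_bounded[OF \<psi>] by auto
  have 1: "(\<lambda>n. (\<Sum>m=1..n. \<psi> m) * ?\<Delta> n) sums dirichlet_sum \<psi> s"
    by (rule dirichlet_abel_summation[OF dirichlet_character_norm_le[OF \<psi>] s])
  have 2: "(\<lambda>n. (\<Sum>m=1..n. 1) * ?\<Delta> n) sums dirichlet_sum (\<lambda>_. 1) s"
    by (rule dirichlet_abel_summation[OF _ s]) simp
  have 3: "(\<lambda>n. char_disc M \<psi> n * ?\<Delta> n) sums char_reg M \<psi> s"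
    unfolding char_reg_def
    by (rule summable_sums, rule summable_norm_cancel, rule holomorphic_bounded_partial_sums(2)[OF B]) (use s in auto)
  have "(\<lambda>n. char_disc M \<psi> n * ?\<Delta> n + char_mean M \<psi> * ((\<Sum>m=1..n. 1) * ?\<Delta> n)) sums
      (char_reg M \<psi> s + char_mean M \<psi> * dirichlet_sum (\<lambda>_. 1) s)"
    by (rule sums_add[OF 3 sums_mult[OF 2]])
  also have "(\<lambda>n. char_disc M \<psi> n * ?\<Delta> n + char_mean M \<psi> * ((\<Sum>m=1..n. 1) * ?\<Delta> n)) = (\<lambda>n. (\<Sum>m=1..n. \<psi> m) * ?\<Delta> n)"
    by (auto simp: char_disc_def algebra_simps)
  finally have "dirichlet_sum \<psi> s = char_reg M \<psi> s + char_mean M \<psi> * dirichlet_sum (\<lambda>_. 1) s"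
    using 1 sums_unique2 by blast
  moreover have "s - 1 \<noteq> 0" using s by auto
  ultimately show ?thesis unfolding L_cont_def zeta_reg_eq[OF s] by simp
qed

lemma L_cont_holomorphic:
  assumes \<psi>: "dirichlet_character M \<psi>" and A: "A \<subseteq> {s. Re s > 0}" "char_mean M \<psi> = 0 \<or> 1 \<notin> A"
  shows "L_cont M \<psi> holomorphic_on A"
proof -
  have r: "char_reg M \<psi> holomorphic_on A"
    by (rule holomorphic_on_subset[OF char_reg_holomorphic[OF \<psi>] A(1)])
  have z: "zeta_reg holomorphic_on A" by (rule holomorphic_on_subset[OF zeta_reg_holomorphic A(1)])
  show ?thesis
  proof (cases "char_mean M \<psi> = 0")
    case True
    then show ?thesis using r by (simp add: L_cont_def[abs_def])
  next
    case False
    then have "s - 1 \<noteq> 0" if "s \<in> A" for s using A(2) that by auto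
    then show ?thesis unfolding L_cont_def[abs_def] by (intro holomorphic_intros r z) auto
  qed
qed

section \<open>Moebius and von Mangoldt series, orders of zeros\<close>

text \<open>The divisors of p x are the divisors of x prime to p, and p d for the divisors d of x.
  In the second group mu vanishes if p divides d, and the others cancel the first group.\<close>

lemma sum_divisors_moebius:
  assumes "n > 0"
  shows "(\<Sum>d | d dvd n. moebius_mu d) = of_bool (n = 1)"
  using assms
proof (induction n rule: prime_divisors_induct)
  case zero then show ?case by simp
next
  case (unit x) then show ?case by simp
next
  case (factor p x)
  have p: "prime p" by fact
  have x: "x > 0" using factor by auto
  have px: "p * x > 1" using prime_gt_1_nat[OF p] x by (metis less_1_mult One_nat_def Suc_lessI nat_mult_1_right)
  have dec: "{d. d dvd p * x} = {d. d dvd x \<and> \<not> p dvd d} \<union> (\<lambda>d. p * d) ` {d. d dvd x}"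
  proof (intro equalityI subsetI)
    fix d assume d: "d \<in> {d. d dvd p * x}"
    show "d \<in> {d. d dvd x \<and> \<not> p dvd d} \<union> (\<lambda>d. p * d) ` {d. d dvd x}"
    proof (cases "p dvd d")
      case True
      then obtain e where "d = p * e" by auto
      then show ?thesis using d prime_gt_0_nat[OF p] by auto
    next
      case False
      then have "coprime d p" using p prime_imp_coprime coprime_commute by blast
      then have "d dvd x" using d by (auto simp: coprime_dvd_mult_right_iff)
      then show ?thesis using False by auto
    qed
  qed auto
  have fin: "finite {d. d dvd x}" using x by simp
  have "(\<Sum>d | d dvd p * x. moebius_mu d) = (\<Sum>d | d dvd x \<and> \<not> p dvd d. moebius_mu d) + (\<Sum>d\<in>(\<lambda>d. p * d) ` {d. d dvd x}. moebius_mu d)"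
    unfolding dec using fin by (intro sum.union_disjoint) auto
  also have "(\<Sum>d\<in>(\<lambda>d. p * d) ` {d. d dvd x}. moebius_mu d) = (\<Sum>d | d dvd x. moebius_mu (p * d))"
    using prime_gt_0_nat[OF p] by (subst sum.reindex) (auto simp: inj_on_def)
  also have "\<dots> = (\<Sum>d | d dvd x \<and> \<not> p dvd d. moebius_mu (p * d))"
    using fin by (intro sum.mono_neutral_right) (auto simp: moebius_mu_prime_mult_dvd[OF p])
  also have "\<dots> = (\<Sum>d | d dvd x \<and> \<not> p dvd d. - moebius_mu d)"
    by (intro sum.cong) (auto simp: moebius_mu_prime_mult[OF p])
  finally show ?case using px by (auto simp: sum_negf)
qed

lemma dirichlet_sum_mult_moebius:
  assumes \<psi>: "dirichlet_character M \<psi>" and s: "Re s > 1"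
  shows "dirichlet_sum \<psi> s * dirichlet_sum (\<lambda>n. of_int (moebius_mu n) * \<psi> n) s = 1"
proof -
  have s1: "summable (\<lambda>n. norm (\<psi> n) * real n powr (- Re s))"
    by (rule summable_bounded_dirichlet[where B = 1]) (use s dirichlet_character_norm_le[OF \<psi>] in auto)
  have s2: "summable (\<lambda>n. norm (of_int (moebius_mu n) * \<psi> n) * real n powr (- Re s))"
    by (rule summable_bounded_dirichlet[where B = 1])
      (use s dirichlet_character_norm_le[OF \<psi>] norm_moebius_mu_le in \<open>auto simp: norm_mult simp del: norm_of_int intro!: mult_le_one\<close>)
  have "dirichlet_sum \<psi> s * dirichlet_sum (\<lambda>n. of_int (moebius_mu n) * \<psi> n) s
      = dirichlet_sum (\<lambda>n. \<Sum>d | d dvd n. of_int (moebius_mu d) * \<psi> d * \<psi> (n div d)) s"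
    using dirichlet_sum_product[OF s2 s1] by (simp only: mult.commute)
  also have "\<dots> = (\<Sum>n. of_bool (n = 1))"
    unfolding dirichlet_sum_def
  proof (rule arg_cong[where f = suminf], rule ext)
    fix n :: nat
    show "(\<Sum>d | d dvd n. of_int (moebius_mu d) * \<psi> d * \<psi> (n div d)) * of_nat n powr (-s) = (of_bool (n = 1) :: complex)"
    proof (cases "n = 0")
      case False
      have "(\<Sum>d | d dvd n. of_int (moebius_mu d) * \<psi> d * \<psi> (n div d)) = (\<Sum>d | d dvd n. of_int (moebius_mu d) * \<psi> n)"
        by (intro sum.cong refl) (auto simp: dirichlet_character_mult[OF \<psi>, symmetric] mult.assoc)
      also have "\<dots> = of_int (\<Sum>d | d dvd n. moebius_mu d) * \<psi> n" by (simp add: sum_distrib_right)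
      also have "\<dots> = of_bool (n = 1)" using False dirichlet_character_1[OF \<psi>] by (subst sum_divisors_moebius) auto
      finally show ?thesis by simp
    qed simp
  qed
  also have "\<dots> = 1" using sums_single[of 1 "\<lambda>_. 1 :: complex"] by (simp add: sums_iff of_bool_def)
  finally show ?thesis .
qed

text \<open>With g = (s - z0)^m h and h z0 nonzero, x g' / g = m + x h' / h. The order of a zero on
  the line Re s = 1 thus becomes a limit from the right, where the Dirichlet series
  converge.\<close>

lemma logderiv_limit:
  fixes g :: "complex \<Rightarrow> complex"
  assumes hol: "g holomorphic_on ball z0 r" and r: "r > 0"
    and nz: "w \<in> ball z0 r" "g w \<noteq> 0"
  obtains m :: nat where "m = 0 \<longleftrightarrow> g z0 \<noteq> 0"
    "((\<lambda>x::real. of_real x * deriv g (z0 + of_real x) / g (z0 + of_real x)) \<longlongrightarrow> of_nat m) (at_right 0)"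
proof -
  obtain m h e where e: "e > 0" "ball z0 e \<subseteq> ball z0 r" "h holomorphic_on ball z0 e"
    and gh: "\<And>w. w \<in> ball z0 e \<Longrightarrow> g w = (w - z0) ^ m * h w"
    and hnz: "h z0 \<noteq> 0" and m: "m = 0 \<longleftrightarrow> g z0 \<noteq> 0"
  proof (cases "g z0 = 0")
    case True
    have nc: "\<not> g constant_on ball z0 r"
      using nz True r unfolding constant_on_def by (metis centre_in_ball)
    obtain h e n where "0 < n" "0 < e" "ball z0 e \<subseteq> ball z0 r" "h holomorphic_on ball z0 e"
      "\<And>w. w \<in> ball z0 e \<Longrightarrow> g w = (w - z0) ^ n * h w" "\<And>w. w \<in> ball z0 e \<Longrightarrow> h w \<noteq> 0"
      by (rule holomorphic_factor_zero_nonconstant[OF hol _ _ _ True nc]) (use r in auto)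
    then show ?thesis using that[of e h n] True by auto
  next
    case False
    then show ?thesis using that[of r g 0] r hol by auto
  qed
  have hcont: "continuous_on (ball z0 e) h" using e(3) by (rule holomorphic_on_imp_continuous_on)
  have dhol: "deriv h holomorphic_on ball z0 e" using e(3) by (intro holomorphic_deriv) auto
  have dhcont: "continuous_on (ball z0 e) (deriv h)" using dhol by (rule holomorphic_on_imp_continuous_on)
  have ic: "isCont h z0" "isCont (deriv h) z0"
    using hcont dhcont e(1) by (auto simp: continuous_on_eq_continuous_at)
  have to: "((\<lambda>x::real. z0 + of_real x) \<longlongrightarrow> z0) (at_right 0)"
    by (auto intro!: tendsto_eq_intros)
  have lim: "((\<lambda>x::real. of_nat m + of_real x * deriv h (z0 + of_real x) / h (z0 + of_real x)) \<longlongrightarrow> of_nat m + of_real 0 * deriv h z0 / h z0) (at_right 0)"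
    by (intro tendsto_intros isCont_tendsto_compose[OF ic(1)] isCont_tendsto_compose[OF ic(2)] to hnz)
  have "eventually (\<lambda>x::real. x \<in> {0<..<e}) (at_right 0)"
    using e(1) by (rule eventually_at_right_real)
  moreover have "eventually (\<lambda>x::real. h (z0 + of_real x) \<noteq> 0) (at_right 0)"
    using isCont_tendsto_compose[OF ic(1) to] hnz by (rule tendsto_imp_eventually_ne)
  ultimately have ev: "eventually (\<lambda>x::real. of_nat m + of_real x * deriv h (z0 + of_real x) / h (z0 + of_real x)
      = of_real x * deriv g (z0 + of_real x) / g (z0 + of_real x)) (at_right 0)"
  proof eventually_elim
    case (elim x)
    let ?w = "z0 + complex_of_real x"
    have w: "?w \<in> ball z0 e" using elim by (simp add: dist_norm)
    have hd: "(h has_field_derivative deriv h ?w) (at ?w)"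
      using e(3) w by (simp add: holomorphic_derivI)
    have "((\<lambda>w. (w - z0) ^ m * h w) has_field_derivative
        (of_nat m * (?w - z0) ^ (m - 1) * h ?w + (?w - z0) ^ m * deriv h ?w)) (at ?w)"
      by (auto intro!: derivative_eq_intros hd simp: algebra_simps)
    then have "(g has_field_derivative
        (of_nat m * (?w - z0) ^ (m - 1) * h ?w + (?w - z0) ^ m * deriv h ?w)) (at ?w)"
      by (rule has_field_derivative_transform_within_open[of _ _ _ "ball z0 e"]) (use w gh in auto)
    then have "deriv g ?w = of_nat m * of_real x ^ (m - 1) * h ?w + of_real x ^ m * deriv h ?w"
      by (simp add: DERIV_imp_deriv)
    moreover have "g ?w = of_real x ^ m * h ?w" using gh[OF w] by simp
    ultimately show ?case using elim by (cases m) (simp_all add: field_simps)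
  qed
  have "((\<lambda>x::real. of_real x * deriv g (z0 + of_real x) / g (z0 + of_real x)) \<longlongrightarrow> of_nat m) (at_right 0)"
    by (rule Lim_transform_eventually[OF _ ev]) (use lim in simp)
  then show ?thesis by (rule that[OF m])
qed

lemma summable_ln_powr:
  assumes "\<sigma> > 1"
  shows "summable (\<lambda>n. ln (real n) * real n powr (- \<sigma>))"
proof (rule summable_comparison_test')
  define e where "e = (\<sigma> - 1) / 2"
  have e: "e > 0" using assms by (simp add: e_def)
  show "summable (\<lambda>n. 1 / e * real n powr (- 1 - e))" using e by (rule summable_powr_minus_offset)
  show "norm (ln (real n) * real n powr (- \<sigma>)) \<le> 1 / e * real n powr (- 1 - e)" if "n \<ge> 1" for n
  proof -
    have "ln (real n) \<le> real n powr e / e" using that e by (intro ln_powr_bound) auto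
    then have "ln (real n) * real n powr (- \<sigma>) \<le> real n powr e / e * real n powr (- \<sigma>)"
      by (intro mult_right_mono) auto
    also have "\<dots> = 1 / e * real n powr (e - \<sigma>)" by (simp add: powr_add[symmetric])
    also have "e - \<sigma> = - 1 - e" by (simp add: e_def field_simps)
    finally show ?thesis using that by simp
  qed
qed

lemma summable_mangoldt_char:
  assumes "\<And>n. norm (f n :: complex) \<le> 1" "\<sigma> > 1"
  shows "summable (\<lambda>n. norm (f n * mangoldt n) * real n powr (- \<sigma>))"
proof (rule summable_comparison_test'[OF summable_ln_powr[OF assms(2)]])
  show "norm (norm (f n * mangoldt n) * real n powr (- \<sigma>)) \<le> ln (real n) * real n powr (- \<sigma>)" if "n \<ge> 1" for n
  proof -
    have "norm (f n * mangoldt n) \<le> 1 * ln (real n)"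
      unfolding norm_mult norm_mangoldt using that assms(1)[of n] mangoldt_le[of n] mangoldt_nonneg[of n]
      by (intro mult_mono) auto
    then show ?thesis by (simp add: mult_right_mono)
  qed
qed

text \<open>The convolution of \<psi> times von Mangoldt's function with \<psi> is \<psi> times the
  logarithm, and termwise differentiation identifies the latter with the coefficients of -
  L'.\<close>

lemma dirichlet_sum_logderiv:
  assumes \<psi>: "dirichlet_character M \<psi>" and s: "Re s > 1"
  shows "dirichlet_sum (\<lambda>n. \<psi> n * mangoldt n) s * L_cont M \<psi> s = - deriv (L_cont M \<psi>) s"
proof -
  have n1: "norm (\<psi> n) \<le> 1" for n by (rule dirichlet_character_norm_le[OF \<psi>])
  have "dirichlet_sum (\<lambda>n. \<psi> n * mangoldt n) s * dirichlet_sum \<psi> s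
      = dirichlet_sum (\<lambda>n. \<Sum>d | d dvd n. \<psi> d * mangoldt d * \<psi> (n div d)) s"
    by (rule dirichlet_sum_product[symmetric, OF summable_mangoldt_char[OF n1 s] summable_bounded_dirichlet[OF n1 s]])
  also have "\<dots> = (\<Sum>n. \<psi> n * of_real (ln (real n)) * of_nat n powr (-s))"
    unfolding dirichlet_sum_def
  proof (rule arg_cong[where f = suminf], rule ext)
    fix n :: nat
    show "(\<Sum>d | d dvd n. \<psi> d * mangoldt d * \<psi> (n div d)) * of_nat n powr (-s) = \<psi> n * of_real (ln (real n)) * of_nat n powr (-s)"
    proof (cases "n = 0")
      case False
      have "(\<Sum>d | d dvd n. \<psi> d * mangoldt d * \<psi> (n div d)) = (\<Sum>d | d dvd n. \<psi> n * mangoldt d)"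
      proof (intro sum.cong refl)
        fix d assume "d \<in> {d. d dvd n}"
        then have "\<psi> n = \<psi> d * \<psi> (n div d)" by (simp add: dirichlet_character_mult[OF \<psi>, symmetric])
        then show "\<psi> d * mangoldt d * \<psi> (n div d) = \<psi> n * mangoldt d" by simp
      qed
      also have "\<dots> = \<psi> n * of_real (ln (real n))"
        using mangoldt_sum[OF False, where ?'a = complex] by (simp add: sum_distrib_left[symmetric])
      finally show ?thesis by simp
    qed simp
  qed
  also have "\<dots> = - deriv (L_cont M \<psi>) s"
  proof -
    have "(\<lambda>n. \<psi> n * (- of_real (ln (real n)) * of_nat n powr (-s))) sums deriv (\<lambda>s. \<Sum>n. \<psi> n * of_nat n powr (-s)) s"
    proof (rule has_field_derivative_suminf[of "{s. Re s > 1}"])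
      fix n z assume "z \<in> {s. Re s > 1}"
      show "((\<lambda>s. \<psi> n * of_nat n powr (-s)) has_field_derivative \<psi> n * (- of_real (ln (real n)) * of_nat n powr (-z))) (at z)"
      proof (cases "n = 0")
        case False
        then show ?thesis
          unfolding powr_def by (auto intro!: derivative_eq_intros simp: Ln_of_nat)
      qed simp
    next
      fix z assume "z \<in> {s. Re s > 1}"
      then have z: "Re z > 1" by simp
      obtain d where d: "d > 0" "cball z d \<subseteq> {s. Re s > 1}" "\<And>w. w \<in> cball z d \<Longrightarrow> Re w \<ge> (Re z + 1) / 2"
        "\<And>w. w \<in> cball z d \<Longrightarrow> norm w \<le> norm z + d"
        using half_plane_cball[OF z] by blast
      have "norm (\<psi> n * of_nat n powr (-w)) \<le> real n powr (- ((Re z + 1) / 2))" if w: "w \<in> cball z d" for n w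
      proof -
        have "norm (\<psi> n * of_nat n powr (-w)) \<le> 1 * real n powr (- Re w)"
          unfolding norm_mult norm_nat_powr using n1[of n] by (intro mult_mono) auto
        also have "\<dots> \<le> real n powr (- ((Re z + 1) / 2))"
          using d(3)[OF w] by (cases "n = 0") (auto intro!: powr_mono)
        finally show ?thesis .
      qed
      moreover have "summable (\<lambda>n. real n powr (- ((Re z + 1) / 2)))" using z by (simp add: summable_real_powr_iff)
      ultimately show "\<exists>d>0. \<exists>m. cball z d \<subseteq> {s. Re s > 1} \<and> summable m \<and> (\<forall>n. \<forall>w\<in>cball z d. norm (\<psi> n * of_nat n powr (-w)) \<le> m n)"
        using d(1,2) by (intro exI[of _ d] conjI exI[of _ "\<lambda>n. real n powr (- ((Re z + 1) / 2))"]) auto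
    qed (use s in auto)
    then have "(\<lambda>n. - (\<psi> n * of_real (ln (real n)) * of_nat n powr (-s))) sums deriv (dirichlet_sum \<psi>) s"
      unfolding dirichlet_sum_def by (simp add: mult.assoc)
    then have "(\<lambda>n. (\<psi> n * of_real (ln (real n)) * of_nat n powr (-s))) sums (- deriv (dirichlet_sum \<psi>) s)"
      using sums_minus by fastforce
    moreover have "deriv (dirichlet_sum \<psi>) s = deriv (L_cont M \<psi>) s"
    proof (rule deriv_cong_ev)
      have "eventually (\<lambda>x. x \<in> {s. Re s > 1}) (nhds s)" using s by (intro eventually_nhds_in_open) auto
      then show "eventually (\<lambda>x. dirichlet_sum \<psi> x = L_cont M \<psi> x) (nhds s)"
        by eventually_elim (simp add: L_cont_eq[OF \<psi>])
    qed simp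
    ultimately show ?thesis by (simp add: sums_iff)
  qed
  finally show ?thesis using L_cont_eq[OF \<psi> s] by simp
qed

lemma L_cont_nonzero_gt_1:
  assumes \<psi>: "dirichlet_character M \<psi>" and s: "Re s > 1"
  shows "L_cont M \<psi> s \<noteq> 0"
  using dirichlet_sum_mult_moebius[OF assms] L_cont_eq[OF assms] by auto

lemma L_cont_order:
  assumes \<psi>: "dirichlet_character M \<psi>" and u: "char_mean M \<psi> = 0 \<or> u \<noteq> 0"
  obtains m :: nat where "m = 0 \<longleftrightarrow> L_cont M \<psi> (Complex 1 u) \<noteq> 0"
    "((\<lambda>x::real. of_real x * dirichlet_sum (\<lambda>n. \<psi> n * mangoldt n) (Complex 1 u + of_real x)) \<longlongrightarrow> - of_nat m) (at_right 0)"
proof -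
  define z0 where "z0 = Complex 1 u"
  \<comment> \<open>If the mean is nonzero then u is nonzero, and the pole s = 1 has distance |u|
    from the centre; this radius keeps it outside the disc.\<close>
  define r where "r = (if u = 0 then 1 else min 1 \<bar>u\<bar>)"
  have r: "r > 0" by (simp add: r_def)
  have sub: "ball z0 r \<subseteq> {s. Re s > 0}"
  proof
    fix w assume "w \<in> ball z0 r"
    then have "norm (z0 - w) < 1" by (simp add: dist_norm r_def split: if_splits)
    then have "\<bar>Re (z0 - w)\<bar> < 1" using abs_Re_le_cmod[of "z0 - w"] by linarith
    then show "w \<in> {s. Re s > 0}" by (simp add: z0_def)
  qed
  have n1: "char_mean M \<psi> = 0 \<or> 1 \<notin> ball z0 r"
  proof (cases "char_mean M \<psi> = 0")
    case False
    then have "u \<noteq> 0" using u by simp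
    have "norm (z0 - 1) \<ge> \<bar>u\<bar>" using abs_Im_le_cmod[of "z0 - 1"] by (simp add: z0_def)
    then show ?thesis using \<open>u \<noteq> 0\<close> by (simp add: dist_norm r_def)
  qed simp
  have hol: "L_cont M \<psi> holomorphic_on ball z0 r" by (rule L_cont_holomorphic[OF \<psi> sub n1])
  have w: "z0 + of_real (r/2) \<in> ball z0 r" using r by (simp add: dist_norm)
  have nz: "L_cont M \<psi> (z0 + of_real (r/2)) \<noteq> 0" using r by (intro L_cont_nonzero_gt_1[OF \<psi>]) (simp add: z0_def)
  obtain m where m: "m = 0 \<longleftrightarrow> L_cont M \<psi> z0 \<noteq> 0"
    and lim: "((\<lambda>x::real. of_real x * deriv (L_cont M \<psi>) (z0 + of_real x) / L_cont M \<psi> (z0 + of_real x)) \<longlongrightarrow> of_nat m) (at_right 0)"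
    by (rule logderiv_limit[OF hol r w nz])
  have "((\<lambda>x::real. of_real x * dirichlet_sum (\<lambda>n. \<psi> n * mangoldt n) (z0 + of_real x)) \<longlongrightarrow> - of_nat m) (at_right 0)"
  proof (rule Lim_transform_eventually[OF tendsto_minus[OF lim]])
    have "eventually (\<lambda>x::real. x > 0) (at_right 0)" by (rule eventually_at_right_less)
    then show "eventually (\<lambda>x::real. - (of_real x * deriv (L_cont M \<psi>) (z0 + of_real x) / L_cont M \<psi> (z0 + of_real x))
       = of_real x * dirichlet_sum (\<lambda>n. \<psi> n * mangoldt n) (z0 + of_real x)) (at_right 0)"
    proof eventually_elim
      case (elim x)
      have re: "Re (z0 + of_real x) > 1" using elim by (simp add: z0_def)
      from dirichlet_sum_logderiv[OF \<psi> re] L_cont_nonzero_gt_1[OF \<psi> re]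
      have "dirichlet_sum (\<lambda>n. \<psi> n * mangoldt n) (z0 + of_real x) = - deriv (L_cont M \<psi>) (z0 + of_real x) / L_cont M \<psi> (z0 + of_real x)"
        by (metis nonzero_eq_divide_eq)
      then show ?case by simp
    qed
  qed
  then show ?thesis using m unfolding z0_def by (intro that[of m])
qed

lemma char_mean_principal_nonzero:
  assumes "M > 0"
  shows "char_mean M (\<lambda>n. of_bool (coprime n M)) \<noteq> 0"
proof -
  have "(\<Sum>m=1..M. of_bool (coprime m M) :: complex) = of_nat (card {m\<in>{1..M}. coprime m M})"
    by (simp add: of_bool_def sum.If_cases Int_def)
  moreover have "1 \<in> {m\<in>{1..M}. coprime m M}" using assms by auto
  then have "card {m\<in>{1..M}. coprime m M} \<noteq> 0" by (auto simp: card_eq_0_iff)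
  ultimately show ?thesis using assms unfolding char_mean_def by simp
qed

text \<open>Since (s - 1) L is regular and nonzero at 1, its logarithmic derivative contributes 0 in
  the limit, and the simple pole of L contributes the 1.\<close>

lemma principal_order:
  assumes M: "M > 0"
  shows "((\<lambda>x::real. of_real x * dirichlet_sum (\<lambda>n. of_bool (coprime n M) * mangoldt n) (1 + of_real x)) \<longlongrightarrow> 1) (at_right 0)"
proof -
  define \<psi> where "\<psi> = (\<lambda>n. of_bool (coprime n M) :: complex)"
  have \<psi>: "dirichlet_character M \<psi>" unfolding \<psi>_def by (rule dirichlet_character_principal[OF M])
  define g where "g = (\<lambda>s. (s - 1) * char_reg M \<psi> s + char_mean M \<psi> * zeta_reg s)"
  have sub: "ball 1 1 \<subseteq> {s. Re s > 0}"
  proof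
    fix w :: complex assume "w \<in> ball 1 1"
    then have "\<bar>Re (1 - w)\<bar> < 1" using abs_Re_le_cmod[of "1 - w"] by (simp add: dist_norm)
    then show "w \<in> {s. Re s > 0}" by simp
  qed
  have hol: "g holomorphic_on ball 1 1" unfolding g_def
    by (intro holomorphic_intros holomorphic_on_subset[OF char_reg_holomorphic[OF \<psi>] sub]
        holomorphic_on_subset[OF zeta_reg_holomorphic sub])
  have g1: "g 1 \<noteq> 0" unfolding g_def zeta_reg_1 \<psi>_def using char_mean_principal_nonzero[OF M] by simp
  obtain m where m: "m = 0 \<longleftrightarrow> g 1 \<noteq> 0"
    and lim: "((\<lambda>x::real. of_real x * deriv g (1 + of_real x) / g (1 + of_real x)) \<longlongrightarrow> of_nat m) (at_right 0)"
    by (rule logderiv_limit[OF hol, of 1]) (use g1 in auto)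
  have "((\<lambda>x::real. 1 - of_real x * deriv g (1 + of_real x) / g (1 + of_real x)) \<longlongrightarrow> 1 - of_nat m) (at_right 0)"
    by (intro tendsto_intros lim)
  then have lim': "((\<lambda>x::real. 1 - of_real x * deriv g (1 + of_real x) / g (1 + of_real x)) \<longlongrightarrow> 1) (at_right 0)"
    using m g1 by simp
  show ?thesis
  proof (rule Lim_transform_eventually[OF lim'])
    have "eventually (\<lambda>x::real. x > 0) (at_right 0)" by (rule eventually_at_right_less)
    then show "eventually (\<lambda>x::real. 1 - of_real x * deriv g (1 + of_real x) / g (1 + of_real x)
       = of_real x * dirichlet_sum (\<lambda>n. of_bool (coprime n M) * mangoldt n) (1 + of_real x)) (at_right 0)"
    proof eventually_elim
      case (elim x)
      let ?s = "1 + complex_of_real x"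
      let ?L = "L_cont M \<psi>"
      have re: "Re ?s > 1" using elim by simp
      have nz: "?L ?s \<noteq> 0" by (rule L_cont_nonzero_gt_1[OF \<psi> re])
      have gL: "g s = (s - 1) * ?L s" if "s \<in> {s. Re s > 1}" for s
      proof -
        have "s - 1 \<noteq> 0" using that by auto
        then show ?thesis unfolding g_def L_cont_def by (simp add: field_simps)
      qed
      have "?L holomorphic_on {s. Re s > 1}"
        by (rule L_cont_holomorphic[OF \<psi>]) auto
      then have dL: "(?L has_field_derivative deriv ?L ?s) (at ?s)"
        by (rule holomorphic_derivI) (use re in auto)
      have "((\<lambda>s. (s - 1) * ?L s) has_field_derivative (?L ?s + of_real x * deriv ?L ?s)) (at ?s)"
        by (auto intro!: derivative_eq_intros dL)
      then have "(g has_field_derivative (?L ?s + of_real x * deriv ?L ?s)) (at ?s)"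
        by (rule has_field_derivative_transform_within_open[of _ _ _ "{s. Re s > 1}"]) (use re gL in auto)
      then have dg: "deriv g ?s = ?L ?s + of_real x * deriv ?L ?s" by (rule DERIV_imp_deriv)
      have ds: "deriv ?L ?s = - (dirichlet_sum (\<lambda>n. \<psi> n * mangoldt n) ?s * ?L ?s)"
        using dirichlet_sum_logderiv[OF \<psi> re] by (metis minus_equation_iff)
      have "g ?s = of_real x * ?L ?s" using gL[of ?s] re by simp
      then show ?case unfolding dg ds using nz elim by (simp add: field_simps \<psi>_def)
    qed
  qed
qed

lemma nat_powr_polar:
  assumes "n > 0"
  shows "of_nat n powr (-(Complex 1 u + of_real x)) = of_real (real n powr (-(1 + x))) * cis (- u * ln (real n))"
proof -
  have "of_nat n powr (-(Complex 1 u + of_real x)) = exp (-(Complex 1 u + of_real x) * of_real (ln (real n)))"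
    using assms by (simp add: powr_def Ln_of_nat)
  also have "\<dots> = of_real (exp (-(1 + x) * ln (real n))) * cis (- u * ln (real n))"
    by (subst exp_eq_polar) simp
  also have "exp (-(1 + x) * ln (real n)) = real n powr (-(1 + x))"
    using assms by (simp add: powr_def)
  finally show ?thesis .
qed

section \<open>Nonvanishing on the line Re s = 1\<close>

text \<open>On the unit circle this real part is the square 2 (1 + Re z)^2.\<close>

lemma three_four_one:
  fixes z :: complex
  assumes "norm z = 1"
  shows "Re (3 + 4 * z + z\<^sup>2) \<ge> 0"
proof -
  have "(Re z)\<^sup>2 + (Im z)\<^sup>2 = 1" using assms cmod_power2[of z] by simp
  then have "Re (3 + 4 * z + z\<^sup>2) = 2 * (1 + Re z)\<^sup>2"
    by (simp add: power2_eq_square algebra_simps)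
  then show ?thesis by simp
qed

lemma mangoldt_three_four_one:
  assumes \<psi>: "dirichlet_character M \<psi>" and x: "x > 0"
  shows "Re (3 * dirichlet_sum (\<lambda>n. of_bool (coprime n M) * mangoldt n) (1 + of_real x)
     + 4 * dirichlet_sum (\<lambda>n. \<psi> n * mangoldt n) (Complex 1 u + of_real x)
     + dirichlet_sum (\<lambda>n. \<psi> n ^ 2 * mangoldt n) (Complex 1 (2 * u) + of_real x)) \<ge> 0"
proof -
  let ?a = "\<lambda>n. of_bool (coprime n M) * mangoldt n * of_nat n powr (-(Complex 1 0 + of_real x)) :: complex"
  let ?b = "\<lambda>n. \<psi> n * mangoldt n * of_nat n powr (-(Complex 1 u + of_real x))"
  let ?c = "\<lambda>n. \<psi> n ^ 2 * mangoldt n * of_nat n powr (-(Complex 1 (2 * u) + of_real x))"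
  have M: "M > 0" using \<psi> by (simp add: dirichlet_character_def)
  have re: "Re (Complex 1 v + of_real x) > 1" for v using x by simp
  have 1: "?a sums dirichlet_sum (\<lambda>n. of_bool (coprime n M) * mangoldt n) (Complex 1 0 + of_real x)"
    by (rule dirichlet_sums, rule summable_mangoldt_char[OF _ re]) auto
  have 2: "?b sums dirichlet_sum (\<lambda>n. \<psi> n * mangoldt n) (Complex 1 u + of_real x)"
    by (rule dirichlet_sums, rule summable_mangoldt_char[OF dirichlet_character_norm_le[OF \<psi>] re])
  have 3: "?c sums dirichlet_sum (\<lambda>n. \<psi> n ^ 2 * mangoldt n) (Complex 1 (2 * u) + of_real x)"
    by (rule dirichlet_sums, rule summable_mangoldt_char[OF dirichlet_character_norm_le[OF dirichlet_character_square[OF \<psi>]] re])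
  have "(\<lambda>n. 3 * ?a n + 4 * ?b n + ?c n) sums
     (3 * dirichlet_sum (\<lambda>n. of_bool (coprime n M) * mangoldt n) (Complex 1 0 + of_real x)
     + 4 * dirichlet_sum (\<lambda>n. \<psi> n * mangoldt n) (Complex 1 u + of_real x)
     + dirichlet_sum (\<lambda>n. \<psi> n ^ 2 * mangoldt n) (Complex 1 (2 * u) + of_real x))"
    by (intro sums_add sums_mult 1 2 3)
  then have sums: "(\<lambda>n. Re (3 * ?a n + 4 * ?b n + ?c n)) sums
     Re (3 * dirichlet_sum (\<lambda>n. of_bool (coprime n M) * mangoldt n) (Complex 1 0 + of_real x)
     + 4 * dirichlet_sum (\<lambda>n. \<psi> n * mangoldt n) (Complex 1 u + of_real x)
     + dirichlet_sum (\<lambda>n. \<psi> n ^ 2 * mangoldt n) (Complex 1 (2 * u) + of_real x))"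
    by (rule sums_Re)
  have nonneg: "Re (3 * ?a n + 4 * ?b n + ?c n) \<ge> 0" for n
  proof (cases "n > 0 \<and> coprime n M")
    case True
    then have n: "n > 0" and cop: "coprime n M" by auto
    define z where "z = \<psi> n * cis (- u * ln (real n))"
    have nz: "norm z = 1" using dirichlet_character_norm[OF \<psi> cop] by (simp add: z_def norm_mult)
    have z2: "z ^ 2 = \<psi> n ^ 2 * cis (- (2 * u) * ln (real n))"
      by (simp add: z_def power_mult_distrib Complex.DeMoivre mult.assoc)
    have "3 * ?a n + 4 * ?b n + ?c n = of_real (mangoldt n * real n powr (-(1 + x))) * (3 + 4 * z + z\<^sup>2)"
      unfolding nat_powr_polar[OF n] z2 using cop by (simp add: z_def algebra_simps)
    then have "Re (3 * ?a n + 4 * ?b n + ?c n) = mangoldt n * real n powr (-(1 + x)) * Re (3 + 4 * z + z\<^sup>2)"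
      by (simp only: Re_complex_of_real times_complex.simps Im_complex_of_real mult_zero_left diff_0_right)
    then show ?thesis using three_four_one[OF nz] mangoldt_nonneg[of n] by simp
  next
    case False
    show ?thesis
    proof (cases "n = 0")
      case False
      then have "\<not> coprime n M" using \<open>\<not> (n > 0 \<and> coprime n M)\<close> by simp
      moreover from this have "\<psi> n = 0" using \<psi> unfolding dirichlet_character_def by blast
      ultimately show ?thesis by simp
    qed simp
  qed
  have "0 \<le> Re (3 * dirichlet_sum (\<lambda>n. of_bool (coprime n M) * mangoldt n) (Complex 1 0 + of_real x)
     + 4 * dirichlet_sum (\<lambda>n. \<psi> n * mangoldt n) (Complex 1 u + of_real x)
     + dirichlet_sum (\<lambda>n. \<psi> n ^ 2 * mangoldt n) (Complex 1 (2 * u) + of_real x))"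
    by (rule sums_le[OF nonneg sums_zero sums])
  then show ?thesis by (simp only: one_complex.code[symmetric])
qed

text \<open>Multiplied by x and in the limit x -> 0, the three series contribute 3 from the pole, -
  4 m from a zero of order m >= 1 and - m2 <= 0; their sum would be negative. The hypothesis on u
  keeps \<psi> and its square away from a pole.\<close>

lemma L_cont_nonzero_341:
  assumes \<psi>: "dirichlet_character M \<psi>"
    and u: "u \<noteq> 0 \<or> char_mean M \<psi> = 0 \<and> char_mean M (\<lambda>n. \<psi> n ^ 2) = 0"
  shows "L_cont M \<psi> (Complex 1 u) \<noteq> 0"
proof
  assume zero: "L_cont M \<psi> (Complex 1 u) = 0"
  have M: "M > 0" using \<psi> by (simp add: dirichlet_character_def)
  obtain m :: nat where m: "m = 0 \<longleftrightarrow> L_cont M \<psi> (Complex 1 u) \<noteq> 0"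
    and l1: "((\<lambda>x::real. of_real x * dirichlet_sum (\<lambda>n. \<psi> n * mangoldt n) (Complex 1 u + of_real x)) \<longlongrightarrow> - of_nat m) (at_right 0)"
    by (rule L_cont_order[OF \<psi>, of u]) (use u in auto)
  obtain m2 :: nat where "m2 = 0 \<longleftrightarrow> L_cont M (\<lambda>n. \<psi> n ^ 2) (Complex 1 (2 * u)) \<noteq> 0"
    and l2: "((\<lambda>x::real. of_real x * dirichlet_sum (\<lambda>n. \<psi> n ^ 2 * mangoldt n) (Complex 1 (2 * u) + of_real x)) \<longlongrightarrow> - of_nat m2) (at_right 0)"
    by (rule L_cont_order[OF dirichlet_character_square[OF \<psi>], of "2 * u"]) (use u in auto)
  have m1: "m \<ge> 1" using m zero by simp
  note l0 = principal_order[OF M]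
  let ?A = "\<lambda>x. of_real x * dirichlet_sum (\<lambda>n. of_bool (coprime n M) * mangoldt n) (1 + of_real x)"
  let ?B = "\<lambda>x. of_real x * dirichlet_sum (\<lambda>n. \<psi> n * mangoldt n) (Complex 1 u + of_real x)"
  let ?C = "\<lambda>x. of_real x * dirichlet_sum (\<lambda>n. \<psi> n ^ 2 * mangoldt n) (Complex 1 (2 * u) + of_real x)"
  have lim: "((\<lambda>x::real. Re (3 * ?A x + 4 * ?B x + ?C x)) \<longlongrightarrow> Re (3 * 1 + 4 * (- of_nat m) + (- of_nat m2))) (at_right 0)"
    by (intro tendsto_intros l0 l1 l2)
  have "eventually (\<lambda>x::real. 0 \<le> Re (3 * ?A x + 4 * ?B x + ?C x)) (at_right 0)"
  proof (rule eventually_mono[OF eventually_at_right_less])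
    fix x :: real assume x: "0 < x"
    have "3 * ?A x + 4 * ?B x + ?C x = of_real x * (3 * dirichlet_sum (\<lambda>n. of_bool (coprime n M) * mangoldt n) (1 + of_real x)
     + 4 * dirichlet_sum (\<lambda>n. \<psi> n * mangoldt n) (Complex 1 u + of_real x)
     + dirichlet_sum (\<lambda>n. \<psi> n ^ 2 * mangoldt n) (Complex 1 (2 * u) + of_real x))"
      by (simp add: algebra_simps)
    then have "Re (3 * ?A x + 4 * ?B x + ?C x) = x * Re (3 * dirichlet_sum (\<lambda>n. of_bool (coprime n M) * mangoldt n) (1 + of_real x)
     + 4 * dirichlet_sum (\<lambda>n. \<psi> n * mangoldt n) (Complex 1 u + of_real x)
     + dirichlet_sum (\<lambda>n. \<psi> n ^ 2 * mangoldt n) (Complex 1 (2 * u) + of_real x))"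
      by (simp only: Re_complex_of_real times_complex.simps Im_complex_of_real mult_zero_left diff_0_right)
    then show "0 \<le> Re (3 * ?A x + 4 * ?B x + ?C x)"
      using mangoldt_three_four_one[OF \<psi> x, of u] x by simp
  qed
  then have "0 \<le> Re (3 * 1 + 4 * (- of_nat m) + (- of_nat m2) :: complex)"
    by (rule tendsto_lowerbound[OF lim]) simp
  then show False using m1 by simp
qed

text \<open>Multiplication by \<open>a\<close> permutes the residues modulo M, so the sum over a
  period equals \<psi> a times itself.\<close>

lemma char_mean_nonprincipal:
  assumes \<psi>: "dirichlet_character M \<psi>" and a: "coprime a M" "\<psi> a \<noteq> 1"
  shows "char_mean M \<psi> = 0"
proof -
  have M: "M > 0" and per: "\<And>n. \<psi> (n + M) = \<psi> n" using \<psi> by (auto simp: dirichlet_character_def)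
  have inj: "inj_on (\<lambda>m. a * m mod M) {..<M}"
  proof (rule inj_onI)
    fix x y assume xy: "x \<in> {..<M}" "y \<in> {..<M}" "a * x mod M = a * y mod M"
    then have "[a * x = a * y] (mod M)" by (simp add: cong_def)
    then have "[x = y] (mod M)" using a(1) by (simp add: cong_mult_lcancel_nat coprime_commute)
    then show "x = y" using xy by (simp add: cong_def)
  qed
  have "(\<lambda>m. a * m mod M) ` {..<M} = {..<M}"
    by (rule endo_inj_surj[OF _ _ inj]) (use M in auto)
  then have "(\<Sum>m<M. \<psi> m) = (\<Sum>m\<in>(\<lambda>m. a * m mod M) ` {..<M}. \<psi> m)" by simp
  also have "\<dots> = (\<Sum>m<M. \<psi> (a * m mod M))" by (subst sum.reindex[OF inj]) simp
  also have "\<dots> = (\<Sum>m<M. \<psi> a * \<psi> m)"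
    by (intro sum.cong refl) (metis dirichlet_character_mult[OF \<psi>] periodic_mod[of \<psi>, OF per])
  finally have "(\<Sum>m<M. \<psi> m) = \<psi> a * (\<Sum>m<M. \<psi> m)" by (simp only: sum_distrib_left[symmetric])
  then have "(1 - \<psi> a) * (\<Sum>m<M. \<psi> m) = 0" unfolding left_diff_distrib by simp
  then have z: "(\<Sum>m<M. \<psi> m) = 0" using a(2) by simp
  have "(\<Sum>m=1..M. \<psi> m) = (\<Sum>m<M. \<psi> (Suc m))"
    by (rule sum.reindex_bij_witness[of _ Suc "\<lambda>m. m - 1"]) auto
  also have "\<dots> = (\<Sum>m<M. \<psi> m) + \<psi> M - \<psi> 0"
    using sum.lessThan_Suc_shift[of \<psi> M] by simp
  also have "\<psi> M = \<psi> 0" using per[of 0] by simp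
  finally show ?thesis using z by (simp add: char_mean_def)
qed

section \<open>Real characters at s = 1\<close>

text \<open>Monotone weights let Abel summation bound the Lambert series uniformly in t. With G(n) =
  1 + t + ... + t^(n-1) the claim reduces to n (n + 1) t^n <= G(n) G(n + 1); Cauchy-Schwarz, pairing
  t^i with t^(n-1-i), gives n^2 t^(n-1) <= G(n)^2.\<close>

lemma lambert_coefficient_antimono:
  fixes t :: real
  assumes t: "0 < t" "t < 1" and n: "n \<ge> 1"
  shows "1 / (real (Suc n) * (1 - t)) - t ^ Suc n / (1 - t ^ Suc n) \<le> 1 / (real n * (1 - t)) - t ^ n / (1 - t ^ n)"
proof -
  define G where "G = (\<lambda>n. \<Sum>i<n. t ^ i)"
  have G: "1 - t ^ n = (1 - t) * G n" for n
    using one_diff_power_eq[of t n] by (simp add: G_def)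
  have Gpos: "G n > 0" if "n \<ge> 1" for n
    unfolding G_def using t that by (intro sum_pos) (auto simp: lessThan_empty_iff)
  have am: "(real n)\<^sup>2 * t ^ (n - 1) \<le> (G n)\<^sup>2" if "n \<ge> 1" for n
  proof -
    have "(\<Sum>i<n. sqrt (t ^ i) * sqrt (t ^ (n - 1 - i)))\<^sup>2 \<le> (\<Sum>i<n. (sqrt (t ^ i))\<^sup>2) * (\<Sum>i<n. (sqrt (t ^ (n - 1 - i)))\<^sup>2)"
      by (rule Cauchy_Schwarz_ineq_sum)
    also have "(\<Sum>i<n. (sqrt (t ^ i))\<^sup>2) = G n" unfolding G_def using t by simp
    also have "(\<Sum>i<n. (sqrt (t ^ (n - 1 - i)))\<^sup>2) = G n" unfolding G_def using t
      by (subst sum.nat_diff_reindex[symmetric]) (simp add: algebra_simps)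
    also have "(\<Sum>i<n. sqrt (t ^ i) * sqrt (t ^ (n - 1 - i))) = (\<Sum>i<n. sqrt (t ^ (n - 1)))"
      by (intro sum.cong refl) (auto simp: real_sqrt_mult[symmetric] power_add[symmetric])
    also have "(\<dots>)\<^sup>2 = (real n)\<^sup>2 * t ^ (n - 1)" using t by (simp add: power_mult_distrib)
    finally show ?thesis by (simp add: power2_eq_square)
  qed
  have key: "real n * real (Suc n) * t ^ n \<le> G n * G (Suc n)"
  proof (rule power2_le_imp_le)
    have tn: "t ^ n * t ^ n \<le> t ^ (n - 1) * t ^ n"
      using t by (intro mult_right_mono power_decreasing) auto
    have "(real n * real (Suc n) * t ^ n)\<^sup>2 = ((real n)\<^sup>2 * (real (Suc n))\<^sup>2) * (t ^ n * t ^ n)"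
      by (simp only: power_mult_distrib) (simp add: power2_eq_square)
    also have "\<dots> \<le> ((real n)\<^sup>2 * (real (Suc n))\<^sup>2) * (t ^ (n - 1) * t ^ n)"
      by (rule mult_left_mono[OF tn]) simp
    also have "\<dots> = ((real n)\<^sup>2 * t ^ (n - 1)) * ((real (Suc n))\<^sup>2 * t ^ (Suc n - 1))" by simp
    also have "\<dots> \<le> (G n)\<^sup>2 * (G (Suc n))\<^sup>2"
      using am[OF n] am[of "Suc n"] t by (intro mult_mono) auto
    finally show "(real n * real (Suc n) * t ^ n)\<^sup>2 \<le> (G n * G (Suc n))\<^sup>2" by (simp only: power_mult_distrib)
    show "0 \<le> G n * G (Suc n)" using Gpos[OF n] Gpos[of "Suc n"] by simp
  qed
  have GS: "G (Suc n) = 1 + t * G n" unfolding G_def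
    by (subst sum.lessThan_Suc_shift) (simp add: sum_distrib_left)
  have "t ^ n / G n - t ^ Suc n / G (Suc n) = t ^ n * (G (Suc n) - t * G n) / (G n * G (Suc n))"
    using Gpos[OF n] Gpos[of "Suc n"] by (simp add: field_simps)
  also have "\<dots> = t ^ n / (G n * G (Suc n))" by (simp add: GS)
  also have "\<dots> \<le> 1 / (real n * real (Suc n))"
    using key Gpos[OF n] Gpos[of "Suc n"] n by (simp add: divide_simps) (simp add: algebra_simps)
  also have "\<dots> = 1 / real n - 1 / real (Suc n)" using n by (simp add: field_simps)
  finally have fin: "1 / real (Suc n) - t ^ Suc n / G (Suc n) \<le> 1 / real n - t ^ n / G n" by linarith
  have eq: "1 / (real k * (1 - t)) - t ^ k / (1 - t ^ k) = (1 / real k - t ^ k / G k) / (1 - t)" for k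
    unfolding G by (simp add: diff_divide_distrib mult.commute)
  show ?thesis unfolding eq using fin t by (intro divide_right_mono) auto
qed

lemma abel_bound:
  fixes c b :: "nat \<Rightarrow> real"
  assumes X: "\<And>n. \<bar>\<Sum>m=1..n. c m\<bar> \<le> B"
    and b: "\<And>n. n \<ge> 1 \<Longrightarrow> b (Suc n) \<le> b n" "\<And>n. n \<ge> 1 \<Longrightarrow> 0 \<le> b n"
  shows "\<bar>\<Sum>n=1..N. c n * b n\<bar> \<le> B * b 1"
proof (cases "N = 0")
  case True
  have "B \<ge> 0" using X[of 0] by simp
  then show ?thesis using b(2)[of 1] True by simp
next
  case False
  let ?X = "\<lambda>n. \<Sum>m=1..n. c m"
  have id: "(\<Sum>n=1..Suc N. c n * b n) = (\<Sum>n=1..N. ?X n * (b n - b (Suc n))) + ?X (Suc N) * b (Suc N)" for N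
    by (induction N) (simp_all add: algebra_simps)
  obtain K where K: "N = Suc K" using False not0_implies_Suc by blast
  have tel: "(\<Sum>n=1..K. b n - b (Suc n)) = b 1 - b (Suc K)" by (induction K) simp_all
  have "\<bar>\<Sum>n=1..N. c n * b n\<bar> \<le> \<bar>\<Sum>n=1..K. ?X n * (b n - b (Suc n))\<bar> + \<bar>?X (Suc K) * b (Suc K)\<bar>"
    unfolding K id by (rule abs_triangle_ineq)
  also have "\<dots> \<le> (\<Sum>n=1..K. B * (b n - b (Suc n))) + B * b (Suc K)"
  proof (rule add_mono)
    show "\<bar>\<Sum>n=1..K. ?X n * (b n - b (Suc n))\<bar> \<le> (\<Sum>n=1..K. B * (b n - b (Suc n)))"
    proof (rule order_trans[OF sum_abs], rule sum_mono)
      fix n assume "n \<in> {1..K}"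
      then have "b n - b (Suc n) \<ge> 0" using b(1)[of n] by simp
      then show "\<bar>?X n * (b n - b (Suc n))\<bar> \<le> B * (b n - b (Suc n))"
        using X[of n] by (simp add: abs_mult mult_right_mono)
    qed
    show "\<bar>?X (Suc K) * b (Suc K)\<bar> \<le> B * b (Suc K)"
      unfolding abs_mult using X[of "Suc K"] b(2)[of "Suc K"] by (intro mult_mono) auto
  qed
  also have "\<dots> = B * b 1" unfolding sum_distrib_left[symmetric] tel by (simp add: algebra_simps)
  finally show ?thesis .
qed

lemma sum_divisors_coprime_mult:
  fixes c :: "nat \<Rightarrow> real"
  assumes mult: "\<And>m n. c (m * n) = c m * c n" and cop: "coprime a b" and ab: "a > 0" "b > 0"
  shows "(\<Sum>d | d dvd a * b. c d) = (\<Sum>d | d dvd a. c d) * (\<Sum>d | d dvd b. c d)"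
proof -
  have inj: "inj_on (\<lambda>(x, y). x * y) ({d. d dvd a} \<times> {d. d dvd b})"
  proof (rule inj_onI, clarsimp)
    fix x y x' y' :: nat
    assume h: "x dvd a" "y dvd b" "x' dvd a" "y' dvd b" "x * y = x' * y'"
    have c: "coprime x y'" "coprime x' y" using h cop by (meson coprime_divisors)+
    have "x dvd x' * y'" "x' dvd x * y" using h(5) by (metis dvd_triv_left)+
    then have "x dvd x'" "x' dvd x" using c by (simp_all add: coprime_dvd_mult_left_iff)
    then have "x = x'" by (rule dvd_antisym)
    moreover have "x > 0" using h(1) ab(1) by (auto intro: Nat.gr0I)
    ultimately show "x = x' \<and> y = y'" using h(5) by simp
  qed
  have img: "(\<lambda>(x, y). x * y) ` ({d. d dvd a} \<times> {d. d dvd b}) = {d. d dvd a * b}"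
  proof (intro equalityI subsetI)
    fix d assume "d \<in> {d. d dvd a * b}"
    then obtain x y where "d = x * y" "x dvd a" "y dvd b" using division_decomp[of d a b] by auto
    then show "d \<in> (\<lambda>(x, y). x * y) ` ({d. d dvd a} \<times> {d. d dvd b})" by auto
  qed (auto intro: mult_dvd_mono)
  have "(\<Sum>d | d dvd a * b. c d) = (\<Sum>(x, y)\<in>{d. d dvd a} \<times> {d. d dvd b}. c (x * y))"
    unfolding img[symmetric] by (subst sum.reindex[OF inj]) (simp add: case_prod_unfold comp_def)
  also have "\<dots> = (\<Sum>d | d dvd a. c d) * (\<Sum>d | d dvd b. c d)"
    by (simp add: mult sum_product sum.cartesian_product)
  finally show ?thesis .
qed

text \<open>The divisor sum is multiplicative. At p^k it is a geometric sum of powers of c p: k + 1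
  for c p = 1, 1 for c p = 0, and 1 or 0 by the parity of k for c p = -1. The induction strips the
  full power of one prime.\<close>

lemma sum_divisors_real_character:
  fixes c :: "nat \<Rightarrow> real"
  assumes mult: "\<And>m n. c (m * n) = c m * c n" and c1: "c 1 = 1" and cv: "\<And>n. c n \<in> {-1, 0, 1}" and n: "n > 0"
  shows "(\<Sum>d | d dvd n. c d) \<ge> 0 \<and> ((\<forall>p. prime p \<longrightarrow> even (multiplicity p n)) \<longrightarrow> (\<Sum>d | d dvd n. c d) \<ge> 1)"
  using n
proof (induction n rule: less_induct)
  case (less n)
  show ?case
  proof (cases "n = 1")
    case True
    then show ?thesis using c1 by simp
  next
    case False
    then obtain p where p: "prime p" "p dvd n" using prime_factor_nat by blast
    define k where "k = multiplicity p n"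
    define m where "m = n div p ^ k"
    have nm: "n = p ^ k * m" unfolding m_def k_def by (simp add: multiplicity_dvd)
    have pm: "\<not> p dvd m" unfolding m_def k_def using less.prems p(1)
      by (intro multiplicity_decompose) (auto simp: prime_gt_1_nat)
    have k: "k > 0" unfolding k_def using p less.prems by (simp add: prime_multiplicity_gt_zero_iff)
    have m0: "m > 0" using nm less.prems by (auto intro: Nat.gr0I)
    have pk: "p ^ k > 1" by (rule one_less_power[OF prime_gt_1_nat[OF p(1)] k])
    have mn: "m < n" using nm pk m0 by simp
    have cop: "coprime (p ^ k) m" using p(1) pm by (simp add: prime_imp_coprime)
    have cpow: "c (p ^ i) = c p ^ i" for i by (induction i) (use c1 mult in auto)
    have "(\<Sum>d | d dvd p ^ k. c d) = (\<Sum>d\<in>(\<lambda>i. p ^ i) ` {..k}. c d)"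
      by (intro sum.cong) (auto simp: divides_primepow_nat[OF p(1)])
    also have "\<dots> = (\<Sum>i\<le>k. c p ^ i)"
      using prime_gt_1_nat[OF p(1)] by (subst sum.reindex) (auto simp: inj_on_def cpow)
    finally have pp: "(\<Sum>d | d dvd p ^ k. c d) = (\<Sum>i\<le>k. c p ^ i)" .
    have alt: "(\<Sum>i\<le>k. (-1::real) ^ i) = of_bool (even k)" for k by (induction k) auto
    have pos: "(\<Sum>i\<le>k. c p ^ i) \<ge> 0" and pos1: "even k \<Longrightarrow> (\<Sum>i\<le>k. c p ^ i) \<ge> 1"
      using cv[of p] alt[of k] by (auto simp: power_0_left)
    have eq: "(\<Sum>d | d dvd n. c d) = (\<Sum>i\<le>k. c p ^ i) * (\<Sum>d | d dvd m. c d)"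
      unfolding pp[symmetric] nm using prime_gt_0_nat[OF p(1)] m0 by (intro sum_divisors_coprime_mult[OF mult cop]) auto
    note IH = less.IH[OF mn m0]
    have "(\<Sum>d | d dvd n. c d) \<ge> 1" if ev: "\<forall>q. prime q \<longrightarrow> even (multiplicity q n)"
    proof -
      have "even (multiplicity q m)" if q: "prime q" for q
      proof (cases "q = p")
        case True
        then show ?thesis using pm by (simp add: not_dvd_imp_multiplicity_0)
      next
        case False
        have "multiplicity q n = multiplicity q (p ^ k) + multiplicity q m"
          unfolding nm using q prime_gt_0_nat[OF p(1)] m0 by (intro prime_elem_multiplicity_mult_distrib) auto
        moreover have "multiplicity q (p ^ k) = 0"
          using q p(1) False by (simp add: multiplicity_distinct_prime_power)
        ultimately show ?thesis using ev q by (metis add_0)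
      qed
      then have "(\<Sum>d | d dvd m. c d) \<ge> 1" using IH by blast
      moreover have "(\<Sum>i\<le>k. c p ^ i) \<ge> 1" using pos1 ev p(1) unfolding k_def by blast
      ultimately show ?thesis unfolding eq using mult_mono[of 1 "\<Sum>i\<le>k. c p ^ i" 1 "\<Sum>d | d dvd m. c d"] by simp
    qed
    moreover have "(\<Sum>d | d dvd n. c d) \<ge> 0" unfolding eq using pos IH by simp
    ultimately show ?thesis by blast
  qed
qed

text \<open>Geometric expansion of t^n / (1 - t^n) gives an absolutely convergent double series in
  t^(n j); grouping by k = n j produces the divisor sums.\<close>

lemma lambert_series_rearrange:
  fixes c :: "nat \<Rightarrow> real"
  assumes cb: "\<And>n. \<bar>c n\<bar> \<le> 1" and t: "0 < t" "t < 1"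
  obtains f where "(\<lambda>N. \<Sum>n=1..N. c n * (t ^ n / (1 - t ^ n))) \<longlonglongrightarrow> f"
    "((\<lambda>k. (\<Sum>d | d dvd k. c d) * t ^ k) has_sum f) {1..}"
proof -
  define T where "T = (\<lambda>(n, j). c n * t ^ (n * j))"
  have tn: "t ^ n \<le> t" "0 < t ^ n" "t ^ n < 1" if "n \<ge> 1" for n
  proof -
    show "t ^ n \<le> t" using power_decreasing[of 1 n t] t that by simp
    then show "t ^ n < 1" using t by simp
    show "0 < t ^ n" using t by simp
  qed
  have geo: "((\<lambda>j. (t ^ n) ^ j) has_sum (t ^ n / (1 - t ^ n))) {1..}" if "n \<ge> 1" for n
  proof -
    have "((\<lambda>j. (t ^ n) ^ j) has_sum (1 / (1 - t ^ n))) UNIV"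
      by (rule norm_summable_imp_has_sum) (use tn[OF that] in \<open>auto intro!: geometric_sums summable_geometric\<close>)
    then have "((\<lambda>j. (t ^ n) ^ j) has_sum (1 / (1 - t ^ n) - (\<Sum>j\<in>{0}. (t ^ n) ^ j))) (UNIV - {0})"
      by (intro has_sum_Diff has_sum_finite) auto
    moreover have "UNIV - {0 :: nat} = {1..}" by auto
    moreover have "1 / (1 - t ^ n) - (\<Sum>j\<in>{0::nat}. (t ^ n) ^ j) = t ^ n / (1 - t ^ n)"
      using tn[OF that] by (simp add: field_simps)
    ultimately show ?thesis by simp
  qed
  have inner: "((\<lambda>j. T (n, j)) has_sum (c n * (t ^ n / (1 - t ^ n)))) {1..}" if "n \<ge> 1" for n
    using has_sum_cmult_right[OF geo[OF that], of "c n"] by (simp add: T_def power_mult)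
  have innern: "((\<lambda>j. norm (T (n, j))) has_sum (\<bar>c n\<bar> * (t ^ n / (1 - t ^ n)))) {1..}" if "n \<ge> 1" for n
    using has_sum_cmult_right[OF geo[OF that], of "\<bar>c n\<bar>"] t by (simp add: T_def power_mult abs_mult)
  have bd: "\<bar>c n\<bar> * (t ^ n / (1 - t ^ n)) \<le> 1 / (1 - t) * t ^ n" if "n \<ge> 1" for n
  proof -
    have "t ^ n / (1 - t ^ n) \<le> t ^ n / (1 - t)" using tn[OF that] t by (intro divide_left_mono) auto
    then have "\<bar>c n\<bar> * (t ^ n / (1 - t ^ n)) \<le> 1 * (t ^ n / (1 - t))"
      using cb[of n] tn[OF that] by (intro mult_mono) auto
    then show ?thesis by simp
  qed
  have "(\<lambda>x. norm (T x)) summable_on ({1..} \<times> {1..})"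
    unfolding Infinite_Sum.abs_summable_on_Sigma_iff
  proof (intro conjI ballI)
    show "(\<lambda>j. norm (T (n, j))) summable_on {1..}" if "n \<in> {1..}" for n
      using innern[of n] that by (auto simp: summable_on_def)
    have eq: "infsum (\<lambda>j. norm (T (n, j))) {1..} = \<bar>c n\<bar> * (t ^ n / (1 - t ^ n))" if "n \<in> {1..}" for n
      using innern[of n] that by (intro infsumI) auto
    have "(\<lambda>n. 1 / (1 - t) * t ^ n) summable_on {1..}"
      by (rule summable_on_subset_banach[OF norm_summable_imp_summable_on])
        (use t in \<open>auto simp: abs_mult intro!: summable_mult summable_geometric\<close>)
    then show "(\<lambda>n. norm (infsum (\<lambda>j. norm (T (n, j))) {1..})) summable_on {1..}"
    proof (rule summable_on_comparison_test)
      fix n :: nat assume n: "n \<in> {1..}"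
      show "norm (infsum (\<lambda>j. norm (T (n, j))) {1..}) \<le> 1 / (1 - t) * t ^ n"
        unfolding eq[OF n] using bd[of n] tn[of n] n by simp
    qed simp
  qed
  then have "T summable_on ({1..} \<times> {1..})" by (rule abs_summable_summable)
  then obtain f where f: "(T has_sum f) ({1..} \<times> {1..})" by (auto simp: summable_on_def)
  have "((\<lambda>n. c n * (t ^ n / (1 - t ^ n))) has_sum f) {1..}"
    by (rule has_sum_SigmaD[OF f]) (use inner in auto)
  then have "((\<lambda>n. of_bool (n \<ge> 1) * (c n * (t ^ n / (1 - t ^ n)))) has_sum f) UNIV"
    by (rule has_sum_cong_neutral[THEN iffD1, rotated -1]) auto
  then have "(\<lambda>n. of_bool (n \<ge> 1) * (c n * (t ^ n / (1 - t ^ n)))) sums f" by (rule has_sum_imp_sums)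
  then have "(\<lambda>N. \<Sum>n\<le>N. of_bool (n \<ge> 1) * (c n * (t ^ n / (1 - t ^ n)))) \<longlonglongrightarrow> f"
    unfolding sums_def_le .
  moreover have "(\<Sum>n\<le>N. of_bool (n \<ge> 1) * (c n * (t ^ n / (1 - t ^ n)))) = (\<Sum>n=1..N. c n * (t ^ n / (1 - t ^ n)))" for N
    by (rule sum.mono_neutral_cong_right) auto
  ultimately have l1: "(\<lambda>N. \<Sum>n=1..N. c n * (t ^ n / (1 - t ^ n))) \<longlonglongrightarrow> f" by simp
  have bij: "bij_betw (\<lambda>(n :: nat, d). (d, n div d)) (SIGMA n:{1..}. {d. d dvd n}) ({1..} \<times> {1..})"
    by (rule bij_betwI[where g = "\<lambda>(d, e). (d * e, d)"])
      (auto simp: Suc_le_eq dvd_imp_le div_greater_zero_iff intro: Nat.gr0I)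
  have "((\<lambda>x. T (case x of (n, d) \<Rightarrow> (d, n div d))) has_sum f) (SIGMA n:{1..}. {d. d dvd n})"
    using has_sum_reindex_bij_betw[OF bij, of T f] f by (simp add: case_prod_unfold)
  then have "((\<lambda>n. \<Sum>d | d dvd n. T (d, n div d)) has_sum f) {1..}"
    by (rule has_sum_SigmaD) (auto intro!: has_sum_finite)
  then have l2: "((\<lambda>k. (\<Sum>d | d dvd k. c d) * t ^ k) has_sum f) {1..}"
    by (rule has_sum_cong[THEN iffD1, rotated]) (auto simp: T_def sum_distrib_right intro!: sum.cong)
  show ?thesis by (rule that[OF l1 l2])
qed

text \<open>Monsky's argument: were \<open>L(1, \<psi>) = 0\<close>, the Lambert series of \<open>\<psi>\<close> would stay bounded as its
  argument tends to \<open>1\<close>, but its power series coefficients are non-negative and at least \<open>1\<close> at squares.\<close>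
lemma L_cont_real_nonzero:
  assumes \<psi>: "dirichlet_character M \<psi>" and mean: "char_mean M \<psi> = 0" and real: "\<And>n. \<psi> n \<in> {-1, 0, 1}"
  shows "L_cont M \<psi> 1 \<noteq> 0"
proof
  assume zero: "L_cont M \<psi> 1 = 0"
  define c where "c = (\<lambda>n. Re (\<psi> n))"
  have c: "\<psi> n = of_real (c n)" for n using real[of n] by (auto simp: c_def)
  have cv: "c n \<in> {-1, 0, 1}" for n using real[of n] by (auto simp: c_def)
  have cb: "\<bar>c n\<bar> \<le> 1" for n using cv[of n] by auto
  have mult: "c (m * n) = c m * c n" for m n
    using dirichlet_character_mult[OF \<psi>, of m n] unfolding c by (metis of_real_eq_iff of_real_mult)
  have c1: "c 1 = 1" using dirichlet_character_1[OF \<psi>] by (simp add: c_def)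
  let ?X = "\<lambda>n. \<Sum>m=1..n. c m"
  have disc: "char_disc M \<psi> n = of_real (?X n)" for n
    unfolding char_disc_def mean by (simp add: c)
  obtain B0 where "\<And>n. norm (char_disc M \<psi> n) \<le> B0" using char_disc_bounded[OF \<psi>] by auto
  then have B: "\<bar>?X n\<bar> \<le> B0" for n unfolding disc by (simp del: of_real_sum)
  have B0: "B0 \<ge> 0" using B[of 0] by simp
  \<comment> \<open>At s = 1 the continuation is the Abel sum of c n / n, so the assumed zero says
    that this series converges to 0.\<close>
  have harm: "(\<lambda>N. \<Sum>n=1..N. c n / real n) \<longlonglongrightarrow> 0"
  proof -
    have "(\<lambda>n. char_disc M \<psi> n * (of_nat n powr (-1) - of_nat (Suc n) powr (-1))) sums char_reg M \<psi> 1"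
      unfolding char_reg_def
      by (rule summable_sums, rule summable_norm_cancel, rule holomorphic_bounded_partial_sums(2)[of _ B0])
        (use \<open>\<And>n. norm (char_disc M \<psi> n) \<le> B0\<close> in auto)
    moreover have "char_reg M \<psi> 1 = 0" using zero mean by (simp add: L_cont_def)
    moreover have "char_disc M \<psi> n * (of_nat n powr (-1) - of_nat (Suc n) powr (-1)) = of_real (?X n * (1 / real n - 1 / real (Suc n)))" for n
      unfolding disc by (cases "n = 0") (simp_all add: powr_minus powr_to_1 divide_inverse del: of_nat_Suc)
    ultimately have "(\<lambda>n. complex_of_real (?X n * (1 / real n - 1 / real (Suc n)))) sums of_real 0" by simp
    then have "(\<lambda>n. ?X n * (1 / real n - 1 / real (Suc n))) sums 0" by (subst (asm) sums_of_real_iff)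
    then have a: "(\<lambda>N. \<Sum>n\<le>N. ?X n * (1 / real n - 1 / real (Suc n))) \<longlonglongrightarrow> 0"
      unfolding sums_def_le .
    have b: "(\<lambda>N. ?X N / real (Suc N)) \<longlonglongrightarrow> 0"
    proof (rule Lim_null_comparison)
      show "\<forall>\<^sub>F N in sequentially. norm (?X N / real (Suc N)) \<le> B0 / real (Suc N)"
        using B by (auto intro!: always_eventually divide_right_mono)
      show "(\<lambda>N. B0 / real (Suc N)) \<longlonglongrightarrow> 0"
        by (rule LIMSEQ_Suc) (rule lim_const_over_n)
    qed
    have "(\<Sum>n=1..N. c n / real n) = (\<Sum>n\<le>N. ?X n * (1 / real n - 1 / real (Suc n))) + ?X N / real (Suc N)" for N
    proof (induction N)
      case (Suc N)
      then show ?case by (simp add: right_diff_distrib add_divide_distrib del: of_nat_Suc)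
    qed simp
    then show ?thesis using tendsto_add[OF a b] by simp
  qed
  have bound: "(\<Sum>m=1..K. t ^ (m^2)) \<le> B0" if t: "0 < t" "t < 1" for t :: real and K :: nat
  proof -
    obtain f where f1: "(\<lambda>N. \<Sum>n=1..N. c n * (t ^ n / (1 - t ^ n))) \<longlonglongrightarrow> f"
      and f2: "((\<lambda>k. (\<Sum>d | d dvd k. c d) * t ^ k) has_sum f) {1..}"
      by (rule lambert_series_rearrange[OF cb t])
    \<comment> \<open>The term 1 / (n (1 - t)) makes the weights decreasing with b 1 = 1, and it
      disappears in the limit because the series of c n / n is 0.\<close>
    define b where "b = (\<lambda>n. 1 / (real n * (1 - t)) - t ^ n / (1 - t ^ n))"
    have b1: "b 1 = 1" using t by (simp add: b_def field_simps)
    have bnn: "b n \<ge> 0" if "n \<ge> 1" for n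
    proof -
      have "(\<Sum>i<n. t ^ n) \<le> (\<Sum>i<n. t ^ i)" using t by (intro sum_mono power_decreasing) auto
      then have "(1 - t) * (real n * t ^ n) \<le> (1 - t) * (\<Sum>i<n. t ^ i)" using t by (intro mult_left_mono) auto
      also have "\<dots> = 1 - t ^ n" using one_diff_power_eq[of t n] by simp
      finally have "(real n * (1 - t)) * t ^ n \<le> 1 - t ^ n" by (simp add: mult_ac)
      moreover have "1 - t ^ n > 0" using t that by (simp add: power_less_one_iff)
      moreover have "real n * (1 - t) > 0" using t that by simp
      ultimately have "t ^ n / (1 - t ^ n) \<le> 1 / (real n * (1 - t))"
        by (simp only: divide_le_eq pos_le_divide_eq mult.commute) (simp add: field_simps)
      then show ?thesis by (simp add: b_def)
    qed
    have "(\<lambda>N. \<bar>\<Sum>n=1..N. c n * b n\<bar>) \<longlonglongrightarrow> \<bar>1 / (1 - t) * 0 - f\<bar>"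
    proof -
      have "(\<Sum>n=1..N. c n * b n) = 1 / (1 - t) * (\<Sum>n=1..N. c n / real n) - (\<Sum>n=1..N. c n * (t ^ n / (1 - t ^ n)))" for N
        by (simp add: b_def sum_distrib_left sum_subtractf algebra_simps)
      then show ?thesis by (simp only:) (intro tendsto_intros harm f1)
    qed
    moreover have "\<bar>\<Sum>n=1..N. c n * b n\<bar> \<le> B0" for N
      using abel_bound[of c B0 b N, OF B] lambert_coefficient_antimono[OF t] bnn b1 unfolding b_def by simp
    ultimately have "\<bar>1 / (1 - t) * 0 - f\<bar> \<le> B0" by (intro LIMSEQ_le_const2) auto
    then have fB: "f \<le> B0" by simp
    have "(\<Sum>m=1..K. t ^ (m^2)) = (\<Sum>k\<in>(\<lambda>m. m^2) ` {1..K}. t ^ k)"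
      by (subst sum.reindex) (auto simp: inj_on_def power2_eq_iff_nonneg)
    also have "\<dots> \<le> (\<Sum>k\<in>(\<lambda>m. m^2) ` {1..K}. (\<Sum>d | d dvd k. c d) * t ^ k)"
    proof (rule sum_mono)
      fix k assume "k \<in> (\<lambda>m. m^2) ` {1..K}"
      then obtain m where m: "k = m^2" "m \<ge> 1" by auto
      have "even (multiplicity p k)" if "prime p" for p
        unfolding m using that m(2) by (subst prime_elem_multiplicity_power_distrib) auto
      then have "(\<Sum>d | d dvd k. c d) \<ge> 1"
        using sum_divisors_real_character[OF mult c1 cv, of k] m by auto
      then show "t ^ k \<le> (\<Sum>d | d dvd k. c d) * t ^ k"
        using t mult_right_mono[of 1 "\<Sum>d | d dvd k. c d" "t ^ k"] by simp
    qed
    also have "\<dots> \<le> f"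
    proof (rule finite_sum_le_has_sum[OF f2])
      fix k :: nat assume "k \<in> {1..} - (\<lambda>m. m^2) ` {1..K}"
      then show "0 \<le> (\<Sum>d | d dvd k. c d) * t ^ k"
        using sum_divisors_real_character[OF mult c1 cv, of k] t by auto
    qed auto
    finally show ?thesis using fB by simp
  qed
  \<comment> \<open>The bound \<open>B0\<close> does not depend on t, so letting t -> 1 in more than
    \<open>B0\<close> square terms gives the contradiction.\<close>
  obtain K :: nat where K: "B0 < real K" using reals_Archimedean2 by blast
  have "((\<lambda>t::real. \<Sum>m=1..K. t ^ (m^2)) \<longlongrightarrow> (\<Sum>m=1..K. 1 ^ (m^2))) (at_left 1)"
    by (intro tendsto_intros)
  moreover have "eventually (\<lambda>t::real. (\<Sum>m=1..K. t ^ (m^2)) \<le> B0) (at_left 1)"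
  proof (rule eventually_mono[OF eventually_at_left_real[of 0 "1::real"]])
    show "(\<Sum>m=1..K. t ^ (m^2)) \<le> B0" if "t \<in> {0<..<1}" for t :: real by (rule bound) (use that in auto)
  qed simp
  ultimately have "(\<Sum>m=1..K. (1::real) ^ (m^2)) \<le> B0"
    by (rule tendsto_upperbound) simp
  then show False using K by simp
qed

text \<open>What the 3-4-1 argument leaves open is s = 1 with \<psi> of mean zero and its square of
  nonzero mean. Then the square is 1 on the units, so \<psi> is real.\<close>

theorem L_cont_nonzero:
  assumes \<psi>: "dirichlet_character M \<psi>" and s: "Re s \<ge> 1" "char_mean M \<psi> = 0 \<or> s \<noteq> 1"
  shows "L_cont M \<psi> s \<noteq> 0"
proof (cases "Re s > 1")
  case True
  then show ?thesis by (rule L_cont_nonzero_gt_1[OF \<psi>])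
next
  case False
  then have se: "s = Complex 1 (Im s)" using s(1) by (simp add: complex_eq_iff)
  show ?thesis
  proof (cases "Im s \<noteq> 0 \<or> char_mean M \<psi> = 0 \<and> char_mean M (\<lambda>n. \<psi> n ^ 2) = 0")
    case True
    then show ?thesis using L_cont_nonzero_341[OF \<psi> True] se by simp
  next
    case False
    then have s1: "s = 1" using se by (simp add: complex_eq_iff)
    then have mean: "char_mean M \<psi> = 0" using s(2) by simp
    then have sq: "char_mean M (\<lambda>n. \<psi> n ^ 2) \<noteq> 0" using False by simp
    have "\<psi> n \<in> {-1, 0, 1}" for n
    proof (cases "coprime n M")
      case True
      then have "\<psi> n ^ 2 = 1" using char_mean_nonprincipal[OF dirichlet_character_square[OF \<psi>] True] sq by blast
      then show ?thesis by (auto simp: power2_eq_1_iff)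
    next
      case False
      then have "\<psi> n = 0" using \<psi> unfolding dirichlet_character_def by blast
      then show ?thesis by simp
    qed
    then show ?thesis unfolding s1 by (rule L_cont_real_nonzero[OF \<psi> mean])
  qed
qed

section \<open>A Tauberian theorem with the Fejer kernel\<close>

text \<open>A shift by half a period, pi / L, reverses the sign of the oscillating factor. Twice the
  integral is therefore the integral against h t - h (t + pi / L), up to two short end pieces, and
  uniform continuity makes it small.\<close>

lemma riemann_lebesgue_interval:
  fixes h :: "real \<Rightarrow> complex"
  assumes cont: "continuous_on UNIV h" and l: "l > 0"
  shows "((\<lambda>L. integral {0..l} (\<lambda>t. h t * cis (t * L))) \<longlongrightarrow> 0) at_top"
proof (rule tendstoI)
  fix e :: real assume e: "e > 0"
  have cc: "continuous_on A h" for A using cont continuous_on_subset by blast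
  have "compact (h ` {0..l+1})" by (intro compact_continuous_image cc) auto
  then obtain B where B: "B > 0" "\<And>t. t \<in> {0..l+1} \<Longrightarrow> norm (h t) \<le> B"
    by (metis compact_imp_bounded bounded_pos imageI)
  have "uniformly_continuous_on {0..l+1} h" by (intro compact_uniformly_continuous cc) auto
  then obtain d where d: "d > 0" "\<And>t t'. t \<in> {0..l+1} \<Longrightarrow> t' \<in> {0..l+1} \<Longrightarrow> dist t' t < d \<Longrightarrow> dist (h t') (h t) < e / (2 * l)"
    unfolding uniformly_continuous_on_def using e l by (metis divide_pos_pos mult_pos_pos zero_less_numeral)
  have "((\<lambda>L::real. pi / L) \<longlongrightarrow> 0) at_top" by real_asymp
  then have "eventually (\<lambda>L. dist (pi / L) 0 < min (min d 1) (e / (4 * B))) at_top"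
    using d(1) e B(1) by (intro tendstoD) auto
  moreover have "eventually (\<lambda>L::real. L > 0) at_top" by (rule eventually_gt_at_top)
  ultimately show "eventually (\<lambda>L. dist (integral {0..l} (\<lambda>t. h t * cis (t * L))) 0 < e) at_top"
  proof eventually_elim
    case (elim L)
    define \<delta> where "\<delta> = pi / L"
    have \<delta>: "\<delta> > 0" "\<delta> < d" "\<delta> < 1" "\<delta> < e / (4 * B)" using elim by (auto simp: \<delta>_def)
    let ?E = "\<lambda>t. h t * cis (t * L)"
    have cE: "continuous_on A ?E" for A by (intro continuous_intros cc)
    have int: "?E integrable_on {a..b}" for a b by (intro integrable_continuous_real cE)
    have shift: "cis ((t + \<delta>) * L) = - cis (t * L)" for t
    proof -
      have "(t + \<delta>) * L = t * L + pi" using elim by (simp add: \<delta>_def field_simps)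
      then show ?thesis by (simp add: cis_mult[symmetric] complex_eq_iff)
    qed
    have "integral {0..l} (?E \<circ> (\<lambda>t. t + \<delta>)) = integral {0 + \<delta>..l + \<delta>} ?E"
      by (rule integral_shift) (rule cE)
    moreover have "(?E \<circ> (\<lambda>t. t + \<delta>)) = (\<lambda>t. - (h (t + \<delta>) * cis (t * L)))"
      by (auto simp: shift)
    ultimately have s1: "integral {0..l} (\<lambda>t. h (t + \<delta>) * cis (t * L)) = - integral {\<delta>..l + \<delta>} ?E"
      by (simp add: integral_neg) (metis minus_minus)
    have c1: "integral {0..\<delta>} ?E + integral {\<delta>..l+\<delta>} ?E = integral {0..l+\<delta>} ?E"
      using \<delta> l by (intro Henstock_Kurzweil_Integration.integral_combine int) auto
    have c2: "integral {0..l} ?E + integral {l..l+\<delta>} ?E = integral {0..l+\<delta>} ?E"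
      using \<delta> l by (intro Henstock_Kurzweil_Integration.integral_combine int) auto
    have "integral {0..l} (\<lambda>t. ?E t - h (t + \<delta>) * cis (t * L)) = integral {0..l} ?E - integral {0..l} (\<lambda>t. h (t + \<delta>) * cis (t * L))"
      by (intro integral_diff int integrable_continuous_real continuous_intros
          continuous_on_compose2[OF cont]) auto
    then have two: "2 * integral {0..l} ?E = integral {0..l} (\<lambda>t. ?E t - h (t + \<delta>) * cis (t * L)) + integral {0..\<delta>} ?E - integral {l..l+\<delta>} ?E"
      using s1 c1 c2 by (simp add: algebra_simps)
    have b1: "norm (integral {0..l} (\<lambda>t. ?E t - h (t + \<delta>) * cis (t * L))) \<le> e / (2 * l) * (l - 0)"
    proof (rule integral_bound)
      show "continuous_on {0..l} (\<lambda>t. ?E t - h (t + \<delta>) * cis (t * L))"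
        by (intro continuous_intros cc continuous_on_compose2[OF cont]) auto
      fix t assume t: "t \<in> {0..l}"
      have "norm (?E t - h (t + \<delta>) * cis (t * L)) = norm (h t - h (t + \<delta>))"
        by (simp add: left_diff_distrib[symmetric] norm_mult)
      also have "\<dots> < e / (2 * l)"
        using d(2)[of "t + \<delta>" t] t \<delta> by (simp add: dist_norm)
      finally show "norm (?E t - h (t + \<delta>) * cis (t * L)) \<le> e / (2 * l)" by simp
    qed (use l in simp)
    have b2: "norm (integral {0..\<delta>} ?E) \<le> B * (\<delta> - 0)"
      by (rule integral_bound) (use \<delta> l B cE in \<open>auto simp: norm_mult\<close>)
    have b3: "norm (integral {l..l+\<delta>} ?E) \<le> B * ((l + \<delta>) - l)"
      by (rule integral_bound) (use \<delta> l B cE in \<open>auto simp: norm_mult\<close>)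
    have "norm (2 * integral {0..l} ?E) \<le> e / 2 + B * \<delta> + B * \<delta>"
      unfolding two using b1 b2 b3 l
      by (intro order_trans[OF norm_triangle_ineq4] add_mono order_trans[OF norm_triangle_ineq]) auto
    also have "\<dots> < e / 2 + e / 4 + e / 4" using \<delta>(4) B(1) by (intro add_strict_mono add_strict_left_mono) (simp_all add: field_simps)
    finally have "norm (integral {0..l} ?E) < e" using e by (simp add: norm_mult)
    then show ?case by simp
  qed
qed

section \<open>The Fejer kernel\<close>

text \<open>The Fourier transform of the tent function 1 - |t| / l on [-l, l], with the removable
  singularity at 0 filled in.\<close>

definition fejer :: "real \<Rightarrow> real \<Rightarrow> real" where
  "fejer l u = (if u = 0 then l else 2 * (1 - cos (l * u)) / (l * u\<^sup>2))"

lemma fejer_has_integral: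
  assumes l: "l > 0"
  shows "((\<lambda>t. (1 - t / l) * (2 * cos (t * u))) has_integral fejer l u) {0..l}"
proof (cases "u = 0")
  case True
  have "((\<lambda>t. (1 - t / l) * (2 * cos (t * u))) has_integral ((2 * l - l\<^sup>2 / l) - (2 * 0 - 0\<^sup>2 / l))) {0..l}"
    by (rule fundamental_theorem_of_calculus)
      (use l True in \<open>auto simp: has_real_derivative_iff_has_vector_derivative[symmetric] intro!: derivative_eq_intros simp: field_simps\<close>)
  moreover have "(2 * l - l\<^sup>2 / l) - (2 * 0 - 0\<^sup>2 / l) = fejer l u" using True l by (simp add: fejer_def power2_eq_square)
  ultimately show ?thesis by simp
next
  case False
  define F where "F = (\<lambda>t. (1 - t / l) * (2 * sin (t * u) / u) - 2 * cos (t * u) / (l * u\<^sup>2))"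
  have "((\<lambda>t. (1 - t / l) * (2 * cos (t * u))) has_integral (F l - F 0)) {0..l}"
  proof (rule fundamental_theorem_of_calculus)
    fix t assume "t \<in> {0..l}"
    have "(F has_real_derivative (1 - t / l) * (2 * cos (t * u))) (at t within {0..l})"
      unfolding F_def using l False
      by (auto intro!: derivative_eq_intros simp: power2_eq_square field_simps)
    then show "(F has_vector_derivative (1 - t / l) * (2 * cos (t * u))) (at t within {0..l})"
      by (simp add: has_real_derivative_iff_has_vector_derivative)
  qed (use l in simp)
  moreover have "F l - F 0 = fejer l u" using False l by (simp add: F_def fejer_def field_simps)
  ultimately show ?thesis by simp
qed

lemma fejer_nonneg: "l > 0 \<Longrightarrow> fejer l u \<ge> 0"
  by (auto simp: fejer_def)

lemma fejer_le: "l > 0 \<Longrightarrow> u \<noteq> 0 \<Longrightarrow> fejer l u \<le> 4 / (l * u\<^sup>2)"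
proof -
  assume "l > 0" "u \<noteq> 0"
  define x where "x = cos (l * u)"
  have "x \<ge> -1" unfolding x_def by (rule cos_ge_minus_one)
  then have "2 * (1 - x) \<le> 4" by simp
  then have "2 * (1 - cos (l * u)) \<le> 4" by (simp only: x_def)
  then show ?thesis using \<open>l > 0\<close> \<open>u \<noteq> 0\<close> by (simp add: fejer_def divide_right_mono)
qed

lemma cos_le_one_minus:
  fixes y :: real
  assumes "\<bar>y\<bar> \<le> 1"
  shows "cos y \<le> 1 - y\<^sup>2 / 4"
proof -
  have *: "cos y \<le> 1 - y\<^sup>2 / 4" if y: "0 \<le> y" "y \<le> 1" for y :: real
  proof -
    have sn: "sin x \<ge> x / 2" if x: "0 \<le> x" "x \<le> 1" for x :: real
    proof -
      have "sin 0 - 0 / 2 \<le> sin x - x / 2"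
      proof (rule DERIV_nonneg_imp_nondecreasing[OF x(1)])
        fix z :: real assume z: "0 \<le> z" "z \<le> x"
        have "z \<le> pi / 3" using z x pi_gt3 by linarith
        then have "cos (pi / 3) \<le> cos z" using z pi_gt3 by (intro cos_monotone_0_pi_le) auto
        then have "cos z - 1 / 2 \<ge> 0" by (simp add: cos_60)
        moreover have "((\<lambda>x. sin x - x / 2) has_real_derivative (cos z - 1 / 2)) (at z)"
          by (auto intro!: derivative_eq_intros)
        ultimately show "\<exists>y. ((\<lambda>x. sin x - x / 2) has_real_derivative y) (at z) \<and> 0 \<le> y" by blast
      qed
      then show ?thesis by simp
    qed
    have "1 - 0\<^sup>2 / 4 - cos 0 \<le> 1 - y\<^sup>2 / 4 - cos y"
    proof (rule DERIV_nonneg_imp_nondecreasing[OF y(1)])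
      fix z :: real assume z: "0 \<le> z" "z \<le> y"
      have "sin z - z / 2 \<ge> 0" using sn[of z] z y by simp
      moreover have "((\<lambda>x. 1 - x\<^sup>2 / 4 - cos x) has_real_derivative (sin z - z / 2)) (at z)"
        by (auto intro!: derivative_eq_intros)
      ultimately show "\<exists>d. ((\<lambda>x. 1 - x\<^sup>2 / 4 - cos x) has_real_derivative d) (at z) \<and> 0 \<le> d" by blast
    qed
    then show ?thesis by simp
  qed
  show ?thesis using *[of "\<bar>y\<bar>"] assms by simp
qed

lemma fejer_ge:
  assumes "l > 0" "\<bar>l * u\<bar> \<le> 1"
  shows "fejer l u \<ge> l / 2"
proof (cases "u = 0")
  case False
  have "2 * (1 - cos (l * u)) \<ge> 2 * ((l * u)\<^sup>2 / 4)" using cos_le_one_minus[OF assms(2)] by simp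
  then have "2 * ((l * u)\<^sup>2 / 4) / (l * u\<^sup>2) \<le> 2 * (1 - cos (l * u)) / (l * u\<^sup>2)"
    using assms by (intro divide_right_mono) auto
  also have "\<dots> = fejer l u" using False by (simp add: fejer_def)
  also have "2 * ((l * u)\<^sup>2 / 4) / (l * u\<^sup>2) = l / 2"
    using False assms by (simp add: power2_eq_square field_simps)
  finally show ?thesis .
qed (use assms in \<open>simp add: fejer_def\<close>)

lemma fejer_le_l:
  assumes l: "l > 0"
  shows "fejer l u \<le> 2 * l"
proof -
  have "norm (integral {0..l} (\<lambda>t. (1 - t / l) * (2 * cos (t * u)))) \<le> 2 * (l - 0)"
  proof (rule integral_bound)
    show "continuous_on {0..l} (\<lambda>t. (1 - t / l) * (2 * cos (t * u)))" using l by (intro continuous_intros) auto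
    fix t assume t: "t \<in> {0..l}"
    have "\<bar>1 - t / l\<bar> * (2 * \<bar>cos (t * u)\<bar>) \<le> 1 * (2 * 1)"
      using t l by (intro mult_mono) (auto simp: field_simps)
    then show "norm ((1 - t / l) * (2 * cos (t * u))) \<le> 2" by (simp add: abs_mult)
  qed (use l in simp)
  then show ?thesis using integral_unique[OF fejer_has_integral[OF l, of u]] by simp
qed

text \<open>The arctangent telescopes over the points \<open>ln (n / N)\<close>, which are \<open>1 / n\<close>-spaced.\<close>
lemma sum_reciprocal_log_square:
  assumes N: "N \<ge> (1::nat)" and \<eta>: "\<eta> > 0" "1 / real N \<le> \<eta>"
  shows "(\<Sum>n=1..K. 1 / (real n * (\<eta>\<^sup>2 + (ln (real n) - ln (real N))\<^sup>2))) \<le> 6 * pi / \<eta>"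
proof -
  define y where "y = (\<lambda>n. ln (real n) - ln (real N))"
  define \<theta> where "\<theta> = (\<lambda>n. arctan (y n / \<eta>))"
  \<comment> \<open>The constant is 6 = 2 * 3: consecutive points are at least 1 / (2 n) apart, and
    1 + z^2 <= 3 (1 + (y n / \<eta>)^2) at the mean value point.\<close>
  have step: "1 / (real n * (\<eta>\<^sup>2 + (y n)\<^sup>2)) \<le> 6 / \<eta> * (\<theta> (Suc n) - \<theta> n)" if n: "n \<ge> 1" for n
  proof -
    have "ln (real n / real (Suc n)) \<le> real n / real (Suc n) - 1" using n by (intro ln_le_minus_one) auto
    then have "y (Suc n) - y n \<ge> 1 - real n / real (Suc n)" using n by (simp add: y_def ln_div)
    moreover have "1 - real n / real (Suc n) \<ge> 1 / (2 * real n)" using n by (simp add: field_simps)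
    ultimately have lo: "y (Suc n) - y n \<ge> 1 / (2 * real n)" by linarith
    have "ln (real (Suc n) / real n) \<le> real (Suc n) / real n - 1" using n by (intro ln_le_minus_one) auto
    moreover have "real (Suc n) / real n - 1 = 1 / real n" using n by (simp add: field_simps)
    ultimately have up: "y (Suc n) - y n \<le> 1 / real n" using n by (simp add: y_def ln_div)
    have ylt: "y n < y (Suc n)" 
    proof -
      have "1 / (2 * real n) > 0" using n by simp
      then show ?thesis using lo by linarith
    qed
    have "\<exists>z. y n / \<eta> < z \<and> z < y (Suc n) / \<eta> \<and> \<theta> (Suc n) - \<theta> n = (y (Suc n) / \<eta> - y n / \<eta>) * (1 / (1 + z\<^sup>2))"
      unfolding \<theta>_def using ylt \<eta>
      by (intro MVT2) (auto simp: divide_strict_right_mono intro!: derivative_eq_intros simp: field_simps)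
    then obtain z where z: "y n / \<eta> < z" "z < y (Suc n) / \<eta>"
      "\<theta> (Suc n) - \<theta> n = (y (Suc n) - y n) / \<eta> * (1 / (1 + z\<^sup>2))" by (auto simp: diff_divide_distrib)
    \<comment> \<open>From N on, a step of y is at most 1 / N <= \<eta>; before N the next point is
      still at most 0.\<close>
    have zb: "\<bar>z\<bar> \<le> \<bar>y n\<bar> / \<eta> + 1"
    proof (cases "z \<ge> 0")
      case True
      have "y (Suc n) \<le> \<bar>y n\<bar> + \<eta>"
      proof (cases "n \<ge> N")
        case True
        then have "1 / real n \<le> 1 / real N" using N by (intro divide_left_mono) auto
        then show ?thesis using up \<eta>(2) by linarith
      next
        case False
        then have "Suc n \<le> N" by simp
        then have "y (Suc n) \<le> 0" unfolding y_def by simp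
        then show ?thesis using \<eta>(1) by linarith
      qed
      then have "y (Suc n) / \<eta> \<le> (\<bar>y n\<bar> + \<eta>) / \<eta>" using \<eta>(1) by (intro divide_right_mono) auto
      then show ?thesis using z(2) True \<eta>(1) by (simp add: add_divide_distrib)
    next
      case False
      have "\<bar>y n / \<eta>\<bar> = \<bar>y n\<bar> / \<eta>" using \<eta>(1) by (simp only: abs_divide abs_of_pos)
      then have "- (\<bar>y n\<bar> / \<eta>) \<le> y n / \<eta>" using abs_ge_minus_self[of "y n / \<eta>"] by linarith
      then show ?thesis using z(1) False by linarith
    qed
    have "z\<^sup>2 \<le> (\<bar>y n\<bar> / \<eta> + 1)\<^sup>2" using power_mono[OF zb, of 2] by simp
    also have "\<dots> \<le> 2 * (\<bar>y n\<bar> / \<eta>)\<^sup>2 + 2"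
      using sum_squares_bound[of "\<bar>y n\<bar> / \<eta>" 1] by (simp add: power2_sum)
    also have "(\<bar>y n\<bar> / \<eta>)\<^sup>2 = (y n / \<eta>)\<^sup>2" by (simp add: power_divide)
    finally have "1 + z\<^sup>2 \<le> 3 * (1 + (y n / \<eta>)\<^sup>2)" using zero_le_power2[of "y n / \<eta>"] by argo
    then have "1 / (3 * (1 + (y n / \<eta>)\<^sup>2)) \<le> 1 / (1 + z\<^sup>2)"
      by (intro divide_left_mono) (auto simp: add_pos_nonneg)
    moreover have "1 / (2 * real n) / \<eta> \<le> (y (Suc n) - y n) / \<eta>" using lo \<eta> by (intro divide_right_mono) auto
    ultimately have "1 / (2 * real n) / \<eta> * (1 / (3 * (1 + (y n / \<eta>)\<^sup>2))) \<le> \<theta> (Suc n) - \<theta> n"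
      unfolding z(3) using \<eta> n ylt by (intro mult_mono) auto
    moreover have "1 / (2 * real n) / \<eta> * (1 / (3 * (1 + (y n / \<eta>)\<^sup>2))) = \<eta> / 6 * (1 / (real n * (\<eta>\<^sup>2 + (y n)\<^sup>2)))"
      using \<eta> n by (simp add: field_simps power2_eq_square)
    ultimately have "\<eta> / 6 * (1 / (real n * (\<eta>\<^sup>2 + (y n)\<^sup>2))) \<le> \<theta> (Suc n) - \<theta> n" by simp
    then have "6 / \<eta> * (\<eta> / 6 * (1 / (real n * (\<eta>\<^sup>2 + (y n)\<^sup>2)))) \<le> 6 / \<eta> * (\<theta> (Suc n) - \<theta> n)"
      using \<eta> by (intro mult_left_mono) auto
    then show ?thesis using \<eta> by simp
  qed
  have "(\<Sum>n=1..K. 1 / (real n * (\<eta>\<^sup>2 + (y n)\<^sup>2))) \<le> (\<Sum>n=1..K. 6 / \<eta> * (\<theta> (Suc n) - \<theta> n))"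
    using step by (intro sum_mono) auto
  also have "\<dots> = 6 / \<eta> * (\<theta> (Suc K) - \<theta> 1)"
    unfolding sum_distrib_left[symmetric] by (subst sum_Suc_diff) auto
  also have "\<dots> \<le> 6 / \<eta> * pi"
    unfolding \<theta>_def using arctan_bounded[of "y (Suc K) / \<eta>"] arctan_bounded[of "y 1 / \<eta>"] \<eta>
    by (intro mult_left_mono) auto
  finally show ?thesis by (simp add: y_def)
qed

text \<open>For \<sigma> > 1 the series converges uniformly on the segment, so the tent-weighted
  integral may be taken termwise and each n contributes the kernel at ln n - v. The points t and - t
  are folded together, which leaves cosines.\<close>

lemma dirichlet_sum_fejer:
  fixes b :: "nat \<Rightarrow> complex"
  assumes b: "\<And>n. norm (b n) \<le> 1" and \<sigma>: "\<sigma> > 1" and l: "l > 0"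
  shows "(\<lambda>n. b n * of_real (real n powr (- \<sigma>) * fejer l (ln (real n) - v))) sums
     integral {0..l} (\<lambda>t. of_real (1 - t / l) * (dirichlet_sum b (Complex \<sigma> t) * cis (t * v)
        + dirichlet_sum b (Complex \<sigma> (-t)) * cis (- (t * v))))"
proof -
  define u where "u = (\<lambda>n t. b n * of_real (real n powr (- \<sigma>) * ((1 - t / l) * (2 * cos (t * (ln (real n) - v))))))"
  have powr: "of_nat n powr (- Complex \<sigma> t) = of_real (real n powr (- \<sigma>)) * cis (- (t * ln (real n)))" for n t
  proof (cases "n = 0")
    case False
    then show ?thesis using nat_powr_polar[of n t "\<sigma> - 1"] by (simp add: Complex_eq algebra_simps)
  qed simp
  have sm: "summable (\<lambda>n. norm (b n) * real n powr (- Re (Complex \<sigma> t)))" for t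
    by (rule summable_bounded_dirichlet[OF b]) (use \<sigma> in simp)
  have ptw: "(\<lambda>n. u n t) sums (of_real (1 - t / l) * (dirichlet_sum b (Complex \<sigma> t) * cis (t * v)
        + dirichlet_sum b (Complex \<sigma> (-t)) * cis (- (t * v))))" for t
  proof -
    have "(\<lambda>n. of_real (1 - t / l) * (b n * of_nat n powr (- Complex \<sigma> t) * cis (t * v)
        + b n * of_nat n powr (- Complex \<sigma> (-t)) * cis (- (t * v)))) sums (of_real (1 - t / l) * (dirichlet_sum b (Complex \<sigma> t) * cis (t * v)
        + dirichlet_sum b (Complex \<sigma> (-t)) * cis (- (t * v))))"
      by (intro sums_mult sums_add sums_mult2 dirichlet_sums sm)
    moreover have "of_real (1 - t / l) * (b n * of_nat n powr (- Complex \<sigma> t) * cis (t * v)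
        + b n * of_nat n powr (- Complex \<sigma> (-t)) * cis (- (t * v))) = u n t" for n
    proof -
      define w where "w = t * (ln (real n) - v)"
      have 1: "cis (- (t * ln (real n))) * cis (t * v) = cis (- w)" unfolding w_def by (simp add: cis_mult algebra_simps)
      have 2: "cis (t * ln (real n)) * cis (- (t * v)) = cis w" unfolding w_def by (simp add: cis_mult algebra_simps)
      have 3: "cis (- w) + cis w = of_real (2 * cos w)" by (simp add: complex_eq_iff)
      have "of_real (1 - t / l) * (b n * of_nat n powr (- Complex \<sigma> t) * cis (t * v)
        + b n * of_nat n powr (- Complex \<sigma> (-t)) * cis (- (t * v)))
        = of_real (1 - t / l) * (b n * of_real (real n powr (- \<sigma>))) * ((cis (- (t * ln (real n))) * cis (t * v)) + (cis (t * ln (real n)) * cis (- (t * v))))"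
        unfolding powr by (simp add: algebra_simps)
      also have "\<dots> = u n t" unfolding 1 2 3 u_def w_def[symmetric] by (simp add: mult_ac)
      finally show ?thesis .
    qed
    ultimately show ?thesis by simp
  qed
  have ul: "uniform_limit {0..l} (\<lambda>N t. \<Sum>n<N. u n t) (\<lambda>t. \<Sum>n. u n t) sequentially"
  proof (rule Weierstrass_m_test)
    show "summable (\<lambda>n. 2 * real n powr (- \<sigma>))" using \<sigma> by (intro summable_mult) (simp add: summable_real_powr_iff)
    fix n t assume t: "t \<in> {0..l}"
    have "\<bar>1 - t / l\<bar> * (2 * \<bar>cos (t * (ln (real n) - v))\<bar>) \<le> 1 * (2 * 1)"
      using t l by (intro mult_mono) (auto simp: field_simps)
    then have "real n powr (- \<sigma>) * (\<bar>1 - t / l\<bar> * (2 * \<bar>cos (t * (ln (real n) - v))\<bar>)) \<le> real n powr (- \<sigma>) * 2"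
      by (intro mult_left_mono) simp_all
    then have "norm (b n) * (real n powr (- \<sigma>) * (\<bar>1 - t / l\<bar> * (2 * \<bar>cos (t * (ln (real n) - v))\<bar>))) \<le> 1 * (real n powr (- \<sigma>) * 2)"
      by (rule mult_mono[OF b[of n]]) simp_all
    then show "norm (u n t) \<le> 2 * real n powr (- \<sigma>)" unfolding u_def norm_mult norm_of_real by (simp add: abs_mult mult_ac)
  qed
  have cont: "continuous_on {0..l} (\<lambda>t. \<Sum>n<N. u n t)" for N
    unfolding u_def using l by (intro continuous_intros) auto
  obtain I J where I: "\<And>N. ((\<lambda>t. \<Sum>n<N. u n t) has_integral I N) {0..l}"
    and J: "((\<lambda>t. \<Sum>n. u n t) has_integral J) {0..l}" and IJ: "I \<longlonglongrightarrow> J"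
    by (rule uniform_limit_integral[OF ul cont]) auto
  have tm: "(u n has_integral (b n * of_real (real n powr (- \<sigma>) * fejer l (ln (real n) - v)))) {0..l}" for n
    unfolding u_def
    by (intro has_integral_mult_right has_integral_of_real fejer_has_integral l)
  have "I = (\<lambda>N. \<Sum>n<N. b n * of_real (real n powr (- \<sigma>) * fejer l (ln (real n) - v)))"
    by (rule ext, rule has_integral_unique[OF I]) (intro has_integral_sum tm; simp)
  then have "(\<lambda>n. b n * of_real (real n powr (- \<sigma>) * fejer l (ln (real n) - v))) sums J"
    using IJ unfolding sums_def by (simp only:)
  moreover have "J = integral {0..l} (\<lambda>t. of_real (1 - t / l) * (dirichlet_sum b (Complex \<sigma> t) * cis (t * v)
        + dirichlet_sum b (Complex \<sigma> (-t)) * cis (- (t * v))))"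
  proof -
    have "(\<lambda>t. \<Sum>n. u n t) = (\<lambda>t. of_real (1 - t / l) * (dirichlet_sum b (Complex \<sigma> t) * cis (t * v)
        + dirichlet_sum b (Complex \<sigma> (-t)) * cis (- (t * v))))"
      using ptw by (auto simp: sums_iff)
    then show ?thesis using J by (metis integral_unique)
  qed
  ultimately show ?thesis by simp
qed

text \<open>The Fejer kernel concentrates at \<open>n\<close> close to \<open>N\<close>, where \<open>b\<close> is nearly constant.\<close>
lemma tauberian_bound:
  fixes b :: "nat \<Rightarrow> complex" and G :: "complex \<Rightarrow> complex"
  assumes b: "\<And>n. norm (b n) \<le> 1"
    and slow: "\<And>m n. 1 \<le> m \<Longrightarrow> m \<le> n \<Longrightarrow> norm (b n - b m) \<le> 2 * (real n - real m) / real n"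
    and contG: "continuous_on {s. Re s \<ge> 1} G"
    and G: "\<And>s. Re s > 1 \<Longrightarrow> G s = dirichlet_sum b s"
    and l: "l \<ge> 1" and \<eta>: "\<eta> > 0" "1 / real N \<le> \<eta>" and N: "real N \<ge> 2 * l"
  shows "norm (b N) \<le> 2 * \<eta> + 8 * (norm (integral {0..l} (\<lambda>t. of_real (1 - t / l) * (G (Complex 1 t) * cis (t * ln (real N))
        + G (Complex 1 (-t)) * cis (- (t * ln (real N)))))) + 96 * pi / (l * \<eta>))"
proof -
  have l0: "l > 0" using l by simp
  have N1: "N \<ge> 1" using N l by (cases N) auto
  define v where "v = ln (real N)"
  define I where "I = (\<lambda>\<sigma>. integral {0..l} (\<lambda>t. of_real (1 - t / l) * (G (Complex \<sigma> t) * cis (t * v) + G (Complex \<sigma> (-t)) * cis (- (t * v)))))"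
  define k where "k = (\<lambda>n. fejer l (ln (real n) - v))"
  have k0: "k n \<ge> 0" for n unfolding k_def by (rule fejer_nonneg[OF l0])
  \<comment> \<open>For these n, |l (ln n - ln N)| <= 1, where the kernel is at least l / 2. There
    are at least N / l of them, so their total weight is bounded below independently of N and
    l.\<close>
  define S where "S = {N..N + nat \<lfloor>real N / l\<rfloor>}"
  define w where "w = (\<lambda>\<sigma>. \<Sum>n\<in>S. real n powr (- \<sigma>) * k n)"
  \<comment> \<open>Slow variation amounts to a Lipschitz condition in ln n, because 1 - m / n <= ln
    (n / m).\<close>
  have diff: "norm (b n - b N) \<le> 2 * \<bar>ln (real n) - v\<bar>" if n: "n \<ge> 1" for n
  proof -
    have ineq: "2 * (real y - real x) / real y \<le> 2 * \<bar>ln (real y) - ln (real x)\<bar>" if "1 \<le> x" "x \<le> y" for x y :: nat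
    proof -
      have "ln (real x / real y) \<le> real x / real y - 1" using that by (intro ln_le_minus_one) auto
      then have "1 - real x / real y \<le> ln (real y) - ln (real x)" using that by (simp add: ln_div)
      then have "1 - real x / real y \<le> \<bar>ln (real y) - ln (real x)\<bar>" by (rule order_trans[OF _ abs_ge_self])
      then have le: "2 * (1 - real x / real y) \<le> 2 * \<bar>ln (real y) - ln (real x)\<bar>" by (rule mult_left_mono) simp
      have "2 * (real y - real x) / real y = 2 * (1 - real x / real y)" using that by (simp add: field_simps)
      then show ?thesis using le by (simp only:)
    qed
    show ?thesis
    proof (cases "n \<le> N")
      case True
      have "norm (b N - b n) \<le> 2 * (real N - real n) / real N" by (rule slow[OF n True])
      also have "\<dots> \<le> 2 * \<bar>ln (real N) - ln (real n)\<bar>" by (rule ineq[OF n True])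
      finally show ?thesis by (simp add: v_def norm_minus_commute abs_minus_commute)
    next
      case False
      then have nN: "N \<le> n" by simp
      have "norm (b n - b N) \<le> 2 * (real n - real N) / real n" by (rule slow[OF N1 nN])
      also have "\<dots> \<le> 2 * \<bar>ln (real n) - ln (real N)\<bar>" by (rule ineq[OF N1 nN])
      finally show ?thesis by (simp add: v_def)
    qed
  qed
  define r where "r = (\<lambda>n. 1 / (real n * (\<eta>\<^sup>2 + (ln (real n) - v)\<^sup>2)))"
  have r0: "r n \<ge> 0" for n unfolding r_def by auto
  have rsum: "(\<Sum>n<K. r n) \<le> 6 * pi / \<eta>" for K
  proof -
    have "(\<Sum>n<K. r n) \<le> (\<Sum>n\<in>insert 0 {1..K}. r n)" using r0 by (intro sum_mono2) auto
    also have "\<dots> = (\<Sum>n=1..K. r n)" by (simp add: r_def)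
    also have "\<dots> \<le> 6 * pi / \<eta>" unfolding r_def v_def by (rule sum_reciprocal_log_square[OF N1 \<eta>])
    finally show ?thesis .
  qed
  have rsummable: "summable r" by (rule summableI_nonneg_bounded[OF r0 rsum])
  have rinf: "suminf r \<le> 6 * pi / \<eta>" by (rule suminf_le_const[OF rsummable rsum])
  \<comment> \<open>Let y = ln n - v. If |y| <= \<eta>, then b n and b N differ by at most 2 \<eta>.
    Otherwise they differ by at most 2, and the kernel is at most 4 / (l y^2) <= 8 / (l (\<eta>^2 +
    y^2)); summation gives 16 / l * 6 pi / \<eta>.\<close>
  have main: "(norm (b N) - 2 * \<eta>) * w \<sigma> \<le> norm (I \<sigma>) + 96 * pi / (l * \<eta>)" if \<sigma>: "\<sigma> > 1" and big: "norm (b N) \<ge> 2 * \<eta>" for \<sigma>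
  proof -
    define q where "q = (\<lambda>n. real n powr (- \<sigma>) * k n)"
    have q0: "q n \<ge> 0" for n unfolding q_def using k0 by simp
    have qs: "summable q"
    proof (rule summable_comparison_test')
      show "summable (\<lambda>n. 2 * l * real n powr (- \<sigma>))" using \<sigma> by (intro summable_mult) (simp add: summable_real_powr_iff)
      have "q n \<le> 2 * l * real n powr (- \<sigma>)" for n
        unfolding q_def k_def using mult_left_mono[OF fejer_le_l[OF l0, of "ln (real n) - v"], of "real n powr (- \<sigma>)"]
        by (simp add: mult_ac)
      then show "norm (q n) \<le> 2 * l * real n powr (- \<sigma>)" for n using q0[of n] by simp
    qed
    have eqI: "integral {0..l} (\<lambda>t. of_real (1 - t / l) * (dirichlet_sum b (Complex \<sigma> t) * cis (t * v) + dirichlet_sum b (Complex \<sigma> (-t)) * cis (- (t * v)))) = I \<sigma>"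
      unfolding I_def using \<sigma> by (intro arg_cong[where f = "integral {0..l}"] ext) (simp add: G)
    have s1: "(\<lambda>n. b n * of_real (q n)) sums I \<sigma>"
      using dirichlet_sum_fejer[of b, OF b \<sigma> l0, of v] unfolding eqI q_def k_def .
    have s2: "(\<lambda>n. b N * of_real (q n)) sums (b N * of_real (suminf q))"
      by (intro sums_mult sums_of_real summable_sums qs)
    have bd: "norm ((b n - b N) * of_real (q n)) \<le> 2 * \<eta> * q n + 16 / l * r n" for n
    proof (cases "n = 0")
      case True
      then show ?thesis by (simp add: q_def r_def)
    next
      case False
      then have n: "n \<ge> 1" by simp
      define y where "y = ln (real n) - v"
      show ?thesis
      proof (cases "\<bar>y\<bar> \<le> \<eta>")
        case True
        then have "norm (b n - b N) \<le> 2 * \<eta>" using diff[OF n] by (simp add: y_def)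
        then have "norm (b n - b N) * q n \<le> 2 * \<eta> * q n" using q0 by (intro mult_right_mono) auto
        then show ?thesis using r0[of n] l0 q0[of n] by (simp add: norm_mult add_increasing2)
      next
        case False
        then have y0: "y \<noteq> 0" using \<eta>(1) by auto
        have "\<eta>\<^sup>2 \<le> y\<^sup>2" using False \<eta>(1) by (metis abs_le_square_iff abs_of_pos linorder_not_le less_imp_le)
        then have y2: "\<eta>\<^sup>2 + y\<^sup>2 \<le> 2 * y\<^sup>2" by simp
        have yp: "\<eta>\<^sup>2 + y\<^sup>2 > 0" using \<eta>(1) by (simp add: add_pos_nonneg)
        have "norm (b n - b N) \<le> 2" using norm_triangle_ineq4[of "b n" "b N"] b[of n] b[of N] by linarith
        then have "norm (b n - b N) * q n \<le> 2 * q n" using q0 by (intro mult_right_mono) auto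
        also have "q n \<le> real n powr (-1) * (4 / (l * y\<^sup>2))"
          unfolding q_def k_def y_def[symmetric] using fejer_le[OF l0 y0] n \<sigma> fejer_nonneg[OF l0]
          by (intro mult_mono powr_mono) auto
        also have "real n powr (-1) = 1 / real n" using n by (simp add: powr_minus divide_inverse)
        also have "1 / real n * (4 / (l * y\<^sup>2)) \<le> 1 / real n * (8 / (l * (\<eta>\<^sup>2 + y\<^sup>2)))"
        proof (rule mult_left_mono)
          have p1: "l * (\<eta>\<^sup>2 + y\<^sup>2) > 0" using l0 yp by (rule mult_pos_pos)
          have p2: "l * (2 * y\<^sup>2) > 0" using l0 y0 by simp
          have "8 / (l * (2 * y\<^sup>2)) \<le> 8 / (l * (\<eta>\<^sup>2 + y\<^sup>2))"
            by (rule divide_left_mono[OF mult_left_mono[OF y2] _ mult_pos_pos[OF p2 p1]]) (use l0 in auto)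
          then show "4 / (l * y\<^sup>2) \<le> 8 / (l * (\<eta>\<^sup>2 + y\<^sup>2))" by simp
        qed simp
        also have "1 / real n * (8 / (l * (\<eta>\<^sup>2 + y\<^sup>2))) = 8 / l * r n"
          unfolding r_def y_def[symmetric] by simp
        finally have "norm (b n - b N) * q n \<le> 16 / l * r n" by simp
        then show ?thesis using q0[of n] \<eta>(1) by (simp add: norm_mult add_increasing)
      qed
    qed
    have s3: "(\<lambda>n. (b n - b N) * of_real (q n)) sums (I \<sigma> - b N * of_real (suminf q))"
      using sums_diff[OF s1 s2] by (simp add: left_diff_distrib)
    have sumb: "summable (\<lambda>n. 2 * \<eta> * q n + 16 / l * r n)" by (intro summable_add summable_mult qs rsummable)
    have "norm (I \<sigma> - b N * of_real (suminf q)) \<le> (\<Sum>n. 2 * \<eta> * q n + 16 / l * r n)"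
      using sums_unique[OF s3] norm_suminf_le[OF bd sumb] by simp
    also have "\<dots> = 2 * \<eta> * suminf q + 16 / l * suminf r"
      by (simp only: suminf_add[symmetric] summable_mult qs rsummable suminf_mult)
    also have "\<dots> \<le> 2 * \<eta> * suminf q + 16 / l * (6 * pi / \<eta>)"
      using rinf l0 by (intro add_left_mono mult_left_mono) auto
    finally have "norm (I \<sigma> - b N * of_real (suminf q)) \<le> 2 * \<eta> * suminf q + 96 * pi / (l * \<eta>)" by simp
    moreover have "norm (b N * of_real (suminf q)) \<le> norm (I \<sigma>) + norm (I \<sigma> - b N * of_real (suminf q))"
      by (metis norm_triangle_sub norm_minus_commute add.commute)
    moreover have "norm (b N * of_real (suminf q)) = norm (b N) * suminf q"
      using suminf_nonneg[OF qs q0] by (simp add: norm_mult)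
    ultimately have "(norm (b N) - 2 * \<eta>) * suminf q \<le> norm (I \<sigma>) + 96 * pi / (l * \<eta>)"
      by (simp add: left_diff_distrib)
    moreover have "w \<sigma> \<le> suminf q" unfolding w_def q_def[symmetric]
      by (rule sum_le_suminf[OF qs]) (use q0 in \<open>auto simp: S_def\<close>)
    then have "(norm (b N) - 2 * \<eta>) * w \<sigma> \<le> (norm (b N) - 2 * \<eta>) * suminf q"
      using big by (intro mult_left_mono) auto
    ultimately show ?thesis by linarith
  qed
  have w1: "w 1 \<ge> 1 / 8"
  proof -
    have el: "real n powr (-1) * k n \<ge> 1 / (2 * real N) * (l / 2)" if "n \<in> S" for n
    proof -
      have n: "N \<le> n" "real n \<le> real N + real N / l"
        using that l0 unfolding S_def by (auto simp: le_nat_iff le_floor_iff) (smt (verit) of_int_floor_le of_nat_add of_nat_le_iff of_nat_nat zero_le_floor divide_nonneg_pos of_nat_0_le_iff)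
      have "real N / l \<le> real N" using l mult_left_mono[of 1 l "real N"] by (simp add: divide_le_eq)
      then have n2: "real n \<le> 2 * real N" using n by linarith
      have "ln (real n / real N) \<le> real n / real N - 1" using n N1 by (intro ln_le_minus_one) auto
      also have "\<dots> \<le> 1 / l" using n(2) N1 l0 by (simp add: field_simps)
      finally have "ln (real n) - v \<le> 1 / l" using n N1 by (simp add: v_def ln_div)
      moreover have "ln (real n) - v \<ge> 0" using n N1 by (simp add: v_def)
      ultimately have "\<bar>l * (ln (real n) - v)\<bar> \<le> 1" using l0 by (simp add: abs_mult field_simps)
      then have "k n \<ge> l / 2" unfolding k_def by (rule fejer_ge[OF l0])
      moreover have "real n powr (-1) \<ge> 1 / (2 * real N)"
        using n n2 N1 by (simp add: powr_minus divide_inverse[symmetric] inverse_eq_divide divide_left_mono)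
      ultimately show ?thesis using l0 by (intro mult_mono) auto
    qed
    have "real (card S) * (1 / (2 * real N) * (l / 2)) \<le> w 1"
      unfolding w_def using sum_bounded_below[of S "1 / (2 * real N) * (l / 2)" "\<lambda>n. real n powr (-1) * k n", OF el] by simp
    moreover have "real (card S) \<ge> real N / l"
    proof -
      have "\<lfloor>real N / l\<rfloor> \<ge> 0" using l0 by simp
      then have "real (card S) = real_of_int \<lfloor>real N / l\<rfloor> + 1" unfolding S_def by simp
      then show ?thesis by linarith
    qed
    then have "real N / l * (1 / (2 * real N) * (l / 2)) \<le> real (card S) * (1 / (2 * real N) * (l / 2))"
      using l0 by (intro mult_right_mono) auto
    moreover have "real N / l * (1 / (2 * real N) * (l / 2)) = 1 / 4" using l0 N1 by (simp add: field_simps)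
    ultimately show ?thesis by linarith
  qed
  have Icont: "continuous_on {1..2} I"
  proof -
    have "continuous_on ({1..2} \<times> cbox 0 l) (\<lambda>(\<sigma>, t). of_real (1 - t / l) * (G (Complex \<sigma> t) * cis (t * v) + G (Complex \<sigma> (-t)) * cis (- (t * v))))"
      unfolding case_prod_unfold
      by (intro continuous_intros continuous_on_compose2[OF contG] ) (use l0 in \<open>auto simp: Complex_eq intro!: continuous_intros\<close>)
    from integral_continuous_on_param[OF this] show ?thesis unfolding I_def by simp
  qed
  show ?thesis
  proof (cases "norm (b N) \<ge> 2 * \<eta>")
    case False
    have "0 \<le> 96 * pi / (l * \<eta>)" using l0 \<eta> by simp
    then show ?thesis using False norm_ge_zero by (smt (verit) mult_nonneg_nonneg)
  next
    case True
    \<comment> \<open>Only now does \<sigma> tend to 1: \<open>w\<close> is a finite sum, and the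
      integrand extends continuously to the line.\<close>
    have wlim: "(w \<longlongrightarrow> w 1) (at_right 1)"
      unfolding w_def using N1 by (intro tendsto_intros) (auto simp: S_def)
    have Ilim: "(I \<longlongrightarrow> I 1) (at_right 1)"
    proof -
      have "(I \<longlongrightarrow> I 1) (at 1 within {1..2})" using Icont by (auto simp: continuous_on_def)
      moreover have "at (1::real) within {1..2} = at_right 1" by (rule at_within_Icc_at_right) simp
      ultimately show ?thesis by simp
    qed
    have l1: "((\<lambda>\<sigma>. (norm (b N) - 2 * \<eta>) * w \<sigma>) \<longlongrightarrow> (norm (b N) - 2 * \<eta>) * w 1) (at_right 1)"
      by (intro tendsto_intros wlim)
    have l2: "((\<lambda>\<sigma>. norm (I \<sigma>) + 96 * pi / (l * \<eta>)) \<longlongrightarrow> norm (I 1) + 96 * pi / (l * \<eta>)) (at_right 1)"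
      by (intro tendsto_intros Ilim)
    have ev: "eventually (\<lambda>\<sigma>. (norm (b N) - 2 * \<eta>) * w \<sigma> \<le> norm (I \<sigma>) + 96 * pi / (l * \<eta>)) (at_right 1)"
      by (rule eventually_mono[OF eventually_at_right_less main[OF _ True]])
    have "(norm (b N) - 2 * \<eta>) * w 1 \<le> norm (I 1) + 96 * pi / (l * \<eta>)"
      by (rule tendsto_le[OF trivial_limit_at_right_real l2 l1 ev])
    moreover have "(norm (b N) - 2 * \<eta>) * (1 / 8) \<le> (norm (b N) - 2 * \<eta>) * w 1"
      using w1 True by (intro mult_left_mono) auto
    ultimately have "norm (b N) \<le> 2 * \<eta> + 8 * (norm (I 1) + 96 * pi / (l * \<eta>))" by argo
    then show ?thesis unfolding I_def v_def .
  qed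
qed

text \<open>For fixed l the boundary values of \<open>G\<close> enter only on the compact segment
  |t| <= l, where Riemann-Lebesgue makes the integral vanish as N grows; l depends on e
  alone.\<close>

theorem fejer_tauberian:
  fixes b :: "nat \<Rightarrow> complex" and G :: "complex \<Rightarrow> complex"
  assumes b: "\<And>n. norm (b n) \<le> 1"
    and slow: "\<And>m n. 1 \<le> m \<Longrightarrow> m \<le> n \<Longrightarrow> norm (b n - b m) \<le> 2 * (real n - real m) / real n"
    and contG: "continuous_on {s. Re s \<ge> 1} G"
    and G: "\<And>s. Re s > 1 \<Longrightarrow> G s = dirichlet_sum b s"
  shows "b \<longlonglongrightarrow> 0"
proof (rule tendstoI)
  fix e :: real assume e: "e > 0"
  \<comment> \<open>With l = x^2 and \<eta> = 1 / x, both 2 \<eta> and 1 / (l \<eta>) are of order 1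
    / x.\<close>
  define x where "x = max 1 (2 * (2 + 768 * pi) / e + 1)"
  define l where "l = x\<^sup>2"
  define \<eta> where "\<eta> = 1 / x"
  have x1: "x \<ge> 1" and xe: "x > 2 * (2 + 768 * pi) / e" by (auto simp: x_def)
  have l: "l \<ge> 1" using x1 by (simp add: l_def one_le_power)
  have l0: "l > 0" using l by simp
  have \<eta>: "\<eta> > 0" using x1 by (simp add: \<eta>_def)
  have small: "2 * \<eta> + 8 * (96 * pi / (l * \<eta>)) < e / 2"
  proof -
    have "2 * \<eta> + 8 * (96 * pi / (l * \<eta>)) = (2 + 768 * pi) / x"
      using x1 by (simp add: l_def \<eta>_def power2_eq_square field_simps)
    also have "\<dots> < e / 2" using xe x1 e by (simp add: field_simps)
    finally show ?thesis .
  qed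
  define h1 where "h1 = (\<lambda>t. of_real (1 - t / l) * G (Complex 1 t))"
  \<comment> \<open>Conjugation turns the frequency - v into v, so one form of Riemann-Lebesgue
    covers both halves.\<close>
  define h2 where "h2 = (\<lambda>t. cnj (of_real (1 - t / l) * G (Complex 1 (-t))))"
  have c1: "continuous_on UNIV h1" unfolding h1_def
    by (intro continuous_intros continuous_on_compose2[OF contG]) (use l0 in \<open>auto simp: Complex_eq intro!: continuous_intros\<close>)
  have c2: "continuous_on UNIV h2" unfolding h2_def
    by (intro continuous_intros continuous_on_compose2[OF contG]) (use l0 in \<open>auto simp: Complex_eq intro!: continuous_intros\<close>)
  define I where "I = (\<lambda>v. integral {0..l} (\<lambda>t. of_real (1 - t / l) * (G (Complex 1 t) * cis (t * v) + G (Complex 1 (-t)) * cis (- (t * v)))))"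
  have Ieq: "I v = integral {0..l} (\<lambda>t. h1 t * cis (t * v)) + cnj (integral {0..l} (\<lambda>t. h2 t * cis (t * v)))" for v
  proof -
    have i1: "(\<lambda>t. h1 t * cis (t * v)) integrable_on {0..l}"
      by (intro integrable_continuous_real continuous_intros continuous_on_subset[OF c1]) auto
    have i2: "(\<lambda>t. h2 t * cis (t * v)) integrable_on {0..l}"
      by (intro integrable_continuous_real continuous_intros continuous_on_subset[OF c2]) auto
    have "((\<lambda>t. cnj (h2 t * cis (t * v))) has_integral cnj (integral {0..l} (\<lambda>t. h2 t * cis (t * v)))) {0..l}"
      using has_integral_linear[OF integrable_integral[OF i2] bounded_linear_cnj] by (simp add: o_def)
    from has_integral_add[OF integrable_integral[OF i1] this]
    have "((\<lambda>t. of_real (1 - t / l) * (G (Complex 1 t) * cis (t * v) + G (Complex 1 (-t)) * cis (- (t * v)))) has_integral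
       (integral {0..l} (\<lambda>t. h1 t * cis (t * v)) + cnj (integral {0..l} (\<lambda>t. h2 t * cis (t * v))))) {0..l}"
      by (rule has_integral_eq_rhs[OF has_integral_eq[rotated]]) (auto simp: h1_def h2_def cis_cnj algebra_simps)
    then show ?thesis unfolding I_def by (rule integral_unique)
  qed
  have "((\<lambda>v. integral {0..l} (\<lambda>t. h1 t * cis (t * v)) + cnj (integral {0..l} (\<lambda>t. h2 t * cis (t * v)))) \<longlongrightarrow> 0 + cnj 0) at_top"
    by (intro tendsto_add tendsto_cnj riemann_lebesgue_interval c1 c2 l0)
  then have "(I \<longlongrightarrow> 0) at_top" unfolding Ieq[abs_def] by simp
  then have "((\<lambda>N. I (ln (real N))) \<longlongrightarrow> 0) sequentially"
    by (rule filterlim_compose) (rule filterlim_compose[OF ln_at_top filterlim_real_sequentially])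
  then have "eventually (\<lambda>N. dist (I (ln (real N))) 0 < e / 16) sequentially" using e by (intro tendstoD) auto
  moreover have "eventually (\<lambda>N. N \<ge> nat \<lceil>2 * l\<rceil>) sequentially" by (rule eventually_ge_at_top)
  moreover have "eventually (\<lambda>N. N \<ge> nat \<lceil>1 / \<eta>\<rceil>) sequentially" by (rule eventually_ge_at_top)
  ultimately show "eventually (\<lambda>N. dist (b N) 0 < e) sequentially"
  proof eventually_elim
    case (elim N)
    have N2: "real N \<ge> 2 * l" using elim(2) by linarith
    have N3: "1 / real N \<le> \<eta>"
    proof -
      have "real N \<ge> 1 / \<eta>" using elim(3) by linarith
      then show ?thesis using \<eta> N2 l0 by (simp add: field_simps)
    qed
    have "norm (b N) \<le> 2 * \<eta> + 8 * (norm (I (ln (real N))) + 96 * pi / (l * \<eta>))"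
      unfolding I_def by (rule tauberian_bound[OF b slow contG G l \<eta> N3 N2])
    also have "\<dots> = (2 * \<eta> + 8 * (96 * pi / (l * \<eta>))) + 8 * norm (I (ln (real N)))" by (simp add: algebra_simps)
    also have "\<dots> < e / 2 + 8 * (e / 16)"
      by (intro add_strict_mono small mult_strict_left_mono) (use elim(1) in auto)
    finally show ?case by simp
  qed
qed

section \<open>Means of the Moebius function times a character\<close>

text \<open>The Tauberian theorem is applied to the means b n = A n / n themselves. Their Dirichlet
  series is the sum of A n * n powr (-s - 1), which Abel summation compares with 1 / L; the
  nonvanishing of L on Re s >= 1 provides the continuous extension.\<close>

theorem moebius_character_mean:
  assumes \<psi>: "dirichlet_character M \<psi>"
  shows "(\<lambda>N. 1 / of_nat N * (\<Sum>n=1..N. of_int (moebius_mu n) * \<psi> n)) \<longlonglongrightarrow> 0"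
proof -
  define a where "a = (\<lambda>n. of_int (moebius_mu n) * \<psi> n)"
  define A where "A = (\<lambda>n. \<Sum>m=1..n. a m)"
  define b where "b = (\<lambda>n. 1 / of_nat n * A n)"
  define \<kappa> where "\<kappa> = char_mean M \<psi>"
  have a1: "norm (a n) \<le> 1" for n
    unfolding a_def norm_mult using norm_moebius_mu_le[of n] dirichlet_character_norm_le[OF \<psi>, of n]
    by (intro mult_le_one) auto
  have AA: "norm (A n - A m) \<le> real n - real m" if "m \<le> n" for m n
  proof -
    have "A n - A m = (\<Sum>i\<in>{m<..n}. a i)"
    proof -
      have "{1..n} = {1..m} \<union> {m<..n}" using that by auto
      then have "A n = A m + (\<Sum>i\<in>{m<..n}. a i)" unfolding A_def by (simp add: sum.union_disjoint ivl_disj_int)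
      then show ?thesis by simp
    qed
    also have "norm \<dots> \<le> (\<Sum>i\<in>{m<..n}. 1)" by (rule sum_norm_le) (use a1 in auto)
    finally show ?thesis using that by (simp add: of_nat_diff)
  qed
  have An: "norm (A n) \<le> real n" for n using AA[of 0 n] by (simp add: A_def)
  have "b \<longlonglongrightarrow> 0"
  proof -
    \<comment> \<open>\<open>E\<close> is the cost of replacing n powr (-s) - (n + 1) powr (-s) by s
      n powr (-s - 1), regular for Re s > 0 because |A n| <= n. \<open>F\<close> is 1 / L, written
      through P = (s - 1) L if L has a pole at 1.\<close>
    define E where "E = (\<lambda>s. \<Sum>n. A n * (of_nat (Suc n) powr (-s) - of_nat n powr (-s) + s * of_nat n powr (-s - 1)))"
    define P where "P = (\<lambda>s. (s - 1) * char_reg M \<psi> s + \<kappa> * zeta_reg s)"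
    define F where "F = (\<lambda>s. if \<kappa> = 0 then 1 / char_reg M \<psi> s else (s - 1) / P s)"
    have An1: "norm (A n) \<le> real n powr 1" for n using An[of n] by simp
    have E_hol: "E holomorphic_on {s. Re s > 0}" unfolding E_def
      by (rule holomorphic_second_difference(1)[OF An1]) auto
    have sub: "{s. Re s \<ge> 1} \<subseteq> {s. Re s > 0}" by auto
    have Ec: "continuous_on {s. Re s \<ge> 1} E"
      by (rule continuous_on_subset[OF holomorphic_on_imp_continuous_on[OF E_hol] sub])
    have rc: "continuous_on {s. Re s \<ge> 1} (char_reg M \<psi>)"
      by (rule continuous_on_subset[OF holomorphic_on_imp_continuous_on[OF char_reg_holomorphic[OF \<psi>]] sub])
    have zc: "continuous_on {s. Re s \<ge> 1} zeta_reg"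
      by (rule continuous_on_subset[OF holomorphic_on_imp_continuous_on[OF zeta_reg_holomorphic] sub])
    have nz0: "char_reg M \<psi> s \<noteq> 0" if "\<kappa> = 0" "Re s \<ge> 1" for s
      using L_cont_nonzero[OF \<psi> that(2)] that(1) by (simp add: L_cont_def \<kappa>_def)
    have nz1: "P s \<noteq> 0" if k: "\<kappa> \<noteq> 0" "Re s \<ge> 1" for s
    proof (cases "s = 1")
      case True
      then show ?thesis using k by (simp add: P_def zeta_reg_1)
    next
      case False
      then have "L_cont M \<psi> s \<noteq> 0" using L_cont_nonzero[OF \<psi> k(2)] by simp
      moreover have "P s = (s - 1) * L_cont M \<psi> s" using False by (simp add: P_def L_cont_def \<kappa>_def field_simps)
      ultimately show ?thesis using False by simp
    qed
    have Fc: "continuous_on {s. Re s \<ge> 1} F"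
    proof (cases "\<kappa> = 0")
      case True
      then have "F = (\<lambda>s. 1 / char_reg M \<psi> s)" by (simp add: F_def)
      then show ?thesis using nz0[OF True] rc by (auto intro!: continuous_intros)
    next
      case False
      then have "F = (\<lambda>s. (s - 1) / P s)" by (simp add: F_def)
      moreover have "continuous_on {s. Re s \<ge> 1} P" unfolding P_def by (intro continuous_intros rc zc)
      ultimately show ?thesis using nz1[OF False] by (auto intro!: continuous_intros)
    qed
    have Feq: "F s = dirichlet_sum a s" if s: "Re s > 1" for s
    proof -
      have s1: "s \<noteq> 1" using s by auto
      have "dirichlet_sum \<psi> s * dirichlet_sum a s = 1" unfolding a_def by (rule dirichlet_sum_mult_moebius[OF \<psi> s])
      then have 1: "L_cont M \<psi> s * dirichlet_sum a s = 1" using L_cont_eq[OF \<psi> s] by simp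
      show ?thesis
      proof (cases "\<kappa> = 0")
        case True
        then show ?thesis using 1 nz0[OF True, of s] s by (simp add: F_def L_cont_def \<kappa>_def[symmetric] field_simps)
      next
        case False
        have "P s = (s - 1) * L_cont M \<psi> s" using s1 by (simp add: P_def L_cont_def \<kappa>_def field_simps)
        moreover have "L_cont M \<psi> s \<noteq> 0" using 1 by auto
        moreover from this have "dirichlet_sum a s = 1 / L_cont M \<psi> s" using 1 by (simp add: field_simps)
        ultimately show ?thesis using False s1 by (simp add: F_def)
      qed
    qed
    show ?thesis
    proof (rule fejer_tauberian[where G = "\<lambda>s. (F s + E s) / s"])
      show "norm (b n) \<le> 1" for n using An[of n] by (cases "n = 0") (simp_all add: b_def norm_mult norm_divide)
      show "norm (b n - b m) \<le> 2 * (real n - real m) / real n" if "1 \<le> m" "m \<le> n" for m n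
      proof -
        have pos: "real m > 0" "real n > 0" using that by auto
        have "b n - b m = (A n - A m) / of_nat n - A m * of_real ((real n - real m) / (real m * real n))"
          using pos by (simp add: b_def field_simps)
        also have "norm \<dots> \<le> norm ((A n - A m) / of_nat n) + norm (A m * of_real ((real n - real m) / (real m * real n)))"
          by (rule norm_triangle_ineq4)
        also have "\<dots> \<le> (real n - real m) / real n + real m * ((real n - real m) / (real m * real n))"
        proof (rule add_mono)
          show "norm ((A n - A m) / of_nat n) \<le> (real n - real m) / real n"
            using AA[OF that(2)] by (simp add: norm_divide divide_right_mono)
          have nn: "(real n - real m) / (real m * real n) \<ge> 0" using that by simp
          show "norm (A m * of_real ((real n - real m) / (real m * real n))) \<le> real m * ((real n - real m) / (real m * real n))"
            unfolding norm_mult norm_of_real abs_of_nonneg[OF nn] using An[of m] nn by (rule mult_right_mono)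
        qed
        also have "\<dots> = 2 * (real n - real m) / real n" using pos by (simp add: field_simps)
        finally show ?thesis .
      qed
      have "s \<noteq> 0" if "Re s \<ge> 1" for s using that by auto
      then show "continuous_on {s. Re s \<ge> 1} (\<lambda>s. (F s + E s) / s)" by (intro continuous_intros Fc Ec) auto
      fix s assume s: "Re s > 1"
      then have s0: "s \<noteq> 0" by auto
      have 1: "(\<lambda>n. A n * (of_nat n powr (-s) - of_nat (Suc n) powr (-s))) sums dirichlet_sum a s"
        unfolding A_def by (rule dirichlet_abel_summation[OF a1 s])
      have 2: "(\<lambda>n. A n * (of_nat (Suc n) powr (-s) - of_nat n powr (-s) + s * of_nat n powr (-s - 1))) sums E s"
        unfolding E_def by (rule summable_sums, rule summable_norm_cancel, rule holomorphic_second_difference(2)[OF An1]) (use s in auto)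
      have 3: "(\<lambda>n. b n * of_nat n powr (-s)) sums ((F s + E s) / s)"
      proof -
        have "(\<lambda>n. (A n * (of_nat n powr (-s) - of_nat (Suc n) powr (-s)) + A n * (of_nat (Suc n) powr (-s) - of_nat n powr (-s) + s * of_nat n powr (-s - 1))) / s)
            sums ((dirichlet_sum a s + E s) / s)"
          by (intro sums_divide sums_add 1 2)
        moreover have "(A n * (of_nat n powr (-s) - of_nat (Suc n) powr (-s)) + A n * (of_nat (Suc n) powr (-s) - of_nat n powr (-s) + s * of_nat n powr (-s - 1))) / s
            = b n * of_nat n powr (-s)" for n
        proof (cases "n = 0")
          case False
          have "of_nat n powr (-s - 1) = of_nat n powr (-s) / (of_nat n :: complex)"
            using False by (simp add: powr_diff powr_to_1)
          then show ?thesis using s0 False by (simp add: b_def field_simps)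
        qed (simp add: A_def)
        ultimately show ?thesis using Feq[OF s] by simp
      qed
      then show "(F s + E s) / s = dirichlet_sum b s" unfolding dirichlet_sum_def by (rule sums_unique)
    qed
  qed
  then show ?thesis unfolding b_def A_def a_def .
qed

section \<open>The Moebius function against periodic sequences\<close>

definition moebius_null :: "(nat \<Rightarrow> complex) \<Rightarrow> bool" where
  "moebius_null f \<longleftrightarrow> (\<lambda>N. 1 / of_nat N * (\<Sum>n=1..N. of_int (moebius_mu n) * f n)) \<longlonglongrightarrow> 0"

lemma moebius_null_zero: "moebius_null (\<lambda>_. 0)"
  by (simp add: moebius_null_def)

lemma moebius_null_add:
  assumes "moebius_null f" "moebius_null g"
  shows "moebius_null (\<lambda>n. f n + g n)"
proof -
  have "(\<lambda>N. 1 / of_nat N * (\<Sum>n=1..N. of_int (moebius_mu n) * f n) + 1 / of_nat N * (\<Sum>n=1..N. of_int (moebius_mu n) * g n)) \<longlonglongrightarrow> 0 + 0"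
    using assms unfolding moebius_null_def by (rule tendsto_add)
  then show ?thesis unfolding moebius_null_def by (simp add: sum.distrib distrib_left)
qed

lemma moebius_null_cmult:
  assumes "moebius_null f"
  shows "moebius_null (\<lambda>n. c * f n)"
proof -
  have "(\<lambda>N. c * (1 / of_nat N * (\<Sum>n=1..N. of_int (moebius_mu n) * f n))) \<longlonglongrightarrow> c * 0"
    using assms unfolding moebius_null_def by (intro tendsto_mult tendsto_const)
  moreover have "c * (1 / of_nat N * (\<Sum>n=1..N. of_int (moebius_mu n) * f n)) = 1 / of_nat N * (\<Sum>n=1..N. of_int (moebius_mu n) * (c * f n))" for N
    by (simp add: sum_distrib_left mult_ac)
  ultimately show ?thesis unfolding moebius_null_def by (simp only: mult_zero_right)
qed

lemma moebius_null_sum: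
  assumes "\<And>k. k \<in> S \<Longrightarrow> moebius_null (f k)"
  shows "moebius_null (\<lambda>n. \<Sum>k\<in>S. f k n)"
  using assms
  by (induction S rule: infinite_finite_induct) (auto intro: moebius_null_zero moebius_null_add)

lemma moebius_mu_coprime_mult:
  assumes "coprime a b"
  shows "moebius_mu (a * b) = moebius_mu a * moebius_mu b"
proof (cases "a = 0 \<or> b = 0")
  case True
  then show ?thesis by (auto simp: moebius_mu_def)
next
  case False
  have sq: "squarefree (a * b) \<longleftrightarrow> squarefree a \<and> squarefree b"
    using assms squarefree_mult_coprime squarefree_multD by blast
  have "prime_factors a \<inter> prime_factors b = {}"
  proof (rule ccontr)
    assume "prime_factors a \<inter> prime_factors b \<noteq> {}"
    then obtain p where "prime p" "p dvd a" "p dvd b" by (auto simp: in_prime_factors_iff)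
    then show False using assms by (meson coprime_common_divisor not_prime_unit)
  qed
  then have "card (prime_factors (a * b)) = card (prime_factors a) + card (prime_factors b)"
    using False by (simp add: prime_factors_product card_Un_disjoint)
  then show ?thesis unfolding moebius_mu_def sq by (simp add: power_add)
qed

lemma roots_of_unity_sum:
  assumes j: "j < (m::nat)"
  shows "(\<Sum>k<m. exp (2 * of_real pi * \<i> * of_nat j / of_nat m) ^ k) = (if j = 0 then of_nat m else (0::complex))"
proof (cases "j = 0")
  case False
  let ?z = "exp (2 * of_real pi * \<i> * of_nat j / of_nat m) :: complex"
  have z1: "?z \<noteq> 1" using complex_root_unity_eq_1[of m j] j False by (auto dest: dvd_imp_le)
  have "?z ^ m = 1" using j by (intro complex_root_unity) auto
  then show ?thesis using False z1 by (simp add: sum_gp_strict)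
qed simp

text \<open>Simultaneous diagonalisation of the dilations \<open>F \<mapsto> F(g\<cdot>)\<close>, \<open>g\<close> coprime to \<open>M\<close>, one \<open>g\<close> at a time.\<close>
lemma periodic_eigen_induct:
  fixes P :: "(nat \<Rightarrow> complex) \<Rightarrow> bool"
  assumes M: "M > 0"
    and sum: "\<And>m F. (\<And>k. k < m \<Longrightarrow> P (F k)) \<Longrightarrow> P (\<lambda>n. \<Sum>k<(m::nat). F k n)"
    and base: "\<And>F. (\<And>n. F (n + M) = F n) \<Longrightarrow> (\<And>g. g < M \<Longrightarrow> coprime g M \<Longrightarrow> \<exists>\<omega>. \<forall>n. F (g * n) = \<omega> * F n) \<Longrightarrow> P F"
    and per: "\<And>n. F (n + M) = F n"
  shows "P F"
proof -
  define Cop where "Cop = {g. g < M \<and> coprime g M}"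
  have finC: "finite Cop" unfolding Cop_def by simp
  have claim: "P F" if "finite S" "\<And>n. F (n + M) = F n" "S \<subseteq> Cop" "\<And>g. g \<in> Cop - S \<Longrightarrow> \<exists>\<omega>. \<forall>n. F (g * n) = \<omega> * F n" for S F
    using that
  proof (induction S arbitrary: F rule: finite_induct)
    case empty
    then show ?case by (intro base) (auto simp: Cop_def)
  next
    case (insert g S)
    have g: "coprime g M" using insert.prems(2) by (auto simp: Cop_def)
    define m where "m = totient M"
    have m: "m > 0" using M by (simp add: m_def)
    define z where "z = (exp (2 * of_real pi * \<i> * of_nat 1 / of_nat m) :: complex)"
    have z_pow: "exp (2 * of_real pi * \<i> * of_nat j / of_nat m) = z ^ j" for j
      unfolding z_def exp_of_nat_mult[symmetric] by (simp add: field_simps)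
    have zm: "z ^ m = 1" unfolding z_def using m by (intro complex_root_unity) auto
    have z0: "z \<noteq> 0" unfolding z_def by simp
    have zsum: "(\<Sum>k<m. z ^ (j * k)) = (if j = 0 then of_nat m else 0)" if "j < m" for j
      using roots_of_unity_sum[OF that] unfolding z_pow power_mult .
    \<comment> \<open>The projection to the eigenvalue z^(-k) of the dilation by g. It commutes with
      the other dilations, so the eigenvalue equations already available persist.\<close>
    define Fk where "Fk = (\<lambda>k n. 1 / of_nat m * (\<Sum>j<m. z ^ (j * k) * F (g ^ j * n)))"
    have gm: "F (g ^ m * n) = F n" for n
    proof (rule periodic_cong[of F M, OF insert.prems(1)])
      have "[g ^ m = 1] (mod M)" unfolding m_def by (rule euler_theorem[OF g])
      then have "[g ^ m * n = 1 * n] (mod M)" by (rule cong_scalar_right)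
      then show "[g ^ m * n = n] (mod M)" by simp
    qed
    have "F = (\<lambda>n. \<Sum>k<m. Fk k n)"
    proof
      fix n
      have "(\<Sum>k<m. Fk k n) = 1 / of_nat m * (\<Sum>j<m. (\<Sum>k<m. z ^ (j * k)) * F (g ^ j * n))"
        unfolding Fk_def sum_distrib_left[symmetric] by (subst sum.swap) (simp add: sum_distrib_right)
      also have "\<dots> = 1 / of_nat m * (\<Sum>j<m. (if j = 0 then of_nat m else 0) * F (g ^ j * n))"
        by (simp add: zsum)
      also have "\<dots> = 1 / of_nat m * (\<Sum>j\<in>{0}. of_nat m * F (g ^ j * n))"
        using m by (intro arg_cong2[where f = "(*)"] refl sum.mono_neutral_cong_right) auto
      also have "\<dots> = F n" using m by simp
      finally show "F n = (\<Sum>k<m. Fk k n)" ..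
    qed
    moreover have "P (\<lambda>n. \<Sum>k<m. Fk k n)"
    proof (rule sum)
      fix k assume "k < m"
      show "P (Fk k)"
      proof (rule insert.IH)
        show "Fk k (n + M) = Fk k n" for n
        proof -
          have "F (g ^ j * (n + M)) = F (g ^ j * n)" for j
            by (rule periodic_cong[of F M, OF insert.prems(1)]) (simp add: cong_def distrib_left)
          then show ?thesis unfolding Fk_def by simp
        qed
        show "S \<subseteq> Cop" using insert.prems(2) by auto
        fix h assume h: "h \<in> Cop - S"
        show "\<exists>\<omega>. \<forall>n. Fk k (h * n) = \<omega> * Fk k n"
        proof (cases "h = g")
          case False
          then obtain \<omega> where \<omega>: "\<And>n. F (h * n) = \<omega> * F n" using insert.prems(3)[of h] h by auto
          have "Fk k (h * n) = \<omega> * Fk k n" for n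
          proof -
            have "F (g ^ j * (h * n)) = \<omega> * F (g ^ j * n)" for j
              using \<omega>[of "g ^ j * n"] by (simp add: mult_ac)
            then show ?thesis unfolding Fk_def by (simp add: sum_distrib_left mult_ac)
          qed
          then show ?thesis by blast
        next
          case True
          have eq: "z ^ k * Fk k (g * n) = Fk k n" for n
          proof -
            define u where "u = (\<lambda>j. z ^ (j * k) * F (g ^ j * n))"
            have um: "u m = u 0" unfolding u_def using gm zm by (simp add: power_mult)
            have "z ^ k * Fk k (g * n) = 1 / of_nat m * (\<Sum>j<m. u (Suc j))"
              unfolding Fk_def u_def sum_distrib_left
              by (intro sum.cong refl) (simp add: power_add mult_ac)
            also have "(\<Sum>j<m. u (Suc j)) = (\<Sum>j<m. u j)"
              using sum.lessThan_Suc_shift[of u m] um by simp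
            finally show ?thesis unfolding Fk_def u_def .
          qed
          have "Fk k (g * n) = (1 / z ^ k) * Fk k n" for n
          proof -
            have "(1 / z ^ k) * (z ^ k * Fk k (g * n)) = Fk k (g * n)" using z0 by simp
            then show ?thesis using eq[of n] by (simp only:)
          qed
          then show ?thesis using True by blast
        qed
      qed
    qed
    ultimately show ?case by simp
  qed
  show ?thesis by (rule claim[of Cop F, OF finC per]) auto
qed

text \<open>The eigenvalues are multiplicative in g and form a Dirichlet character. Sorting n by d =
  gcd n M and writing n = d m, only m coprime to M count, and there mu(d m) F(d m) = mu(d) F(d) *
  mu(m) \<psi>(m).\<close>

lemma moebius_null_eigen:
  fixes F :: "nat \<Rightarrow> complex"
  assumes M: "M > 0" and per: "\<And>n. F (n + M) = F n"
    and eig: "\<And>g. g < M \<Longrightarrow> coprime g M \<Longrightarrow> \<exists>\<omega>. \<forall>n. F (g * n) = \<omega> * F n"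
  shows "moebius_null F"
proof (cases "\<forall>n. F n = 0")
  case True
  then have "F = (\<lambda>_. 0)" by auto
  then show ?thesis using moebius_null_zero by simp
next
  case False
  then obtain n0 where n0: "F n0 \<noteq> 0" by auto
  have eig': "\<exists>\<omega>. \<forall>n. F (g * n) = \<omega> * F n" if "coprime g M" for g
  proof -
    have "coprime (g mod M) M" using that M by simp
    then obtain \<omega> where \<omega>: "\<And>n. F ((g mod M) * n) = \<omega> * F n" using eig[of "g mod M"] M by auto
    have "F (g * n) = F ((g mod M) * n)" for n
      by (rule periodic_cong[of F M, OF per]) (simp add: cong_def mod_mult_left_eq)
    then show ?thesis using \<omega> by auto
  qed
  define \<psi> where "\<psi> = (\<lambda>g. if coprime g M then F (g * n0) / F n0 else 0)"
  have \<psi>F: "F (g * n) = \<psi> g * F n" if g: "coprime g M" for g n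
  proof -
    obtain \<omega> where \<omega>: "\<And>n. F (g * n) = \<omega> * F n" using eig'[OF g] by auto
    then have "\<psi> g = \<omega>" using g n0 by (simp add: \<psi>_def)
    then show ?thesis using \<omega> by simp
  qed
  have nz: "\<psi> g \<noteq> 0" if g: "coprime g M" for g
  proof
    assume z: "\<psi> g = 0"
    have "[g ^ totient M * n0 = 1 * n0] (mod M)" by (rule cong_scalar_right[OF euler_theorem[OF g]])
    then have "F (g ^ totient M * n0) = F n0" using periodic_cong[of F M, OF per] by simp
    moreover have "totient M > 0" using M by simp
    then obtain k where "totient M = Suc k" using gr0_implies_Suc by blast
    then have "F (g ^ totient M * n0) = \<psi> g * F (g ^ k * n0)" using \<psi>F[OF g, of "g ^ k * n0"] by (simp add: mult_ac)
    ultimately show False using z n0 by simp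
  qed
  have \<psi>: "dirichlet_character M \<psi>"
    unfolding dirichlet_character_def
  proof (intro conjI allI)
    show "M > 0" by (rule M)
    fix m n
    show "\<psi> (m * n) = \<psi> m * \<psi> n"
    proof (cases "coprime m M \<and> coprime n M")
      case True
      then have "F (m * n * n0) = \<psi> m * (\<psi> n * F n0)" using \<psi>F[of m "n * n0"] \<psi>F[of n n0] by (simp add: mult_ac)
      then show ?thesis using True n0 by (simp add: \<psi>_def[of] coprime_mult_left_iff)
    next
      case False
      then show ?thesis by (auto simp: \<psi>_def coprime_mult_left_iff)
    qed
    have "coprime (n + M) M \<longleftrightarrow> coprime n M"
      by (metis add.commute coprime_iff_gcd_eq_1 gcd_add2 gcd.commute)
    moreover have "F ((n + M) * n0) = F (n * n0)"
      by (rule periodic_cong[of F M, OF per]) (simp add: cong_def distrib_right)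
    ultimately show "\<psi> (n + M) = \<psi> n" by (simp add: \<psi>_def)
    show "\<psi> n \<noteq> 0 \<longleftrightarrow> coprime n M" using nz[of n] by (auto simp: \<psi>_def split: if_splits)
  qed
  define S where "S = (\<lambda>K. \<Sum>n=1..K. of_int (moebius_mu n) * \<psi> n)"
  define c where "c = (\<lambda>d. of_int (moebius_mu d) * F d)"
  have S0: "(\<lambda>N. 1 / of_nat N * S N) \<longlonglongrightarrow> 0" unfolding S_def by (rule moebius_character_mean[OF \<psi>])
  have finD: "finite {d. d dvd M}" using M by simp
  have main: "(\<Sum>n=1..N. of_int (moebius_mu n) * F n) = (\<Sum>d | d dvd M. c d * S (N div d))" for N
  proof -
    have "(\<Sum>n=1..N. of_int (moebius_mu n) * F n) = (\<Sum>d | d dvd M. \<Sum>n | n \<in> {1..N} \<and> gcd n M = d. of_int (moebius_mu n) * F n)"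
      by (rule sum.group[symmetric]) (use finD in auto)
    also have "\<dots> = (\<Sum>d | d dvd M. c d * S (N div d))"
    proof (rule sum.cong[OF refl])
      fix d assume "d \<in> {d. d dvd M}"
      then have d: "d dvd M" by simp
      have d0: "d > 0" using d M by (auto intro: Nat.gr0I)
      let ?A = "{n. n \<in> {1..N} \<and> gcd n M = d}"
      let ?B = "{n \<in> {1..N div d}. coprime n M}"
      have sub: "(\<lambda>m. d * m) ` ?B \<subseteq> ?A"
      proof
        fix n assume "n \<in> (\<lambda>m. d * m) ` ?B"
        then obtain m where m: "n = d * m" "m \<in> {1..N div d}" "coprime m M" by auto
        have "d * m \<le> N" using m(2) d0 by (simp add: less_eq_div_iff_mult_less_eq mult.commute)
        moreover have "gcd (d * m) M = d" using m(3) d by (simp add: gcd_mult_left_right_cancel coprime_commute gcd_proj1_iff)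
        ultimately show "n \<in> ?A" using m d0 by simp
      qed
      \<comment> \<open>A prime dividing both m and M divides n and M, hence also d; so its square
        divides n.\<close>
      have zero: "of_int (moebius_mu n) * F n = 0" if n: "n \<in> ?A - (\<lambda>m. d * m) ` ?B" for n
      proof -
        have nA: "n \<in> {1..N}" "gcd n M = d" using n by auto
        then obtain m where m: "n = d * m" by (metis gcd_dvd1 dvdE)
        have "m \<in> {1..N div d}" using nA m d0 by (auto simp: less_eq_div_iff_mult_less_eq mult.commute intro: Suc_leI Nat.gr0I)
        then have "\<not> coprime m M" using n m by auto
        then obtain p where p: "prime p" "p dvd m" "p dvd M"
          by (metis coprime_iff_gcd_eq_1 gcd_dvd1 gcd_dvd2 dvd_trans prime_factor_nat)
        have "p dvd n" using p m by simp
        then have "p dvd d" using p nA(2) by (metis gcd_greatest)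
        then have "p\<^sup>2 dvd n" unfolding m power2_eq_square using p by (intro mult_dvd_mono) auto
        then have "\<not> squarefree n" using p(1) by (meson not_prime_unit squarefreeD)
        then show ?thesis by (simp add: moebius_mu_def)
      qed
      have "(\<Sum>n\<in>?A. of_int (moebius_mu n) * F n) = (\<Sum>n\<in>(\<lambda>m. d * m) ` ?B. of_int (moebius_mu n) * F n)"
        by (rule sum.mono_neutral_right) (use sub zero in auto)
      also have "\<dots> = (\<Sum>m\<in>?B. of_int (moebius_mu (d * m)) * F (d * m))"
        using d0 by (subst sum.reindex) (auto simp: inj_on_def)
      also have "\<dots> = (\<Sum>m\<in>?B. c d * (of_int (moebius_mu m) * \<psi> m))"
      proof (rule sum.cong[OF refl])
        fix m assume "m \<in> ?B"
        then have m: "coprime m M" by simp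
        have "coprime d m" using m d by (meson coprime_commute coprime_divisors dvd_refl)
        then have "moebius_mu (d * m) = moebius_mu d * moebius_mu m" by (rule moebius_mu_coprime_mult)
        moreover have "F (d * m) = \<psi> m * F d" using \<psi>F[OF m, of d] by (simp add: mult.commute)
        ultimately show "of_int (moebius_mu (d * m)) * F (d * m) = c d * (of_int (moebius_mu m) * \<psi> m)"
          by (simp add: c_def)
      qed
      also have "\<dots> = c d * (\<Sum>m\<in>?B. of_int (moebius_mu m) * \<psi> m)" by (simp only: sum_distrib_left)
      also have "(\<Sum>m\<in>?B. of_int (moebius_mu m) * \<psi> m) = S (N div d)"
        unfolding S_def by (rule sum.mono_neutral_left) (auto simp: \<psi>_def)
      finally show "(\<Sum>n\<in>?A. of_int (moebius_mu n) * F n) = c d * S (N div d)" .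
    qed
    finally show ?thesis .
  qed
  have "(\<lambda>N. \<Sum>d | d dvd M. c d * (1 / of_nat N * S (N div d))) \<longlonglongrightarrow> (\<Sum>d | d dvd M. c d * 0)"
  proof (intro tendsto_sum tendsto_mult tendsto_const)
    fix d
    show "(\<lambda>N. 1 / of_nat N * S (N div d)) \<longlonglongrightarrow> 0"
    proof (rule tendstoI)
      fix e :: real assume e: "e > 0"
      have "eventually (\<lambda>N. norm (S (N div d)) \<le> (e / 2) * real N) sequentially"
        by (rule average_div_small[OF S0]) (use e in simp)
      moreover have "eventually (\<lambda>N::nat. N > 0) sequentially" by (rule eventually_gt_at_top)
      ultimately show "eventually (\<lambda>N. dist (1 / of_nat N * S (N div d)) 0 < e) sequentially"
      proof eventually_elim
        case (elim N)
        have "norm (S (N div d)) / real N \<le> e / 2" using elim by (simp add: divide_le_eq)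
        then have "norm (S (N div d)) / real N < e" using e by linarith
        then show ?case by (simp add: norm_mult norm_divide)
      qed
    qed
  qed
  then show ?thesis unfolding moebius_null_def main by (simp add: sum_distrib_left mult_ac)
qed

theorem moebius_null_periodic:
  fixes F :: "nat \<Rightarrow> complex"
  assumes "M > 0" "\<And>n. F (n + M) = F n"
  shows "moebius_null F"
proof (rule periodic_eigen_induct[of M moebius_null])
  show "moebius_null (\<lambda>n. \<Sum>k<m. G k n)" if "\<And>k. k < m \<Longrightarrow> moebius_null (G k)" for m :: nat and G
    by (rule moebius_null_sum) (use that in auto)
  show "moebius_null G" if "\<And>n. G (n + M) = G n" "\<And>g. g < M \<Longrightarrow> coprime g M \<Longrightarrow> \<exists>\<omega>. \<forall>n. G (g * n) = \<omega> * G n" for G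
    by (rule moebius_null_eigen[OF assms(1) that])
qed (use assms in auto)

section \<open>Correlations along dilations\<close>

text \<open>The arguments are integers, although only y >= 0 is averaged, so that shifts in either
  direction can be written.\<close>

definition avg :: "nat \<Rightarrow> (int \<Rightarrow> complex) \<Rightarrow> complex" where
  "avg N g = (\<Sum>y<N. g (int y)) / of_nat N"

lemma avg_diff: "avg N (\<lambda>y. f y - g y) = avg N f - avg N g"
  by (simp add: avg_def sum_subtractf diff_divide_distrib)

lemma avg_cmult: "avg N (\<lambda>y. c * f y) = c * avg N f"
  by (simp add: avg_def sum_distrib_left)

lemma avg_sum: "avg N (\<lambda>y. \<Sum>s\<in>S. f s y) = (\<Sum>s\<in>S. avg N (f s))"
  unfolding avg_def by (subst sum.swap) (simp add: sum_divide_distrib)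

lemma avg_cnj: "avg N (\<lambda>y. cnj (f y)) = cnj (avg N f)"
  by (simp add: avg_def)

lemma norm_avg_le:
  assumes "\<And>y. norm (f y) \<le> B"
  shows "norm (avg N f) \<le> B"
proof (cases "N = 0")
  case True
  then show ?thesis using order_trans[OF norm_ge_zero assms[of 0]] by (simp add: avg_def)
next
  case False
  have "norm (\<Sum>y<N. f (int y)) \<le> (\<Sum>y<N. B)" by (rule sum_norm_le) (use assms in auto)
  then show ?thesis using False by (simp add: avg_def norm_divide divide_le_eq mult.commute)
qed

lemma norm_triangle_sub_through: "norm (a - c) \<le> norm (a - b) + norm (b - c :: complex)"
  using norm_triangle_ineq[of "a - b" "b - c"] by simp

lemma sum_shift_bound:
  fixes g :: "int \<Rightarrow> complex"
  assumes B: "\<And>y. norm (g y) \<le> B"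
  shows "norm ((\<Sum>y<N. g (int y + int a)) - (\<Sum>y<N. g (int y))) \<le> 2 * B * real a"
proof (induction a)
  case (Suc a)
  have "(\<Sum>y<N. g (int y + int (Suc a))) - (\<Sum>y<N. g (int y + int a)) = g (int N + int a) - g (int a)"
    by (induction N) (simp_all add: algebra_simps)
  then have 1: "norm ((\<Sum>y<N. g (int y + int (Suc a))) - (\<Sum>y<N. g (int y + int a))) \<le> 2 * B"
    using norm_triangle_ineq4[of "g (int N + int a)" "g (int a)"] B[of "int N + int a"] B[of "int a"] by simp
  have "norm ((\<Sum>y<N. g (int y + int (Suc a))) - (\<Sum>y<N. g (int y)))
      \<le> norm ((\<Sum>y<N. g (int y + int (Suc a))) - (\<Sum>y<N. g (int y + int a))) + norm ((\<Sum>y<N. g (int y + int a)) - (\<Sum>y<N. g (int y)))"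
    by (rule norm_triangle_sub_through)
  also have "\<dots> \<le> 2 * B + 2 * B * real a" by (rule add_mono[OF 1 Suc])
  finally show ?case by (simp add: algebra_simps)
qed simp

lemma avg_shift_bound:
  fixes g :: "int \<Rightarrow> complex"
  assumes B: "\<And>y. norm (g y) \<le> B"
  shows "norm (avg N (\<lambda>y. g (y + a)) - avg N g) \<le> 2 * B * real_of_int \<bar>a\<bar> / real N"
proof -
  have "norm ((\<Sum>y<N. g (int y + a)) - (\<Sum>y<N. g (int y))) \<le> 2 * B * real_of_int \<bar>a\<bar>"
  proof (cases "a \<ge> 0")
    case True
    then show ?thesis using sum_shift_bound[where g = g and N = N and a = "nat a", OF B] by simp
  next
    case False
    have "norm ((\<Sum>y<N. (\<lambda>y. g (y + a)) (int y + int (nat (-a)))) - (\<Sum>y<N. (\<lambda>y. g (y + a)) (int y))) \<le> 2 * B * real (nat (- a))"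
      by (rule sum_shift_bound) (rule B)
    then show ?thesis using False by (simp add: norm_minus_commute)
  qed
  then show ?thesis
    by (simp add: avg_def diff_divide_distrib[symmetric] norm_divide divide_right_mono)
qed

lemma avg_shift_tendsto:
  fixes g :: "int \<Rightarrow> complex"
  assumes B: "\<And>y. norm (g y) \<le> B" and N: "filterlim N at_top sequentially"
    and lim: "(\<lambda>k. avg (N k) g) \<longlonglongrightarrow> l"
  shows "(\<lambda>k. avg (N k) (\<lambda>y. g (y + a))) \<longlonglongrightarrow> l"
proof -
  have "(\<lambda>k. avg (N k) (\<lambda>y. g (y + a)) - avg (N k) g) \<longlonglongrightarrow> 0"
  proof (rule Lim_null_comparison)
    show "\<forall>\<^sub>F k in sequentially. norm (avg (N k) (\<lambda>y. g (y + a)) - avg (N k) g) \<le> 2 * B * real_of_int \<bar>a\<bar> / real (N k)"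
      using avg_shift_bound[of g B, OF B] by simp
    have "filterlim (\<lambda>k. real (N k)) at_top sequentially"
      by (rule filterlim_compose[OF filterlim_real_sequentially N])
    then show "(\<lambda>k. 2 * B * real_of_int \<bar>a\<bar> / real (N k)) \<longlonglongrightarrow> 0"
      by (intro tendsto_divide_0[OF tendsto_const] filterlim_at_top_imp_at_infinity)
  qed
  from tendsto_add[OF this lim] show ?thesis by simp
qed

text \<open>Bessel's inequality for asymptotically orthogonal vectors: \<open>z\<close> plays the coefficients \<open>\<langle>u\<^sub>j, v\<rangle>\<close>
  and \<open>\<Gamma>\<close> the Gram matrix of the \<open>u\<^sub>j\<close>.\<close>
lemma bessel_null:
  fixes z :: "nat \<Rightarrow> complex" and \<Gamma> :: "nat \<Rightarrow> nat \<Rightarrow> complex"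
  assumes bess: "\<And>F \<alpha>. finite F \<Longrightarrow> (norm (\<Sum>j\<in>F. \<alpha> j * z j))\<^sup>2 \<le> norm (\<Sum>i\<in>F. \<Sum>j\<in>F. \<alpha> i * cnj (\<alpha> j) * \<Gamma> i j)"
    and lim: "\<And>i. (\<lambda>j. \<Gamma> i j) \<longlonglongrightarrow> 0" and sym: "\<And>i j. norm (\<Gamma> i j) = norm (\<Gamma> j i)" and diag: "\<And>i. norm (\<Gamma> i i) \<le> B"
  shows "z \<longlonglongrightarrow> 0"
proof (rule ccontr)
  assume "\<not> z \<longlonglongrightarrow> 0"
  then obtain e where e: "e > 0" "\<And>n0. \<exists>n\<ge>n0. norm (z n) \<ge> e"
    unfolding LIMSEQ_iff by (auto simp: not_less)
  \<comment> \<open>A greedy choice yields K indices with |z j| >= e and pairwise |\<Gamma> i j| <=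
    e^2 / 2. With aligned phases the inequality becomes K e^2 <= K e^2 / 2 + B, absurd for large
    K.\<close>
  define \<delta> where "\<delta> = e\<^sup>2 / 2"
  have \<delta>: "\<delta> > 0" using e by (simp add: \<delta>_def)
  have ex: "\<exists>F. finite F \<and> card F = K \<and> (\<forall>j\<in>F. norm (z j) \<ge> e) \<and> (\<forall>i\<in>F. \<forall>j\<in>F. i \<noteq> j \<longrightarrow> norm (\<Gamma> i j) \<le> \<delta>)" for K
  proof (induction K)
    case 0
    show ?case by (intro exI[of _ "{}"]) auto
  next
    case (Suc K)
    then obtain F where F: "finite F" "card F = K" "\<And>j. j \<in> F \<Longrightarrow> norm (z j) \<ge> e" "\<And>i j. i \<in> F \<Longrightarrow> j \<in> F \<Longrightarrow> i \<noteq> j \<Longrightarrow> norm (\<Gamma> i j) \<le> \<delta>"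
      by blast
    have "eventually (\<lambda>j. \<forall>i\<in>F. dist (\<Gamma> i j) 0 < \<delta>) sequentially"
      by (intro eventually_ball_finite F(1) ballI tendstoD lim \<delta>)
    then obtain n1 where n1: "\<And>j i. j \<ge> n1 \<Longrightarrow> i \<in> F \<Longrightarrow> norm (\<Gamma> i j) < \<delta>"
      unfolding eventually_sequentially by auto
    obtain j where j: "j \<ge> max n1 (Suc (Max (insert 0 F)))" "norm (z j) \<ge> e" using e(2) by blast
    have "j \<notin> F"
    proof
      assume "j \<in> F"
      then have "j \<le> Max (insert 0 F)" using F(1) by (intro Max_ge) auto
      then show False using j(1) by simp
    qed
    have "norm (\<Gamma> i j) \<le> \<delta> \<and> norm (\<Gamma> j i) \<le> \<delta>" if "i \<in> F" for i
      using n1[of j i] that j(1) sym[of i j] by simp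
    then show ?case using F j(2) \<open>j \<notin> F\<close> by (intro exI[of _ "insert j F"]) auto
  qed
  have B0: "B \<ge> 0" using diag[of 0] norm_ge_zero order_trans by blast
  obtain K :: nat where K: "real K > B / \<delta>" using reals_Archimedean2 by blast
  then have K0: "real K > 0" using B0 \<delta> by (smt (verit) divide_nonneg_pos)
  obtain F where F: "finite F" "card F = K" "\<And>j. j \<in> F \<Longrightarrow> norm (z j) \<ge> e" "\<And>i j. i \<in> F \<Longrightarrow> j \<in> F \<Longrightarrow> i \<noteq> j \<Longrightarrow> norm (\<Gamma> i j) \<le> \<delta>"
    using ex[of K] by blast
  define \<alpha> where "\<alpha> = (\<lambda>j. cnj (sgn (z j)))"
  have n\<alpha>: "norm (\<alpha> j) \<le> 1" for j by (simp add: \<alpha>_def norm_sgn)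
  have az: "\<alpha> j * z j = of_real (norm (z j))" for j
  proof -
    have "cnj (z j) * z j = of_real (norm (z j)) * of_real (norm (z j))"
      by (metis complex_norm_square mult.commute of_real_mult power2_eq_square)
    then show ?thesis by (cases "z j = 0") (simp_all add: \<alpha>_def sgn_div_norm scaleR_conv_of_real field_simps)
  qed
  have "real K * e \<le> (\<Sum>j\<in>F. norm (z j))" using sum_bounded_below[of F e "\<lambda>j. norm (z j)"] F by simp
  also have "\<dots> = norm (\<Sum>j\<in>F. \<alpha> j * z j)"
    unfolding az of_real_sum[symmetric] norm_of_real by (simp add: sum_nonneg)
  finally have "(real K * e)\<^sup>2 \<le> (norm (\<Sum>j\<in>F. \<alpha> j * z j))\<^sup>2" using e(1) by (intro power_mono) auto
  also have "\<dots> \<le> norm (\<Sum>i\<in>F. \<Sum>j\<in>F. \<alpha> i * cnj (\<alpha> j) * \<Gamma> i j)" by (rule bess[OF F(1)])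
  also have "\<dots> \<le> (\<Sum>i\<in>F. \<Sum>j\<in>F. \<delta> + (if i = j then B else 0))"
  proof (rule order_trans[OF norm_sum], rule sum_mono, rule order_trans[OF norm_sum], rule sum_mono)
    fix i j assume ij: "i \<in> F" "j \<in> F"
    have "norm (\<Gamma> i j) \<le> \<delta> + (if i = j then B else 0)"
      using F(4)[OF ij] diag[of i] \<delta> by auto
    moreover have "norm (\<alpha> i) * norm (\<alpha> j) \<le> 1" by (rule mult_le_one) (use n\<alpha> in auto)
    ultimately show "norm (\<alpha> i * cnj (\<alpha> j) * \<Gamma> i j) \<le> \<delta> + (if i = j then B else 0)"
      unfolding norm_mult complex_mod_cnj using mult_right_mono[of "norm (\<alpha> i) * norm (\<alpha> j)" 1 "norm (\<Gamma> i j)"] by simp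
  qed
  also have "\<dots> = real K * (real K * \<delta> + B)"
    using F(1,2) by (simp add: sum.distrib)
  finally have "real K * (real K * e\<^sup>2) \<le> real K * (real K * \<delta> + B)" by (simp add: power2_eq_square mult_ac)
  then have "real K * e\<^sup>2 \<le> real K * \<delta> + B" using K0 by simp
  moreover have "real K * e\<^sup>2 = real K * \<delta> + real K * \<delta>" by (simp add: \<delta>_def)
  moreover have "real K * \<delta> > B" using K \<delta> by (simp add: field_simps)
  ultimately show False by linarith
qed

text \<open>In operator terms, the translates of f by \<kappa> j converge weakly to a combination of
  fixed translates. The hypothesis tests this only against translates of f, the conclusion against
  any bounded v. The differences \<open>u j\<close> have a Gram matrix \<Gamma> whose entries tend
  to 0 in j for each i, so \<open>bessel_null\<close> applies to their correlations with v.\<close>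

lemma weak_limit_transfer:
  fixes f v :: "int \<Rightarrow> complex" and N :: "nat \<Rightarrow> nat" and \<kappa> :: "nat \<Rightarrow> int" and \<sigma> :: "'a \<Rightarrow> int" and p :: "'a \<Rightarrow> real"
  assumes f: "\<And>y. norm (f y) \<le> 1" and v: "\<And>y. norm (v y) \<le> 1"
    and N: "filterlim N at_top sequentially"
    and c: "\<And>t. (\<lambda>k. avg (N k) (\<lambda>y. f (y + t) * cnj (f y))) \<longlonglongrightarrow> c t"
    and V: "\<And>t. (\<lambda>k. avg (N k) (\<lambda>y. f (y + t) * v y)) \<longlonglongrightarrow> V t"
    and S: "finite S"
    and lim: "\<And>t. (\<lambda>j. c (t + \<kappa> j)) \<longlonglongrightarrow> (\<Sum>s\<in>S. of_real (p s) * c (t + \<sigma> s))"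
  shows "(\<lambda>j. V (t + \<kappa> j)) \<longlonglongrightarrow> (\<Sum>s\<in>S. of_real (p s) * V (t + \<sigma> s))"
proof -
  have c2: "(\<lambda>k. avg (N k) (\<lambda>y. f (y + a) * cnj (f (y + b)))) \<longlonglongrightarrow> c (a - b)" for a b
  proof -
    have "(\<lambda>k. avg (N k) (\<lambda>y. (\<lambda>y. f (y + (a - b)) * cnj (f y)) (y + b))) \<longlonglongrightarrow> c (a - b)"
      by (rule avg_shift_tendsto[where B = 1, OF _ N c]) (simp add: norm_mult mult_le_one f)
    then show ?thesis by (simp add: algebra_simps)
  qed
  have csym: "c (- a) = cnj (c a)" for a
  proof -
    have 1: "(\<lambda>k. avg (N k) (\<lambda>y. f (y + 0) * cnj (f (y + a)))) \<longlonglongrightarrow> c (0 - a)" by (rule c2)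
    have 2: "avg M (\<lambda>y. f (y + 0) * cnj (f (y + a))) = cnj (avg M (\<lambda>y. f (y + a) * cnj (f y)))" for M
      unfolding avg_cnj[symmetric] by (simp add: mult.commute)
    have 3: "(\<lambda>k. cnj (avg (N k) (\<lambda>y. f (y + a) * cnj (f y)))) \<longlonglongrightarrow> cnj (c a)"
      by (intro tendsto_cnj c)
    show ?thesis using LIMSEQ_unique[OF 1[unfolded 2] 3] by simp
  qed
  define u where "u = (\<lambda>j y. f (y + (t + \<kappa> j)) - (\<Sum>s\<in>S. of_real (p s) * f (y + (t + \<sigma> s))))"
  define z where "z = (\<lambda>j. V (t + \<kappa> j) - (\<Sum>s\<in>S. of_real (p s) * V (t + \<sigma> s)))"
  define \<Gamma> where "\<Gamma> = (\<lambda>i j. (c (\<kappa> i - \<kappa> j) - (\<Sum>s\<in>S. of_real (p s) * c (\<kappa> i - \<sigma> s)))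
      - (\<Sum>s\<in>S. of_real (p s) * (c (\<sigma> s - \<kappa> j) - (\<Sum>s'\<in>S. of_real (p s') * c (\<sigma> s - \<sigma> s')))))"
  have zlim: "(\<lambda>k. avg (N k) (\<lambda>y. u j y * v y)) \<longlonglongrightarrow> z j" for j
  proof -
    have "(\<lambda>k. avg (N k) (\<lambda>y. f (y + (t + \<kappa> j)) * v y) - (\<Sum>s\<in>S. of_real (p s) * avg (N k) (\<lambda>y. f (y + (t + \<sigma> s)) * v y))) \<longlonglongrightarrow> z j"
      unfolding z_def by (intro tendsto_intros V)
    moreover have "avg M (\<lambda>y. u j y * v y) = avg M (\<lambda>y. f (y + (t + \<kappa> j)) * v y) - (\<Sum>s\<in>S. of_real (p s) * avg M (\<lambda>y. f (y + (t + \<sigma> s)) * v y))" for M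
      unfolding avg_cmult[symmetric] avg_sum[symmetric] avg_diff[symmetric]
      by (simp add: u_def left_diff_distrib sum_distrib_right mult.assoc)
    ultimately show ?thesis by simp
  qed
  have \<Gamma>lim: "(\<lambda>k. avg (N k) (\<lambda>y. u i y * cnj (u j y))) \<longlonglongrightarrow> \<Gamma> i j" for i j
  proof -
    let ?A = "\<lambda>M a b. avg M (\<lambda>y. f (y + (t + a)) * cnj (f (y + (t + b))))"
    have A: "(\<lambda>k. ?A (N k) a b) \<longlonglongrightarrow> c (a - b)" for a b
      using c2[of "t + a" "t + b"] by simp
    have "(\<lambda>k. (?A (N k) (\<kappa> i) (\<kappa> j) - (\<Sum>s\<in>S. of_real (p s) * ?A (N k) (\<kappa> i) (\<sigma> s)))
      - (\<Sum>s\<in>S. of_real (p s) * (?A (N k) (\<sigma> s) (\<kappa> j) - (\<Sum>s'\<in>S. of_real (p s') * ?A (N k) (\<sigma> s) (\<sigma> s'))))) \<longlonglongrightarrow> \<Gamma> i j"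
      unfolding \<Gamma>_def by (intro tendsto_intros A)
    moreover have "avg M (\<lambda>y. u i y * cnj (u j y)) = (?A M (\<kappa> i) (\<kappa> j) - (\<Sum>s\<in>S. of_real (p s) * ?A M (\<kappa> i) (\<sigma> s)))
      - (\<Sum>s\<in>S. of_real (p s) * (?A M (\<sigma> s) (\<kappa> j) - (\<Sum>s'\<in>S. of_real (p s') * ?A M (\<sigma> s) (\<sigma> s'))))" for M
      unfolding avg_cmult[symmetric] avg_sum[symmetric] avg_diff[symmetric]
      by (rule arg_cong[where f = "avg M"], rule ext)
        (simp add: u_def left_diff_distrib right_diff_distrib sum_distrib_right sum_distrib_left sum_subtractf mult_ac,
         subst sum.swap, simp add: mult_ac)
    ultimately show ?thesis by simp
  qed
  have "z \<longlonglongrightarrow> 0"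
  proof (rule bessel_null[where \<Gamma> = \<Gamma> and B = "(1 + (\<Sum>s\<in>S. \<bar>p s\<bar>))\<^sup>2"])
    fix F :: "nat set" and \<alpha> :: "nat \<Rightarrow> complex" assume F: "finite F"
    define w where "w = (\<lambda>y. \<Sum>j\<in>F. \<alpha> j * u j y)"
    have "(\<lambda>k. \<Sum>j\<in>F. \<alpha> j * avg (N k) (\<lambda>y. u j y * v y)) \<longlonglongrightarrow> (\<Sum>j\<in>F. \<alpha> j * z j)"
      by (intro tendsto_intros zlim)
    moreover have e1: "(\<Sum>j\<in>F. \<alpha> j * avg M (\<lambda>y. u j y * v y)) = avg M (\<lambda>y. w y * v y)" for M
      unfolding avg_cmult[symmetric] avg_sum[symmetric] by (simp add: w_def sum_distrib_right mult.assoc)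
    ultimately have l1: "(\<lambda>k. (norm (avg (N k) (\<lambda>y. w y * v y)))\<^sup>2) \<longlonglongrightarrow> (norm (\<Sum>j\<in>F. \<alpha> j * z j))\<^sup>2"
      by (intro tendsto_power tendsto_norm) simp
    have "(\<lambda>k. \<Sum>i\<in>F. \<Sum>j\<in>F. \<alpha> i * cnj (\<alpha> j) * avg (N k) (\<lambda>y. u i y * cnj (u j y))) \<longlonglongrightarrow> (\<Sum>i\<in>F. \<Sum>j\<in>F. \<alpha> i * cnj (\<alpha> j) * \<Gamma> i j)"
      by (intro tendsto_intros \<Gamma>lim)
    moreover have "(\<Sum>i\<in>F. \<Sum>j\<in>F. \<alpha> i * cnj (\<alpha> j) * avg M (\<lambda>y. u i y * cnj (u j y))) = avg M (\<lambda>y. w y * cnj (w y))" for M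
      unfolding avg_cmult[symmetric] avg_sum[symmetric]
      by (simp add: w_def sum_product mult_ac)
    ultimately have l2: "(\<lambda>k. norm (avg (N k) (\<lambda>y. w y * cnj (w y)))) \<longlonglongrightarrow> norm (\<Sum>i\<in>F. \<Sum>j\<in>F. \<alpha> i * cnj (\<alpha> j) * \<Gamma> i j)"
      by (intro tendsto_norm) simp
    have cs: "(norm (avg M (\<lambda>y. w y * v y)))\<^sup>2 \<le> norm (avg M (\<lambda>y. w y * cnj (w y)))" for M
    proof (cases "M = 0")
      case False
      have "norm (\<Sum>y<M. v (int y) * w (int y)) \<le> sqrt (real (card {..<M}) * (\<Sum>y<M. (norm (w (int y)))\<^sup>2))"
        by (rule norm_sum_le_sqrt) (rule v)
      then have "(norm (\<Sum>y<M. v (int y) * w (int y)))\<^sup>2 \<le> real M * (\<Sum>y<M. (norm (w (int y)))\<^sup>2)"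
        using power_mono[of "norm (\<Sum>y<M. v (int y) * w (int y))" _ 2] by (fastforce simp: sum_nonneg)
      then have "(norm (\<Sum>y<M. w (int y) * v (int y)))\<^sup>2 / (real M)\<^sup>2 \<le> (real M * (\<Sum>y<M. (norm (w (int y)))\<^sup>2)) / (real M)\<^sup>2"
        by (intro divide_right_mono) (simp_all add: mult.commute)
      also have "\<dots> = (\<Sum>y<M. (norm (w (int y)))\<^sup>2) / real M" using False by (simp add: power2_eq_square)
      also have "\<dots> = norm (avg M (\<lambda>y. w y * cnj (w y)))"
      proof -
        have "(\<Sum>y<M. w (int y) * cnj (w (int y))) = of_real (\<Sum>y<M. (norm (w (int y)))\<^sup>2)"
          by (simp only: of_real_sum complex_norm_square)
        then have "norm (\<Sum>y<M. w (int y) * cnj (w (int y))) = (\<Sum>y<M. (norm (w (int y)))\<^sup>2)"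
          by (simp only: norm_of_real) (simp add: sum_nonneg)
        then show ?thesis by (simp add: avg_def norm_divide)
      qed
      finally show ?thesis by (simp add: avg_def norm_divide power_divide)
    qed (simp add: avg_def)
    show "(norm (\<Sum>j\<in>F. \<alpha> j * z j))\<^sup>2 \<le> norm (\<Sum>i\<in>F. \<Sum>j\<in>F. \<alpha> i * cnj (\<alpha> j) * \<Gamma> i j)"
      by (rule tendsto_le[OF _ l2 l1]) (use cs in auto)
  next
    fix i
    \<comment> \<open>Here \<kappa> j occurs with a minus sign. The symmetry c (- a) = cnj (c a)
      reduces this to the hypothesis, after which each bracket cancels.\<close>
    have "(\<lambda>j. \<Gamma> i j) \<longlonglongrightarrow> (cnj (\<Sum>s\<in>S. of_real (p s) * c (- \<kappa> i + \<sigma> s)) - (\<Sum>s\<in>S. of_real (p s) * c (\<kappa> i - \<sigma> s)))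
      - (\<Sum>s\<in>S. of_real (p s) * (cnj (\<Sum>s'\<in>S. of_real (p s') * c (- \<sigma> s + \<sigma> s')) - (\<Sum>s'\<in>S. of_real (p s') * c (\<sigma> s - \<sigma> s'))))"
    proof -
      have *: "(\<lambda>j. c (a - \<kappa> j)) \<longlonglongrightarrow> cnj (\<Sum>s\<in>S. of_real (p s) * c (- a + \<sigma> s))" for a
      proof -
        have "(\<lambda>j. cnj (c (- a + \<kappa> j))) \<longlonglongrightarrow> cnj (\<Sum>s\<in>S. of_real (p s) * c (- a + \<sigma> s))"
          by (intro tendsto_cnj lim)
        moreover have "cnj (c (- a + \<kappa> j)) = c (a - \<kappa> j)" for j using csym[of "- a + \<kappa> j"] by simp
        ultimately show ?thesis by simp
      qed
      show ?thesis unfolding \<Gamma>_def by (intro tendsto_intros *)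
    qed
    moreover have "cnj (c (- a + b)) = c (a - b)" for a b using csym[of "- a + b"] by simp
    ultimately show "(\<lambda>j. \<Gamma> i j) \<longlonglongrightarrow> 0" by simp
  next
    fix i j
    have "(\<lambda>k. cnj (avg (N k) (\<lambda>y. u i y * cnj (u j y)))) \<longlonglongrightarrow> cnj (\<Gamma> i j)" by (intro tendsto_cnj \<Gamma>lim)
    moreover have "cnj (avg M (\<lambda>y. u i y * cnj (u j y))) = avg M (\<lambda>y. u j y * cnj (u i y))" for M
      unfolding avg_cnj[symmetric] by (simp add: mult.commute)
    ultimately have "(\<lambda>k. avg (N k) (\<lambda>y. u j y * cnj (u i y))) \<longlonglongrightarrow> cnj (\<Gamma> i j)" by simp
    then have "\<Gamma> j i = cnj (\<Gamma> i j)" using \<Gamma>lim LIMSEQ_unique by blast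
    then show "norm (\<Gamma> i j) = norm (\<Gamma> j i)" by simp
  next
    fix i
    have ub: "norm (u i y) \<le> 1 + (\<Sum>s\<in>S. \<bar>p s\<bar>)" for y
      unfolding u_def
      by (rule order_trans[OF norm_triangle_ineq4], rule add_mono[OF f], rule order_trans[OF norm_sum], rule sum_mono)
        (use f in \<open>simp add: norm_mult mult_left_le\<close>)
    have "norm (avg M (\<lambda>y. u i y * cnj (u i y))) \<le> (1 + (\<Sum>s\<in>S. \<bar>p s\<bar>))\<^sup>2" for M
    proof (rule norm_avg_le)
      fix y
      show "norm (u i y * cnj (u i y)) \<le> (1 + (\<Sum>s\<in>S. \<bar>p s\<bar>))\<^sup>2"
        unfolding norm_mult complex_mod_cnj power2_eq_square
        by (rule mult_mono[OF ub ub]) (simp_all add: sum_nonneg add_nonneg_nonneg)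
    qed
    then show "norm (\<Gamma> i i) \<le> (1 + (\<Sum>s\<in>S. \<bar>p s\<bar>))\<^sup>2"
      by (intro tendsto_upperbound[OF tendsto_norm[OF \<Gamma>lim]]) auto
  qed
  then have "(\<lambda>j. z j + (\<Sum>s\<in>S. of_real (p s) * V (t + \<sigma> s))) \<longlonglongrightarrow> 0 + (\<Sum>s\<in>S. of_real (p s) * V (t + \<sigma> s))"
    by (intro tendsto_intros)
  then show ?thesis by (simp add: z_def)
qed

section \<open>Bounded solutions of linear recurrences\<close>

text \<open>Points of the boundary circle are extreme in the disc: with w the combination, Re (cnj w
  * a s) <= \<rho>^2 must be an equality wherever the weight is positive.\<close>

lemma convex_combination_extreme:
  fixes a :: "'a \<Rightarrow> complex" and p :: "'a \<Rightarrow> real"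
  assumes S: "finite S" and p: "\<And>s. s \<in> S \<Longrightarrow> p s \<ge> 0" "(\<Sum>s\<in>S. p s) = 1"
    and a: "\<And>s. s \<in> S \<Longrightarrow> norm (a s) \<le> \<rho>" and W: "norm (\<Sum>s\<in>S. of_real (p s) * a s) = \<rho>"
    and s1: "s1 \<in> S" "p s1 > 0"
  shows "a s1 = (\<Sum>s\<in>S. of_real (p s) * a s)"
proof -
  define w where "w = (\<Sum>s\<in>S. of_real (p s) * a s)"
  have nw: "norm w = \<rho>" using W by (simp add: w_def)
  have le: "Re (cnj w * a s) \<le> \<rho>\<^sup>2" if "s \<in> S" for s
  proof -
    have "Re (cnj w * a s) \<le> norm (cnj w * a s)" by (rule complex_Re_le_cmod)
    also have "\<dots> \<le> \<rho> * \<rho>" unfolding norm_mult complex_mod_cnj nw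
      using a[OF that] norm_ge_zero[of w] nw by (intro mult_left_mono) auto
    finally show ?thesis by (simp add: power2_eq_square)
  qed
  have ww: "cnj w * w = of_real (\<rho>\<^sup>2)" using complex_norm_square[of w] nw by (simp add: mult.commute)
  have "Re (cnj w * w) = (\<Sum>s\<in>S. p s * Re (cnj w * a s))"
  proof -
    have "cnj w * w = (\<Sum>s\<in>S. of_real (p s) * (cnj w * a s))"
      by (subst (2) w_def) (simp add: sum_distrib_left mult_ac)
    then show ?thesis by (simp only: Re_sum Re_complex_of_real times_complex.simps Im_complex_of_real mult_zero_left diff_0_right)
  qed
  then have "\<rho>\<^sup>2 = (\<Sum>s\<in>S. p s * Re (cnj w * a s))" unfolding ww by simp
  moreover have "\<rho>\<^sup>2 = (\<Sum>s\<in>S. p s * \<rho>\<^sup>2)" using p(2) by (simp add: sum_distrib_right[symmetric])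
  ultimately have "(\<Sum>s\<in>S. p s * (\<rho>\<^sup>2 - Re (cnj w * a s))) = 0" by (simp add: right_diff_distrib sum_subtractf)
  then have "\<forall>s\<in>S. p s * (\<rho>\<^sup>2 - Re (cnj w * a s)) = 0"
    using S p(1) le by (subst (asm) sum_nonneg_eq_0_iff) auto
  then have eq: "Re (cnj w * a s1) = \<rho>\<^sup>2" using s1 by auto
  have "(norm (a s1 - w))\<^sup>2 = (norm (a s1))\<^sup>2 + (norm w)\<^sup>2 - 2 * Re (cnj w * a s1)"
    unfolding cmod_power2 by (simp add: power2_eq_square algebra_simps)
  also have "\<dots> \<le> \<rho>\<^sup>2 + \<rho>\<^sup>2 - 2 * \<rho>\<^sup>2"
    unfolding eq nw using power_mono[OF a[OF s1(1)], of 2] by simp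
  finally have "norm (a s1 - w) = 0" by simp
  then show ?thesis by (simp add: w_def)
qed

text \<open>\<open>E\<close> is geometric with ratio z, and boundedness in both directions gives |z|
  = 1 unless \<open>E\<close> vanishes. All values then have one norm, so the limit relation
  presents a point of a circle as a convex combination of points of that circle. The terms at s1 and
  s2 must agree, whence z^(q (s2 - s1)) = 1.\<close>

lemma unimodular_factor_periodic:
  fixes E :: "int \<Rightarrow> complex" and \<kappa> :: "nat \<Rightarrow> int" and p :: "nat \<Rightarrow> real"
  assumes step: "\<And>t. E (t + 1) = z * E t" and bd: "\<And>t. norm (E t) \<le> B"
    and S: "finite S" and p: "\<And>s. s \<in> S \<Longrightarrow> p s \<ge> 0" "(\<Sum>s\<in>S. p s) = 1"
    and s12: "s1 \<in> S" "s2 \<in> S" "s1 < s2" "p s1 > 0" "p s2 > 0" "(s2 - s1) dvd M"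
    and lim: "\<And>t. (\<lambda>n. E (t + \<kappa> n)) \<longlonglongrightarrow> (\<Sum>s\<in>S. of_real (p s) * E (t - int (q * s)))"
  shows "E (t + int (q * M)) = E t"
proof (cases "\<forall>t. E t = 0")
  case False
  then obtain t0 where t0: "E t0 \<noteq> 0" by auto
  have pw: "E (t + int n) = z ^ n * E t" for t n
  proof (induction n)
    case (Suc n)
    have "E (t + int (Suc n)) = E ((t + int n) + 1)" by (simp add: algebra_simps)
    then show ?case using Suc step[of "t + int n"] by simp
  qed simp
  have nz: "E t \<noteq> 0" for t
  proof
    assume Et: "E t = 0"
    show False
    proof (cases "t0 \<ge> t")
      case True
      then show ?thesis using pw[of t "nat (t0 - t)"] Et t0 by simp
    next
      case False
      define n where "n = nat (t - t0)"
      have n: "t = t0 + int n" using False by (simp add: n_def)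
      have "z = 0" using pw[of t0 n] Et t0 n by simp
      then show ?thesis using step[of "t0 - 1"] t0 by simp
    qed
  qed
  have z1: "norm z = 1"
  proof (rule ccontr)
    assume ne: "norm z \<noteq> 1"
    have B0: "B > 0" using bd[of t0] t0 by (meson order_less_le_trans zero_less_norm_iff)
    show False
    proof (cases "norm z > 1")
      case True
      obtain n where "norm z ^ n > B / norm (E t0)" using real_arch_pow[OF True] by blast
      then have "norm z ^ n * norm (E t0) > B" using t0 by (simp add: field_simps)
      then show False using bd[of "t0 + int n"] pw[of t0 n] by (simp add: norm_mult norm_power)
    next
      case False
      then have lt: "norm z < 1" using ne by simp
      obtain n where n: "norm z ^ n < norm (E t0) / B" using real_arch_pow_inv[OF _ lt, of "norm (E t0) / B"] B0 t0 by auto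
      have "norm (E t0) = norm z ^ n * norm (E (t0 - int n))" using pw[of "t0 - int n" n] by (simp add: norm_mult norm_power)
      also have "\<dots> \<le> norm z ^ n * B" by (intro mult_left_mono bd) auto
      also have "\<dots> < norm (E t0)" using n B0 by (simp add: field_simps)
      finally show False by simp
    qed
  qed
  have const: "norm (E t) = norm (E t0)" for t
  proof (cases "t \<ge> t0")
    case True
    then show ?thesis using pw[of t0 "nat (t - t0)"] z1 by (simp add: norm_mult norm_power)
  next
    case False
    then show ?thesis using pw[of t "nat (t0 - t)"] z1 by (simp add: norm_mult norm_power)
  qed
  have "(\<lambda>n. norm (E (t0 + \<kappa> n))) \<longlonglongrightarrow> norm (\<Sum>s\<in>S. of_real (p s) * E (t0 - int (q * s)))"
    by (intro tendsto_norm lim)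
  then have W: "norm (\<Sum>s\<in>S. of_real (p s) * E (t0 - int (q * s))) = norm (E t0)"
    unfolding const[of "t0 + _"] by (simp add: LIMSEQ_const_iff)
  have "E (t0 - int (q * s1)) = (\<Sum>s\<in>S. of_real (p s) * E (t0 - int (q * s)))"
    by (rule convex_combination_extreme[OF S p _ W s12(1,4)]) (assumption | rule eq_refl[OF const])+
  moreover have "E (t0 - int (q * s2)) = (\<Sum>s\<in>S. of_real (p s) * E (t0 - int (q * s)))"
    by (rule convex_combination_extreme[OF S p _ W s12(2,5)]) (assumption | rule eq_refl[OF const])+
  ultimately have eq: "E (t0 - int (q * s1)) = E (t0 - int (q * s2))" by simp
  have "t0 - int (q * s1) = (t0 - int (q * s2)) + int (q * (s2 - s1))"
    using s12(3) by (simp add: of_nat_diff right_diff_distrib)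
  then have "E (t0 - int (q * s1)) = z ^ (q * (s2 - s1)) * E (t0 - int (q * s2))" by (simp only: pw)
  then have zq: "z ^ (q * (s2 - s1)) = 1" using eq nz by simp
  obtain k where k: "M = (s2 - s1) * k" using s12(6) by auto
  have "z ^ (q * M) = (z ^ (q * (s2 - s1))) ^ k" unfolding k power_mult[symmetric] by (simp add: mult_ac)
  then show ?thesis using pw[of t "q * M"] zq by simp
qed simp

text \<open>Each root of the characteristic polynomial is either removed or, by the previous lemma, a root of unity.\<close>
lemma bounded_recurrence_periodic:
  fixes C :: "int \<Rightarrow> complex" and \<kappa> :: "nat \<Rightarrow> int" and p :: "nat \<Rightarrow> real" and Q :: "complex poly"
  assumes Q: "Q \<noteq> 0" "\<And>t. (\<Sum>i\<le>degree Q. poly.coeff Q i * C (t + int i)) = 0" and bd: "\<And>t. norm (C t) \<le> B"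
    and S: "finite S" and p: "\<And>s. s \<in> S \<Longrightarrow> p s \<ge> 0" "(\<Sum>s\<in>S. p s) = 1"
    and s12: "s1 \<in> S" "s2 \<in> S" "s1 < s2" "p s1 > 0" "p s2 > 0" "(s2 - s1) dvd M"
    and lim: "\<And>t. (\<lambda>n. C (t + \<kappa> n)) \<longlonglongrightarrow> (\<Sum>s\<in>S. of_real (p s) * C (t - int (q * s)))"
  shows "C (t + int (q * M)) = C t"
proof -
  have "\<forall>t. C (t + int (q * M)) = C t"
    if "degree Q = d" "Q \<noteq> 0" "\<And>t. (\<Sum>i\<le>degree Q. poly.coeff Q i * C (t + int i)) = 0" "\<And>t. norm (C t) \<le> B"
      "\<And>t. (\<lambda>n. C (t + \<kappa> n)) \<longlonglongrightarrow> (\<Sum>s\<in>S. of_real (p s) * C (t - int (q * s)))" for d and Q :: "complex poly" and C :: "int \<Rightarrow> complex" and B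
    using that
  proof (induction d arbitrary: Q C B)
    case 0
    then have "poly.coeff Q 0 \<noteq> 0" by (metis leading_coeff_0_iff)
    then have "C t = 0" for t using 0(3)[of t] 0(1) by simp
    then show ?case by simp
  next
    case (Suc d)
    obtain z where "poly Q z = 0" using alg_closed_imp_poly_has_root[of Q] Suc.prems(1) by auto
    then obtain R where R: "Q = [:-z, 1:] * R" by (auto simp: poly_eq_0_iff_dvd)
    have R0: "R \<noteq> 0" using Suc.prems(2) R by auto
    have "degree Q = degree [:-z, 1:] + degree R" unfolding R by (rule degree_mult_eq) (use R0 in auto)
    then have dR: "degree R = d" using Suc.prems(1) by simp
    \<comment> \<open>One root is isolated: applying R to C gives a sequence on which the shift acts
      as multiplication by z, and the limit relation is inherited by linearity.\<close>
    define E where "E = (\<lambda>t. \<Sum>i\<le>d. poly.coeff R i * C (t + int i))"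
    have cQ: "poly.coeff Q i = (case i of 0 \<Rightarrow> 0 | Suc j \<Rightarrow> poly.coeff R j) - z * poly.coeff R i" for i
      unfolding R by (simp add: coeff_pCons split: nat.splits)
    have step: "E (t + 1) = z * E t" for t
    proof -
      have "0 = (\<Sum>i\<le>Suc d. poly.coeff Q i * C (t + int i))" using Suc.prems(1) Suc.prems(3)[of t] by simp
      also have "\<dots> = (\<Sum>i\<le>Suc d. (case i of 0 \<Rightarrow> 0 | Suc j \<Rightarrow> poly.coeff R j) * C (t + int i)) - z * (\<Sum>i\<le>Suc d. poly.coeff R i * C (t + int i))"
        unfolding cQ by (simp only: left_diff_distrib sum_subtractf sum_distrib_left mult.assoc)
      also have "(\<Sum>i\<le>Suc d. (case i of 0 \<Rightarrow> 0 | Suc j \<Rightarrow> poly.coeff R j) * C (t + int i)) = E (t + 1)"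
        unfolding E_def by (subst sum.atMost_Suc_shift) (simp add: algebra_simps)
      also have "(\<Sum>i\<le>Suc d. poly.coeff R i * C (t + int i)) = E t"
        unfolding E_def using dR by (simp add: coeff_eq_0)
      finally show ?thesis by simp
    qed
    have Ebd: "norm (E t) \<le> (\<Sum>i\<le>d. norm (poly.coeff R i) * B)" for t
      unfolding E_def by (rule order_trans[OF norm_sum], rule sum_mono) (simp add: norm_mult Suc.prems(4) mult_left_mono)
    have Elim: "(\<lambda>n. E (t + \<kappa> n)) \<longlonglongrightarrow> (\<Sum>s\<in>S. of_real (p s) * E (t - int (q * s)))" for t
    proof -
      have "(\<lambda>n. \<Sum>i\<le>d. poly.coeff R i * C ((t + int i) + \<kappa> n)) \<longlonglongrightarrow> (\<Sum>i\<le>d. poly.coeff R i * (\<Sum>s\<in>S. of_real (p s) * C ((t + int i) - int (q * s))))"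
        by (intro tendsto_intros Suc.prems(5))
      moreover have "(\<Sum>i\<le>d. poly.coeff R i * (\<Sum>s\<in>S. of_real (p s) * C ((t + int i) - int (q * s)))) = (\<Sum>s\<in>S. of_real (p s) * E (t - int (q * s)))"
        unfolding E_def sum_distrib_left by (subst sum.swap) (simp add: algebra_simps)
      ultimately show ?thesis unfolding E_def by (simp add: algebra_simps)
    qed
    have Eper: "E (t + int (q * M)) = E t" for t
      by (rule unimodular_factor_periodic[OF step Ebd S p s12 Elim])
    \<comment> \<open>Differencing with the period of \<open>E\<close> leaves a sequence annihilated
      by R, so the induction hypothesis makes it periodic. C is then linear along steps of q M, and
      boundedness forces the slope C' to be 0; this also deals with multiple roots.\<close>
    define C' where "C' = (\<lambda>t. C (t + int (q * M)) - C t)"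
    have "\<forall>t. C' (t + int (q * M)) = C' t"
    proof (rule Suc.IH[OF dR R0])
      fix t
      have "(\<Sum>i\<le>degree R. poly.coeff R i * C' (t + int i)) = E (t + int (q * M)) - E t"
        unfolding C'_def E_def dR by (simp add: right_diff_distrib sum_subtractf algebra_simps)
      then show "(\<Sum>i\<le>degree R. poly.coeff R i * C' (t + int i)) = 0" using Eper by simp
      show "norm (C' t) \<le> B + B" unfolding C'_def
        by (rule order_trans[OF norm_triangle_ineq4]) (intro add_mono Suc.prems(4))
      have "(\<lambda>n. C ((t + int (q * M)) + \<kappa> n) - C (t + \<kappa> n)) \<longlonglongrightarrow>
          (\<Sum>s\<in>S. of_real (p s) * C ((t + int (q * M)) - int (q * s))) - (\<Sum>s\<in>S. of_real (p s) * C (t - int (q * s)))"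
        by (intro tendsto_diff Suc.prems(5))
      then show "(\<lambda>n. C' (t + \<kappa> n)) \<longlonglongrightarrow> (\<Sum>s\<in>S. of_real (p s) * C' (t - int (q * s)))"
        unfolding C'_def by (simp add: right_diff_distrib sum_subtractf algebra_simps)
    qed
    then have per: "C' (t + int (q * M)) = C' t" for t by blast
    have C'k: "C' (t + int k * int (q * M)) = C' t" for t k
    proof (induction k)
      case (Suc k)
      have "C' (t + int (Suc k) * int (q * M)) = C' ((t + int k * int (q * M)) + int (q * M))" by (simp add: algebra_simps)
      then show ?case using Suc per by simp
    qed simp
    have lin: "C (t + int k * int (q * M)) = C t + of_nat k * C' t" for t k
    proof (induction k)
      case (Suc k)
      have "C (t + int (Suc k) * int (q * M)) = C ((t + int k * int (q * M)) + int (q * M))" by (simp add: algebra_simps)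
      also have "\<dots> = C (t + int k * int (q * M)) + C' (t + int k * int (q * M))" by (simp add: C'_def)
      finally show ?case unfolding Suc C'k by (simp add: algebra_simps)
    qed simp
    have "C' t = 0" for t
    proof (rule ccontr)
      assume ne: "C' t \<noteq> 0"
      obtain k :: nat where k: "real k > 2 * B / norm (C' t)" using reals_Archimedean2 by blast
      have "real k * norm (C' t) = norm (C (t + int k * int (q * M)) - C t)" unfolding lin by (simp add: norm_mult)
      also have "\<dots> \<le> B + B" by (rule order_trans[OF norm_triangle_ineq4]) (intro add_mono Suc.prems(4))
      finally show False using k ne by (simp add: field_simps)
    qed
    then show ?case unfolding C'_def by simp
  qed
  from this[OF refl Q bd lim] show ?thesis by blast
qed

section \<open>Limits of correlations\<close>

lemma filterlim_at_top_inverse_real: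
  fixes N :: "nat \<Rightarrow> nat"
  assumes "filterlim N at_top sequentially"
  shows "(\<lambda>k. K / real (N k)) \<longlonglongrightarrow> 0"
  by (intro tendsto_divide_0[OF tendsto_const] filterlim_at_top_imp_at_infinity
      filterlim_compose[OF filterlim_real_sequentially assms])

text \<open>Two limits in succession: at a fixed level n the length N grows and removes K / N, where
  K depends on n; then n runs through \<open>nj\<close> and removes e n.\<close>

lemma autocorrelation_limit:
  fixes f :: "int \<Rightarrow> complex" and N nj :: "nat \<Rightarrow> nat" and H :: "nat \<Rightarrow> int"
    and \<pi> :: "nat \<Rightarrow> nat \<Rightarrow> nat \<Rightarrow> real" and w :: "nat \<Rightarrow> nat \<Rightarrow> real"
  assumes N: "filterlim N at_top sequentially" and nj: "filterlim nj at_top sequentially"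
    and c: "\<And>t. (\<lambda>k. avg (N k) (\<lambda>y. f (y + t) * cnj (f y))) \<longlonglongrightarrow> c t"
    and w: "\<And>n s. (\<lambda>k. \<pi> n (N k) s) \<longlonglongrightarrow> w n s"
    and P: "\<And>s. (\<lambda>j. w (nj j) s) \<longlonglongrightarrow> P s"
    and err: "\<And>t. \<exists>e. e \<longlonglongrightarrow> 0 \<and> (\<forall>n. \<exists>K. \<forall>N>0. norm (avg N (\<lambda>y. f (y + (t + H n)) * cnj (f y))
        - (\<Sum>s\<in>S. of_real (\<pi> n N s) * avg N (\<lambda>y. f (y + (t - int s)) * cnj (f y)))) \<le> e n + K / real N)"
  shows "(\<lambda>j. c (t + H (nj j))) \<longlonglongrightarrow> (\<Sum>s\<in>S. of_real (P s) * c (t - int s))"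
proof -
  obtain e :: "nat \<Rightarrow> real" where e: "e \<longlonglongrightarrow> 0" and eb: "\<And>n. \<exists>K. \<forall>N>0. norm (avg N (\<lambda>y. f (y + (t + H n)) * cnj (f y))
        - (\<Sum>s\<in>S. of_real (\<pi> n N s) * avg N (\<lambda>y. f (y + (t - int s)) * cnj (f y)))) \<le> e n + K / real N"
    using err[of t] by auto
  have bound: "norm (c (t + H n) - (\<Sum>s\<in>S. of_real (w n s) * c (t - int s))) \<le> e n" for n
  proof -
    obtain K where K: "\<And>N. N > 0 \<Longrightarrow> norm (avg N (\<lambda>y. f (y + (t + H n)) * cnj (f y))
        - (\<Sum>s\<in>S. of_real (\<pi> n N s) * avg N (\<lambda>y. f (y + (t - int s)) * cnj (f y)))) \<le> e n + K / real N"
      using eb[of n] by blast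
    have l1: "(\<lambda>k. norm (avg (N k) (\<lambda>y. f (y + (t + H n)) * cnj (f y))
        - (\<Sum>s\<in>S. of_real (\<pi> n (N k) s) * avg (N k) (\<lambda>y. f (y + (t - int s)) * cnj (f y)))))
        \<longlonglongrightarrow> norm (c (t + H n) - (\<Sum>s\<in>S. of_real (w n s) * c (t - int s)))"
      by (intro tendsto_intros c w)
    have l2: "(\<lambda>k. e n + K / real (N k)) \<longlonglongrightarrow> e n + 0"
      by (intro tendsto_add tendsto_const filterlim_at_top_inverse_real[OF N])
    have "eventually (\<lambda>k. N k \<ge> 1) sequentially" using N unfolding filterlim_at_top by blast
    then have "eventually (\<lambda>k. N k > 0) sequentially" by (rule eventually_mono) simp
    then have ev: "eventually (\<lambda>k. norm (avg (N k) (\<lambda>y. f (y + (t + H n)) * cnj (f y))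
        - (\<Sum>s\<in>S. of_real (\<pi> n (N k) s) * avg (N k) (\<lambda>y. f (y + (t - int s)) * cnj (f y)))) \<le> e n + K / real (N k)) sequentially"
      by (rule eventually_mono) (rule K)
    show ?thesis using tendsto_le[OF _ l2 l1 ev] by simp
  qed
  have "(\<lambda>j. c (t + H (nj j)) - (\<Sum>s\<in>S. of_real (w (nj j) s) * c (t - int s))) \<longlonglongrightarrow> 0"
  proof (rule Lim_null_comparison)
    show "\<forall>\<^sub>F j in sequentially. norm (c (t + H (nj j)) - (\<Sum>s\<in>S. of_real (w (nj j) s) * c (t - int s))) \<le> e (nj j)"
      using bound by simp
    show "(\<lambda>j. e (nj j)) \<longlonglongrightarrow> 0" by (rule filterlim_compose[OF e nj])
  qed
  moreover have "(\<lambda>j. \<Sum>s\<in>S. of_real (w (nj j) s) * c (t - int s)) \<longlonglongrightarrow> (\<Sum>s\<in>S. of_real (P s) * c (t - int s))"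
    by (intro tendsto_intros P)
  ultimately have "(\<lambda>j. (c (t + H (nj j)) - (\<Sum>s\<in>S. of_real (w (nj j) s) * c (t - int s))) + (\<Sum>s\<in>S. of_real (w (nj j) s) * c (t - int s)))
      \<longlonglongrightarrow> 0 + (\<Sum>s\<in>S. of_real (P s) * c (t - int s))"
    by (rule tendsto_add)
  then show ?thesis by simp
qed

lemma autocorrelation_symmetric:
  fixes f :: "int \<Rightarrow> complex"
  assumes f: "\<And>y. norm (f y) \<le> 1" and N: "filterlim N at_top sequentially"
    and c: "\<And>t. (\<lambda>k. avg (N k) (\<lambda>y. f (y + t) * cnj (f y))) \<longlonglongrightarrow> c t"
  shows "c (- a) = cnj (c a)"
proof -
  have "(\<lambda>k. avg (N k) (\<lambda>y. (\<lambda>y. f (y + - a) * cnj (f y)) (y + a))) \<longlonglongrightarrow> c (- a)"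
    by (rule avg_shift_tendsto[where B = 1, OF _ N c]) (simp add: norm_mult mult_le_one f)
  then have 1: "(\<lambda>k. avg (N k) (\<lambda>y. cnj (f (y + a) * cnj (f y)))) \<longlonglongrightarrow> c (- a)"
    by (simp add: mult.commute)
  have "(\<lambda>k. cnj (avg (N k) (\<lambda>y. f (y + a) * cnj (f y)))) \<longlonglongrightarrow> cnj (c a)"
    by (intro tendsto_cnj c)
  then show ?thesis using LIMSEQ_unique[OF 1] unfolding avg_cnj by simp
qed

text \<open>A correlation along p m is an ordinary correlation with a bounded sequence supported on
  the multiples of p. This makes dilated correlations accessible to
  \<open>weak_limit_transfer\<close>.\<close>

lemma avg_dilate:
  assumes "p > 0"
  shows "avg (p * N) (\<lambda>y. g y * (if int p dvd y then v (y div int p) else 0)) = avg N (\<lambda>m. g (int p * m) * v m) / of_nat p"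
proof -
  have "(\<Sum>y<p * N. g (int y) * (if int p dvd int y then v (int y div int p) else 0))
      = (\<Sum>y\<in>(\<lambda>m. p * m) ` {..<N}. g (int y) * v (int y div int p))"
  proof (rule sum.mono_neutral_cong_right)
    show "(\<lambda>m. p * m) ` {..<N} \<subseteq> {..<p * N}" using assms by auto
    show "\<forall>y\<in>{..<p * N} - (\<lambda>m. p * m) ` {..<N}. g (int y) * (if int p dvd int y then v (int y div int p) else 0) = 0"
      using assms by (auto elim!: dvdE)
  qed auto
  also have "\<dots> = (\<Sum>m<N. g (int p * int m) * v (int m))"
    using assms by (subst sum.reindex) (auto simp: inj_on_def)
  finally show ?thesis by (simp add: avg_def)
qed

text \<open>The correlations \<open>lim 1/N \<Sum> f(pm + a) cnj f(qm + b)\<close> only depend on \<open>qa - pb\<close>.\<close>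
lemma bilinear_correlation_function:
  fixes D :: "int \<Rightarrow> int \<Rightarrow> complex"
  assumes pq: "coprime p (q::nat)" and inv: "\<And>a b. D (a + int p) (b + int q) = D a b"
  obtains C where "\<And>a b. D a b = C (int q * a - int p * b)"
proof -
  have inv_nat: "D (a + int l * int p) (b + int l * int q) = D a b" for a b l
  proof (induction l)
    case (Suc l)
    have "D (a + int (Suc l) * int p) (b + int (Suc l) * int q) = D ((a + int l * int p) + int p) ((b + int l * int q) + int q)"
      by (simp add: algebra_simps)
    then show ?case using Suc inv by simp
  qed simp
  have inv_int: "D (a + l * int p) (b + l * int q) = D a b" for a b l
  proof (cases "l \<ge> 0")
    case True
    then show ?thesis using inv_nat[of a "nat l" b] by simp
  next
    case False
    then show ?thesis using inv_nat[of "a + l * int p" "nat (- l)" "b + l * int q"] by simp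
  qed
  \<comment> \<open>Bezout's relation gives the pair (t u, - t v) for each value t; any other pair
    with this value differs from it by a multiple of (p, q).\<close>
  obtain u v where uv: "u * int q + v * int p = 1"
    using bezout_int[of "int q" "int p"] pq by (auto simp: coprime_commute)
  define C where "C = (\<lambda>t. D (t * u) (- t * v))"
  have "D a b = C (int q * a - int p * b)" for a b
  proof -
    define t where "t = int q * a - int p * b"
    define l where "l = a * v + b * u"
    have 1: "a - t * u = l * int p"
    proof -
      have "a - t * u = a * (u * int q + v * int p) - t * u" using uv by simp
      also have "\<dots> = l * int p" by (simp add: t_def l_def algebra_simps)
      finally show ?thesis .
    qed
    have 2: "b + t * v = l * int q"
    proof -
      have "b + t * v = b * (u * int q + v * int p) + t * v" using uv by simp
      also have "\<dots> = l * int q" by (simp add: t_def l_def algebra_simps)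
      finally show ?thesis .
    qed
    have "a = t * u + l * int p" "b = - t * v + l * int q" using 1 2 by linarith+
    then have "D a b = D (t * u + l * int p) (- t * v + l * int q)" by (rule arg_cong2[where f = D])
    then show ?thesis unfolding C_def t_def[symmetric] by (simp only: inv_int)
  qed
  then show ?thesis by (rule that)
qed

lemma two_positive_weights:
  fixes P :: "nat \<Rightarrow> real"
  assumes "finite S" "(\<Sum>s\<in>S. P s) = 1" "\<And>s. s \<in> S \<Longrightarrow> P s \<ge> 0" "\<And>s. s \<in> S \<Longrightarrow> P s < 1"
  obtains s1 s2 where "s1 \<in> S" "s2 \<in> S" "s1 < s2" "P s1 > 0" "P s2 > 0"
proof -
  have "\<exists>s\<in>S. P s > 0"
  proof (rule ccontr)
    assume "\<not> ?thesis"
    then have "(\<Sum>s\<in>S. P s) \<le> 0" by (intro sum_nonpos) (auto simp: not_less)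
    then show False using assms(2) by simp
  qed
  then obtain a where a: "a \<in> S" "P a > 0" by blast
  have "\<exists>s\<in>S - {a}. P s > 0"
  proof (rule ccontr)
    assume "\<not> ?thesis"
    then have "(\<Sum>s\<in>S - {a}. P s) \<le> 0" by (intro sum_nonpos) (auto simp: not_less)
    then show False using assms(1,2) assms(4)[OF a(1)] a sum.remove[of S a P] by simp
  qed
  then obtain b where b: "b \<in> S" "b \<noteq> a" "P b > 0" by blast
  show ?thesis
  proof (cases "a < b")
    case True
    then show ?thesis by (rule that[OF a(1) b(1) _ a(2) b(3)])
  next
    case False
    then have "b < a" using b(2) by simp
    then show ?thesis by (rule that[OF b(1) a(1) _ b(3) a(2)])
  qed
qed

text \<open>If the two sides of the recurrence had the same characteristic polynomial, \<open>P\<close> would be supported on multiples of \<open>p\<close>.\<close>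
lemma recurrence_polynomial:
  fixes C :: "int \<Rightarrow> complex" and P P' :: "nat \<Rightarrow> real"
  assumes pq: "prime p" "prime q" "p \<noteq> q"
    and rec: "\<And>t. (\<Sum>s\<le>p * G. of_real (P s) * C (t - int (q * s))) = (\<Sum>s\<le>q * G. of_real (P' s) * C (t - int (p * s)))"
    and s0: "s0 \<le> p * G" "\<not> p dvd s0" "P s0 \<noteq> 0"
  obtains Q :: "complex poly" where "Q \<noteq> 0" "\<And>t. (\<Sum>i\<le>degree Q. poly.coeff Q i * C (t + int i)) = 0"
proof -
  \<comment> \<open>All delays q s and p s are at most p q G; a shift by this amount turns them into
    nonnegative exponents.\<close>
  define B where "B = p * q * G"
  define e where "e = (\<lambda>i. (\<Sum>s\<le>p * G. if i = B - q * s then of_real (P s) else 0) - (\<Sum>s\<le>q * G. if i = B - p * s then of_real (P' s) else 0) :: complex)"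
  have B1: "q * s \<le> B" if "s \<le> p * G" for s using mult_le_mono2[OF that, of q] by (simp add: B_def mult_ac)
  have B2: "p * s \<le> B" if "s \<le> q * G" for s using mult_le_mono2[OF that, of p] by (simp add: B_def mult_ac)
  define Q where "Q = (\<Sum>i\<le>B. Polynomial.monom (e i) i)"
  have cQ: "poly.coeff Q i = (if i \<le> B then e i else 0)" for i
    unfolding Q_def by (simp add: Polynomial.coeff_sum)
  \<comment> \<open>The second sum does not reach this exponent: q s0 = p s would imply
    \<open>p dvd s0\<close>.\<close>
  have "e (B - q * s0) = of_real (P s0)"
  proof -
    have q0: "q > 0" using pq(2) prime_gt_0_nat by blast
    have "(\<Sum>s\<le>p * G. if B - q * s0 = B - q * s then of_real (P s) else 0) = (\<Sum>s\<le>p * G. if s0 = s then of_real (P s) else (0::complex))"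
    proof (rule sum.cong[OF refl])
      fix s assume "s \<in> {..p * G}"
      then have le: "q * s \<le> B" using B1 by simp
      have "s0 = s" if "B - q * s0 = B - q * s"
      proof -
        have "q * s0 = q * s" using that le B1[OF s0(1)] by linarith
        then show ?thesis using q0 by simp
      qed
      then show "(if B - q * s0 = B - q * s then of_real (P s) else 0) = (if s0 = s then of_real (P s) else (0::complex))"
        by auto
    qed
    also have "\<dots> = of_real (P s0)" using s0(1) by simp
    finally have 1: "(\<Sum>s\<le>p * G. if B - q * s0 = B - q * s then of_real (P s) else 0) = (of_real (P s0) :: complex)" .
    have 2: "(\<Sum>s\<le>q * G. if B - q * s0 = B - p * s then of_real (P' s) else 0) = (0::complex)"
    proof (rule sum.neutral, rule ballI)
      fix s assume "s \<in> {..q * G}"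
      then have "p * s \<le> B" using B2 by simp
      have "B - q * s0 \<noteq> B - p * s"
      proof
        assume "B - q * s0 = B - p * s"
        then have "q * s0 = p * s" using \<open>p * s \<le> B\<close> B1[OF s0(1)] by linarith
        then have "p dvd q * s0" by simp
        then have "p dvd q" using pq(1) s0(2) prime_dvd_mult_iff by blast
        then show False using pq primes_dvd_imp_eq by blast
      qed
      then show "(if B - q * s0 = B - p * s then of_real (P' s) else 0) = (0::complex)" by simp
    qed
    show ?thesis unfolding e_def 1 2 by simp
  qed
  then have "poly.coeff Q (B - q * s0) \<noteq> 0" unfolding cQ using s0(3) by simp
  then have Q0: "Q \<noteq> 0" by auto
  have act: "(\<Sum>i\<le>degree Q. poly.coeff Q i * C (t + int i)) = 0" for t
  proof -
    have degB: "degree Q \<le> B" by (rule degree_le) (simp add: cQ)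
    have "(\<Sum>i\<le>degree Q. poly.coeff Q i * C (t + int i)) = (\<Sum>i\<le>B. poly.coeff Q i * C (t + int i))"
      using degB by (intro sum.mono_neutral_left) (auto simp: not_le coeff_eq_0)
    also have "\<dots> = (\<Sum>i\<le>B. e i * C (t + int i))" by (intro sum.cong refl) (simp add: cQ)
    also have "\<dots> = (\<Sum>s\<le>p * G. of_real (P s) * C (t + int (B - q * s))) - (\<Sum>s\<le>q * G. of_real (P' s) * C (t + int (B - p * s)))"
    proof -
      have d1: "(\<Sum>i\<le>B. (\<Sum>s\<in>A. if i = B - m * s then of_real (R s) else 0) * C (t + int i)) = (\<Sum>s\<in>A. of_real (R s) * C (t + int (B - m * s)))"
        for A :: "nat set" and m and R :: "nat \<Rightarrow> real"
      proof -
        have "(\<Sum>i\<le>B. (\<Sum>s\<in>A. if i = B - m * s then of_real (R s) else 0) * C (t + int i)) = (\<Sum>i\<le>B. \<Sum>s\<in>A. if i = B - m * s then of_real (R s) * C (t + int i) else 0)"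
          unfolding sum_distrib_right by (intro sum.cong refl) auto
        also have "\<dots> = (\<Sum>s\<in>A. \<Sum>i\<le>B. if i = B - m * s then of_real (R s) * C (t + int i) else 0)" by (rule sum.swap)
        also have "\<dots> = (\<Sum>s\<in>A. of_real (R s) * C (t + int (B - m * s)))" by (intro sum.cong refl) simp
        finally show ?thesis .
      qed
      show ?thesis unfolding e_def left_diff_distrib sum_subtractf d1 ..
    qed
    also have "(\<Sum>s\<le>p * G. of_real (P s) * C (t + int (B - q * s))) = (\<Sum>s\<le>p * G. of_real (P s) * C ((t + int B) - int (q * s)))"
    proof (rule sum.cong[OF refl])
      fix s assume "s \<in> {..p * G}"
      then have "int (B - q * s) = int B - int (q * s)" using B1[of s] by (simp only: of_nat_diff atMost_iff)
      then show "of_real (P s) * C (t + int (B - q * s)) = of_real (P s) * C ((t + int B) - int (q * s))" by (simp only: add_diff_eq)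
    qed
    also have "(\<Sum>s\<le>q * G. of_real (P' s) * C (t + int (B - p * s))) = (\<Sum>s\<le>q * G. of_real (P' s) * C ((t + int B) - int (p * s)))"
    proof (rule sum.cong[OF refl])
      fix s assume "s \<in> {..q * G}"
      then have "int (B - p * s) = int B - int (p * s)" using B2[of s] by (simp only: of_nat_diff atMost_iff)
      then show "of_real (P' s) * C (t + int (B - p * s)) = of_real (P' s) * C ((t + int B) - int (p * s))" by (simp only: add_diff_eq)
    qed
    finally show ?thesis using rec[of "t + int B"] by simp
  qed
  show ?thesis by (rule that[OF Q0 act])
qed

text \<open>\<open>h\<close> and \<open>\<pi>\<close> stand for the heights and for the observed
  frequencies of spacer numbers over r copies. The weight off the multiples of p makes the
  recurrence nontrivial; the bound 1 - \<delta> on single weights yields two positive ones. Both are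
  uniform over \<open>good\<close> and so survive the limit.\<close>

theorem dilated_correlation_null:
  fixes f :: "int \<Rightarrow> complex" and h :: "nat \<Rightarrow> nat" and \<pi> :: "nat \<Rightarrow> nat \<Rightarrow> nat \<Rightarrow> nat \<Rightarrow> real"
  assumes f: "\<And>y. norm (f y) \<le> 1"
    and pq: "prime p" "prime q" "p \<noteq> q"
    and \<pi>: "\<And>n N r s. 0 \<le> \<pi> n N r s" "\<And>n N r s. \<pi> n N r s \<le> 1"
    and sum1: "\<And>n r. eventually (\<lambda>N. (\<Sum>s\<le>r * G. \<pi> n N r s) = 1) sequentially"
    and good: "infinite good" and \<delta>: "\<delta> > 0"
    and nonconst: "\<And>n s. n \<in> good \<Longrightarrow> eventually (\<lambda>N. \<pi> n N 1 s \<le> 1 - \<delta>) sequentially"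
    and notp: "\<And>n. n \<in> good \<Longrightarrow> eventually (\<lambda>N. (\<Sum>s | s \<le> p * G \<and> \<not> p dvd s. \<pi> n N p s) \<ge> \<delta>) sequentially"
    and err: "\<And>r t. \<exists>e. e \<longlonglongrightarrow> 0 \<and> (\<forall>n. \<exists>K. \<forall>N>0. norm (avg N (\<lambda>y. f (y + (t + int (r * h n))) * cnj (f y))
        - (\<Sum>s\<le>r * G. of_real (\<pi> n N r s) * avg N (\<lambda>y. f (y + (t - int s)) * cnj (f y)))) \<le> e n + K / real N)"
    and M: "\<And>d. 1 \<le> d \<Longrightarrow> d \<le> G \<Longrightarrow> d dvd M"
  defines "g \<equiv> \<lambda>y. f y - f (y + int M)"
  shows "(\<lambda>N. avg N (\<lambda>m. g (int p * m) * cnj (g (int q * m)))) \<longlonglongrightarrow> 0"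
proof (rule ccontr)
  assume neg: "\<not> ?thesis"
  define b where "b = (\<lambda>N. avg N (\<lambda>m. g (int p * m) * cnj (g (int q * m))))"
  have p0: "p > 0" and q0: "q > 0" using pq prime_gt_0_nat by blast+
  obtain e where e: "e > 0" "\<And>n0. \<exists>n\<ge>n0. norm (b n) \<ge> e"
    using neg unfolding LIMSEQ_iff b_def by (auto simp: not_less)
  have inf: "infinite {n. norm (b n) \<ge> e}" unfolding infinite_nat_iff_unbounded_le using e(2) by blast
  define \<nu>0 where "\<nu>0 = enumerate {n. norm (b n) \<ge> e}"
  have \<nu>0: "strict_mono \<nu>0" "\<And>k. norm (b (\<nu>0 k)) \<ge> e"
    unfolding \<nu>0_def using strict_mono_enumerate[OF inf] enumerate_in_set[OF inf] by auto
  \<comment> \<open>All quantities whose limits are needed, for every level and shift, form one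
    bounded family over a countable index set; a single diagonal extraction treats them
    together.\<close>
  define \<phi> :: "nat \<Rightarrow> nat \<times> int \<times> int \<Rightarrow> complex" where
    "\<phi> = (\<lambda>k (i, a, b).
       if i = 0 then avg (\<nu>0 k) (\<lambda>m. f (int p * m + a) * cnj (f (int q * m + b)))
       else if i = 1 then avg (p * \<nu>0 k) (\<lambda>y. f (y + a) * cnj (f y))
       else if i = 2 then avg (q * \<nu>0 k) (\<lambda>y. f (y + a) * cnj (f y))
       else if i = 3 then of_real (\<pi> (nat a) (p * \<nu>0 k) 1 (nat b))
       else if i = 4 then of_real (\<pi> (nat a) (p * \<nu>0 k) p (nat b))
       else of_real (\<pi> (nat a) (q * \<nu>0 k) q (nat b)))"
  have \<phi>1: "norm (\<phi> k x) \<le> 1" for k x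
  proof -
    have "norm (avg N (\<lambda>m. f (u m) * cnj (f (v m)))) \<le> 1" for N u v
      by (rule norm_avg_le) (simp add: norm_mult mult_le_one f)
    then show ?thesis unfolding \<phi>_def using \<pi> by (auto split: prod.splits)
  qed
  obtain k0 :: "nat \<Rightarrow> nat" where k0: "strict_mono k0" "\<And>x. x \<in> UNIV \<Longrightarrow> \<exists>l. (\<lambda>n. \<phi> (k0 n) x) \<longlonglongrightarrow> l"
    by (rule function_convergent_subsequence[of "UNIV :: (nat \<times> int \<times> int) set" \<phi> 1]) (use \<phi>1 in auto)
  define \<nu> where "\<nu> = (\<lambda>k. \<nu>0 (k0 k))"
  have \<nu>: "strict_mono \<nu>" using strict_mono_o[OF \<nu>0(1) k0(1)] by (simp add: \<nu>_def o_def)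
  have \<nu>top: "filterlim \<nu> at_top sequentially" by (rule filterlim_subseq[OF \<nu>])
  have rtop: "filterlim (\<lambda>k. r * \<nu> k) at_top sequentially" if "r > 0" for r :: nat
  proof (rule filterlim_at_top_mono[OF \<nu>top])
    show "\<forall>\<^sub>F k in sequentially. \<nu> k \<le> r * \<nu> k" using that by simp
  qed
  define lm where "lm = (\<lambda>x. SOME l. (\<lambda>n. \<phi> (k0 n) x) \<longlonglongrightarrow> l)"
  have lm: "(\<lambda>n. \<phi> (k0 n) x) \<longlonglongrightarrow> lm x" for x
    unfolding lm_def by (rule someI_ex, rule k0(2)) simp
  define D where "D = (\<lambda>a b. lm (0, a, b))"
  define cp where "cp = (\<lambda>t. lm (1, t, 0))"
  define cq where "cq = (\<lambda>t. lm (2, t, 0))"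
  define w1 where "w1 = (\<lambda>n s. Re (lm (3, int n, int s)))"
  define wp where "wp = (\<lambda>n s. Re (lm (4, int n, int s)))"
  define wq where "wq = (\<lambda>n s. Re (lm (5, int n, int s)))"
  have D: "(\<lambda>k. avg (\<nu> k) (\<lambda>m. f (int p * m + a) * cnj (f (int q * m + b)))) \<longlonglongrightarrow> D a b" for a b
    using lm[of "(0, a, b)"] by (simp add: \<phi>_def \<nu>_def D_def)
  have cp: "(\<lambda>k. avg (p * \<nu> k) (\<lambda>y. f (y + t) * cnj (f y))) \<longlonglongrightarrow> cp t" for t
    using lm[of "(1, t, 0)"] by (simp add: \<phi>_def \<nu>_def cp_def)
  have cq: "(\<lambda>k. avg (q * \<nu> k) (\<lambda>y. f (y + t) * cnj (f y))) \<longlonglongrightarrow> cq t" for t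
    using lm[of "(2, t, 0)"] by (simp add: \<phi>_def \<nu>_def cq_def)
  have w1: "(\<lambda>k. \<pi> n (p * \<nu> k) 1 s) \<longlonglongrightarrow> w1 n s" for n s
    using tendsto_Re[OF lm[of "(3, int n, int s)"]] by (simp add: \<phi>_def \<nu>_def w1_def)
  have wp: "(\<lambda>k. \<pi> n (p * \<nu> k) p s) \<longlonglongrightarrow> wp n s" for n s
    using tendsto_Re[OF lm[of "(4, int n, int s)"]] by (simp add: \<phi>_def \<nu>_def wp_def)
  have wq: "(\<lambda>k. \<pi> n (q * \<nu> k) q s) \<longlonglongrightarrow> wq n s" for n s
    using tendsto_Re[OF lm[of "(5, int n, int s)"]] by (simp add: \<phi>_def \<nu>_def wq_def)
  note ptop = rtop[OF p0] and qtop = rtop[OF q0]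
  have w1b: "0 \<le> w1 n s" "w1 n s \<le> 1" for n s
    by (rule tendsto_lowerbound[OF w1], use \<pi> in auto)+ (rule tendsto_upperbound[OF w1], use \<pi> in auto)
  have wpb: "0 \<le> wp n s" "wp n s \<le> 1" for n s
    by (rule tendsto_lowerbound[OF wp], use \<pi> in auto)+ (rule tendsto_upperbound[OF wp], use \<pi> in auto)
  have wqb: "0 \<le> wq n s" "wq n s \<le> 1" for n s
    by (rule tendsto_lowerbound[OF wq], use \<pi> in auto)+ (rule tendsto_upperbound[OF wq], use \<pi> in auto)
  have w1s: "(\<Sum>s\<le>1 * G. w1 n s) = 1" for n
  proof (rule LIMSEQ_unique)
    show "(\<lambda>k. \<Sum>s\<le>1 * G. \<pi> n (p * \<nu> k) 1 s) \<longlonglongrightarrow> (\<Sum>s\<le>1 * G. w1 n s)" by (intro tendsto_sum w1)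
    have "eventually (\<lambda>k. (\<Sum>s\<le>1 * G. \<pi> n (p * \<nu> k) 1 s) = 1) sequentially"
      by (rule eventually_compose_filterlim[OF sum1 ptop])
    then show "(\<lambda>k. \<Sum>s\<le>1 * G. \<pi> n (p * \<nu> k) 1 s) \<longlonglongrightarrow> 1" by (rule tendsto_eventually)
  qed
  have w1d: "w1 n s \<le> 1 - \<delta>" if "n \<in> good" for n s
    using eventually_compose_filterlim[OF nonconst[OF that, of s] ptop]
    by (intro tendsto_upperbound[OF w1]) auto
  have wpd: "(\<Sum>s | s \<le> p * G \<and> \<not> p dvd s. wp n s) \<ge> \<delta>" if "n \<in> good" for n
  proof (rule tendsto_lowerbound)
    show "(\<lambda>k. \<Sum>s | s \<le> p * G \<and> \<not> p dvd s. \<pi> n (p * \<nu> k) p s) \<longlonglongrightarrow> (\<Sum>s | s \<le> p * G \<and> \<not> p dvd s. wp n s)"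
      by (intro tendsto_sum wp)
    show "eventually (\<lambda>k. \<delta> \<le> (\<Sum>s | s \<le> p * G \<and> \<not> p dvd s. \<pi> n (p * \<nu> k) p s)) sequentially"
      by (rule eventually_compose_filterlim[OF notp[OF that] ptop])
  qed simp
  \<comment> \<open>The second extraction, now along the levels in \<open>good\<close>.\<close>
  define \<gamma> where "\<gamma> = enumerate good"
  have \<gamma>: "strict_mono \<gamma>" "\<And>j. \<gamma> j \<in> good"
    unfolding \<gamma>_def using strict_mono_enumerate[OF good] enumerate_in_set[OF good] by auto
  define \<phi>' :: "nat \<Rightarrow> nat \<times> nat \<Rightarrow> real" where
    "\<phi>' = (\<lambda>j (i, s). if i = 0 then w1 (\<gamma> j) s else if i = 1 then wp (\<gamma> j) s else wq (\<gamma> j) s)"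
  have \<phi>'1: "norm (\<phi>' j x) \<le> 1" for j x
    unfolding \<phi>'_def using w1b wpb wqb by (auto split: prod.splits)
  obtain k1 :: "nat \<Rightarrow> nat" where k1: "strict_mono k1" "\<And>x. x \<in> UNIV \<Longrightarrow> \<exists>l. (\<lambda>n. \<phi>' (k1 n) x) \<longlonglongrightarrow> l"
    by (rule function_convergent_subsequence[of "UNIV :: (nat \<times> nat) set" \<phi>' 1]) (use \<phi>'1 in auto)
  define nj where "nj = (\<lambda>j. \<gamma> (k1 j))"
  have njs: "strict_mono nj" using strict_mono_o[OF \<gamma>(1) k1(1)] by (simp add: nj_def o_def)
  have njtop: "filterlim nj at_top sequentially" by (rule filterlim_subseq[OF njs])
  have njg: "nj j \<in> good" for j by (simp add: nj_def \<gamma>(2))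
  obtain P1 where P1: "\<And>s. (\<lambda>j. w1 (nj j) s) \<longlonglongrightarrow> P1 s"
  proof -
    have "\<forall>s. \<exists>l. (\<lambda>j. w1 (nj j) s) \<longlonglongrightarrow> l" using k1(2)[of "(0, _)"] by (auto simp: \<phi>'_def nj_def)
    then show ?thesis using that by metis
  qed
  obtain Pp where Pp: "\<And>s. (\<lambda>j. wp (nj j) s) \<longlonglongrightarrow> Pp s"
  proof -
    have "\<forall>s. \<exists>l. (\<lambda>j. wp (nj j) s) \<longlonglongrightarrow> l" using k1(2)[of "(1, _)"] by (auto simp: \<phi>'_def nj_def)
    then show ?thesis using that by metis
  qed
  obtain Pq where Pq: "\<And>s. (\<lambda>j. wq (nj j) s) \<longlonglongrightarrow> Pq s"
  proof -
    have "\<forall>s. \<exists>l. (\<lambda>j. wq (nj j) s) \<longlonglongrightarrow> l" using k1(2)[of "(2, _)"] by (auto simp: \<phi>'_def nj_def)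
    then show ?thesis using that by metis
  qed
  have P1b: "0 \<le> P1 s" "P1 s \<le> 1 - \<delta>" for s
    by (rule tendsto_lowerbound[OF P1], use w1b in auto)+ (rule tendsto_upperbound[OF P1], use w1d[OF njg] in auto)
  have P1s: "(\<Sum>s\<le>1 * G. P1 s) = 1"
  proof (rule LIMSEQ_unique)
    show "(\<lambda>j. \<Sum>s\<le>1 * G. w1 (nj j) s) \<longlonglongrightarrow> (\<Sum>s\<le>1 * G. P1 s)" by (intro tendsto_sum P1)
    show "(\<lambda>j. \<Sum>s\<le>1 * G. w1 (nj j) s) \<longlonglongrightarrow> 1" unfolding w1s by simp
  qed
  have "(\<Sum>s | s \<le> p * G \<and> \<not> p dvd s. Pp s) \<ge> \<delta>"
  proof (rule tendsto_lowerbound)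
    show "(\<lambda>j. \<Sum>s | s \<le> p * G \<and> \<not> p dvd s. wp (nj j) s) \<longlonglongrightarrow> (\<Sum>s | s \<le> p * G \<and> \<not> p dvd s. Pp s)"
      by (intro tendsto_sum Pp)
    show "eventually (\<lambda>j. \<delta> \<le> (\<Sum>s | s \<le> p * G \<and> \<not> p dvd s. wp (nj j) s)) sequentially"
      using wpd[OF njg] by simp
  qed simp
  then have "(\<Sum>s | s \<le> p * G \<and> \<not> p dvd s. Pp s) \<noteq> 0" using \<delta> by simp
  then obtain s0 where s0: "s0 \<le> p * G" "\<not> p dvd s0" "Pp s0 \<noteq> 0"
    by (metis (mono_tags, lifting) mem_Collect_eq sum.neutral)
  have ac1: "(\<lambda>j. cp (t + int (1 * h (nj j)))) \<longlonglongrightarrow> (\<Sum>s\<le>1 * G. of_real (P1 s) * cp (t - int s))" for t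
    by (rule autocorrelation_limit[where \<pi> = "\<lambda>n N s. \<pi> n N 1 s", OF ptop njtop cp w1 P1 err])
  have acp: "(\<lambda>j. cp (t + int (p * h (nj j)))) \<longlonglongrightarrow> (\<Sum>s\<le>p * G. of_real (Pp s) * cp (t - int s))" for t
    by (rule autocorrelation_limit[where \<pi> = "\<lambda>n N s. \<pi> n N p s", OF ptop njtop cp wp Pp err])
  have acq: "(\<lambda>j. cq (t + int (q * h (nj j)))) \<longlonglongrightarrow> (\<Sum>s\<le>q * G. of_real (Pq s) * cq (t - int s))" for t
    by (rule autocorrelation_limit[where \<pi> = "\<lambda>n N s. \<pi> n N q s", OF qtop njtop cq wq Pq err])
  have acq': "(\<lambda>j. cq (t + - int (q * h (nj j)))) \<longlonglongrightarrow> (\<Sum>s\<le>q * G. of_real (Pq s) * cq (t + int s))" for t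
  proof -
    have sym: "cnj (cq (- x)) = cq x" for x
      using autocorrelation_symmetric[of f "\<lambda>k. q * \<nu> k" cq "- x", OF f qtop cq] by simp
    have "(\<lambda>j. cnj (cq (- t + int (q * h (nj j))))) \<longlonglongrightarrow> cnj (\<Sum>s\<le>q * G. of_real (Pq s) * cq (- t - int s))"
      by (intro tendsto_cnj acq)
    moreover have "cnj (cq (- t + x)) = cq (t + - x)" "cnj (cq (- t - x)) = cq (t + x)" for x
      using sym[of "t - x"] sym[of "t + x"] by simp_all
    ultimately show ?thesis by (simp del: of_nat_mult)
  qed
  have T1: "(\<lambda>j. D (a + int (1 * h (nj j))) b) \<longlonglongrightarrow> (\<Sum>s\<le>1 * G. of_real (P1 s) * D (a + - int s) b)"
    and Tp: "(\<lambda>j. D (a + int (p * h (nj j))) b) \<longlonglongrightarrow> (\<Sum>s\<le>p * G. of_real (Pp s) * D (a + - int s) b)" for a b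
  proof -
    define v where "v = (\<lambda>y. if int p dvd y then cnj (f (int q * (y div int p) + b)) else 0)"
    have v: "norm (v y) \<le> 1" for y by (simp add: v_def f)
    have V: "(\<lambda>k. avg (p * \<nu> k) (\<lambda>y. f (y + x) * v y)) \<longlonglongrightarrow> D x b / of_nat p" for x
    proof -
      have "avg (p * \<nu> k) (\<lambda>y. f (y + x) * v y) = avg (\<nu> k) (\<lambda>m. f (int p * m + x) * cnj (f (int q * m + b))) / of_nat p" for k
        unfolding v_def by (rule avg_dilate[OF p0])
      then show ?thesis using tendsto_divide[OF D[of x b] tendsto_const[of "of_nat p"]] p0 by simp
    qed
    have resc: "(\<lambda>j. D (a + \<kappa> j) b) \<longlonglongrightarrow> (\<Sum>s\<in>S. of_real (P s) * D (a + \<sigma> s) b)"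
      if "(\<lambda>j. D (a + \<kappa> j) b / of_nat p) \<longlonglongrightarrow> (\<Sum>s\<in>S. of_real (P s) * (D (a + \<sigma> s) b / of_nat p))"
      for \<kappa> :: "nat \<Rightarrow> int" and S :: "nat set" and P :: "nat \<Rightarrow> real" and \<sigma> :: "nat \<Rightarrow> int"
    proof -
      have "(\<lambda>j. of_nat p * (D (a + \<kappa> j) b / of_nat p)) \<longlonglongrightarrow> of_nat p * (\<Sum>s\<in>S. of_real (P s) * (D (a + \<sigma> s) b / of_nat p))"
        by (intro tendsto_mult tendsto_const that)
      then show ?thesis using p0 by (simp add: sum_distrib_left)
    qed
    show "(\<lambda>j. D (a + int (1 * h (nj j))) b) \<longlonglongrightarrow> (\<Sum>s\<le>1 * G. of_real (P1 s) * D (a + - int s) b)"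
      by (rule resc, rule weak_limit_transfer[where v = v and c = cp and V = "\<lambda>x. D x b / of_nat p", OF f v ptop cp V])
        (use ac1 in simp_all)
    show "(\<lambda>j. D (a + int (p * h (nj j))) b) \<longlonglongrightarrow> (\<Sum>s\<le>p * G. of_real (Pp s) * D (a + - int s) b)"
      by (rule resc, rule weak_limit_transfer[where v = v and c = cp and V = "\<lambda>x. D x b / of_nat p", OF f v ptop cp V])
        (use acp in simp_all)
  qed
  \<comment> \<open>The shift acts on the conjugated factor and backwards, so the spacers appear as
    b + s.\<close>
  have Tq: "(\<lambda>j. D a (b + - int (q * h (nj j)))) \<longlonglongrightarrow> (\<Sum>s\<le>q * G. of_real (Pq s) * D a (b + int s))" for a b
  proof -
    define v where "v = (\<lambda>y. if int q dvd y then cnj (f (int p * (y div int q) + a)) else 0)"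
    have v: "norm (v y) \<le> 1" for y by (simp add: v_def f)
    have V: "(\<lambda>k. avg (q * \<nu> k) (\<lambda>y. f (y + x) * v y)) \<longlonglongrightarrow> cnj (D a x) / of_nat q" for x
    proof -
      have 1: "avg (q * \<nu> k) (\<lambda>y. f (y + x) * v y) = avg (\<nu> k) (\<lambda>m. f (int q * m + x) * cnj (f (int p * m + a))) / of_nat q" for k
        unfolding v_def by (rule avg_dilate[OF q0])
      have 2: "avg (\<nu> k) (\<lambda>m. f (int q * m + x) * cnj (f (int p * m + a))) = cnj (avg (\<nu> k) (\<lambda>m. f (int p * m + a) * cnj (f (int q * m + x))))" for k
        unfolding avg_cnj[symmetric] by (simp add: mult.commute)
      show ?thesis unfolding 1 2 using tendsto_divide[OF tendsto_cnj[OF D[of a x]] tendsto_const[of "of_nat q"]] q0 by simp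
    qed
    have "(\<lambda>j. cnj (D a (b + - int (q * h (nj j)))) / of_nat q) \<longlonglongrightarrow> (\<Sum>s\<le>q * G. of_real (Pq s) * (cnj (D a (b + int s)) / of_nat q))"
      by (rule weak_limit_transfer[where v = v and c = cq and V = "\<lambda>x. cnj (D a x) / of_nat q", OF f v qtop cq V])
        (use acq' in simp_all)
    then have "(\<lambda>j. of_nat q * cnj (cnj (D a (b + - int (q * h (nj j)))) / of_nat q)) \<longlonglongrightarrow> of_nat q * cnj (\<Sum>s\<le>q * G. of_real (Pq s) * (cnj (D a (b + int s)) / of_nat q))"
      by (intro tendsto_mult tendsto_const tendsto_cnj)
    then show ?thesis using q0 by (simp add: sum_distrib_left)
  qed
  have inv: "D (a + int p) (b + int q) = D a b" for a b
  proof -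
    have "(\<lambda>k. avg (\<nu> k) (\<lambda>m. (\<lambda>m. f (int p * m + a) * cnj (f (int q * m + b))) (m + 1))) \<longlonglongrightarrow> D a b"
      by (rule avg_shift_tendsto[where B = 1, OF _ \<nu>top D]) (simp add: norm_mult mult_le_one f)
    then have "(\<lambda>k. avg (\<nu> k) (\<lambda>m. f (int p * m + (a + int p)) * cnj (f (int q * m + (b + int q))))) \<longlonglongrightarrow> D a b"
      by (simp add: algebra_simps)
    then show ?thesis using LIMSEQ_unique[OF D] by blast
  qed
  have cop: "coprime p q" using pq by (simp add: primes_coprime)
  obtain C where C: "\<And>a b. D a b = C (int q * a - int p * b)"
    by (rule bilinear_correlation_function[of p q D, OF cop inv]) blast
  have ab: "\<exists>a b. int q * a - int p * b = t" for t
  proof -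
    obtain u v where uv: "u * int q + v * int p = 1"
      using bezout_int[of "int q" "int p"] cop by (auto simp: coprime_commute)
    have "int q * (t * u) - int p * (- t * v) = t * (u * int q + v * int p)" by (simp add: algebra_simps)
    then show ?thesis using uv by (intro exI[of _ "t * u"] exI[of _ "- t * v"]) simp
  qed
  have bd: "norm (C t) \<le> 1" for t
  proof -
    obtain a b where t: "int q * a - int p * b = t" using ab by blast
    have "norm (D a b) \<le> 1"
    proof (rule tendsto_upperbound[OF tendsto_norm[OF D]])
      show "\<forall>\<^sub>F k in sequentially. norm (avg (\<nu> k) (\<lambda>m. f (int p * m + a) * cnj (f (int q * m + b)))) \<le> 1"
        by (intro always_eventually allI norm_avg_le) (simp add: norm_mult mult_le_one f)
    qed simp
    then show ?thesis using C[of a b] t by simp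
  qed
  have C1: "(\<lambda>j. C (t + int (q * h (nj j)))) \<longlonglongrightarrow> (\<Sum>s\<le>1 * G. of_real (P1 s) * C (t - int (q * s)))" for t
  proof -
    obtain a b where t: "t = int q * a - int p * b" using ab by metis
    show ?thesis using T1[of a b] unfolding C t by (simp add: algebra_simps)
  qed
  \<comment> \<open>Moving a forward by p copies or b backward by q copies changes q a - p b by the
    same amount p q h; hence the two expansions have a common limit.\<close>
  have Cp: "(\<lambda>j. C (t + int (p * q * h (nj j)))) \<longlonglongrightarrow> (\<Sum>s\<le>p * G. of_real (Pp s) * C (t - int (q * s)))" for t
  proof -
    obtain a b where t: "t = int q * a - int p * b" using ab by metis
    show ?thesis using Tp[of a b] unfolding C t by (simp add: algebra_simps)
  qed
  have Cq: "(\<lambda>j. C (t + int (p * q * h (nj j)))) \<longlonglongrightarrow> (\<Sum>s\<le>q * G. of_real (Pq s) * C (t - int (p * s)))" for t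
  proof -
    obtain a b where t: "t = int q * a - int p * b" using ab by metis
    show ?thesis using Tq[of a b] unfolding C t by (simp add: algebra_simps)
  qed
  have rec: "(\<Sum>s\<le>p * G. of_real (Pp s) * C (t - int (q * s))) = (\<Sum>s\<le>q * G. of_real (Pq s) * C (t - int (p * s)))" for t
    by (rule LIMSEQ_unique[OF Cp Cq])
  obtain Q :: "complex poly" where Q: "Q \<noteq> 0" "\<And>t. (\<Sum>i\<le>degree Q. poly.coeff Q i * C (t + int i)) = 0"
    by (rule recurrence_polynomial[OF pq rec s0]) blast
  obtain s1 s2 where s12: "s1 \<in> {..1 * G}" "s2 \<in> {..1 * G}" "s1 < s2" "P1 s1 > 0" "P1 s2 > 0"
  proof (rule two_positive_weights[OF _ P1s])
    show "P1 s < 1" for s using P1b(2)[of s] \<delta> by linarith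
  qed (use P1b in auto)
  have dvd: "(s2 - s1) dvd M" using s12 by (intro M) auto
  have per: "C (t + int (q * M)) = C t" for t
    by (rule bounded_recurrence_periodic[OF Q bd _ _ P1s s12 dvd C1]) (use P1b in auto)
  \<comment> \<open>The limit is C 0 - C (q M) - C (- p M) + C (q M - p M), and the terms cancel in
    pairs by the period q M.\<close>
  have "(\<lambda>k. b (\<nu> k)) \<longlonglongrightarrow> (D 0 0 - D (int M) 0) - (D 0 (int M) - D (int M) (int M))"
  proof -
    have "(\<lambda>k. (avg (\<nu> k) (\<lambda>m. f (int p * m + 0) * cnj (f (int q * m + 0))) - avg (\<nu> k) (\<lambda>m. f (int p * m + int M) * cnj (f (int q * m + 0))))
       - (avg (\<nu> k) (\<lambda>m. f (int p * m + 0) * cnj (f (int q * m + int M))) - avg (\<nu> k) (\<lambda>m. f (int p * m + int M) * cnj (f (int q * m + int M)))))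
       \<longlonglongrightarrow> (D 0 0 - D (int M) 0) - (D 0 (int M) - D (int M) (int M))"
      by (intro tendsto_diff D)
    then show ?thesis unfolding b_def g_def avg_diff[symmetric] by (simp add: algebra_simps)
  qed
  moreover have "(D 0 0 - D (int M) 0) - (D 0 (int M) - D (int M) (int M)) = 0"
    using per[of 0] per[of "- int p * int M"] unfolding C by (simp add: algebra_simps)
  ultimately have "(\<lambda>k. norm (b (\<nu> k))) \<longlonglongrightarrow> 0" by (simp add: tendsto_norm_zero)
  then have "e \<le> 0" by (rule tendsto_lowerbound) (use \<nu>0(2) in \<open>auto simp: \<nu>_def\<close>)
  then show False using e(1) by simp
qed

section \<open>Positions of blocks in the rank-one word\<close>

text \<open>\<open>gap w a n i\<close> is the number of spacers after the \<open>i\<close>-th (\<open>i \<ge> 1\<close>) copy of the \<open>n\<close>-th word in the infinite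
  rank-one word; it is only meaningful if all \<open>w n \<ge> 2\<close>.\<close>
function gap :: "(nat \<Rightarrow> nat) \<Rightarrow> (nat \<Rightarrow> nat \<Rightarrow> nat) \<Rightarrow> nat \<Rightarrow> nat \<Rightarrow> nat" where
  "gap w a n i = (if w n < 2 \<or> i = 0 then 0 else if i mod w n \<noteq> 0 then a n (i mod w n)
     else gap w a (Suc n) (i div w n))"
  by pat_completeness auto
termination
proof (relation "Wellfounded.measure (\<lambda>(w, a, n, i). i)")
  fix w :: "nat \<Rightarrow> nat" and a :: "nat \<Rightarrow> nat \<Rightarrow> nat" and n i :: nat
  assume "\<not> (w n < 2 \<or> i = 0)"
  then have "i div w n < i" by (intro div_less_dividend) auto
  then show "((w, a, Suc n, i div w n), (w, a, n, i)) \<in> Wellfounded.measure (\<lambda>(w, a, n, i). i)" by simp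
qed simp

declare gap.simps [simp del]

text \<open>One constant \<open>G\<close> bounds the numbers of copies and of spacers. Levels with a
  single copy, which repeat the previous word, are removed before the locale is entered.\<close>

locale tower =
  fixes w :: "nat \<Rightarrow> nat" and a :: "nat \<Rightarrow> nat \<Rightarrow> nat" and G :: nat
  assumes w2: "\<And>n. w n \<ge> 2" and wG: "\<And>n. w n \<le> G"
    and aG: "\<And>n j. 1 \<le> j \<Longrightarrow> j < w n \<Longrightarrow> a n j \<le> G"
begin

abbreviation "H \<equiv> rank_one_height w a"
abbreviation "g \<equiv> gap w a"

text \<open>The starting position of copy number i, counted from 0, of the n-th word in the infinite
  word.\<close>

definition pos :: "nat \<Rightarrow> nat \<Rightarrow> nat" where "pos n i = (\<Sum>j=1..i. H n + g n j)"

lemma gap_nondiv: "1 \<le> c \<Longrightarrow> c < w n \<Longrightarrow> g n (w n * i + c) = a n c"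
  using w2[of n] by (subst gap.simps) auto

lemma gap_mult: "i \<ge> 1 \<Longrightarrow> g n (w n * i) = g (Suc n) i"
  using w2[of n] by (subst gap.simps) auto

lemma gap_le: "g n i \<le> G"
proof (induction i arbitrary: n rule: less_induct)
  case (less i)
  show ?case
  proof (cases "i = 0 \<or> i mod w n \<noteq> 0")
    case True
    have "i mod w n < w n" using w2[of n] by simp
    then show ?thesis using True aG[of "i mod w n" n] by (subst gap.simps) auto
  next
    case False
    then have "i div w n < i" using w2[of n] by (intro div_less_dividend) auto
    then show ?thesis using False less[of "i div w n" "Suc n"] by (subst gap.simps) auto
  qed
qed

lemma pos_0 [simp]: "pos n 0 = 0" by (simp add: pos_def)

lemma pos_Suc: "pos n (Suc i) = pos n i + H n + g n (Suc i)" by (simp add: pos_def)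

lemma pos_add: "pos n (i + r) = pos n i + r * H n + (\<Sum>j=1..r. g n (i + j))"
  by (induction r) (auto simp: pos_Suc)

lemma pos_le_add: "pos n (i + r) \<le> pos n i + r * (H n + G)"
proof (induction r)
  case (Suc r)
  then show ?case using gap_le[of n "Suc (i + r)"] by (simp add: pos_Suc)
qed simp

lemma pos_ge_add: "pos n i + r * H n \<le> pos n (i + r)"
  by (simp add: pos_add)

lemma pos_mono: "i \<le> j \<Longrightarrow> pos n i \<le> pos n j"
  using pos_ge_add[of n i "j - i"] by simp

lemma pos_less: "i < j \<Longrightarrow> pos n i + H n \<le> pos n j"
  using pos_mono[of "Suc i" j n] by (simp add: pos_Suc)

lemma sum_gap_block: "(\<Sum>c=1..w n - 1. H n + g n (w n * i + c)) + H n = H (Suc n)"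
proof -
  have "(\<Sum>c=1..w n - 1. H n + g n (w n * i + c)) = (\<Sum>c=1..w n - 1. H n + a n c)"
    by (intro sum.cong refl) (auto simp: gap_nondiv)
  moreover obtain v where "w n = Suc v" using w2[of n] by (cases "w n") auto
  ultimately show ?thesis by (simp add: sum.distrib)
qed

lemma pos_block: "pos n (w n * i + w n) = pos n (w n * i) + H (Suc n) + g n (w n * i + w n)"
proof -
  define v where "v = w n - 1"
  have v: "w n = Suc v" using w2[of n] by (simp add: v_def)
  have aux: "pos n (m + k) = pos n m + (\<Sum>c=1..k. H n + g n (m + c))" for m k
    by (induction k) (simp_all add: pos_Suc)
  have "pos n (w n * i + w n) = pos n (w n * i + v) + H n + g n (w n * i + w n)"
    using pos_Suc[of n "w n * i + v"] v by simp
  also have "\<dots> = pos n (w n * i) + ((\<Sum>c=1..v. H n + g n (w n * i + c)) + H n) + g n (w n * i + w n)"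
    unfolding aux by simp
  also have "(\<Sum>c=1..v. H n + g n (w n * i + c)) + H n = H (Suc n)"
    unfolding v_def by (rule sum_gap_block)
  finally show ?thesis .
qed

lemma pos_mult: "pos (Suc n) i = pos n (w n * i)"
proof (induction i)
  case (Suc i)
  have "pos n (w n * Suc i) = pos n (w n * i) + H (Suc n) + g n (w n * i + w n)"
    using pos_block[of n i] by (simp add: add.commute)
  also have "g n (w n * i + w n) = g (Suc n) (Suc i)" using gap_mult[of "Suc i" n] by (simp add: add.commute)
  finally show ?case using Suc by (simp add: pos_Suc)
qed simp

lemma H_ge_1: "H n \<ge> 1"
proof (induction n)
  case (Suc n)
  then have "1 \<le> w n * H n" using w2[of n] by (simp add: Suc_le_eq)
  also have "\<dots> \<le> H (Suc n)" by simp
  finally show ?case .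
qed simp

lemma H_ge_mult: "w n * H n \<le> H (Suc n)" by simp

lemma H_ge_pow: "2 ^ n \<le> H n"
proof (induction n)
  case (Suc n)
  have "2 * 2 ^ n \<le> w n * H n" using Suc w2 by (intro mult_mono) auto
  then show ?case using H_ge_mult[of n] by simp
qed simp

lemma H_tendsto: "(\<lambda>n. c / real (H n)) \<longlonglongrightarrow> 0"
proof -
  have "filterlim H at_top sequentially"
  proof (rule filterlim_at_top_mono)
    show "filterlim (\<lambda>n. 2 ^ n :: nat) at_top sequentially"
      by (rule filterlim_subseq) (simp add: strict_mono_def)
    show "\<forall>\<^sub>F n in sequentially. 2 ^ n \<le> H n" using H_ge_pow by simp
  qed
  then show ?thesis by (rule filterlim_at_top_inverse_real)
qed

text \<open>The number of copies of the n-th word inside the (n + J)-th.\<close>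

definition W :: "nat \<Rightarrow> nat \<Rightarrow> nat" where "W n J = (\<Prod>j<J. w (n + j))"

lemma W_Suc: "W n (Suc J) = w n * W (Suc n) J"
  unfolding W_def by (subst prod.lessThan_Suc_shift) simp

lemma W_ge: "2 ^ J \<le> W n J"
  unfolding W_def using w2 prod_mono[of "{..<J}" "\<lambda>_. 2" "\<lambda>j. w (n + j)"] by simp

lemma W_le: "W n J \<le> G ^ J"
  unfolding W_def using wG prod_mono[of "{..<J}" "\<lambda>j. w (n + j)" "\<lambda>_. G"] by simp

lemma W_mono:
  assumes "J \<le> J'"
  shows "W n J \<le> W n J'"
proof -
  have "{..<J'} = {..<J} \<union> {J..<J'}" using assms by auto
  then have "W n J' = W n J * (\<Prod>j=J..<J'. w (n + j))" unfolding W_def by (simp add: prod.union_disjoint ivl_disj_int)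
  moreover have "(\<Prod>j=J..<J'. w (n + j)) \<ge> 1" by (intro prod_ge_1) (use w2 in \<open>auto intro: order_trans[OF _ w2]\<close>)
  ultimately show ?thesis by simp
qed

text \<open>These indices belong to gaps inside a single copy of the (n + J)-th word, and all its
  copies are equal.\<close>

lemma gap_W_periodic: "0 < c \<Longrightarrow> c < W n J \<Longrightarrow> g n (W n J * k + c) = g n c"
proof (induction J arbitrary: n c)
  case 0
  then show ?case by (simp add: W_def)
next
  case (Suc J)
  have w0: "w n > 0" using w2[of n] by simp
  define d where "d = c mod w n"
  define i where "i = c div w n"
  have c: "c = w n * i + d" by (simp add: d_def i_def)
  have dw: "d < w n" using w0 by (simp add: d_def)
  have e: "W n (Suc J) * k + c = w n * (W (Suc n) J * k + i) + d" unfolding W_Suc by (subst c) (simp add: algebra_simps)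
  show ?case
  proof (cases "d = 0")
    case False
    then show ?thesis unfolding e using gap_nondiv[of d n] dw c by simp
  next
    case True
    then have i0: "i > 0" using Suc.prems(1) c by (cases i) auto
    have iW: "i < W (Suc n) J" using Suc.prems(2) w0 c True unfolding W_Suc by simp
    have "g n (W n (Suc J) * k + c) = g (Suc n) (W (Suc n) J * k + i)"
      unfolding e True using gap_mult[of "W (Suc n) J * k + i" n] i0 by simp
    also have "\<dots> = g (Suc n) i" by (rule Suc.IH[OF i0 iW])
    also have "\<dots> = g n c" using gap_mult[of i n] i0 c True by simp
    finally show ?thesis .
  qed
qed

text \<open>The spacers met between the start of copy i and the start of copy i + r.\<close>

definition S :: "nat \<Rightarrow> nat \<Rightarrow> nat \<Rightarrow> nat" where "S n r i = (\<Sum>j=1..r. g n (i + j))"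

lemma S_le: "S n r i \<le> r * G"
  unfolding S_def using sum_bounded_above[of "{1..r}" "\<lambda>j. g n (i + j)" G] gap_le by simp

lemma S_W_periodic:
  assumes "i + r < W n J"
  shows "S n r (W n J * k + i) = S n r i"
  unfolding S_def
proof (rule sum.cong[OF refl])
  fix j assume "j \<in> {1..r}"
  then show "g n (W n J * k + i + j) = g n (i + j)"
    using gap_W_periodic[of "i + j" n J k] assms by (simp add: add.assoc)
qed

text \<open>The indices are those of the gaps inside the (n + 2)-th word. A single level would not
  do: for w n = 2 the (n + 1)-th word has one gap only, whereas two levels also compare it with gaps
  inherited from the next level.\<close>

definition good :: "nat \<Rightarrow> bool" where
  "good n \<longleftrightarrow> (\<exists>i i'. 1 \<le> i \<and> i < W n 2 \<and> 1 \<le> i' \<and> i' < W n 2 \<and> g n i \<noteq> g n i')"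

text \<open>Divisibility of all sums of \<open>p\<close> consecutive gaps by \<open>p > G\<close> makes the gaps \<open>p\<close>-periodic; they are also constant on the
  nonzero residues modulo \<open>w n\<close>, which is coprime to \<open>p\<close>.\<close>
lemma good_imp_not_dvd:
  assumes good: "good n" and p: "prime p" "p > G" and J: "J \<ge> 2" "W n J > p * G + 2 * p + 1"
  shows "\<exists>i. i + p < W n J \<and> \<not> p dvd S n p i"
proof (rule ccontr)
  assume "\<not> ?thesis"
  then have dvd: "p dvd S n p i" if "i + p < W n J" for i using that by blast
  \<comment> \<open>The sums started at k + 1 and at k differ by two end gaps; this difference is
    divisible by p and smaller than p.\<close>
  have per: "g n (i + p) = g n i" if i: "1 \<le> i" "i + p < W n J" for i
  proof -
    obtain k where k: "i = Suc k" using i(1) by (cases i) auto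
    have id: "S n p (Suc k) + g n (Suc k) = S n p k + g n (Suc k + p)"
    proof -
      have "(\<Sum>j=1..m. g n (Suc k + j)) + g n (Suc k) = (\<Sum>j=1..m. g n (k + j)) + g n (Suc k + m)" for m
        by (induction m) simp_all
      then show ?thesis by (simp add: S_def)
    qed
    have "int p dvd int (S n p (Suc k)) - int (S n p k)"
      using dvd[of "Suc k"] dvd[of k] i k by (intro dvd_diff) (auto simp: int_dvd_int_iff)
    also have "int (S n p (Suc k)) - int (S n p k) = int (g n (Suc k + p)) - int (g n (Suc k))" using id by linarith
    finally have d: "int p dvd int (g n (Suc k + p)) - int (g n (Suc k))" .
    have "\<bar>int (g n (Suc k + p)) - int (g n (Suc k))\<bar> < int p"
      using gap_le[of n "Suc k + p"] gap_le[of n "Suc k"] p(2) by linarith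
    then have "int (g n (Suc k + p)) - int (g n (Suc k)) = 0" using d zdvd_not_zless dvd_imp_le_int by (metis abs_of_nat linorder_not_le)
    then show ?thesis using k by simp
  qed
  have wp: "coprime p (w n)"
  proof -
    have "\<not> p dvd w n" using wG[of n] p(2) w2[of n] by (auto dest: dvd_imp_le)
    then show ?thesis using p(1) by (simp add: prime_imp_coprime)
  qed
  have pk: "g n (1 + k * p) = g n 1" if "1 + k * p < W n J" for k
    using that
  proof (induction k)
    case (Suc k)
    have "g n ((1 + k * p) + p) = g n (1 + k * p)" by (rule per) (use Suc.prems in auto)
    moreover have e: "1 + Suc k * p = (1 + k * p) + p" using mult_Suc[of k p] by linarith
    moreover have "g n (1 + k * p) = g n 1" by (rule Suc.IH) (use Suc.prems e in linarith)
    ultimately show ?case by (simp only:)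
  qed simp
  \<comment> \<open>Since p is coprime to w n, steps of length p starting at 1 reach every residue
    class modulo w n in fewer than w n <= G steps, and W n J leaves room for them.\<close>
  have acst: "a n c = g n 1" if c: "1 \<le> c" "c < w n" for c
  proof -
    obtain k0 where k0: "[p * k0 = 1] (mod w n)" using cong_solve_coprime_nat[OF wp] by auto
    define k where "k = (k0 * (c - 1)) mod w n"
    have kw: "k < w n" using w2[of n] by (simp add: k_def)
    have "[p * k = p * (k0 * (c - 1))] (mod w n)" unfolding k_def by (simp add: cong_def mod_mult_right_eq)
    also have "p * (k0 * (c - 1)) = p * k0 * (c - 1)" by simp
    also have "[p * k0 * (c - 1) = 1 * (c - 1)] (mod w n)" using k0 by (rule cong_scalar_right)
    finally have "[1 + p * k = 1 + 1 * (c - 1)] (mod w n)" by (rule cong_add[OF cong_refl])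
    then have "(1 + k * p) mod w n = c" using c by (simp add: cong_def mult.commute)
    then have e: "1 + k * p = w n * ((1 + k * p) div w n) + c" by (metis mult_div_mod_eq)
    have "k * p \<le> G * p" using kw wG[of n] by (intro mult_right_mono) auto
    then have "1 + k * p < W n J" using J(2) mult.commute[of p G] by linarith
    then have "g n (1 + k * p) = g n 1" by (rule pk)
    moreover have "g n (1 + k * p) = a n c" by (subst e) (rule gap_nondiv[OF c])
    ultimately show ?thesis by simp
  qed
  have nd: "g n i = g n 1" if "\<not> w n dvd i" for i
  proof -
    have c: "1 \<le> i mod w n" "i mod w n < w n" using that w2[of n] by (auto simp: dvd_eq_mod_eq_0)
    have "g n i = g n (w n * (i div w n) + i mod w n)" by simp
    also have "\<dots> = a n (i mod w n)" by (rule gap_nondiv[OF c])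
    finally show ?thesis using acst[OF c] by simp
  qed
  have ndp: "\<not> w n dvd p"
  proof
    assume "w n dvd p"
    then have "w n dvd 1" using wp by (metis coprime_common_divisor dvd_refl is_unit_gcd)
    then show False using w2[of n] by simp
  qed
  \<comment> \<open>From a multiple of w n a step of p, forwards or near the end backwards, leads to
    a non-multiple without changing the gap.\<close>
  have all: "g n i = g n 1" if i: "1 \<le> i" "i < W n J" for i
  proof (cases "w n dvd i")
    case True
    show ?thesis
    proof (cases "i + p < W n J")
      case T2: True
      have "\<not> w n dvd i + p" using True ndp by (simp add: dvd_add_right_iff)
      then show ?thesis using nd[of "i + p"] per[OF i(1) T2] by simp
    next
      case False
      then have ip: "i \<ge> p + 1" using J(2) by linarith
      have "\<not> w n dvd i - p" using True ndp ip by (metis dvd_diffD1 less_imp_le_nat Suc_eq_plus1 Suc_le_lessD)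
      then have "g n (i - p) = g n 1" by (rule nd)
      moreover have "g n ((i - p) + p) = g n (i - p)" by (rule per) (use ip i in auto)
      ultimately show ?thesis using ip by simp
    qed
  qed (rule nd)
  have "W n 2 \<le> W n J" by (rule W_mono[OF J(1)])
  then have "g n i = g n 1" if "1 \<le> i" "i < W n 2" for i using all that by (meson order_less_le_trans)
  then show False using good unfolding good_def by metis
qed

text \<open>The gap at index w n is the first gap of the next level and still lies in the range
  where level n is constant, so the constants of consecutive levels agree. Dividing out w n reduces
  every index to this range at some level.\<close>

lemma not_good_gap_const:
  assumes ng: "\<And>n. n \<ge> n0 \<Longrightarrow> \<not> good n" and n: "n \<ge> n0" and i: "i \<ge> 1"
  shows "g n i = g n0 1"
proof -
  have W2: "W n 2 = w n * w (Suc n)" for n by (simp add: W_def numeral_2_eq_2)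
  have c: "g n i = g n 1" if "n \<ge> n0" "1 \<le> i" "i < W n 2" for n i
  proof -
    have "1 < W n 2" using W_ge[of 2 n] by simp
    then show ?thesis using ng[OF that(1)] that unfolding good_def by (metis order_refl)
  qed
  have wW: "w n < W n 2" for n unfolding W2 using w2[of n] w2[of "Suc n"] by simp
  have lv: "g (Suc n) 1 = g n 1" if "n \<ge> n0" for n
  proof -
    have "g n (w n * 1) = g (Suc n) 1" by (rule gap_mult) simp
    moreover have "g n (w n) = g n 1" by (rule c[OF that _ wW]) (use w2[of n] in simp)
    ultimately show ?thesis by simp
  qed
  have lv0: "g n 1 = g n0 1" if "n \<ge> n0" for n using that
  proof (induction n rule: dec_induct)
    case (step m)
    then show ?case using lv[of m] by simp
  qed simp
  show ?thesis using n i
  proof (induction i arbitrary: n rule: less_induct)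
    case (less i)
    show ?case
    proof (cases "w n dvd i")
      case True
      then obtain k where k: "i = w n * k" by auto
      have k1: "k \<ge> 1" using k less.prems by (cases k) auto
      have "k < i" using k k1 w2[of n] by simp
      then have "g (Suc n) k = g n0 1" using less.IH[of k "Suc n"] less.prems k1 by simp
      then show ?thesis using gap_mult[OF k1, of n] k by simp
    next
      case False
      have c': "1 \<le> i mod w n" "i mod w n < w n" using False w2[of n] by (auto simp: dvd_eq_mod_eq_0)
      have "g n i = g n (w n * (i div w n) + i mod w n)" by simp
      also have "\<dots> = a n (i mod w n)" by (rule gap_nondiv[OF c'])
      also have "\<dots> = g n (w n * 0 + i mod w n)" by (rule gap_nondiv[OF c', symmetric])
      also have "\<dots> = g n 1" using c[OF less.prems(1), of "i mod w n"] c' wW[of n] by simp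
      finally show ?thesis using lv0[OF less.prems(1)] by simp
    qed
  qed
qed

end

section \<open>Frequencies of spacer numbers in a window\<close>

lemma card_residue_class_ge:
  assumes "i0 < W" "\<And>k :: nat. P (W * k + i0)"
  shows "c div W \<le> card {i \<in> {lo..<lo + c}. P i}"
proof -
  \<comment> \<open>The least k with W * k + i0 >= lo, as a quotient rounded up.\<close>
  define m0 where "m0 = (lo + W - 1 - i0) div W"
  have m1: "W * m0 + i0 \<le> lo + W - 1"
    using assms(1) times_div_less_eq_dividend[of W "lo + W - 1 - i0"] unfolding m0_def by linarith
  have m2: "lo \<le> W * m0 + i0"
  proof -
    have "lo + W - 1 - i0 < W * m0 + W"
      unfolding m0_def using assms(1) by (metis dividend_less_times_div gr_implies_not0 neq0_conv add.commute)
    then show ?thesis using assms(1) by linarith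
  qed
  have "(\<lambda>k. W * (m0 + k) + i0) ` {..<c div W} \<subseteq> {i \<in> {lo..<lo + c}. P i}"
  proof (rule image_subsetI)
    fix k assume "k \<in> {..<c div W}"
    then have "Suc k \<le> c div W" by simp
    then have "W * Suc k \<le> W * (c div W)" by (rule mult_le_mono2)
    also have "\<dots> \<le> c" by (rule times_div_less_eq_dividend)
    finally have "W * k + W \<le> c" by simp
    moreover have e: "W * (m0 + k) + i0 = W * m0 + i0 + W * k" by (simp add: algebra_simps)
    ultimately have "lo \<le> W * (m0 + k) + i0 \<and> W * (m0 + k) + i0 < lo + c"
      using m1 m2 assms(1) by linarith
    then show "W * (m0 + k) + i0 \<in> {i \<in> {lo..<lo + c}. P i}" using assms(2) by simp
  qed
  then have "card ((\<lambda>k. W * (m0 + k) + i0) ` {..<c div W}) \<le> card {i \<in> {lo..<lo + c}. P i}"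
    by (intro card_mono) auto
  moreover have "inj_on (\<lambda>k. W * (m0 + k) + i0) {..<c div W}" using assms(1) by (auto intro!: inj_onI)
  ultimately show ?thesis by (simp add: card_image)
qed

lemma real_div_ge_half:
  assumes "W > 0" "W \<le> c"
  shows "real c / (2 * real W) \<le> real (c div W)"
proof -
  have "1 \<le> c div W" using assms by (simp add: Suc_le_eq div_greater_zero_iff)
  then have "W \<le> W * (c div W)" by simp
  moreover have "c < W * (c div W) + W" using assms(1) by (metis dividend_less_times_div add.commute)
  ultimately have "c \<le> 2 * (W * (c div W))" by linarith
  then have "real c \<le> real (2 * (W * (c div W)))" by (rule of_nat_mono)
  then show ?thesis using assms(1) by (simp add: field_simps)
qed

context tower
begin

lemma G_ge_2: "G \<ge> 2" using w2[of 0] wG[of 0] by linarith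

text \<open>The model is a function of the L letters read from position j of the infinite word:
  inside a copy it depends on the offset only, as long as these letters do not run over the end of
  the copy.\<close>

definition block_local :: "nat \<Rightarrow> (nat \<Rightarrow> complex) \<Rightarrow> bool" where
  "block_local L \<beta> \<longleftrightarrow> (\<forall>n i l. l + L \<le> H n \<longrightarrow> \<beta> (pos n i + l) = \<beta> l) \<and> (\<forall>j. norm (\<beta> j) \<le> 1)"

text \<open>A point of X is known only through its finite blocks, and the place where a block occurs
  in the infinite word may change with its length.\<close>

definition follows :: "(nat \<Rightarrow> complex) \<Rightarrow> (nat \<Rightarrow> complex) \<Rightarrow> bool" where
  "follows f \<beta> \<longleftrightarrow> (\<forall>K. \<exists>v. \<forall>k<K. f k = \<beta> (v + k))"

text \<open>The window from v to v + N has to contain the copies i to i + r and the gap behind the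
  last of them.\<close>

definition blocks :: "nat \<Rightarrow> nat \<Rightarrow> nat \<Rightarrow> nat \<Rightarrow> nat set" where
  "blocks n v N r = {i. v \<le> pos n i \<and> pos n (i + r + 1) \<le> v + N}"

lemma le_pos: "i \<le> pos n i"
proof -
  have "i * 1 \<le> i * H n" using H_ge_1 by (intro mult_le_mono2)
  also have "\<dots> \<le> pos n i" using pos_ge_add[of n 0 i] by simp
  finally show ?thesis by simp
qed

lemma finite_blocks: "finite (blocks n v N r)"
proof (rule finite_subset)
  show "blocks n v N r \<subseteq> {..v + N}"
  proof
    fix i assume "i \<in> blocks n v N r"
    then have "pos n (i + r + 1) \<le> v + N" by (simp add: blocks_def)
    then show "i \<in> {..v + N}" using le_pos[of "i + r + 1" n] by simp
  qed
qed simp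

lemma first_block:
  obtains i0 where "v \<le> pos n i0" "pos n i0 \<le> v + H n + G" "\<And>i. i < i0 \<Longrightarrow> pos n i < v"
proof -
  define i0 where "i0 = (LEAST i. v \<le> pos n i)"
  have a: "v \<le> pos n i0" unfolding i0_def by (rule LeastI[of _ v]) (rule le_pos)
  have b: "pos n i < v" if "i < i0" for i
    using not_less_Least[of i "\<lambda>i. v \<le> pos n i"] that unfolding i0_def by simp
  have "pos n i0 \<le> v + H n + G"
  proof (cases i0)
    case (Suc k)
    then show ?thesis using b[of k] gap_le[of n "Suc k"] by (simp add: pos_Suc)
  qed simp
  then show ?thesis using that a b by blast
qed

lemma blocks_interval: "\<exists>lo. blocks n v N r = {lo..<lo + card (blocks n v N r)}"
proof (cases "blocks n v N r = {}")
  case True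
  then show ?thesis by simp
next
  case False
  define lo where "lo = Min (blocks n v N r)"
  define hi where "hi = Max (blocks n v N r)"
  have lo: "lo \<in> blocks n v N r" unfolding lo_def using False finite_blocks by (rule Min_in[rotated])
  have hi: "hi \<in> blocks n v N r" unfolding hi_def using False finite_blocks by (rule Max_in[rotated])
  have "blocks n v N r = {lo..<Suc hi}"
  proof
    show "blocks n v N r \<subseteq> {lo..<Suc hi}"
      unfolding lo_def hi_def using finite_blocks by (auto intro: Min_le simp: less_Suc_eq_le)
    show "{lo..<Suc hi} \<subseteq> blocks n v N r"
    proof
      fix i assume "i \<in> {lo..<Suc hi}"
      then have "lo \<le> i" "i + r + 1 \<le> hi + r + 1" by auto
      then have "pos n lo \<le> pos n i" "pos n (i + r + 1) \<le> pos n (hi + r + 1)" using pos_mono by blast+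
      then show "i \<in> blocks n v N r" using lo hi unfolding blocks_def by auto
    qed
  qed
  moreover have "lo \<le> Suc hi" using lo unfolding hi_def by (intro le_SucI Max_ge finite_blocks)
  ultimately show ?thesis by (intro exI[of _ lo]) simp
qed

lemma card_blocks_ge: "N div (H n + G) - (r + 1) \<le> card (blocks n v N r)"
proof -
  obtain i0 where i0: "v \<le> pos n i0" "pos n i0 \<le> v + H n + G" by (rule first_block)
  \<comment> \<open>A copy with its gap has at most H n + G letters. One such unit is lost before
    the first complete copy, and r more to the copies that must follow the last admissible
    index.\<close>
  define m where "m = N div (H n + G) - (r + 1)"
  have "{i0..<i0 + m} \<subseteq> blocks n v N r"
  proof
    fix i assume i: "i \<in> {i0..<i0 + m}"
    define d where "d = i - i0"
    have d: "i = i0 + d" "d + r + 2 \<le> N div (H n + G)" using i unfolding d_def m_def by auto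
    have "pos n (i0 + (d + r + 1)) \<le> pos n i0 + (d + r + 1) * (H n + G)" by (rule pos_le_add)
    also have "\<dots> \<le> v + (d + r + 2) * (H n + G)" using i0(2) by (simp add: algebra_simps)
    also have "(d + r + 2) * (H n + G) \<le> (N div (H n + G)) * (H n + G)" by (rule mult_le_mono1[OF d(2)])
    also have "\<dots> \<le> N" by simp
    finally have "pos n (i + r + 1) \<le> v + N" using d(1) by (simp add: add.assoc)
    moreover have "v \<le> pos n i" using i0(1) pos_mono[of i0 i n] d(1) by simp
    ultimately show "i \<in> blocks n v N r" unfolding blocks_def by simp
  qed
  then have "card {i0..<i0 + m} \<le> card (blocks n v N r)" by (rule card_mono[OF finite_blocks])
  then show ?thesis by (simp add: m_def)
qed

lemma eventually_card_blocks_ge: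
  fixes v :: "nat \<Rightarrow> nat"
  shows "eventually (\<lambda>N. c \<le> card (blocks n (v N) N r)) sequentially"
proof (rule eventually_sequentiallyI[of "(c + r + 1) * (H n + G)"])
  fix N assume "(c + r + 1) * (H n + G) \<le> N"
  moreover have "H n + G > 0" using H_ge_1[of n] by simp
  ultimately have "c + r + 1 \<le> N div (H n + G)" by (simp add: less_eq_div_iff_mult_less_eq)
  then show "c \<le> card (blocks n (v N) N r)" using card_blocks_ge[of N n r "v N"] by linarith
qed

text \<open>The empirical distribution of the spacer number over r copies; it is identically 0 if
  the window is too short to contain them.\<close>

definition freq :: "nat \<Rightarrow> nat \<Rightarrow> nat \<Rightarrow> nat \<Rightarrow> nat \<Rightarrow> real" where
  "freq n v N r s = card {i \<in> blocks n v N r. S n r i = s} / card (blocks n v N r)"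

lemma freq_nonneg: "0 \<le> freq n v N r s" by (simp add: freq_def)

lemma freq_sum:
  "(\<Sum>s | s \<le> r * G \<and> Q s. freq n v N r s) = card {i \<in> blocks n v N r. Q (S n r i)} / card (blocks n v N r)"
proof -
  have fin: "finite {i \<in> blocks n v N r. Q (S n r i)}" using finite_blocks by simp
  have "card {i \<in> blocks n v N r. Q (S n r i)} = (\<Sum>s | s \<le> r * G \<and> Q s. card {i \<in> {i \<in> blocks n v N r. Q (S n r i)}. S n r i = s})"
    using sum.group[of "{i \<in> blocks n v N r. Q (S n r i)}" "{s. s \<le> r * G \<and> Q s}" "S n r" "\<lambda>_. 1::nat"] fin S_le
    by (auto simp: image_subset_iff)
  also have "\<dots> = (\<Sum>s | s \<le> r * G \<and> Q s. card {i \<in> blocks n v N r. S n r i = s})"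
    by (intro sum.cong refl arg_cong[of _ _ card]) auto
  finally show ?thesis by (simp add: freq_def sum_divide_distrib)
qed

lemma freq_sum_all: "(\<Sum>s\<le>r * G. freq n v N r s) = (if blocks n v N r = {} then 0 else 1)"
  using freq_sum[where Q = "\<lambda>_. True" and r = r and n = n and v = v and N = N] finite_blocks[of n v N r] by (simp add: atMost_def)

lemma freq_le_1: "freq n v N r s \<le> 1"
proof -
  have "card {i \<in> blocks n v N r. S n r i = s} \<le> card (blocks n v N r)" by (intro card_mono finite_blocks) auto
  then show ?thesis unfolding freq_def by (simp add: divide_le_eq)
qed

text \<open>The pattern at i0 lies inside one copy of the (n + J)-th word and so recurs with period
  W n J. The admissible copies form an interval of indices; rounding its length down to multiples of
  the period costs a factor 2.\<close>

lemma card_S_ge: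
  assumes i: "i0 + r < W n J" and Q: "Q (S n r i0)" and c: "W n J \<le> card (blocks n v N r)"
  shows "1 / (2 * real (W n J)) \<le> card {i \<in> blocks n v N r. Q (S n r i)} / card (blocks n v N r)"
proof -
  obtain lo where lo: "blocks n v N r = {lo..<lo + card (blocks n v N r)}" using blocks_interval by blast
  have W0: "W n J > 0" using i by simp
  have "card (blocks n v N r) div W n J \<le> card {i \<in> {lo..<lo + card (blocks n v N r)}. Q (S n r i)}"
    by (rule card_residue_class_ge[of i0]) (use i Q S_W_periodic[OF i] in auto)
  also have "\<dots> = card {i \<in> blocks n v N r. Q (S n r i)}" using lo by simp
  finally have "real (card (blocks n v N r)) / (2 * real (W n J)) \<le> card {i \<in> blocks n v N r. Q (S n r i)}"
    using real_div_ge_half[OF W0 c] by linarith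
  then show ?thesis using c W0 by (simp add: field_simps)
qed

text \<open>Two different gaps occur inside the (n + 2)-th word, so whatever s is, another value
  recurs with period W n 2. The bound is relaxed to G^J, so that one \<delta>, independent of n,
  serves here and in \<open>freq_not_dvd\<close>.\<close>

lemma freq_nonconst:
  fixes v :: "nat \<Rightarrow> nat"
  assumes "good n" "J \<ge> 2"
  shows "eventually (\<lambda>N. freq n (v N) N 1 s \<le> 1 - 1 / (2 * real (G ^ J))) sequentially"
proof -
  obtain i where i: "1 \<le> i" "i < W n 2" "g n i \<noteq> s"
    using assms(1) unfolding good_def by metis
  have S1: "S n 1 (i - 1) \<noteq> s" and i1: "i - 1 + 1 < W n 2" using i by (simp_all add: S_def)
  have "W n 2 > 0" using i by simp
  have GJ: "W n 2 \<le> G ^ J"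
    using W_le[of n 2] power_increasing[OF assms(2), of G] G_ge_2 by linarith
  from eventually_card_blocks_ge[of "W n 2" n v 1] show ?thesis
  proof eventually_elim
    case (elim N)
    let ?I = "blocks n (v N) N 1"
    have "1 / (2 * real (G ^ J)) \<le> 1 / (2 * real (W n 2))" using GJ \<open>W n 2 > 0\<close> by (intro divide_left_mono mult_pos_pos) (use G_ge_2 in \<open>auto simp del: of_nat_power\<close>)
    also have "\<dots> \<le> card {i \<in> ?I. S n 1 i \<noteq> s} / card ?I"
      by (rule card_S_ge[where Q = "\<lambda>x. x \<noteq> s", OF i1 S1 elim])
    finally have 1: "1 / (2 * real (G ^ J)) \<le> card {i \<in> ?I. S n 1 i \<noteq> s} / card ?I" .
    have "card ?I = card ({i \<in> ?I. S n 1 i \<noteq> s} \<union> {i \<in> ?I. S n 1 i = s})" by (rule arg_cong[of _ _ card]) auto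
    also have "\<dots> = card {i \<in> ?I. S n 1 i \<noteq> s} + card {i \<in> ?I. S n 1 i = s}"
      using finite_blocks by (intro card_Un_disjoint) auto
    finally have 2: "real (card ?I) = real (card {i \<in> ?I. S n 1 i \<noteq> s}) + card {i \<in> ?I. S n 1 i = s}" by linarith
    have "card ?I > 0" using elim \<open>W n 2 > 0\<close> by linarith
    then have "real (card {i \<in> ?I. S n 1 i \<noteq> s}) / card ?I + freq n (v N) N 1 s = 1"
      unfolding freq_def add_divide_distrib[symmetric] 2[symmetric] by simp
    then show ?case using 1 by linarith
  qed
qed

lemma freq_not_dvd:
  fixes v :: "nat \<Rightarrow> nat"
  assumes "good n" "prime p" "p > G" "J \<ge> 2" "2 ^ J > p * G + 2 * p + 1"
  shows "eventually (\<lambda>N. (\<Sum>s | s \<le> p * G \<and> \<not> p dvd s. freq n (v N) N p s) \<ge> 1 / (2 * real (G ^ J))) sequentially"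
proof -
  have "W n J > p * G + 2 * p + 1" using W_ge[of J n] assms(5) by linarith
  then obtain i where i: "i + p < W n J" "\<not> p dvd S n p i" using good_imp_not_dvd[OF assms(1-4)] by blast
  have "W n J > 0" using i by simp
  from eventually_card_blocks_ge[of "W n J" n v p] show ?thesis
  proof eventually_elim
    case (elim N)
    have "1 / (2 * real (G ^ J)) \<le> 1 / (2 * real (W n J))" using W_le[of n J] \<open>W n J > 0\<close> by (intro divide_left_mono mult_pos_pos) (use G_ge_2 in \<open>auto simp del: of_nat_power\<close>)
    also have "\<dots> \<le> card {i \<in> blocks n (v N) N p. \<not> p dvd S n p i} / card (blocks n (v N) N p)"
      by (rule card_S_ge[where Q = "\<lambda>x. \<not> p dvd x", OF i elim])
    finally show ?case unfolding freq_sum .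
  qed
qed

end

section \<open>Correlations over r consecutive copies\<close>

definition extend_zero :: "(nat \<Rightarrow> complex) \<Rightarrow> int \<Rightarrow> complex" where
  "extend_zero f y = (if y < 0 then 0 else f (nat y))"

lemma extend_zero_of_nat [simp]: "extend_zero f (int k) = f k"
  by (simp add: extend_zero_def)

context tower
begin

lemma block_local_shift: "block_local L \<beta> \<Longrightarrow> l + L \<le> H n \<Longrightarrow> \<beta> (pos n i + l) = \<beta> l"
  by (auto simp: block_local_def)

lemma block_local_norm: "block_local L \<beta> \<Longrightarrow> norm (\<beta> j) \<le> 1"
  by (auto simp: block_local_def)

lemma inj_on_block_positions: "inj_on (\<lambda>(i, l). pos n i + l) (UNIV \<times> {..<H n})"
proof (rule inj_onI)
  fix x y assume x: "x \<in> UNIV \<times> {..<H n}" and y: "y \<in> UNIV \<times> {..<H n}"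
    and xy: "(\<lambda>(i, l). pos n i + l) x = (\<lambda>(i, l). pos n i + l) y"
  obtain i l i' l' where il: "x = (i, l)" "y = (i', l')" by (cases x, cases y)
  have l: "l < H n" "l' < H n" and e: "pos n i + l = pos n i' + l'" using x y xy unfolding il by auto
  have "i = i'"
  proof (rule linorder_cases[of i i'])
    assume "i < i'"
    then show ?thesis using pos_less[of i i' n] e l by simp
  next
    assume "i' < i"
    then show ?thesis using pos_less[of i' i n] e l by simp
  qed
  then show "x = y" using e il by simp
qed

text \<open>From offset l of copy i, a shift by r * H n leads to offset l - S n r i of copy i + r.
  For fixed l the sum over i thus depends on the distribution of S alone, and the differences
  \<open>A\<close> sum to 0 exactly. The error counts the other positions, where |A| <= 2: the
  margins \<Lambda> of the copies, the gaps, and the ends of the window.\<close>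

lemma return_correlation_error:
  fixes f :: "nat \<Rightarrow> complex" and t :: int and r :: nat
  assumes \<beta>: "block_local L \<beta>" and f: "\<And>k. k < N \<Longrightarrow> f k = \<beta> (v + k)" "\<And>k. norm (f k) \<le> 1" and N: "N > 0"
  defines "F \<equiv> extend_zero f" and "\<Lambda> \<equiv> nat \<bar>t\<bar> + r * G + L"
  shows "norm (avg N (\<lambda>y. F (y + (t + int (r * H n))) * cnj (F y))
        - (\<Sum>s\<le>r * G. of_real (freq n v N r s) * avg N (\<lambda>y. F (y + (t - int s)) * cnj (F y))))
      \<le> 2 * real (G + 2 * \<Lambda>) / real (H n) + 2 * real ((r + 2) * H n) / real N"
proof -
  define \<pi> where "\<pi> = freq n v N r"
  define I where "I = blocks n v N r"
  define A where "A = (\<lambda>y. F (y + (t + int (r * H n))) * cnj (F y)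
     - (\<Sum>s\<le>r * G. of_real (\<pi> s) * (F (y + (t - int s)) * cnj (F y))))"
  have F1: "norm (F y) \<le> 1" for y unfolding F_def extend_zero_def using f(2) by simp
  have A2: "norm (A y) \<le> 2" for y
  proof -
    have FF: "norm (F x * cnj (F y)) \<le> 1" for x using F1 by (simp add: norm_mult mult_le_one)
    have "norm (\<Sum>s\<le>r * G. of_real (\<pi> s) * (F (y + (t - int s)) * cnj (F y))) \<le> (\<Sum>s\<le>r * G. \<pi> s)"
    proof (rule sum_norm_le)
      fix s
      have "norm (of_real (\<pi> s) * (F (y + (t - int s)) * cnj (F y))) = \<pi> s * norm (F (y + (t - int s)) * cnj (F y))"
        using freq_nonneg[of n v N r s] by (simp add: norm_mult \<pi>_def)
      also have "\<dots> \<le> \<pi> s * 1" using freq_nonneg FF unfolding \<pi>_def by (intro mult_left_mono)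
      finally show "norm (of_real (\<pi> s) * (F (y + (t - int s)) * cnj (F y))) \<le> \<pi> s" by simp
    qed
    also have "\<dots> \<le> 1" unfolding \<pi>_def freq_sum_all by simp
    finally have "norm (\<Sum>s\<le>r * G. of_real (\<pi> s) * (F (y + (t - int s)) * cnj (F y))) \<le> 1" .
    with FF[of "y + (t + int (r * H n))"] show ?thesis
      using norm_triangle_ineq4[of "F (y + (t + int (r * H n))) * cnj (F y)"
        "\<Sum>s\<le>r * G. of_real (\<pi> s) * (F (y + (t - int s)) * cnj (F y))"] unfolding A_def by linarith
  qed
  have avgA: "avg N (\<lambda>y. F (y + (t + int (r * H n))) * cnj (F y))
        - (\<Sum>s\<le>r * G. of_real (\<pi> s) * avg N (\<lambda>y. F (y + (t - int s)) * cnj (F y))) = avg N A"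
    unfolding A_def avg_diff avg_sum avg_cmult by simp
  have card_eq: "(\<Sum>i\<in>I. \<phi> (S n r i)) = of_nat (card I) * (\<Sum>s\<le>r * G. of_real (\<pi> s) * \<phi> s)" for \<phi> :: "nat \<Rightarrow> complex"
  proof (cases "card I = 0")
    case True
    then show ?thesis using finite_blocks unfolding I_def by simp
  next
    case False
    have "(\<Sum>i\<in>I. \<phi> (S n r i)) = (\<Sum>s\<le>r * G. \<Sum>i | i \<in> I \<and> S n r i = s. \<phi> (S n r i))"
      using sum.group[of I "{..r * G}" "S n r" "\<lambda>i. \<phi> (S n r i)"] finite_blocks[of n v N r] S_le unfolding I_def
      by (auto simp: image_subset_iff)
    also have "\<dots> = (\<Sum>s\<le>r * G. of_nat (card {i \<in> I. S n r i = s}) * \<phi> s)"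
    proof (rule sum.cong[OF refl])
      fix s
      have "(\<Sum>i | i \<in> I \<and> S n r i = s. \<phi> (S n r i)) = (\<Sum>i | i \<in> I \<and> S n r i = s. \<phi> s)" by (rule sum.cong) auto
      then show "(\<Sum>i | i \<in> I \<and> S n r i = s. \<phi> (S n r i)) = of_nat (card {i \<in> I. S n r i = s}) * \<phi> s" by simp
    qed
    also have "\<dots> = (\<Sum>s\<le>r * G. of_nat (card I) * (of_real (\<pi> s) * \<phi> s))"
      unfolding \<pi>_def freq_def I_def[symmetric] using False by (intro sum.cong refl) (simp add: field_simps)
    finally show ?thesis by (simp add: sum_distrib_left)
  qed
  \<comment> \<open>The margin \<Lambda> leaves room for the displacement t, for up to r G spacers
    and for the L letters read by \<beta>.\<close>
  define P where "P = I \<times> {\<Lambda>..<H n - \<Lambda>}"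
  define e where "e = (\<lambda>(i, l). pos n i + l - v)"
  have P: "v \<le> pos n i" "pos n i + H n \<le> v + N" "pos n (i + r) + H n \<le> v + N" "\<Lambda> \<le> l" "l + \<Lambda> < H n" if "(i, l) \<in> P" for i l
  proof -
    have il: "v \<le> pos n i" "pos n (i + r + 1) \<le> v + N" using that unfolding P_def I_def blocks_def by auto
    show "v \<le> pos n i" "\<Lambda> \<le> l" "l + \<Lambda> < H n" using that il unfolding P_def by auto
    have "pos n (i + r) + H n \<le> pos n (i + r + 1)" by (rule pos_less) simp
    then show 1: "pos n (i + r) + H n \<le> v + N" using il by linarith
    show "pos n i + H n \<le> v + N" using 1 pos_mono[of i "i + r" n] by simp
  qed
  have inj: "inj_on e P"
  proof (rule inj_onI)
    fix x y assume x: "x \<in> P" and y: "y \<in> P" and xy: "e x = e y"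
    obtain i l i' l' where il: "x = (i, l)" "y = (i', l')" by (cases x, cases y)
    have "(\<lambda>(i, l). pos n i + l) x = (\<lambda>(i, l). pos n i + l) y"
      using xy P(1)[of i l] P(1)[of i' l'] x y unfolding il e_def by simp
    then show "x = y" by (rule inj_onD[OF inj_on_block_positions]) (use x y P(5) il in force)+
  qed
  have sub: "e ` P \<subseteq> {..<N}"
  proof (rule image_subsetI)
    fix x assume x: "x \<in> P"
    obtain i l where il: "x = (i, l)" by (cases x)
    show "e x \<in> {..<N}" using P(1,2,5)[of i l] x il unfolding e_def by auto
  qed
  have Ae: "A (int (e (i, l))) = \<beta> (nat (int l + t) - S n r i) * cnj (\<beta> l)
      - (\<Sum>s\<le>r * G. of_real (\<pi> s) * (\<beta> (nat (int l + t) - s) * cnj (\<beta> l)))" if il: "(i, l) \<in> P" for i l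
  proof -
    note p = P[OF il]
    define u where "u = nat (int l + t)"
    have u: "int u = int l + t" using p(4) unfolding u_def \<Lambda>_def by linarith
    have uG: "r * G \<le> u" "u + L \<le> H n" using p(4,5) u unfolding \<Lambda>_def by linarith+
    have fe: "F (int (pos n j + m) - int v) = \<beta> m" if "v \<le> pos n j" "pos n j + H n \<le> v + N" "m + L \<le> H n" "m < H n" for j m
    proof -
      have "int (pos n j + m) - int v = int (pos n j + m - v)" using that by simp
      then have "F (int (pos n j + m) - int v) = f (pos n j + m - v)" unfolding F_def by (simp only: extend_zero_of_nat)
      also have "\<dots> = \<beta> (v + (pos n j + m - v))" by (rule f(1)) (use that in linarith)
      also have "\<dots> = \<beta> (pos n j + m)" using that by simp
      also have "\<dots> = \<beta> m" by (rule block_local_shift[OF \<beta> that(3)])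
      finally show ?thesis .
    qed
    have ei: "int (e (i, l)) = int (pos n i + l) - int v" using p(1) unfolding e_def by simp
    have uH: "u < H n" using u p(5) unfolding \<Lambda>_def by linarith
    have 1: "F (int (e (i, l))) = \<beta> l" unfolding ei by (rule fe) (use p in \<open>auto simp: \<Lambda>_def\<close>)
    have Sle: "S n r i \<le> u" using S_le[of n r i] uG by linarith
    have "int (e (i, l)) + (t + int (r * H n)) = int (pos n (i + r) + (u - S n r i)) - int v"
      unfolding ei pos_add S_def[symmetric] using u Sle by simp
    also have "F \<dots> = \<beta> (u - S n r i)"
      by (rule fe) (use p uG uH pos_mono[of i "i + r" n] in auto)
    finally have 2: "F (int (e (i, l)) + (t + int (r * H n))) = \<beta> (u - S n r i)" .
    have 3: "F (int (e (i, l)) + (t - int s)) = \<beta> (u - s)" if "s \<le> r * G" for s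
    proof -
      have "int (e (i, l)) + (t - int s) = int (pos n i + (u - s)) - int v"
        unfolding ei using u uG that by simp
      also have "F \<dots> = \<beta> (u - s)" by (rule fe) (use p uG uH in auto)
      finally show ?thesis .
    qed
    show ?thesis unfolding A_def 1 2 u_def[symmetric] using 3 by simp
  qed
  have "(\<Sum>y\<in>e ` P. A (int y)) = (\<Sum>x\<in>P. A (int (e x)))" by (simp add: sum.reindex[OF inj])
  also have "\<dots> = (\<Sum>x\<in>P. case x of (i, l) \<Rightarrow> \<beta> (nat (int l + t) - S n r i) * cnj (\<beta> l)
      - (\<Sum>s\<le>r * G. of_real (\<pi> s) * (\<beta> (nat (int l + t) - s) * cnj (\<beta> l))))"
    by (rule sum.cong[OF refl]) (use Ae in auto)
  also have "\<dots> = (\<Sum>l\<in>{\<Lambda>..<H n - \<Lambda>}. \<Sum>i\<in>I. \<beta> (nat (int l + t) - S n r i) * cnj (\<beta> l)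
      - (\<Sum>s\<le>r * G. of_real (\<pi> s) * (\<beta> (nat (int l + t) - s) * cnj (\<beta> l))))"
    unfolding P_def sum.cartesian_product[symmetric] by (rule sum.swap)
  also have "\<dots> = 0"
  proof (rule sum.neutral, rule ballI)
    fix l
    show "(\<Sum>i\<in>I. \<beta> (nat (int l + t) - S n r i) * cnj (\<beta> l)
      - (\<Sum>s\<le>r * G. of_real (\<pi> s) * (\<beta> (nat (int l + t) - s) * cnj (\<beta> l)))) = 0"
      unfolding sum_subtractf card_eq[of "\<lambda>s. \<beta> (nat (int l + t) - s) * cnj (\<beta> l)"] by simp
  qed
  finally have zero: "(\<Sum>y\<in>e ` P. A (int y)) = 0" .
  have finI: "finite I" unfolding I_def by (rule finite_blocks)
  have "(\<Sum>y<N. A (int y)) = (\<Sum>y\<in>{..<N} - e ` P. A (int y)) + (\<Sum>y\<in>e ` P. A (int y))"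
    by (rule sum.subset_diff[OF sub]) simp
  then have "norm (\<Sum>y<N. A (int y)) \<le> real (card ({..<N} - e ` P)) * 2"
    unfolding zero using sum_norm_bound[of "{..<N} - e ` P" "\<lambda>y. A (int y)" 2] A2 by simp
  also have "card ({..<N} - e ` P) = N - card I * (H n - \<Lambda> - \<Lambda>)"
    using card_Diff_subset[of "e ` P" "{..<N}"] sub finI card_image[OF inj] by (simp add: P_def card_cartesian_product)
  finally have nA: "norm (avg N A) \<le> 2 * real (N - card I * (H n - \<Lambda> - \<Lambda>)) / real N"
    unfolding avg_def by (simp add: norm_divide divide_right_mono mult.commute)
  have H0: "real (H n) \<ge> 1" using H_ge_1[of n] by simp
  have N0: "real N > 0" using N by simp
  have "2 * real (N - card I * (H n - \<Lambda> - \<Lambda>)) / real N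
     \<le> 2 * real (G + 2 * \<Lambda>) / real (H n) + 2 * real ((r + 2) * H n) / real N"
  proof (cases "2 * \<Lambda> \<le> H n")
    \<comment> \<open>For copies shorter than both margins the claimed bound exceeds the trivial
      bound 2.\<close>
    case False
    have "2 * real (N - card I * (H n - \<Lambda> - \<Lambda>)) / real N \<le> 2" using N by (simp add: divide_le_eq)
    also have "2 \<le> 2 * real (G + 2 * \<Lambda>) / real (H n)"
      using False H0 by (simp add: le_divide_eq)
    also have "\<dots> \<le> \<dots> + 2 * real ((r + 2) * H n) / real N" by simp
    finally show ?thesis .
  next
    case True
    define D where "D = real (H n) - 2 * real \<Lambda>"
    have D: "real (H n - \<Lambda> - \<Lambda>) = D" "0 \<le> D" "D \<le> real (H n)" using True unfolding D_def by auto
    have "card I * (H n - \<Lambda> - \<Lambda>) \<le> N"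
      using card_mono[OF _ sub] card_image[OF inj] by (simp add: P_def card_cartesian_product)
    then have 1: "real (N - card I * (H n - \<Lambda> - \<Lambda>)) = real N - real (card I) * D" using D by (simp add: of_nat_diff)
    have HG: "real (H n) + real G > 0" using H0 by linarith
    have "real N / real (H n + G) - 1 \<le> real (N div (H n + G))"
      using floor_divide_of_nat_eq[of N "H n + G", where 'a = real] by linarith
    moreover have "N div (H n + G) \<le> card I + (r + 1)" using card_blocks_ge[of N n r v] unfolding I_def by linarith
    ultimately have cI: "real N / (real (H n) + real G) - (real r + 2) \<le> real (card I)" by simp
    have "(real N / (real (H n) + real G) - (real r + 2)) * D \<le> real (card I) * D" by (rule mult_right_mono[OF cI D(2)])
    moreover have "(real r + 2) * D \<le> (real r + 2) * real (H n)" by (rule mult_left_mono[OF D(3)]) simp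
    moreover have "real N * (1 - real (G + 2 * \<Lambda>) / real (H n)) \<le> real N / (real (H n) + real G) * D"
    proof -
      have "real N / (real (H n) + real G) * D = real N * (1 - real (G + 2 * \<Lambda>) / (real (H n) + real G))"
        unfolding D_def using HG by (simp add: field_simps)
      also have "\<dots> \<ge> real N * (1 - real (G + 2 * \<Lambda>) / real (H n))"
        using H0 HG by (intro mult_left_mono diff_left_mono divide_left_mono mult_pos_pos) auto
      finally show ?thesis .
    qed
    ultimately have "real N - real (card I) * D \<le> real N * (real (G + 2 * \<Lambda>) / real (H n)) + (real r + 2) * real (H n)"
      by (simp add: algebra_simps)
    then have "2 * (real N - real (card I) * D) / real N \<le> 2 * (real N * (real (G + 2 * \<Lambda>) / real (H n)) + (real r + 2) * real (H n)) / real N"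
      using N0 by (intro divide_right_mono mult_left_mono) auto
    also have "\<dots> = 2 * real (G + 2 * \<Lambda>) / real (H n) + 2 * real ((r + 2) * H n) / real N"
      using N0 by (simp add: field_simps)
    finally show ?thesis unfolding 1 .
  qed
  with nA show ?thesis unfolding avgA[unfolded \<pi>_def] by (rule order_trans)
qed

theorem moebius_null_difference:
  fixes f :: "nat \<Rightarrow> complex"
  assumes \<beta>: "block_local L \<beta>" and fol: "follows f \<beta>" and good: "infinite {n. good n}"
  shows "moebius_null (\<lambda>n. f n - f (n + fact G))"
proof -
  obtain v where v: "\<And>N k. k < N \<Longrightarrow> f k = \<beta> (v N + k)" using fol unfolding follows_def by metis
  have f1: "norm (f k) \<le> 1" for k using v[of k "Suc k"] block_local_norm[OF \<beta>] by simp
  define F where "F = extend_zero f"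
  have F1: "norm (F y) \<le> 1" for y unfolding F_def extend_zero_def using f1 by simp
  define D where "D = (\<lambda>y. F y - F (y + int (fact G)))"
  have D: "D (int k) = f k - f (k + fact G)" for k
    unfolding D_def F_def of_nat_add[symmetric] extend_zero_of_nat ..
  have D2: "norm (D y) \<le> 2" for y
    using norm_triangle_ineq4[of "F y" "F (y + int (fact G))"] F1[of y] F1[of "y + int (fact G)"] unfolding D_def by linarith
  have corr: "(\<lambda>N. avg N (\<lambda>m. D (int p * m) * cnj (D (int q * m)))) \<longlonglongrightarrow> 0"
    if pq: "prime p" "prime q" "p \<noteq> q" "p > G" for p q
  proof -
    \<comment> \<open>\<open>2 ^ J > J\<close> gives the size demanded by
      \<open>freq_not_dvd\<close>. As J depends on p but not on the level, \<delta> is uniform over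
      the levels.\<close>
    define J where "J = p * G + 2 * p + 2"
    have J: "J \<ge> 2" "2 ^ J > p * G + 2 * p + 1" using less_exp[of J] unfolding J_def by auto
    show ?thesis unfolding D_def
    proof (rule dilated_correlation_null[where \<pi> = "\<lambda>n N r s. freq n (v N) N r s" and G = G and \<delta> = "1 / (2 * real (G ^ J))" and h = H
          and good = "{n. good n}", OF F1 pq(1-3) freq_nonneg freq_le_1 _ good])
      show "eventually (\<lambda>N. (\<Sum>s\<le>r * G. freq n (v N) N r s) = 1) sequentially" for n r
        using eventually_card_blocks_ge[of 1 n v r]
      proof eventually_elim
        case (elim N)
        then have "blocks n (v N) N r \<noteq> {}" by auto
        then show ?case unfolding freq_sum_all by simp
      qed
      show "1 / (2 * real (G ^ J)) > 0" using G_ge_2 by simp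
      show "eventually (\<lambda>N. freq n (v N) N 1 s \<le> 1 - 1 / (2 * real (G ^ J))) sequentially" if "n \<in> {n. good n}" for n s
        using freq_nonconst[OF _ J(1)] that by blast
      show "eventually (\<lambda>N. (\<Sum>s | s \<le> p * G \<and> \<not> p dvd s. freq n (v N) N p s) \<ge> 1 / (2 * real (G ^ J))) sequentially"
        if "n \<in> {n. good n}" for n
        using freq_not_dvd[OF _ pq(1,4) J] that by blast
      show "d dvd fact G" if "1 \<le> d" "d \<le> G" for d using that by (rule dvd_fact)
      fix r and t :: int
      define \<Lambda> where "\<Lambda> = nat \<bar>t\<bar> + r * G + L"
      define E where "E = (\<lambda>n. 2 * real (G + 2 * \<Lambda>) / real (H n))"
      have "E \<longlonglongrightarrow> 0" unfolding E_def by (rule H_tendsto)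
      moreover have "\<forall>n. \<exists>K. \<forall>N>0. norm (avg N (\<lambda>y. F (y + (t + int (r * H n))) * cnj (F y))
        - (\<Sum>s\<le>r * G. of_real (freq n (v N) N r s) * avg N (\<lambda>y. F (y + (t - int s)) * cnj (F y)))) \<le> E n + K / real N"
      proof
        fix n
        show "\<exists>K. \<forall>N>0. norm (avg N (\<lambda>y. F (y + (t + int (r * H n))) * cnj (F y))
          - (\<Sum>s\<le>r * G. of_real (freq n (v N) N r s) * avg N (\<lambda>y. F (y + (t - int s)) * cnj (F y)))) \<le> E n + K / real N"
        proof (intro exI[of _ "2 * real ((r + 2) * H n)"] allI impI)
          fix N :: nat assume "N > 0"
          then show "norm (avg N (\<lambda>y. F (y + (t + int (r * H n))) * cnj (F y))
          - (\<Sum>s\<le>r * G. of_real (freq n (v N) N r s) * avg N (\<lambda>y. F (y + (t - int s)) * cnj (F y))))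
             \<le> E n + 2 * real ((r + 2) * H n) / real N"
            unfolding E_def F_def \<Lambda>_def by (intro return_correlation_error[OF \<beta> v f1])
        qed
      qed
      ultimately show "\<exists>e. e \<longlonglongrightarrow> 0 \<and> (\<forall>n. \<exists>K. \<forall>N>0. norm (avg N (\<lambda>y. F (y + (t + int (r * H n))) * cnj (F y))
        - (\<Sum>s\<le>r * G. of_real (freq n (v N) N r s) * avg N (\<lambda>y. F (y + (t - int s)) * cnj (F y)))) \<le> e n + K / real N)"
        by blast
    qed
  qed
  have "(\<lambda>N. 1 / of_nat N * (\<Sum>n=1..N. of_int (moebius_mu n) * ((1 / 2) * (f n - f (n + fact G))))) \<longlonglongrightarrow> 0"
  proof (rule katai_criterion[where c = G])
    fix n
    show "norm ((1 / 2) * (f n - f (n + fact G))) \<le> 1" using D2[of "int n"] unfolding D by (simp add: norm_mult norm_divide)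
  next
    fix p q :: nat assume pq: "prime p" "prime q" "p > G" "q > G" "p \<noteq> q"
    define E where "E = (\<lambda>m. D (int p * m) * cnj (D (int q * m)))"
    have E4: "norm (E y) \<le> 4" for y
      unfolding E_def norm_mult complex_mod_cnj using mult_mono[OF D2[of "int p * y"] D2[of "int q * y"]] by simp
    have "(\<lambda>N. avg N E) \<longlonglongrightarrow> 0" unfolding E_def by (rule corr[OF pq(1,2,5,3)])
    \<comment> \<open>The criterion sums from 1, \<open>avg\<close> from 0.\<close>
    then have "(\<lambda>N. avg N (\<lambda>y. E (y + 1))) \<longlonglongrightarrow> 0"
      by (rule avg_shift_tendsto[where N = "\<lambda>N. N" and B = 4, OF E4 filterlim_ident])
    then have "(\<lambda>N. (1 / 4) * avg N (\<lambda>y. E (y + 1))) \<longlonglongrightarrow> (1 / 4) * 0" by (intro tendsto_mult tendsto_const)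
    moreover have "(1 / 4) * avg N (\<lambda>y. E (y + 1)) = 1 / of_nat N * (\<Sum>n=1..N. ((1 / 2) * (f (p * n) - f (p * n + fact G)))
        * cnj ((1 / 2) * (f (q * n) - f (q * n + fact G))))" for N
    proof -
      have "(\<Sum>n=1..N. ((1 / 2) * (f (p * n) - f (p * n + fact G))) * cnj ((1 / 2) * (f (q * n) - f (q * n + fact G))))
         = (\<Sum>n=1..N. (1 / 4) * E (int n))"
        unfolding E_def of_nat_mult[symmetric] D by (intro sum.cong refl) simp
      also have "\<dots> = (\<Sum>n<N. (1 / 4) * E (int n + 1))"
        by (rule sum.reindex_bij_witness[of _ Suc "\<lambda>n. n - 1"]) (auto simp: add.commute)
      finally show ?thesis unfolding avg_def by (simp add: sum_divide_distrib[symmetric])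
    qed
    ultimately show "(\<lambda>N. 1 / of_nat N * (\<Sum>n=1..N. ((1 / 2) * (f (p * n) - f (p * n + fact G)))
        * cnj ((1 / 2) * (f (q * n) - f (q * n + fact G))))) \<longlonglongrightarrow> 0" by (simp only: mult_zero_right)
  qed
  then have "moebius_null (\<lambda>n. (1 / 2) * (f n - f (n + fact G)))" unfolding moebius_null_def .
  then have "moebius_null (\<lambda>n. 2 * ((1 / 2) * (f n - f (n + fact G))))" by (rule moebius_null_cmult)
  moreover have "2 * ((1 / 2) * (f n - f (n + fact G))) = f n - f (n + fact G)" for n by simp
  ultimately show ?thesis by (simp only:)
qed

end

section \<open>Uniform means along windows\<close>

lemma moebius_null_approx:
  assumes "\<And>e. e > 0 \<Longrightarrow> \<exists>g. moebius_null g \<and> (\<forall>n. norm (f n - g n) \<le> e)"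
  shows "moebius_null f"
  unfolding moebius_null_def
proof (rule tendstoI)
  fix e :: real assume "e > 0"
  then obtain g where g: "moebius_null g" "\<And>n. norm (f n - g n) \<le> e / 2" using assms[of "e / 2"] by auto
  have "eventually (\<lambda>N. norm (1 / of_nat N * (\<Sum>n=1..N. of_int (moebius_mu n) * g n) :: complex) < e / 2) sequentially"
    using tendstoD[OF g(1)[unfolded moebius_null_def], of "e / 2"] \<open>e > 0\<close> by simp
  then show "eventually (\<lambda>N. dist (1 / of_nat N * (\<Sum>n=1..N. of_int (moebius_mu n) * f n)) 0 < e) sequentially"
  proof eventually_elim
    case (elim N)
    have "norm (\<Sum>n=1..N. of_int (moebius_mu n) * (f n - g n)) \<le> of_nat (card {1..N}) * (e / 2)"
    proof (rule sum_norm_bound)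
      fix n
      have "norm (of_int (moebius_mu n) * (f n - g n)) \<le> 1 * (e / 2)"
        unfolding norm_mult by (intro mult_mono norm_moebius_mu_le g(2)) auto
      then show "norm (of_int (moebius_mu n) * (f n - g n)) \<le> e / 2" by simp
    qed
    then have "norm (1 / of_nat N * (\<Sum>n=1..N. of_int (moebius_mu n) * (f n - g n)) :: complex) \<le> e / 2"
      using \<open>e > 0\<close> by (cases "N = 0") (auto simp: norm_mult norm_divide field_simps)
    moreover have "1 / of_nat N * (\<Sum>n=1..N. of_int (moebius_mu n) * f n) =
        1 / of_nat N * (\<Sum>n=1..N. of_int (moebius_mu n) * (f n - g n)) + 1 / of_nat N * (\<Sum>n=1..N. of_int (moebius_mu n) * g n)"
      by (simp add: algebra_simps sum_subtractf sum.distrib)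
    ultimately show ?case using elim norm_triangle_ineq[of "1 / of_nat N * (\<Sum>n=1..N. of_int (moebius_mu n) * (f n - g n))"
      "1 / of_nat N * (\<Sum>n=1..N. of_int (moebius_mu n) * g n)"] by simp
  qed
qed

text \<open>Adding the tail 2 C / 2^n of all later errors makes z decreasing, so it has a limit l;
  the contraction along \<open>A\<close> gives l <= r l with r < 1.\<close>

lemma infinitely_often_contraction:
  fixes z :: "nat \<Rightarrow> real"
  assumes z0: "\<And>n. 0 \<le> z n" and C: "C \<ge> 0" and step: "\<And>n. z (Suc n) \<le> z n + C / 2 ^ n"
    and inf: "infinite A" and contr: "\<And>n. n \<in> A \<Longrightarrow> z (Suc n) \<le> r * z n + C / 2 ^ n" and r: "r < 1"
  shows "z \<longlonglongrightarrow> 0"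
proof -
  define t where "t = (\<lambda>n. z n + 2 * C / 2 ^ n)"
  have C0: "(\<lambda>n. c / 2 ^ n :: real) \<longlonglongrightarrow> 0" for c
    using tendsto_mult[OF tendsto_const[of c] LIMSEQ_realpow_zero[of "1 / 2"]] by (simp add: power_one_over)
  have "decseq t"
  proof (rule decseq_SucI)
    fix n
    show "t (Suc n) \<le> t n" using step[of n] by (simp add: t_def)
  qed
  moreover have "0 \<le> t n" for n using z0[of n] C by (simp add: t_def)
  ultimately obtain l where l: "t \<longlonglongrightarrow> l" using decseq_convergent[of t 0] by blast
  have "(\<lambda>n. t n - 2 * C / 2 ^ n) \<longlonglongrightarrow> l - 0" by (rule tendsto_diff[OF l C0])
  then have zl: "z \<longlonglongrightarrow> l" by (simp add: t_def)
  define s where "s = enumerate A"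
  have s: "strict_mono s" "\<And>k. s k \<in> A" unfolding s_def using strict_mono_enumerate[OF inf] enumerate_in_set[OF inf] by auto
  have "(\<lambda>k. z (Suc (s k))) \<longlonglongrightarrow> l" using LIMSEQ_subseq_LIMSEQ[OF LIMSEQ_Suc[OF zl] s(1)] by (simp add: o_def)
  moreover have "(\<lambda>k. r * z (s k) + C / 2 ^ s k) \<longlonglongrightarrow> r * l + 0"
    using LIMSEQ_subseq_LIMSEQ[OF zl s(1)] LIMSEQ_subseq_LIMSEQ[OF C0[of C] s(1)]
    by (intro tendsto_intros) (auto simp: o_def)
  ultimately have "l \<le> r * l + 0" by (rule LIMSEQ_le) (use contr s(2) in auto)
  then have "(1 - r) * l \<le> 0" by (simp add: algebra_simps)
  then have "l \<le> 0" using r by (simp add: mult_le_0_iff)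
  moreover have "l \<ge> 0" by (rule LIMSEQ_le_const[OF zl]) (use z0 in auto)
  ultimately show ?thesis using zl by simp
qed

text \<open>There are finitely many such \<omega>, and for each of them the triangle inequality |1 +
  \<omega>| <= 2 is strict.\<close>

lemma roots_of_unity_separated:
  assumes "M > 0"
  obtains \<eta> where "\<eta> > 0" "\<And>\<omega> :: complex. \<omega> ^ M = 1 \<Longrightarrow> \<omega> \<noteq> 1 \<Longrightarrow> norm (1 + \<omega>) \<le> 2 - \<eta>"
proof -
  define R where "R = {\<omega> :: complex. \<omega> ^ M = 1 \<and> \<omega> \<noteq> 1}"
  have fin: "finite R" by (rule finite_subset[OF _ finite_roots_unity[of M]]) (use assms in \<open>auto simp: R_def\<close>)
  have pos: "2 - norm (1 + \<omega>) > 0" if "\<omega> \<in> R" for \<omega>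
  proof -
    have n1: "norm \<omega> = 1" using that assms power_eq_1_iff[of \<omega> M] unfolding R_def by auto
    have sq: "(Re \<omega>)\<^sup>2 + (Im \<omega>)\<^sup>2 = 1" using n1 cmod_power2[of \<omega>] by simp
    have "Re \<omega> \<noteq> 1"
    proof
      assume "Re \<omega> = 1"
      then have "\<omega> = 1" using sq by (simp add: complex_eq_iff)
      then show False using that unfolding R_def by simp
    qed
    moreover have "Re \<omega> \<le> 1" using complex_Re_le_cmod[of \<omega>] n1 by simp
    ultimately have "Re \<omega> < 1" by simp
    then have "(norm (1 + \<omega>))\<^sup>2 < 2\<^sup>2" using sq unfolding cmod_power2 by (simp add: power2_eq_square algebra_simps)
    then show ?thesis using power2_less_imp_less[of "norm (1 + \<omega>)" 2] by simp
  qed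
  define \<eta> where "\<eta> = Min (insert 1 ((\<lambda>\<omega>. 2 - norm (1 + \<omega>)) ` R))"
  have "\<eta> > 0" unfolding \<eta>_def using fin pos by (subst Min_gr_iff) auto
  moreover have "norm (1 + \<omega>) \<le> 2 - \<eta>" if "\<omega> ^ M = 1" "\<omega> \<noteq> 1" for \<omega> :: complex
  proof -
    have "\<eta> \<le> 2 - norm (1 + \<omega>)" unfolding \<eta>_def using that fin by (intro Min_le) (auto simp: R_def)
    then show ?thesis by simp
  qed
  ultimately show ?thesis by (rule that)
qed

section \<open>Sums over copies twisted by a root of unity\<close>

context tower
begin

lemma pos_digit:
  assumes "c < w n"
  shows "pos n (w n * i + c) = pos (Suc n) i + pos n c"
  using assms
proof (induction c)
  case 0
  then show ?case by (simp add: pos_mult)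
next
  case (Suc c)
  have "g n (w n * i + Suc c) = g n (w n * 0 + Suc c)" using gap_nondiv[of "Suc c" n i] gap_nondiv[of "Suc c" n 0] Suc.prems by simp
  then show ?case using Suc by (simp add: pos_Suc)
qed

lemma pow_pos_Suc_level:
  fixes \<zeta> :: complex
  assumes "\<And>i. \<zeta> ^ pos n i = 1" "n \<le> m"
  shows "\<zeta> ^ pos m i = 1"
  using assms(2)
proof (induction m arbitrary: i rule: dec_induct)
  case base
  then show ?case by (rule assms(1))
next
  case (step m)
  then show ?case by (simp add: pos_mult)
qed

text \<open>In the mixed-radix expansion of i with bases w n, w (n + 1), ..., the position pos n i
  is the sum of pos m c over the digits c at the levels m. If all digits contribute trivially from
  some level on, then \<zeta> ^ pos n i = 1 for all i there.\<close>

lemma pow_pos_nontrivial_infinitely_often: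
  fixes \<zeta> :: complex
  assumes "\<nexists>n. \<forall>i. \<zeta> ^ pos n i = 1"
  shows "infinite {n. \<exists>c<w n. \<zeta> ^ pos n c \<noteq> 1}"
proof
  assume "finite {n. \<exists>c<w n. \<zeta> ^ pos n c \<noteq> 1}"
  then obtain n0 where n0: "\<And>n. n \<in> {n. \<exists>c<w n. \<zeta> ^ pos n c \<noteq> 1} \<Longrightarrow> n < n0"
    using finite_nat_set_iff_bounded by auto
  have "\<zeta> ^ pos n i = 1" if "n \<ge> n0" for n i
    using that
  proof (induction i arbitrary: n rule: less_induct)
    case (less i)
    show ?case
    proof (cases "i = 0")
      case False
      define c where "c = i mod w n"
      define i' where "i' = i div w n"
      have cw: "c < w n" using w2[of n] by (simp add: c_def)
      have i: "i = w n * i' + c" by (simp add: c_def i'_def)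
      have "i' < i" unfolding i'_def using False w2[of n] by (intro div_less_dividend) auto
      then have "\<zeta> ^ pos (Suc n) i' = 1" using less by simp
      moreover have "\<zeta> ^ pos n c = 1" using n0[of n] less.prems cw by (auto simp: not_less[symmetric])
      ultimately show ?thesis unfolding i pos_digit[OF cw] by (simp add: power_add)
    qed simp
  qed
  then show False using assms by blast
qed

definition Z :: "(nat \<Rightarrow> complex) \<Rightarrow> complex \<Rightarrow> nat \<Rightarrow> complex" where
  "Z \<beta> \<zeta> n = (\<Sum>l<H n. \<beta> l * \<zeta> ^ l)"

context
  fixes L :: nat and \<beta> :: "nat \<Rightarrow> complex" and \<zeta> :: complex
  assumes \<beta>: "block_local L \<beta>" and \<zeta>1: "norm \<zeta> = 1"
begin

lemma norm_twist_le: "norm (\<beta> j * \<zeta> ^ j) \<le> 1"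
  using block_local_norm[OF \<beta>] \<zeta>1 by (simp add: norm_mult norm_power)

lemma norm_twist_sum_le:
  assumes "finite A"
  shows "norm (\<Sum>j\<in>A. \<beta> j * \<zeta> ^ j) \<le> real (card A)"
  using sum_norm_bound[of A "\<lambda>j. \<beta> j * \<zeta> ^ j" 1] norm_twist_le by simp

lemma norm_Z_le: "norm (Z \<beta> \<zeta> n) \<le> real (H n)"
  unfolding Z_def using norm_twist_sum_le[of "{..<H n}"] by simp

text \<open>The last L offsets, where \<beta> is not determined by the offset, cost 2 L, and the gap
  behind the copy costs G.\<close>

lemma block_sum:
  "norm ((\<Sum>j=pos n i..<pos n (Suc i). \<beta> j * \<zeta> ^ j) - \<zeta> ^ pos n i * Z \<beta> \<zeta> n) \<le> 2 * real L + real G"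
proof -
  let ?p = "pos n i"
  have s1: "(\<Sum>j=?p..<pos n (Suc i). \<beta> j * \<zeta> ^ j) = (\<Sum>j=?p..<?p + H n. \<beta> j * \<zeta> ^ j) + (\<Sum>j=?p + H n..<pos n (Suc i). \<beta> j * \<zeta> ^ j)"
    by (rule sum.atLeastLessThan_concat[symmetric]) (simp_all add: pos_Suc)
  have s2: "(\<Sum>j=?p..<?p + H n. \<beta> j * \<zeta> ^ j) = (\<Sum>l<H n. \<beta> (?p + l) * \<zeta> ^ (?p + l))"
    using sum.shift_bounds_nat_ivl[of "\<lambda>j. \<beta> j * \<zeta> ^ j" 0 ?p "H n"] by (simp add: atLeast0LessThan add.commute)
  have "(\<Sum>l<H n. \<beta> (?p + l) * \<zeta> ^ (?p + l)) - \<zeta> ^ ?p * Z \<beta> \<zeta> n = (\<Sum>l<H n. \<zeta> ^ (?p + l) * (\<beta> (?p + l) - \<beta> l))"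
    unfolding Z_def sum_distrib_left sum_subtractf[symmetric] by (rule sum.cong) (simp_all add: power_add algebra_simps)
  also have "\<dots> = (\<Sum>l\<in>{H n - L..<H n}. \<zeta> ^ (?p + l) * (\<beta> (?p + l) - \<beta> l))"
  proof (rule sum.mono_neutral_right)
    show "\<forall>l\<in>{..<H n} - {H n - L..<H n}. \<zeta> ^ (?p + l) * (\<beta> (?p + l) - \<beta> l) = 0"
    proof
      fix l assume "l \<in> {..<H n} - {H n - L..<H n}"
      then have "l + L \<le> H n" by auto
      then show "\<zeta> ^ (?p + l) * (\<beta> (?p + l) - \<beta> l) = 0" using block_local_shift[OF \<beta>, of l n i] by simp
    qed
  qed auto
  finally have "norm ((\<Sum>l<H n. \<beta> (?p + l) * \<zeta> ^ (?p + l)) - \<zeta> ^ ?p * Z \<beta> \<zeta> n) \<le> real (card {H n - L..<H n}) * 2"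
  proof (simp only:, intro sum_norm_bound)
    fix l
    have "norm (\<beta> (?p + l) - \<beta> l) \<le> 2"
      using norm_triangle_ineq4[of "\<beta> (?p + l)" "\<beta> l"] block_local_norm[OF \<beta>, of "?p + l"] block_local_norm[OF \<beta>, of l] by linarith
    then show "norm (\<zeta> ^ (?p + l) * (\<beta> (?p + l) - \<beta> l)) \<le> 2" using \<zeta>1 by (simp add: norm_mult norm_power)
  qed
  also have "\<dots> \<le> 2 * real L" by simp
  finally have n1: "norm ((\<Sum>l<H n. \<beta> (?p + l) * \<zeta> ^ (?p + l)) - \<zeta> ^ ?p * Z \<beta> \<zeta> n) \<le> 2 * real L" .
  have "norm (\<Sum>j=?p + H n..<pos n (Suc i). \<beta> j * \<zeta> ^ j) \<le> real (card {?p + H n..<pos n (Suc i)})"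
    by (rule norm_twist_sum_le) simp
  also have "\<dots> \<le> real G" using gap_le[of n "Suc i"] by (simp add: pos_Suc)
  finally have n2: "norm (\<Sum>j=?p + H n..<pos n (Suc i). \<beta> j * \<zeta> ^ j) \<le> real G" .
  have "(\<Sum>j=?p..<pos n (Suc i). \<beta> j * \<zeta> ^ j) - \<zeta> ^ ?p * Z \<beta> \<zeta> n =
     ((\<Sum>l<H n. \<beta> (?p + l) * \<zeta> ^ (?p + l)) - \<zeta> ^ ?p * Z \<beta> \<zeta> n) + (\<Sum>j=?p + H n..<pos n (Suc i). \<beta> j * \<zeta> ^ j)"
    unfolding s1 s2 by simp
  then show ?thesis using norm_triangle_mono[OF n1 n2] by (simp only:)
qed

lemma blocks_sum:
  assumes "i0 \<le> i1"
  shows "norm ((\<Sum>j=pos n i0..<pos n i1. \<beta> j * \<zeta> ^ j) - Z \<beta> \<zeta> n * (\<Sum>i=i0..<i1. \<zeta> ^ pos n i))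
    \<le> real (i1 - i0) * (2 * real L + real G)"
  using assms
proof (induction i1 rule: dec_induct)
  case (step k)
  have s: "(\<Sum>j=pos n i0..<pos n (Suc k). \<beta> j * \<zeta> ^ j) = (\<Sum>j=pos n i0..<pos n k. \<beta> j * \<zeta> ^ j) + (\<Sum>j=pos n k..<pos n (Suc k). \<beta> j * \<zeta> ^ j)"
    using step by (intro sum.atLeastLessThan_concat[symmetric] pos_mono) auto
  have "(\<Sum>j=pos n i0..<pos n (Suc k). \<beta> j * \<zeta> ^ j) - Z \<beta> \<zeta> n * (\<Sum>i=i0..<Suc k. \<zeta> ^ pos n i) =
     ((\<Sum>j=pos n i0..<pos n k. \<beta> j * \<zeta> ^ j) - Z \<beta> \<zeta> n * (\<Sum>i=i0..<k. \<zeta> ^ pos n i)) +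
     ((\<Sum>j=pos n k..<pos n (Suc k). \<beta> j * \<zeta> ^ j) - \<zeta> ^ pos n k * Z \<beta> \<zeta> n)"
    unfolding s using step by (simp add: algebra_simps)
  then have "norm ((\<Sum>j=pos n i0..<pos n (Suc k). \<beta> j * \<zeta> ^ j) - Z \<beta> \<zeta> n * (\<Sum>i=i0..<Suc k. \<zeta> ^ pos n i))
      \<le> real (k - i0) * (2 * real L + real G) + (2 * real L + real G)"
    using norm_triangle_mono[OF step.IH block_sum[of n k]] by simp
  also have "\<dots> = real (Suc k - i0) * (2 * real L + real G)" using step by (simp add: Suc_diff_le algebra_simps)
  finally show ?case .
qed simp

text \<open>A window is a run of complete copies up to two ends of at most H n + G letters each; a
  third such term comes from comparing K with the total length of the copies.
  \<open>\<kappa>\<close> and \<open>\<tau>\<close> are left open for the two cases of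
  \<open>uniform_twisted_mean\<close>.\<close>

lemma window_sum:
  assumes \<kappa>: "norm \<kappa> \<le> 1"
    and \<tau>: "\<And>i0 i1. i0 \<le> i1 \<Longrightarrow>
      norm (Z \<beta> \<zeta> n * (\<Sum>i=i0..<i1. \<zeta> ^ pos n i) - \<kappa> * of_nat (H n) * of_nat (i1 - i0)) \<le> \<tau> * real (H n) * real (i1 - i0)"
    and \<tau>0: "\<tau> \<ge> 0"
  shows "norm ((\<Sum>j=u..<u + K. \<beta> j * \<zeta> ^ j) - \<kappa> * of_nat K)
    \<le> 3 * real (H n + G) + real (K + H n + G) * (2 * real (L + G) / real (H n) + \<tau>)"
proof -
  obtain i0 where i0: "u \<le> pos n i0" "pos n i0 \<le> u + H n + G" "\<And>i. i < i0 \<Longrightarrow> pos n i < u" by (rule first_block[of u n]) blast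
  obtain i1 where i1: "u + K \<le> pos n i1" "pos n i1 \<le> u + K + H n + G" "\<And>i. i < i1 \<Longrightarrow> pos n i < u + K" by (rule first_block[of "u + K" n]) blast
  have le: "i0 \<le> i1" using i0(3)[of i1] i1(1) by (metis add_leD1 not_le)
  define d where "d = i1 - i0"
  have d: "i1 = i0 + d" using le by (simp add: d_def)
  have dH: "d * H n \<le> K + H n + G" using pos_ge_add[of n i0 d] i0(1) i1(2) unfolding d by linarith
  have dG: "K \<le> d * H n + d * G + H n + G" using pos_le_add[of n i0 d] d i0(2) i1(1) by (simp add: algebra_simps)
  have H0: "real (H n) > 0" using H_ge_1[of n] by simp
  let ?\<Sigma> = "\<lambda>a b. (\<Sum>j=a..<b. \<beta> j * \<zeta> ^ j)"
  have sp: "?\<Sigma> u (u + K) + ?\<Sigma> (u + K) (pos n i1) = ?\<Sigma> u (pos n i0) + ?\<Sigma> (pos n i0) (pos n i1)"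
    using sum.atLeastLessThan_concat[of u "u + K" "pos n i1" "\<lambda>j. \<beta> j * \<zeta> ^ j"]
      sum.atLeastLessThan_concat[of u "pos n i0" "pos n i1" "\<lambda>j. \<beta> j * \<zeta> ^ j"] i0(1) i1(1) pos_mono[OF le, of n] by simp
  have e1: "norm (?\<Sigma> u (pos n i0)) \<le> real (H n + G)"
    by (rule order_trans[OF norm_twist_sum_le]) (use i0(2) in \<open>auto simp del: of_nat_add\<close>)
  have e2: "norm (?\<Sigma> (u + K) (pos n i1)) \<le> real (H n + G)"
    by (rule order_trans[OF norm_twist_sum_le]) (use i1(2) in \<open>auto simp del: of_nat_add\<close>)
  have e3: "norm (?\<Sigma> (pos n i0) (pos n i1) - Z \<beta> \<zeta> n * (\<Sum>i=i0..<i1. \<zeta> ^ pos n i)) \<le> real d * (2 * real L + real G)"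
    using blocks_sum[OF le, of n] unfolding d_def .
  have e4: "norm (Z \<beta> \<zeta> n * (\<Sum>i=i0..<i1. \<zeta> ^ pos n i) - \<kappa> * of_nat (H n) * of_nat d) \<le> \<tau> * real (H n) * real d"
    using \<tau>[OF le] unfolding d_def .
  have "\<bar>real (d * H n) - real K\<bar> \<le> real d * real G + real (H n + G)"
  proof -
    have "real (d * H n) \<le> real (K + H n + G)" using dH by (rule of_nat_mono)
    moreover have "real K \<le> real (d * H n + d * G + H n + G)" using dG by (rule of_nat_mono)
    moreover have "0 \<le> real d * real G" by simp
    ultimately show ?thesis unfolding of_nat_add of_nat_mult by linarith
  qed
  moreover have "\<kappa> * of_nat (H n) * of_nat d - \<kappa> * of_nat K = \<kappa> * of_real (real (d * H n) - real K)" by (simp add: algebra_simps)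
  ultimately have e5: "norm (\<kappa> * of_nat (H n) * of_nat d - \<kappa> * of_nat K) \<le> real d * real G + real (H n + G)"
    using \<kappa> mult_mono[of "norm \<kappa>" 1 "\<bar>real (d * H n) - real K\<bar>" "real d * real G + real (H n + G)"]
    by (simp only: norm_mult norm_of_real) simp
  have "?\<Sigma> u (u + K) - \<kappa> * of_nat K = ?\<Sigma> u (pos n i0) + (- ?\<Sigma> (u + K) (pos n i1))
     + (?\<Sigma> (pos n i0) (pos n i1) - Z \<beta> \<zeta> n * (\<Sum>i=i0..<i1. \<zeta> ^ pos n i))
     + (Z \<beta> \<zeta> n * (\<Sum>i=i0..<i1. \<zeta> ^ pos n i) - \<kappa> * of_nat (H n) * of_nat d)
     + (\<kappa> * of_nat (H n) * of_nat d - \<kappa> * of_nat K)" using sp by (simp add: algebra_simps)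
  then have "norm (?\<Sigma> u (u + K) - \<kappa> * of_nat K) \<le> real (H n + G) + real (H n + G) + real d * (2 * real L + real G)
     + \<tau> * real (H n) * real d + (real d * real G + real (H n + G))"
    by (simp only:, intro norm_triangle_mono e1 e3 e4 e5) (use e2 in simp)
  also have "\<dots> = 3 * real (H n + G) + real (d * H n) * (2 * real (L + G) / real (H n) + \<tau>)"
    using H0 by (simp add: field_simps)
  also have "\<dots> \<le> 3 * real (H n + G) + real (K + H n + G) * (2 * real (L + G) / real (H n) + \<tau>)"
    using of_nat_mono[OF dH, where 'a = real] \<tau>0 H0 by (intro add_left_mono mult_right_mono) auto
  finally show ?thesis .
qed

lemma Z_step:
  "norm (Z \<beta> \<zeta> (Suc n)) \<le> norm (Z \<beta> \<zeta> n) * norm (\<Sum>c<w n. \<zeta> ^ pos n c) + real (w n) * (2 * real (L + G))"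
proof -
  have pw: "pos n (w n) = H (Suc n) + g (Suc n) 1" using pos_mult[of n 1] pos_Suc[of "Suc n" 0] by (simp del: rank_one_height.simps)
  let ?s = "\<lambda>A. (\<Sum>j\<in>A. \<beta> j * \<zeta> ^ j)"
  have "?s {0..<pos n (w n)} = ?s {0..<H (Suc n)} + ?s {H (Suc n)..<pos n (w n)}"
    by (rule sum.atLeastLessThan_concat[symmetric]) (simp_all only: pw le_add1 le0)
  then have "Z \<beta> \<zeta> (Suc n) = (?s {pos n 0..<pos n (w n)} - Z \<beta> \<zeta> n * (\<Sum>c=0..<w n. \<zeta> ^ pos n c))
      + (- ?s {H (Suc n)..<pos n (w n)}) + Z \<beta> \<zeta> n * (\<Sum>c<w n. \<zeta> ^ pos n c)"
    unfolding Z_def by (simp add: atLeast0LessThan del: rank_one_height.simps)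
  moreover have "norm (?s {pos n 0..<pos n (w n)} - Z \<beta> \<zeta> n * (\<Sum>c=0..<w n. \<zeta> ^ pos n c)) \<le> real (w n) * (2 * real L + real G)"
    using blocks_sum[of 0 "w n" n] by simp
  moreover have "norm (- ?s {H (Suc n)..<pos n (w n)}) \<le> real G"
    unfolding norm_minus_cancel by (rule order_trans[OF norm_twist_sum_le]) (use gap_le[of "Suc n" 1] pw in auto)
  moreover have "norm (Z \<beta> \<zeta> n * (\<Sum>c<w n. \<zeta> ^ pos n c)) \<le> norm (Z \<beta> \<zeta> n) * norm (\<Sum>c<w n. \<zeta> ^ pos n c)"
    by (simp add: norm_mult)
  ultimately have "norm (Z \<beta> \<zeta> (Suc n)) \<le> real (w n) * (2 * real L + real G) + real G + norm (Z \<beta> \<zeta> n) * norm (\<Sum>c<w n. \<zeta> ^ pos n c)"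
    by (simp only:) (intro norm_triangle_mono)
  moreover have "real G \<le> real (w n) * real G" using w2[of n] by (simp add: mult_le_cancel_right1)
  ultimately show ?thesis by (simp add: algebra_simps)
qed

text \<open>By \<open>Z_step\<close> each level multiplies the mean by the normalised norm of a sum
  of w n phases, the first of which is 1. If another phase differs from 1, this pair falls short of
  2 by \<eta>, so the factor is at most 1 - \<eta> / G; this happens at infinitely many
  levels.\<close>

lemma Z_mean_tendsto_zero:
  assumes M: "M > 0" "\<zeta> ^ M = 1" and inf: "\<nexists>n. \<forall>i. \<zeta> ^ pos n i = 1"
  shows "(\<lambda>n. norm (Z \<beta> \<zeta> n) / real (H n)) \<longlonglongrightarrow> 0"
proof -
  define z where "z = (\<lambda>n. norm (Z \<beta> \<zeta> n) / real (H n))"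
  define \<rho> where "\<rho> = (\<lambda>n. norm (\<Sum>c<w n. \<zeta> ^ pos n c) / real (w n))"
  define C where "C = 2 * real (L + G)"
  obtain \<eta> where \<eta>: "\<eta> > 0" "\<And>\<omega> :: complex. \<omega> ^ M = 1 \<Longrightarrow> \<omega> \<noteq> 1 \<Longrightarrow> norm (1 + \<omega>) \<le> 2 - \<eta>"
    using roots_of_unity_separated[OF M(1)] by blast
  have step: "z (Suc n) \<le> \<rho> n * z n + C / 2 ^ n" for n
  proof -
    have w0: "real (w n) > 0" using w2[of n] by simp
    have H0: "real (H n) > 0" using H_ge_1[of n] by simp
    have wH: "real (w n) * real (H n) \<le> real (H (Suc n))" using of_nat_mono[OF H_ge_mult[of n], where 'a = real] by simp
    have "z (Suc n) \<le> norm (Z \<beta> \<zeta> (Suc n)) / (real (w n) * real (H n))"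
      unfolding z_def using wH w0 H0 H_ge_1[of "Suc n"] by (intro divide_left_mono mult_pos_pos) (auto simp del: rank_one_height.simps)
    also have "\<dots> \<le> (norm (Z \<beta> \<zeta> n) * norm (\<Sum>c<w n. \<zeta> ^ pos n c) + real (w n) * C) / (real (w n) * real (H n))"
      unfolding C_def using Z_step w0 H0 by (intro divide_right_mono) auto
    also have "\<dots> = \<rho> n * z n + C / real (H n)"
      unfolding \<rho>_def z_def using w0 H0 by (simp add: field_simps)
    also have "C / real (H n) \<le> C / 2 ^ n"
      using of_nat_mono[OF H_ge_pow[of n], where 'a = real] H0 unfolding C_def by (intro divide_left_mono) auto
    finally show ?thesis by simp
  qed
  have z0: "0 \<le> z n" for n by (simp add: z_def)
  have tri: "norm (\<Sum>c\<in>A. \<zeta> ^ pos n c) \<le> real (card A)" for A n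
    using sum_norm_bound[of A "\<lambda>c. \<zeta> ^ pos n c" 1] \<zeta>1 by (simp add: norm_power)
  have \<rho>1: "\<rho> n \<le> 1" for n using tri[of n "{..<w n}"] w2[of n] by (simp add: \<rho>_def divide_le_eq)
  have \<rho>2: "\<rho> n \<le> 1 - \<eta> / real G" if n: "n \<in> {n. \<exists>c<w n. \<zeta> ^ pos n c \<noteq> 1}" for n
  proof -
    obtain c where c: "c < w n" "\<zeta> ^ pos n c \<noteq> 1" using n by blast
    have c0: "c \<noteq> 0" using c(2) by (intro notI) simp
    have "(\<zeta> ^ pos n c) ^ M = 1" by (metis M(2) power_commutes power_mult power_one mult.commute)
    then have "norm (1 + \<zeta> ^ pos n c) \<le> 2 - \<eta>" by (rule \<eta>(2)[OF _ c(2)])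
    moreover have "(\<Sum>c<w n. \<zeta> ^ pos n c) = (\<Sum>c\<in>{..<w n} - {0, c}. \<zeta> ^ pos n c) + (\<Sum>c\<in>{0, c}. \<zeta> ^ pos n c)"
      using c by (intro sum.subset_diff) auto
    moreover have "card ({..<w n} - {0, c}) = w n - 2" using c c0 by (subst card_Diff_subset) auto
    ultimately have "norm (\<Sum>c<w n. \<zeta> ^ pos n c) \<le> real (w n - 2) + (2 - \<eta>)"
      using tri[of n "{..<w n} - {0, c}"] c0 norm_triangle_mono[of "\<Sum>c\<in>{..<w n} - {0, c}. \<zeta> ^ pos n c" "real (w n - 2)" "1 + \<zeta> ^ pos n c" "2 - \<eta>"]
      by simp
    then have "norm (\<Sum>c<w n. \<zeta> ^ pos n c) \<le> real (w n) - \<eta>" using w2[of n] by (simp add: of_nat_diff)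
    then have "\<rho> n \<le> (real (w n) - \<eta>) / real (w n)" unfolding \<rho>_def by (intro divide_right_mono) auto
    also have "\<dots> = 1 - \<eta> / real (w n)" using w2[of n] by (simp add: diff_divide_distrib)
    also have "\<dots> \<le> 1 - \<eta> / real G" using wG[of n] w2[of n] \<eta>(1) G_ge_2 by (intro diff_left_mono divide_left_mono) auto
    finally show ?thesis .
  qed
  have "z \<longlonglongrightarrow> 0"
  proof (rule infinitely_often_contraction[where C = C and r = "1 - \<eta> / real G", OF z0 _ _ pow_pos_nontrivial_infinitely_often[OF inf]])
    show "C \<ge> 0" by (simp add: C_def)
    show "z (Suc n) \<le> z n + C / 2 ^ n" for n using step[of n] mult_right_mono[OF \<rho>1 z0, of n n] by simp
    show "z (Suc n) \<le> (1 - \<eta> / real G) * z n + C / 2 ^ n" if "n \<in> {n. \<exists>c<w n. \<zeta> ^ pos n c \<noteq> 1}" for n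
      using step[of n] mult_right_mono[OF \<rho>2[OF that] z0, of n] by linarith
    show "1 - \<eta> / real G < 1" using \<eta>(1) G_ge_2 by simp
  qed
  then show ?thesis unfolding z_def .
qed

text \<open>If the phases are trivial from some level on, the copies add up coherently, and the mean
  over one copy is the mean over all long windows. Otherwise the means over copies tend to 0, and
  \<kappa> = 0.\<close>

lemma uniform_twisted_mean:
  assumes M: "M > 0" "\<zeta> ^ M = 1" and e: "e > 0"
  shows "\<exists>\<kappa> K0. \<forall>K\<ge>K0. \<forall>u. norm ((\<Sum>j=u..<u + K. \<beta> j * \<zeta> ^ j) - \<kappa> * of_nat K) \<le> e * real K"
proof -
  have "\<exists>n \<kappa> \<tau>. norm \<kappa> \<le> 1 \<and> \<tau> \<ge> 0 \<and> 2 * real (L + G) / real (H n) + \<tau> \<le> e / 2 \<and> (\<forall>i0 i1. i0 \<le> i1 \<longrightarrow>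
      norm (Z \<beta> \<zeta> n * (\<Sum>i=i0..<i1. \<zeta> ^ pos n i) - \<kappa> * of_nat (H n) * of_nat (i1 - i0)) \<le> \<tau> * real (H n) * real (i1 - i0))"
  proof (cases "\<exists>n. \<forall>i. \<zeta> ^ pos n i = 1")
    case True
    then obtain n0 where n0: "\<And>i. \<zeta> ^ pos n0 i = 1" by blast
    have "eventually (\<lambda>n. 2 * real (L + G) / real (H n) < e / 2) sequentially"
      using order_tendstoD(2)[OF H_tendsto] e by simp
    then have "eventually (\<lambda>n. 2 * real (L + G) / real (H n) < e / 2 \<and> n \<ge> n0) sequentially"
      using eventually_ge_at_top by (rule eventually_conj)
    then obtain n where n: "2 * real (L + G) / real (H n) < e / 2" "n \<ge> n0"
      unfolding eventually_sequentially by blast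
    have H0: "H n > 0" using H_ge_1[of n] by simp
    define \<kappa> where "\<kappa> = Z \<beta> \<zeta> n / of_nat (H n)"
    have "norm \<kappa> \<le> 1" unfolding \<kappa>_def using norm_Z_le[of n] H0 by (simp add: norm_divide divide_le_eq)
    moreover have "Z \<beta> \<zeta> n * (\<Sum>i=i0..<i1. \<zeta> ^ pos n i) - \<kappa> * of_nat (H n) * of_nat (i1 - i0) = 0" if "i0 \<le> i1" for i0 i1
      unfolding pow_pos_Suc_level[OF n0 n(2)] \<kappa>_def using H0 by simp
    ultimately show ?thesis using n(1) by (intro exI[of _ n] exI[of _ \<kappa>] exI[of _ 0]) simp
  next
    case False
    have "(\<lambda>n. 2 * real (L + G) / real (H n) + norm (Z \<beta> \<zeta> n) / real (H n)) \<longlonglongrightarrow> 0 + 0"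
      by (rule tendsto_add[OF H_tendsto Z_mean_tendsto_zero[OF M False]])
    then have "eventually (\<lambda>n. 2 * real (L + G) / real (H n) + norm (Z \<beta> \<zeta> n) / real (H n) < e / 2) sequentially"
      by (rule order_tendstoD(2)) (use e in simp)
    then obtain n where n: "2 * real (L + G) / real (H n) + norm (Z \<beta> \<zeta> n) / real (H n) < e / 2"
      unfolding eventually_sequentially by blast
    have H0: "H n > 0" using H_ge_1[of n] by simp
    have "norm (Z \<beta> \<zeta> n * (\<Sum>i=i0..<i1. \<zeta> ^ pos n i)) \<le> norm (Z \<beta> \<zeta> n) / real (H n) * real (H n) * real (i1 - i0)" for i0 i1
    proof -
      have "norm (\<Sum>i=i0..<i1. \<zeta> ^ pos n i) \<le> real (i1 - i0)"
        using sum_norm_bound[of "{i0..<i1}" "\<lambda>c. \<zeta> ^ pos n c" 1] \<zeta>1 by (simp add: norm_power)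
      then show ?thesis using H0 by (simp add: norm_mult mult_left_mono)
    qed
    then have "\<forall>i0 i1. i0 \<le> i1 \<longrightarrow>
      norm (Z \<beta> \<zeta> n * (\<Sum>i=i0..<i1. \<zeta> ^ pos n i) - 0 * of_nat (H n) * of_nat (i1 - i0)) \<le> norm (Z \<beta> \<zeta> n) / real (H n) * real (H n) * real (i1 - i0)"
      by (simp only: mult_zero_left diff_zero) blast
    moreover have "norm (0 :: complex) \<le> 1" "norm (Z \<beta> \<zeta> n) / real (H n) \<ge> 0" by simp_all
    ultimately show ?thesis using less_imp_le[OF n] by blast
  qed
  then obtain n \<kappa> \<tau> where k: "norm \<kappa> \<le> 1" "\<tau> \<ge> 0" "2 * real (L + G) / real (H n) + \<tau> \<le> e / 2"
    "\<And>i0 i1. i0 \<le> i1 \<Longrightarrow>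
      norm (Z \<beta> \<zeta> n * (\<Sum>i=i0..<i1. \<zeta> ^ pos n i) - \<kappa> * of_nat (H n) * of_nat (i1 - i0)) \<le> \<tau> * real (H n) * real (i1 - i0)"
    by blast
  define A where "A = real (H n + G)"
  have A0: "A \<ge> 0" by (simp add: A_def)
  define K0 where "K0 = nat \<lceil>(3 * A + A * (e / 2)) / (e / 2)\<rceil>"
  have "norm ((\<Sum>j=u..<u + K. \<beta> j * \<zeta> ^ j) - \<kappa> * of_nat K) \<le> e * real K" if "K \<ge> K0" for K u
  proof -
    have "norm ((\<Sum>j=u..<u + K. \<beta> j * \<zeta> ^ j) - \<kappa> * of_nat K)
      \<le> 3 * real (H n + G) + real (K + H n + G) * (2 * real (L + G) / real (H n) + \<tau>)"
      by (rule window_sum[OF k(1) k(4) k(2)])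
    also have "\<dots> \<le> 3 * real (H n + G) + real (K + H n + G) * (e / 2)" using k(3) by (intro add_left_mono mult_left_mono) auto
    also have "\<dots> = 3 * A + A * (e / 2) + e / 2 * real K" by (simp add: A_def algebra_simps)
    also have "3 * A + A * (e / 2) \<le> e / 2 * real K"
    proof -
      have "(3 * A + A * (e / 2)) / (e / 2) \<le> real K0" unfolding K0_def by (rule real_nat_ceiling_ge)
      also have "\<dots> \<le> real K" using that by simp
      finally have "3 * A + A * (e / 2) \<le> real K * (e / 2)" using e by (subst (asm) pos_divide_le_eq) auto
      then show ?thesis by (simp add: mult.commute)
    qed
    finally show ?thesis by simp
  qed
  then show ?thesis by blast
qed

end

lemma block_local_translate:
  assumes "block_local L \<beta>"
  shows "block_local (L + d) (\<lambda>j. \<beta> (j + d))"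
  using assms unfolding block_local_def
proof (intro conjI allI impI; elim conjE)
  fix n i l assume b: "\<forall>n i l. l + L \<le> H n \<longrightarrow> \<beta> (pos n i + l) = \<beta> l" and l: "l + (L + d) \<le> H n"
  have "(l + d) + L \<le> H n" using l by simp
  then have "\<beta> (pos n i + (l + d)) = \<beta> (l + d)" using b by blast
  then show "\<beta> (pos n i + l + d) = \<beta> (l + d)" by (simp add: add.assoc)
qed blast

lemma follows_translate:
  assumes "follows f \<beta>"
  shows "follows (\<lambda>n. f (n + d)) (\<lambda>j. \<beta> (j + d))"
  unfolding follows_def
proof
  fix K
  obtain v where "\<And>k. k < K + d \<Longrightarrow> f k = \<beta> (v + k)" using assms unfolding follows_def by blast
  then show "\<exists>v. \<forall>k<K. f (k + d) = \<beta> (v + k + d)" by (intro exI[of _ v]) (simp add: add.assoc)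
qed

text \<open>By pigeonhole one residue occurs for arbitrarily long stretches, and a long stretch
  serves for all shorter ones. This fixes the phase \<zeta> ^ v, which could otherwise vary with the
  window.\<close>

lemma follows_fixed_residue:
  assumes "follows f \<beta>" "M > 0"
  obtains \<rho> where "\<rho> < M" "\<And>K. \<exists>v. v mod M = \<rho> \<and> (\<forall>k<K. f k = \<beta> (v + k))"
proof -
  obtain v where v: "\<And>K k. k < K \<Longrightarrow> f k = \<beta> (v K + k)" using assms(1) unfolding follows_def by metis
  have "(\<lambda>K. v K mod M) ` UNIV \<subseteq> {..<M}" using assms(2) by auto
  then have "finite ((\<lambda>K. v K mod M) ` UNIV)" by (rule finite_subset) simp
  then obtain K0 where K0: "infinite {K \<in> UNIV. v K mod M = v K0 mod M}"
    using pigeonhole_infinite[of UNIV "\<lambda>K. v K mod M"] by auto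
  have "\<exists>u. u mod M = v K0 mod M \<and> (\<forall>k<K. f k = \<beta> (u + k))" for K
  proof -
    obtain K' where "K' \<ge> K" "v K' mod M = v K0 mod M" using K0 unfolding infinite_nat_iff_unbounded_le by auto
    then show ?thesis using v[of _ K'] by (intro exI[of _ "v K'"]) auto
  qed
  then show ?thesis using that[of "v K0 mod M"] assms(2) by simp
qed

text \<open>A window of f at u is a window of \<beta> at v + u, so the mean is multiplied by the
  inverse of \<zeta> ^ (v + u). As v mod M is fixed, this is a constant times \<zeta> ^ ((M - 1) *
  u), a natural exponent standing for - u.\<close>

lemma uniform_twisted_mean_follows:
  fixes \<zeta> :: complex
  assumes \<beta>: "block_local L \<beta>" and f: "follows f \<beta>" and M: "M > 0" "\<zeta> ^ M = 1" and e: "e > 0"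
  shows "\<exists>\<kappa> K0. \<forall>K\<ge>K0. \<forall>u. norm ((\<Sum>b<K. f (u + b) * \<zeta> ^ b) - \<kappa> * \<zeta> ^ ((M - 1) * u) * of_nat K) \<le> e * real K"
proof -
  have \<zeta>1: "norm \<zeta> = 1" using M power_eq_1_iff[of \<zeta> M] by auto
  obtain \<rho> where \<rho>: "\<rho> < M" "\<And>K. \<exists>v. v mod M = \<rho> \<and> (\<forall>k<K. f k = \<beta> (v + k))"
    by (rule follows_fixed_residue[OF f M(1)]) blast
  obtain \<kappa> K0 where k: "\<And>K u. K \<ge> K0 \<Longrightarrow> norm ((\<Sum>j=u..<u + K. \<beta> j * \<zeta> ^ j) - \<kappa> * of_nat K) \<le> e * real K"
    using uniform_twisted_mean[OF \<beta> \<zeta>1 M e] by blast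
  have "norm ((\<Sum>b<K. f (u + b) * \<zeta> ^ b) - (\<kappa> * \<zeta> ^ (M - \<rho>)) * \<zeta> ^ ((M - 1) * u) * of_nat K) \<le> e * real K" if K: "K \<ge> K0" for K u
  proof -
    obtain v where v: "v mod M = \<rho>" "\<And>k. k < u + K \<Longrightarrow> f k = \<beta> (v + k)" using \<rho>(2) by blast
    define \<theta> where "\<theta> = \<zeta> ^ (M - \<rho>) * \<zeta> ^ ((M - 1) * u)"
    have "v + u + ((M - \<rho>) + (M - 1) * u) = M * (v div M + 1 + u)"
    proof -
      have "v = M * (v div M) + \<rho>" using v(1) mult_div_mod_eq[of M v] by simp
      moreover obtain m where "M = Suc m" using M(1) by (cases M) auto
      ultimately show ?thesis using \<rho>(1) by (simp add: algebra_simps)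
    qed
    then have "\<zeta> ^ (v + u) * \<theta> = \<zeta> ^ (M * (v div M + 1 + u))"
      unfolding \<theta>_def power_add[symmetric] by (simp only:)
    then have \<theta>: "\<zeta> ^ (v + u) * \<theta> = 1" by (simp only: power_mult M(2) power_one)
    have "(\<Sum>j=v + u..<v + u + K. \<beta> j * \<zeta> ^ j) = (\<Sum>b<K. \<beta> (v + u + b) * \<zeta> ^ (v + u + b))"
      using sum.shift_bounds_nat_ivl[of "\<lambda>j. \<beta> j * \<zeta> ^ j" 0 "v + u" K] by (simp add: atLeast0LessThan ac_simps)
    also have "\<dots> = (\<Sum>b<K. \<zeta> ^ (v + u) * (f (u + b) * \<zeta> ^ b))"
      by (rule sum.cong[OF refl]) (use v(2) in \<open>simp add: power_add ac_simps\<close>)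
    finally have s: "(\<Sum>j=v + u..<v + u + K. \<beta> j * \<zeta> ^ j) = \<zeta> ^ (v + u) * (\<Sum>b<K. f (u + b) * \<zeta> ^ b)"
      by (simp add: sum_distrib_left)
    have "(\<Sum>b<K. f (u + b) * \<zeta> ^ b) - \<kappa> * \<theta> * of_nat K = \<theta> * ((\<Sum>j=v + u..<v + u + K. \<beta> j * \<zeta> ^ j) - \<kappa> * of_nat K)"
    proof -
      have "\<theta> * (\<zeta> ^ (v + u) * (\<Sum>b<K. f (u + b) * \<zeta> ^ b)) = (\<zeta> ^ (v + u) * \<theta>) * (\<Sum>b<K. f (u + b) * \<zeta> ^ b)" by simp
      then show ?thesis unfolding s right_diff_distrib \<theta> by (simp add: ac_simps)
    qed
    moreover have "norm \<theta> = 1" unfolding \<theta>_def by (simp add: norm_mult norm_power \<zeta>1)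
    ultimately have "norm ((\<Sum>b<K. f (u + b) * \<zeta> ^ b) - \<kappa> * \<theta> * of_nat K) = norm ((\<Sum>j=v + u..<v + u + K. \<beta> j * \<zeta> ^ j) - \<kappa> * of_nat K)"
      by (simp only: norm_mult mult_1)
    also have "\<dots> \<le> e * real K" by (rule k[OF K])
    finally show ?thesis by (simp add: \<theta>_def mult.assoc)
  qed
  then show ?thesis by blast
qed

text \<open>Translates of f satisfy the same hypotheses with a longer reading length, so the
  differences telescope along the progression before they are averaged.\<close>

lemma moebius_null_cesaro:
  fixes f :: "nat \<Rightarrow> complex"
  assumes "block_local L \<beta>" "follows f \<beta>" "infinite {n. good n}" "R > 0"
  shows "moebius_null (\<lambda>n. f n - (1 / of_nat R) * (\<Sum>a<R. f (n + fact G * a)))"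
proof -
  have d: "moebius_null (\<lambda>n. f (n + fact G * b) - f (n + fact G * b + fact G))" for b
    using moebius_null_difference[OF block_local_translate[OF assms(1)] follows_translate[OF assms(2)] assms(3), of "fact G * b"]
    by (simp add: ac_simps)
  have "moebius_null (\<lambda>n. \<Sum>b<a. f (n + fact G * b) - f (n + fact G * b + fact G))" for a
    by (rule moebius_null_sum) (rule d)
  moreover have "(\<Sum>b<a. f (n + fact G * b) - f (n + fact G * b + fact G)) = f n - f (n + fact G * a)" for n a
    by (induction a) (simp_all add: algebra_simps)
  ultimately have "moebius_null (\<lambda>n. f n - f (n + fact G * a))" for a by simp
  then have "moebius_null (\<lambda>n. (1 / of_nat R) * (\<Sum>a<R. f n - f (n + fact G * a)))"
    by (intro moebius_null_cmult moebius_null_sum)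
  moreover have "(1 / of_nat R) * (\<Sum>a<R. f n - f (n + fact G * a)) = f n - (1 / of_nat R) * (\<Sum>a<R. f (n + fact G * a))" for n
    using assms(4) by (simp add: sum_subtractf field_simps)
  ultimately show ?thesis by (simp only:)
qed

theorem moebius_null_follows:
  assumes \<beta>: "block_local L \<beta>" and f: "follows f \<beta>" and good: "infinite {n. good n}"
  shows "moebius_null f"
proof (rule moebius_null_approx)
  fix e :: real assume e: "e > 0"
  define M :: nat where "M = fact G"
  have M0: "M > 0" by (simp add: M_def)
  define \<omega> :: complex where "\<omega> = exp (2 * of_real pi * \<i> / of_nat M)"
  have \<omega>j: "\<omega> ^ j = exp (2 * of_real pi * \<i> * of_nat j / of_nat M)" for j
    unfolding \<omega>_def exp_of_nat_mult[symmetric] by (simp add: ac_simps)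
  have \<omega>M: "\<omega> ^ M = 1" unfolding \<omega>j using M0 exp_two_pi_i by (simp add: ac_simps)
  have orth: "(\<Sum>k<M. (\<omega> ^ k) ^ b) = (if M dvd b then of_nat M else 0)" for b
  proof -
    have "\<omega> ^ b = \<omega> ^ (M * (b div M) + b mod M)" by simp
    also have "\<dots> = \<omega> ^ (b mod M)" unfolding power_add power_mult \<omega>M by simp
    finally have b: "\<omega> ^ b = \<omega> ^ (b mod M)" .
    have "(\<Sum>k<M. (\<omega> ^ k) ^ b) = (\<Sum>k<M. (\<omega> ^ b) ^ k)"
      by (rule sum.cong[OF refl]) (simp only: power_mult[symmetric] mult.commute)
    also have "\<dots> = (if b mod M = 0 then of_nat M else 0)"
      unfolding b unfolding \<omega>j using roots_of_unity_sum[of "b mod M" M] M0 by simp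
    finally show ?thesis by (simp add: dvd_eq_mod_eq_0)
  qed
  have \<zeta>M: "(\<omega> ^ k) ^ M = 1" for k by (metis \<omega>M power_mult mult.commute power_one)
  have "\<forall>k. \<exists>\<kappa> K0. \<forall>K\<ge>K0. \<forall>u. norm ((\<Sum>b<K. f (u + b) * (\<omega> ^ k) ^ b) - \<kappa> * (\<omega> ^ k) ^ ((M - 1) * u) * of_nat K) \<le> e / real M * real K"
    using uniform_twisted_mean_follows[OF \<beta> f M0 \<zeta>M, of "e / real M"] e M0 by simp
  then obtain \<kappa> K0 where \<kappa>: "\<And>k K u. K \<ge> K0 k \<Longrightarrow> norm ((\<Sum>b<K. f (u + b) * (\<omega> ^ k) ^ b) - \<kappa> k * (\<omega> ^ k) ^ ((M - 1) * u) * of_nat K) \<le> e / real M * real K"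
    by metis
  \<comment> \<open>One length R * M beyond the thresholds \<open>K0 k\<close> of all M roots of
    unity.\<close>
  define R where "R = Suc (\<Sum>k<M. K0 k)"
  have RK: "R * M \<ge> K0 k" if "k < M" for k
  proof -
    have "K0 k \<le> (\<Sum>k<M. K0 k)" using that by (intro member_le_sum) auto
    also have "\<dots> \<le> R * 1" by (simp add: R_def)
    also have "\<dots> \<le> R * M" using M0 by (intro mult_le_mono2) simp
    finally show ?thesis .
  qed
  have R0: "R > 0" by (simp add: R_def)
  \<comment> \<open>The twisted mean for \<omega>^k varies with u only through \<omega>^(-k u), so
    \<open>Q\<close> is M-periodic. Expanding the indicator of the multiples of M in the roots shows
    that the average along the progression differs from \<open>Q\<close> by at most M * (e /
    M).\<close>
  define Q where "Q = (\<lambda>u. \<Sum>k<M. \<kappa> k * (\<omega> ^ k) ^ ((M - 1) * u))"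
  have "moebius_null Q"
  proof (rule moebius_null_periodic[OF M0])
    fix u
    have "(\<omega> ^ k) ^ ((M - 1) * (u + M)) = (\<omega> ^ k) ^ ((M - 1) * u)" for k
    proof -
      have "(M - 1) * (u + M) = (M - 1) * u + M * (M - 1)" by (simp only: distrib_left mult.commute[of M])
      then have "(\<omega> ^ k) ^ ((M - 1) * (u + M)) = (\<omega> ^ k) ^ ((M - 1) * u) * ((\<omega> ^ k) ^ M) ^ (M - 1)"
        by (simp only: power_add power_mult)
      then show ?thesis unfolding \<zeta>M by simp
    qed
    then show "Q (u + M) = Q u" unfolding Q_def by simp
  qed
  moreover have F: "(1 / of_nat R) * (\<Sum>a<R. f (u + M * a)) = (\<Sum>k<M. (\<Sum>b<R * M. f (u + b) * (\<omega> ^ k) ^ b) / of_nat (R * M))" for u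
  proof -
    have "(\<Sum>k<M. \<Sum>b<R * M. f (u + b) * (\<omega> ^ k) ^ b) = (\<Sum>b<R * M. f (u + b) * (\<Sum>k<M. (\<omega> ^ k) ^ b))"
      by (subst sum.swap) (simp add: sum_distrib_left)
    also have "\<dots> = (\<Sum>b<R * M. if M dvd b then f (u + b) * of_nat M else 0)"
      unfolding orth by (rule sum.cong[OF refl]) simp
    also have "\<dots> = (\<Sum>b | b < R * M \<and> M dvd b. f (u + b) * of_nat M)"
      using sum.inter_filter[of "{..<R * M}" "\<lambda>b. f (u + b) * of_nat M" "\<lambda>b. M dvd b"] by simp
    also have "\<dots> = (\<Sum>a<R. f (u + M * a) * of_nat M)"
      by (rule sum.reindex_bij_witness[of _ "\<lambda>a. M * a" "\<lambda>b. b div M"]) (use M0 in \<open>auto simp: less_mult_imp_div_less mult.commute\<close>)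
    finally have "(\<Sum>k<M. \<Sum>b<R * M. f (u + b) * (\<omega> ^ k) ^ b) = of_nat M * (\<Sum>a<R. f (u + M * a))"
      by (simp add: sum_distrib_left mult.commute)
    then show ?thesis unfolding sum_divide_distrib[symmetric] using M0 R0 by simp
  qed
  have close: "norm ((1 / of_nat R) * (\<Sum>a<R. f (u + M * a)) - Q u) \<le> e" for u
  proof -
    have RM: "real (R * M) > 0" using R0 M0 by simp
    have "norm ((1 / of_nat R) * (\<Sum>a<R. f (u + M * a)) - Q u) =
        norm (\<Sum>k<M. (\<Sum>b<R * M. f (u + b) * (\<omega> ^ k) ^ b) / of_nat (R * M) - \<kappa> k * (\<omega> ^ k) ^ ((M - 1) * u))"
      unfolding F Q_def sum_subtractf ..
    also have "\<dots> \<le> real (card {..<M}) * (e / real M)"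
    proof (rule sum_norm_bound)
      fix k assume "k \<in> {..<M}"
      then have "norm ((\<Sum>b<R * M. f (u + b) * (\<omega> ^ k) ^ b) - \<kappa> k * (\<omega> ^ k) ^ ((M - 1) * u) * of_nat (R * M)) \<le> e / real M * real (R * M)"
        by (intro \<kappa> RK) simp
      then have "norm ((\<Sum>b<R * M. f (u + b) * (\<omega> ^ k) ^ b) - \<kappa> k * (\<omega> ^ k) ^ ((M - 1) * u) * of_nat (R * M)) / real (R * M) \<le> e / real M"
        by (subst pos_divide_le_eq[OF RM])
      also have "norm ((\<Sum>b<R * M. f (u + b) * (\<omega> ^ k) ^ b) - \<kappa> k * (\<omega> ^ k) ^ ((M - 1) * u) * of_nat (R * M)) / real (R * M)
         = norm (((\<Sum>b<R * M. f (u + b) * (\<omega> ^ k) ^ b) - \<kappa> k * (\<omega> ^ k) ^ ((M - 1) * u) * of_nat (R * M)) / of_nat (R * M))"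
        unfolding norm_divide norm_of_nat ..
      also have "((\<Sum>b<R * M. f (u + b) * (\<omega> ^ k) ^ b) - \<kappa> k * (\<omega> ^ k) ^ ((M - 1) * u) * of_nat (R * M)) / of_nat (R * M)
         = (\<Sum>b<R * M. f (u + b) * (\<omega> ^ k) ^ b) / of_nat (R * M) - \<kappa> k * (\<omega> ^ k) ^ ((M - 1) * u)"
        using R0 M0 by (simp add: diff_divide_distrib)
      finally show "norm ((\<Sum>b<R * M. f (u + b) * (\<omega> ^ k) ^ b) / of_nat (R * M) - \<kappa> k * (\<omega> ^ k) ^ ((M - 1) * u)) \<le> e / real M" .
    qed
    also have "\<dots> = e" using M0 by simp
    finally show ?thesis .
  qed
  have "moebius_null (\<lambda>n. (f n - (1 / of_nat R) * (\<Sum>a<R. f (n + M * a))) + Q n)"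
    by (rule moebius_null_add[OF moebius_null_cesaro[OF \<beta> f good R0, folded M_def] \<open>moebius_null Q\<close>])
  moreover have "norm (f n - ((f n - (1 / of_nat R) * (\<Sum>a<R. f (n + M * a))) + Q n)) \<le> e" for n
    using close[of n] by simp
  ultimately show "\<exists>g. moebius_null g \<and> (\<forall>n. norm (f n - g n) \<le> e)" by blast
qed

lemma moebius_null_follows_periodic:
  assumes f: "follows f \<beta>" and P: "P > 0" "\<And>j. \<beta> (j + P) = \<beta> j"
  shows "moebius_null f"
proof (rule moebius_null_periodic[OF P(1)])
  fix n
  obtain v where v: "\<And>k. k < Suc (n + P) \<Longrightarrow> f k = \<beta> (v + k)" using f unfolding follows_def by blast
  have "f (n + P) = \<beta> (v + (n + P))" by (rule v) simp
  also have "\<dots> = f n" using v[of n] P(2)[of "v + n"] by (simp add: add.assoc)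
  finally show "f (n + P) = f n" .
qed

end

section \<open>The rank-one word and the rank-one space\<close>

context tower
begin

text \<open>The infinite word with all \<open>B\<^sub>n\<close> as prefixes: the zeros are the starting points of the copies of \<open>B\<^sub>0\<close>.\<close>
definition letter :: "nat \<Rightarrow> nat" where
  "letter j = (if j \<in> range (pos 0) then 0 else 1)"

lemma block_decomposition:
  obtains c l where "j = pos n c + l" "l < H n + g n (Suc c)"
proof -
  obtain i0 where i0: "Suc j \<le> pos n i0" "pos n i0 \<le> Suc j + H n + G" "\<And>i. i < i0 \<Longrightarrow> pos n i < Suc j" by (rule first_block[of "Suc j" n]) blast
  obtain c where c: "i0 = Suc c" using i0(1) by (cases i0) auto
  have "pos n c \<le> j" using i0(3)[of c] c by simp
  then show ?thesis using that[of c "j - pos n c"] i0(1) unfolding c pos_Suc by linarith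
qed

lemma height_Suc: "H (Suc n) = pos n (w n - 1) + H n"
proof -
  obtain v where v: "w n = Suc v" using w2[of n] by (cases "w n") auto
  have "pos n (w n) = H (Suc n) + g (Suc n) 1" using pos_mult[of n 1] pos_Suc[of "Suc n" 0] by (simp del: rank_one_height.simps)
  moreover have "pos n (w n) = pos n v + H n + g n (w n)" using pos_Suc[of n v] v by simp
  moreover have "g n (w n) = g (Suc n) 1" using gap_mult[of 1 n] by simp
  ultimately show ?thesis using v by simp
qed

text \<open>Both claims are carried together through the induction: inside a copy of the (n + 1)-th
  word the inner gaps are gaps of level n, and the gap behind it is the level-n gap behind its last
  subcopy.\<close>

lemma letter_block: "(l < H n \<longrightarrow> letter (pos n i + l) = letter l) \<and>
    (H n \<le> l \<longrightarrow> l < H n + g n (Suc i) \<longrightarrow> letter (pos n i + l) = 1)"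
proof (induction n arbitrary: i l)
  case 0
  have "letter (pos 0 i + 0) = letter 0"
  proof -
    have "0 \<in> range (pos 0)" using rangeI[of "pos 0" 0] by simp
    then show ?thesis by (simp add: letter_def)
  qed
  moreover have "letter (pos 0 i + l) = 1" if "1 \<le> l" "l < 1 + g 0 (Suc i)"
  proof -
    have "pos 0 i + l \<noteq> pos 0 k" for k
    proof (cases "k \<le> i")
      case True
      then show ?thesis using pos_mono[of k i 0] that by linarith
    next
      case False
      then have "pos 0 (Suc i) \<le> pos 0 k" by (intro pos_mono) simp
      then show ?thesis using that by (simp add: pos_Suc)
    qed
    then show ?thesis by (auto simp: letter_def)
  qed
  ultimately show ?case by simp
next
  case (Suc n)
  have pd: "pos (Suc n) i + pos n c = pos n (w n * i + c)" if "c < w n" for c using pos_digit[OF that] by simp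
  show ?case
  proof (intro conjI impI)
    assume l: "l < H (Suc n)"
    obtain c l' where c: "l = pos n c + l'" "l' < H n + g n (Suc c)" by (rule block_decomposition)
    have cw: "c < w n"
    proof (rule ccontr)
      assume "\<not> c < w n"
      then have "pos n (w n - 1) + H n \<le> pos n c" using w2[of n] by (intro pos_less) auto
      then show False using l c(1) height_Suc[of n] by linarith
    qed
    have e: "pos (Suc n) i + l = pos n (w n * i + c) + l'" unfolding c(1) pd[OF cw, symmetric] by simp
    show "letter (pos (Suc n) i + l) = letter l"
    proof (cases "l' < H n")
      case True
      then show ?thesis unfolding e unfolding c(1) using Suc.IH by simp
    next
      case False
      have "c \<noteq> w n - 1" using False l c(1) height_Suc[of n] by (intro notI) simp
      then have cw': "Suc c < w n" using cw by linarith
      have "g n (w n * i + Suc c) = g n (w n * 0 + Suc c)"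
        using gap_nondiv[of "Suc c" n i] gap_nondiv[of "Suc c" n 0] cw' by simp
      then have "l' < H n + g n (Suc (w n * i + c))" using c(2) by simp
      then have "letter (pos n (w n * i + c) + l') = 1" using Suc.IH False by (simp add: not_less)
      moreover have "letter (pos n c + l') = 1" using Suc.IH False c(2) by (simp add: not_less)
      ultimately show ?thesis unfolding e unfolding c(1) by simp
    qed
  next
    assume l: "H (Suc n) \<le> l" "l < H (Suc n) + g (Suc n) (Suc i)"
    define l' where "l' = l - pos n (w n - 1)"
    have w1: "w n - 1 < w n" using w2[of n] by simp
    have l': "l = pos n (w n - 1) + l'" "H n \<le> l'" using l(1) height_Suc[of n] unfolding l'_def by linarith+
    have "Suc (w n * i + (w n - 1)) = w n * Suc i" using w2[of n] by simp
    then have "g n (Suc (w n * i + (w n - 1))) = g (Suc n) (Suc i)" using gap_mult[of "Suc i" n] by (simp only:)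
    then have "l' < H n + g n (Suc (w n * i + (w n - 1)))" using l(2) l' height_Suc[of n] by linarith
    then have "letter (pos n (w n * i + (w n - 1)) + l') = 1" using Suc.IH l'(2) by blast
    moreover have "pos (Suc n) i + l = pos n (w n * i + (w n - 1)) + l'" unfolding l'(1) pd[OF w1, symmetric] by simp
    ultimately show "letter (pos (Suc n) i + l) = 1" by (simp only:)
  qed
qed

lemma map_letter_pos:
  assumes "rank_one_word w a n = map letter [0..<H n]"
  shows "map letter [0..<pos n k] = concat (map (\<lambda>i. rank_one_word w a n @ replicate (g n i) 1) [1..<Suc k])"
proof (induction k)
  case (Suc k)
  have 1: "map letter [pos n k..<pos n k + H n] = rank_one_word w a n"
    unfolding assms using letter_block[of _ n k] by (intro nth_equalityI) auto
  have 2: "map letter [pos n k + H n..<pos n (Suc k)] = replicate (g n (Suc k)) 1"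
  proof (rule nth_equalityI)
    fix i assume i: "i < length (map letter [pos n k + H n..<pos n (Suc k)])"
    then have "i < g n (Suc k)" by (simp add: pos_Suc)
    then show "map letter [pos n k + H n..<pos n (Suc k)] ! i = replicate (g n (Suc k)) 1 ! i"
      using letter_block[of "H n + i" n k] i by (simp add: add.assoc)
  qed (simp add: pos_Suc)
  have "[0..<pos n (Suc k)] = [0..<pos n k] @ [pos n k..<pos n k + H n] @ [pos n k + H n..<pos n (Suc k)]"
    using upt_add_eq_append[of 0 "pos n k" "H n"] upt_add_eq_append[of 0 "pos n k + H n" "g n (Suc k)"]
    unfolding pos_Suc by (simp only: le0 append_assoc)
  then have "map letter [0..<pos n (Suc k)] = map letter [0..<pos n k] @ rank_one_word w a n @ replicate (g n (Suc k)) 1"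
    by (simp only: map_append 1 2)
  then show ?case unfolding Suc by simp
qed simp

lemma rank_one_word_eq: "rank_one_word w a n = map letter [0..<H n]"
proof (induction n)
  case 0
  have "0 \<in> range (pos 0)" using rangeI[of "pos 0" 0] by simp
  then show ?case by (simp add: letter_def)
next
  case (Suc n)
  obtain v where v: "w n = Suc v" using w2[of n] by (cases "w n") auto
  have "map (\<lambda>j. rank_one_word w a n @ replicate (a n j) 1) [1..<w n] = map (\<lambda>j. rank_one_word w a n @ replicate (g n j) 1) [1..<Suc v]"
    unfolding v using gap_nondiv[of _ n 0] v by (intro map_cong) auto
  then have "rank_one_word w a (Suc n) = map letter [0..<pos n v] @ rank_one_word w a n"
    unfolding map_letter_pos[OF Suc] by simp
  also have "rank_one_word w a n = map letter [pos n v..<pos n v + H n]"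
    unfolding Suc using letter_block[of _ n v] by (intro nth_equalityI) auto
  also have "map letter [0..<pos n v] @ map letter [pos n v..<pos n v + H n] = map letter [0..<H (Suc n)]"
    unfolding height_Suc v using upt_add_eq_append[of 0 "pos n v" "H n"] by simp
  finally show ?case .
qed

lemma letter_periodic:
  assumes "finite {n. good n}"
  obtains P where "P > 0" "\<And>j. letter (j + P) = letter j"
proof -
  obtain n0 where n0: "\<And>n. n \<in> {n. good n} \<Longrightarrow> n < n0" using assms finite_nat_set_iff_bounded by auto
  have gc: "g n0 i = g n0 1" if "i \<ge> 1" for i
    using not_good_gap_const[of n0 n0 i] n0 that by (metis mem_Collect_eq not_le order_refl)
  define P where "P = H n0 + g n0 1"
  have "letter (j + P) = letter j" for j
  proof -
    obtain c l where c: "j = pos n0 c + l" "l < H n0 + g n0 (Suc c)" by (rule block_decomposition)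
    have e: "j + P = pos n0 (Suc c) + l" unfolding c(1) pos_Suc P_def using gc[of "Suc c"] by simp
    have l: "l < H n0 + g n0 (Suc (Suc c))" using c(2) gc[of "Suc c"] gc[of "Suc (Suc c)"] by simp
    show ?thesis unfolding e unfolding c(1)
      using letter_block[of l n0 c] letter_block[of l n0 "Suc c"] c(2) l by (cases "l < H n0") auto
  qed
  moreover have "P > 0" using H_ge_1[of n0] by (simp add: P_def)
  ultimately show ?thesis by (rule that[rotated])
qed

text \<open>Every word of the construction is a prefix of the infinite word, so a block of x is a
  block of \<open>letter\<close>, and the observable along x follows the one along
  \<open>letter\<close>. The cases are distinguished by whether infinitely many levels are
  good.\<close>

theorem moebius_null_cylinder:
  fixes F :: "nat list \<Rightarrow> complex" and x :: "nat \<Rightarrow> nat"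
  assumes F: "\<And>u. norm (F u) \<le> 1"
    and x: "\<And>K. \<exists>m. sublist (map x [1..<Suc K]) (rank_one_word w a m)"
  shows "moebius_null (\<lambda>n. F (map x [n + 1..<n + 1 + L]))"
proof -
  define \<beta> where "\<beta> = (\<lambda>j. F (map letter [j..<j + L]))"
  have \<beta>: "block_local L \<beta>"
    unfolding block_local_def
  proof (intro conjI allI impI)
    fix n i l assume l: "l + L \<le> H n"
    have "map letter [pos n i + l..<pos n i + l + L] = map letter [l..<l + L]"
    proof (rule nth_equalityI)
      fix k assume "k < length (map letter [pos n i + l..<pos n i + l + L])"
      then have "l + k < H n" "k < L" using l by auto
      then show "map letter [pos n i + l..<pos n i + l + L] ! k = map letter [l..<l + L] ! k"
        using letter_block[of "l + k" n i] by (simp add: add.assoc)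
    qed simp
    then show "\<beta> (pos n i + l) = \<beta> l" unfolding \<beta>_def by (simp only:)
  qed (simp add: \<beta>_def F)
  have fol: "follows (\<lambda>n. F (map x [n + 1..<n + 1 + L])) \<beta>"
    unfolding follows_def
  proof
    fix K
    \<comment> \<open>The first K windows of length L read fewer than K + L letters, so these cover
      them all.\<close>
    obtain m where "sublist (map x [1..<Suc (K + L)]) (rank_one_word w a m)" using x by blast
    then obtain ps ss where ps: "map letter [0..<H m] = ps @ map x [1..<Suc (K + L)] @ ss"
      unfolding sublist_def rank_one_word_eq by blast
    have len: "length ps + (K + L) \<le> H m" using arg_cong[OF ps, of length] by (simp del: upt_Suc)
    have eq: "x (Suc s) = letter (length ps + s)" if "s < K + L" for s
    proof -
      have "map letter [0..<H m] ! (length ps + s) = x (Suc s)"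
        unfolding ps using that by (simp add: nth_append del: upt_Suc)
      then show ?thesis using that len by simp
    qed
    have "F (map x [k + 1..<k + 1 + L]) = \<beta> (length ps + k)" if "k < K" for k
    proof -
      have "map x [k + 1..<k + 1 + L] = map letter [length ps + k..<length ps + k + L]"
      proof (rule nth_equalityI)
        fix i assume "i < length (map x [k + 1..<k + 1 + L])"
        then have i: "i < L" by (simp del: upt_Suc)
        then show "map x [k + 1..<k + 1 + L] ! i = map letter [length ps + k..<length ps + k + L] ! i"
          using eq[of "k + i"] that by (simp add: add.assoc del: upt_Suc)
      qed (simp del: upt_Suc)
      then show ?thesis unfolding \<beta>_def by (simp only:)
    qed
    then show "\<exists>v. \<forall>k<K. F (map x [k + 1..<k + 1 + L]) = \<beta> (v + k)" by blast
  qed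
  show ?thesis
  proof (cases "finite {n. good n}")
    case False
    then show ?thesis by (rule moebius_null_follows[OF \<beta> fol])
  next
    case True
    then obtain P where P: "P > 0" "\<And>j. letter (j + P) = letter j" by (rule letter_periodic) blast
    have "\<beta> (j + P) = \<beta> j" for j
    proof -
      have "map letter [j + P..<j + P + L] = map letter [j..<j + L]"
      proof (rule nth_equalityI)
        fix k assume "k < length (map letter [j + P..<j + P + L])"
        then show "map letter [j + P..<j + P + L] ! k = map letter [j..<j + L] ! k"
          using P(2)[of "j + k"] by (simp add: ac_simps)
      qed simp
      then show ?thesis unfolding \<beta>_def by (simp only:)
    qed
    then show ?thesis by (rule moebius_null_follows_periodic[OF fol P(1)])
  qed
qed

end

section \<open>Removing levels with a single copy\<close>

lemma rank_one_word_const: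
  assumes "n \<le> n'" "\<And>m. n \<le> m \<Longrightarrow> m < n' \<Longrightarrow> w m = 1"
  shows "rank_one_word w a n' = rank_one_word w a n"
  using assms
proof (induction n' rule: dec_induct)
  case (step m)
  then have "w m = 1" by simp
  then show ?case using step by simp
qed simp

text \<open>A level with one copy repeats the previous word, so the construction restricted to the
  other levels yields the same set of words.\<close>

lemma rank_one_word_skip:
  fixes w :: "nat \<Rightarrow> nat"
  assumes inf: "infinite {n. w n \<ge> 2}" and w0: "\<And>n. w n > 0"
  defines "e \<equiv> enumerate {n. w n \<ge> 2}"
  shows "\<exists>k. rank_one_word w a n = rank_one_word (\<lambda>k. w (e k)) (\<lambda>k. a (e k)) k"
proof -
  have w1: "w m = 1" if "\<not> w m \<ge> 2" for m using w0[of m] that by linarith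
  have e: "rank_one_word (\<lambda>k. w (e k)) (\<lambda>k. a (e k)) k = rank_one_word w a (e k)" for k
  proof (induction k)
    case 0
    have "w m = 1" if "m < e 0" for m
      by (rule w1) (use not_less_Least[of m "\<lambda>n. n \<in> {n. w n \<ge> 2}"] that in \<open>auto simp: e_def enumerate_0\<close>)
    then have "rank_one_word w a (e 0) = rank_one_word w a 0" by (intro rank_one_word_const) auto
    then show ?case by simp
  next
    case (Suc k)
    have es: "e (Suc k) = (LEAST s. s \<in> {n. w n \<ge> 2} \<and> e k < s)" unfolding e_def by (rule enumerate_Suc''[OF inf])
    have "e k < e (Suc k)" unfolding e_def by (rule enumerate_step[OF inf])
    moreover have "w m = 1" if "Suc (e k) \<le> m" "m < e (Suc k)" for m
      by (rule w1) (use not_less_Least[of m "\<lambda>s. s \<in> {n. w n \<ge> 2} \<and> e k < s"] that es in auto)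
    ultimately have "rank_one_word w a (e (Suc k)) = rank_one_word w a (Suc (e k))" by (intro rank_one_word_const) auto
    then show ?case using Suc by simp
  qed
  obtain m0 where m0: "m0 \<ge> n" "w m0 \<ge> 2" using inf unfolding infinite_nat_iff_unbounded_le by auto
  define m where "m = (LEAST m. m \<ge> n \<and> w m \<ge> 2)"
  have m: "m \<ge> n" "w m \<ge> 2" using LeastI[of "\<lambda>m. m \<ge> n \<and> w m \<ge> 2" m0] m0 unfolding m_def by auto
  have "w j = 1" if "n \<le> j" "j < m" for j
    by (rule w1) (use not_less_Least[of j "\<lambda>m. m \<ge> n \<and> w m \<ge> 2"] that in \<open>auto simp: m_def\<close>)
  then have "rank_one_word w a m = rank_one_word w a n" using m by (intro rank_one_word_const)
  moreover obtain k where "e k = m" using enumerate_Ex[OF inf, of m] m(2) unfolding e_def by auto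
  ultimately show ?thesis using e[of k] by (intro exI[of _ k]) simp
qed

text \<open>The words stabilise and have bounded length, whereas a point of the space shows blocks
  of any length. This disposes of the degenerate case of the theorem.\<close>

lemma rank_one_space_empty:
  fixes w :: "nat \<Rightarrow> nat"
  assumes fin: "finite {n. w n \<ge> 2}" and w0: "\<And>n. w n > 0"
  shows "rank_one_space w a = {}"
proof (rule ccontr)
  assume "rank_one_space w a \<noteq> {}"
  then obtain x where x: "x \<in> rank_one_space w a" by blast
  obtain n0 where n0: "\<And>n. n \<in> {n. w n \<ge> 2} \<Longrightarrow> n < n0" using fin finite_nat_set_iff_bounded by auto
  define h where "h = rank_one_height w a"
  have mono: "h n \<le> h m" if "n \<le> m" for n m
    using that
  proof (rule lift_Suc_mono_le[rotated])
    fix n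
    have "1 * h n \<le> w n * h n" using w0[of n] by (intro mult_le_mono1) simp
    also have "\<dots> \<le> h (Suc n)" unfolding h_def by simp
    finally show "h n \<le> h (Suc n)" by simp
  qed
  have "h n \<le> h n0" for n
  proof (cases "n \<le> n0")
    case False
    have "rank_one_word w a n = rank_one_word w a n0"
    proof (rule rank_one_word_const)
      fix m assume "n0 \<le> m"
      then have "\<not> w m \<ge> 2" using n0[of m] by auto
      then show "w m = 1" using w0[of m] by linarith
    qed (use False in simp)
    then show ?thesis unfolding h_def length_rank_one_word[of w, OF w0, symmetric] by simp
  qed (rule mono)
  moreover obtain n where n: "sublist (map x [1..<Suc (h n0 + 2)]) (rank_one_word w a n)"
  proof -
    have "1 \<le> (1 :: nat)" "1 < h n0 + 2" by simp_all
    then show ?thesis using x that unfolding rank_one_space_def by blast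
  qed
  have "h n0 + 2 \<le> h n"
    using sublist_length_le[OF n] length_rank_one_word[of w a n, OF w0] unfolding h_def by (simp del: upt_Suc)
  ultimately show False by (metis add_2_eq_Suc' le_trans not_less_eq_eq le_SucI order_refl)
qed

lemma funpow_shift:
  assumes "m \<ge> 1"
  shows "(shift ^^ n) x m = x (m + n)"
  using assms by (induction n arbitrary: m) (auto simp: shift_def)

lemma funpow_shift_rank_one_space: "x \<in> rank_one_space w a \<Longrightarrow> (shift ^^ n) x \<in> rank_one_space w a"
  by (induction n) (auto intro: shift_rank_one_space)

section \<open>Continuous functions and cylinder functions\<close>

abbreviation (input) full_shift :: "(nat \<Rightarrow> nat) topology" where
  "full_shift \<equiv> product_topology (\<lambda>_. discrete_topology {0, 1}) {1..}"

lemma openin_cylinder: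
  assumes "y \<in> {1..} \<rightarrow>\<^sub>E {0, 1}"
  shows "openin full_shift {z \<in> {1..} \<rightarrow>\<^sub>E {0, 1}. \<forall>m\<in>{1..L}. z m = y m}"
proof -
  have "{z \<in> {1..} \<rightarrow>\<^sub>E {0, 1}. \<forall>m\<in>{1..L}. z m = y m} = PiE {1..} (\<lambda>m. if m \<le> L then {y m} else {0, 1})"
    (is "?A = ?B")
  proof
    show "?A \<subseteq> ?B" by (simp add: PiE_iff subset_iff)
    show "?B \<subseteq> ?A"
    proof
      fix z assume z: "z \<in> ?B"
      have "z m \<in> {0, 1}" if "m \<in> {1..}" for m
        using PiE_mem[OF z that] PiE_mem[OF assms that] by (auto split: if_splits)
      moreover have "z m = y m" if "m \<in> {1..L}" for m using PiE_mem[OF z, of m] that by auto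
      moreover have "z \<in> extensional {1..}" using z by (simp add: PiE_def)
      ultimately show "z \<in> ?A" by (simp add: PiE_iff)
    qed
  qed
  moreover have "openin full_shift ?B"
    unfolding openin_PiE_gen
  proof (intro disjI2 conjI ballI)
    show "finite {i \<in> {1..}. (if i \<le> L then {y i} else {0, 1}) \<noteq> topspace (discrete_topology {0, 1 :: nat})}"
      by (rule finite_subset[of _ "{..L}"]) auto
    show "openin (discrete_topology {0, 1}) (if i \<le> L then {y i} else {0, 1})" if "i \<in> {1..}" for i
      using PiE_mem[OF assms that] by auto
  qed
  ultimately show ?thesis by simp
qed

text \<open>Each defining condition concerns a finite block, so its failure persists on a
  cylinder.\<close>

lemma closedin_rank_one_space: "closedin full_shift (rank_one_space w a)"
  unfolding closedin_def
proof
  show "rank_one_space w a \<subseteq> topspace full_shift" by (auto simp: rank_one_space_def)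
  show "openin full_shift (topspace full_shift - rank_one_space w a)"
  proof (subst openin_subopen, rule ballI)
    fix y assume y: "y \<in> topspace full_shift - rank_one_space w a"
    then have yP: "y \<in> {1..} \<rightarrow>\<^sub>E {0, 1}" by simp
    then obtain s t where st: "1 \<le> s" "s < t" "\<nexists>n. sublist (map y [s..<Suc t]) (rank_one_word w a n)"
      using y unfolding rank_one_space_def by blast
    let ?U = "{z \<in> {1..} \<rightarrow>\<^sub>E {0, 1}. \<forall>m\<in>{1..t}. z m = y m}"
    have "z \<notin> rank_one_space w a" if "z \<in> ?U" for z
    proof
      assume "z \<in> rank_one_space w a"
      then obtain n where "sublist (map z [s..<Suc t]) (rank_one_word w a n)" using st unfolding rank_one_space_def by blast
      moreover have "map z [s..<Suc t] = map y [s..<Suc t]" using that st(1) by (intro map_cong) auto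
      ultimately show False using st(3) by (metis (no_types))
    qed
    then have "?U \<subseteq> topspace full_shift - rank_one_space w a" by auto
    then show "\<exists>T. openin full_shift T \<and> y \<in> T \<and> T \<subseteq> topspace full_shift - rank_one_space w a"
      using openin_cylinder[OF yP, of t] yP by (intro exI[of _ ?U]) auto
  qed
qed

lemma compactin_rank_one_space: "compactin full_shift (rank_one_space w a)"
proof -
  have "compact_space full_shift" by (simp add: compact_space_product_topology compact_space_discrete_topology)
  then show ?thesis by (rule closedin_compact_space[OF _ closedin_rank_one_space])
qed

lemma continuous_locally_cylindrical:
  fixes \<phi> :: "(nat \<Rightarrow> nat) \<Rightarrow> complex"
  assumes \<phi>: "continuous_map (rank_one_topology w a) euclidean \<phi>" and y: "y \<in> rank_one_space w a" and e: "e > 0"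
  shows "\<exists>L. \<forall>z\<in>rank_one_space w a. (\<forall>m\<in>{1..L}. z m = y m) \<longrightarrow> norm (\<phi> z - \<phi> y) < e"
proof -
  have "openin (rank_one_topology w a) {z \<in> topspace (rank_one_topology w a). \<phi> z \<in> ball (\<phi> y) e}"
    by (rule openin_continuous_map_preimage[OF \<phi>]) (simp add: open_openin[symmetric])
  then obtain T where T: "openin full_shift T" "{z \<in> rank_one_space w a. \<phi> z \<in> ball (\<phi> y) e} = T \<inter> rank_one_space w a"
    unfolding topspace_rank_one_topology unfolding rank_one_topology_def openin_subtopology by blast
  have "y \<in> {z \<in> rank_one_space w a. \<phi> z \<in> ball (\<phi> y) e}" using y e by simp
  then have yT: "y \<in> T" unfolding T(2) by (rule IntD1)
  obtain U where U: "finite {i \<in> {1..}. U i \<noteq> topspace (discrete_topology {0, 1 :: nat})}" "y \<in> PiE {1..} U" "PiE {1..} U \<subseteq> T"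
    using bspec[OF T(1)[unfolded openin_product_topology_alt] yT] by blast
  obtain L where L: "\<And>i. i \<in> {i \<in> {1..}. U i \<noteq> topspace (discrete_topology {0, 1 :: nat})} \<Longrightarrow> i < L"
    using U(1) finite_nat_set_iff_bounded by auto
  have "norm (\<phi> z - \<phi> y) < e" if z: "z \<in> rank_one_space w a" "\<forall>m\<in>{1..L}. z m = y m" for z
  proof -
    have zP: "z \<in> {1..} \<rightarrow>\<^sub>E {0, 1}" using z(1) by (simp add: rank_one_space_def)
    have "z i \<in> U i" if i: "i \<in> {1..}" for i
    proof (cases "U i = topspace (discrete_topology {0, 1 :: nat})")
      case True
      then show ?thesis using PiE_mem[OF zP i] by simp
    next
      case False
      then have "i \<in> {1..L}" using L[of i] i by auto
      then show ?thesis using z(2) PiE_mem[OF U(2) i] by simp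
    qed
    moreover have "z \<in> extensional {1..}" using zP by (simp add: PiE_def)
    ultimately have "z \<in> PiE {1..} U" by (simp add: PiE_iff)
    then have "z \<in> T" using U(3) by blast
    then have "z \<in> T \<inter> rank_one_space w a" using z(1) by (rule IntI)
    then have "\<phi> z \<in> ball (\<phi> y) e" unfolding T(2)[symmetric] by simp
    then show ?thesis by (simp add: dist_norm norm_minus_commute)
  qed
  then show ?thesis by blast
qed

text \<open>Compactness gives a finite subcover by cylinders on which \<phi> is nearly constant; the
  sum of their lengths serves as a common length.\<close>

lemma continuous_uniformly_cylindrical:
  fixes \<phi> :: "(nat \<Rightarrow> nat) \<Rightarrow> complex"
  assumes \<phi>: "continuous_map (rank_one_topology w a) euclidean \<phi>" and e: "e > 0"
  obtains L where "\<And>z z'. z \<in> rank_one_space w a \<Longrightarrow> z' \<in> rank_one_space w a \<Longrightarrow> (\<And>m. m \<in> {1..L} \<Longrightarrow> z m = z' m)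
    \<Longrightarrow> norm (\<phi> z - \<phi> z') \<le> e"
proof -
  let ?X = "rank_one_space w a"
  have "\<forall>y\<in>?X. \<exists>L. \<forall>z\<in>?X. (\<forall>m\<in>{1..L}. z m = y m) \<longrightarrow> norm (\<phi> z - \<phi> y) < e / 2"
    using continuous_locally_cylindrical[OF \<phi>, of _ "e / 2"] half_gt_zero[OF e] by blast
  then obtain l where l: "\<And>y z. y \<in> ?X \<Longrightarrow> z \<in> ?X \<Longrightarrow> (\<forall>m\<in>{1..l y}. z m = y m) \<Longrightarrow> norm (\<phi> z - \<phi> y) < e / 2"
    unfolding bchoice_iff by blast
  define U where "U = (\<lambda>y. {z \<in> {1..} \<rightarrow>\<^sub>E {0, 1 :: nat}. \<forall>m\<in>{1..l y}. z m = y m})"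
  have XP: "?X \<subseteq> {1..} \<rightarrow>\<^sub>E {0, 1}" by (auto simp: rank_one_space_def)
  have "\<exists>\<F>. finite \<F> \<and> \<F> \<subseteq> U ` ?X \<and> ?X \<subseteq> \<Union>\<F>"
  proof (rule compactinD[OF compactin_rank_one_space])
    show "openin full_shift T" if "T \<in> U ` ?X" for T using that XP openin_cylinder unfolding U_def by blast
    show "?X \<subseteq> \<Union> (U ` ?X)" using XP unfolding U_def by auto
  qed
  then obtain Y where Y: "finite Y" "Y \<subseteq> ?X" "?X \<subseteq> \<Union> (U ` Y)" by (metis finite_subset_image)
  define L where "L = (\<Sum>y\<in>Y. l y)"
  have "norm (\<phi> z - \<phi> z') \<le> e" if z: "z \<in> ?X" "z' \<in> ?X" and zz: "\<And>m. m \<in> {1..L} \<Longrightarrow> z m = z' m" for z z'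
  proof -
    obtain y where y: "y \<in> Y" "z \<in> U y" using Y(3) z(1) by blast
    have yX: "y \<in> ?X" using y(1) Y(2) by blast
    have "l y \<le> L" unfolding L_def using Y(1) y(1) by (intro member_le_sum) auto
    then have "z m = y m" "z' m = y m" if "m \<in> {1..l y}" for m
      using y(2) zz[of m] that unfolding U_def by auto
    then have "norm (\<phi> z - \<phi> y) < e / 2" "norm (\<phi> z' - \<phi> y) < e / 2"
      by (intro l[OF yX z(1)] l[OF yX z(2)] ballI; blast)+
    then show ?thesis using norm_triangle_sub_through[of "\<phi> z" "\<phi> z'" "\<phi> y"] norm_minus_commute[of "\<phi> z'" "\<phi> y"] by linarith
  qed
  then show ?thesis by (rule that)
qed

text \<open>\<phi> is sampled at one representative of each word of length L that begins a point of
  the space. These words are finitely many, whence the bound B.\<close>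

lemma continuous_cylinder_approximation:
  fixes \<phi> :: "(nat \<Rightarrow> nat) \<Rightarrow> complex"
  assumes \<phi>: "continuous_map (rank_one_topology w a) euclidean \<phi>" and e: "e > 0"
  obtains L F B where "B > 0" "\<And>u. norm (F u) \<le> B" "\<And>z. z \<in> rank_one_space w a \<Longrightarrow> norm (\<phi> z - F (map z [1..<1 + L])) \<le> e"
proof -
  let ?X = "rank_one_space w a"
  obtain L where L: "\<And>z z'. z \<in> ?X \<Longrightarrow> z' \<in> ?X \<Longrightarrow> (\<And>m. m \<in> {1..L} \<Longrightarrow> z m = z' m) \<Longrightarrow> norm (\<phi> z - \<phi> z') \<le> e"
    by (rule continuous_uniformly_cylindrical[OF \<phi> e]) blast
  define D where "D = (\<lambda>z. map z [1..<1 + L]) ` ?X"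
  have "D \<subseteq> {u. set u \<subseteq> {0, 1} \<and> length u = L}"
  proof
    fix u assume "u \<in> D"
    then obtain z where z: "z \<in> ?X" "u = map z [1..<1 + L]" unfolding D_def by blast
    have "z \<in> {1..} \<rightarrow>\<^sub>E {0, 1}" using z(1) by (simp add: rank_one_space_def)
    then have "z ` {1..<1 + L} \<subseteq> {0, 1}" using PiE_mem by fastforce
    then show "u \<in> {u. set u \<subseteq> {0, 1} \<and> length u = L}" unfolding z(2) by (simp del: upt_Suc)
  qed
  then have finD: "finite D" by (rule finite_subset) (rule finite_lists_length_eq, simp)
  define r where "r = (\<lambda>u. SOME z. z \<in> ?X \<and> map z [1..<1 + L] = u)"
  have r: "r u \<in> ?X \<and> map (r u) [1..<1 + L] = u" if "u \<in> D" for u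
  proof -
    obtain z where "z \<in> ?X" "u = map z [1..<1 + L]" using \<open>u \<in> D\<close> unfolding D_def by (rule imageE)
    then have "\<exists>z. z \<in> ?X \<and> map z [1..<1 + L] = u" by blast
    then show ?thesis unfolding r_def by (rule someI_ex)
  qed
  define F where "F = (\<lambda>u. if u \<in> D then \<phi> (r u) else 0)"
  define B where "B = 1 + (\<Sum>u\<in>D. norm (\<phi> (r u)))"
  have Fb: "norm (F u) \<le> B" for u
  proof (cases "u \<in> D")
    case True
    then have "norm (\<phi> (r u)) \<le> (\<Sum>u\<in>D. norm (\<phi> (r u)))" using finD by (intro member_le_sum) auto
    then show ?thesis using True by (simp add: F_def B_def)
  qed (simp add: F_def B_def sum_nonneg add_nonneg_nonneg)
  have close: "norm (\<phi> z - F (map z [1..<1 + L])) \<le> e" if z: "z \<in> ?X" for z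
  proof -
    have D: "map z [1..<1 + L] \<in> D" using z unfolding D_def by blast
    have "map (r (map z [1..<1 + L])) [1..<1 + L] = map z [1..<1 + L]" using r[OF D] by blast
    then have zr: "z m = r (map z [1..<1 + L]) m" if "m \<in> {1..L}" for m using that unfolding map_eq_conv by (simp del: upt_Suc)
    have "norm (\<phi> z - \<phi> (r (map z [1..<1 + L]))) \<le> e" by (rule L[OF z conjunct1[OF r[OF D]] zr])
    then show ?thesis unfolding F_def if_P[OF D] .
  qed
  have "B > 0" unfolding B_def by (simp add: sum_nonneg add_pos_nonneg)
  then show ?thesis by (rule that[OF _ Fb close])
qed

theorem theorem1:
  fixes w :: "nat \<Rightarrow> nat" and a :: "nat \<Rightarrow> nat \<Rightarrow> nat" and C :: real
  assumes w_pos: "\<And>n. w n > 0"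
    and a_pos: "\<And>n j. 1 \<le> j \<Longrightarrow> j \<le> w n - 1 \<Longrightarrow> a n j > 0"
    and finite_measure:
      "summable (\<lambda>k. let n = Suc k in
         1 / (real (w n) * real (rank_one_height w a n)) * (\<Sum>j=1..w n - 1. real (a n j)))"
    and w_bounded: "\<And>n. real (w n) < C"
    and a_bounded: "\<And>n j. 1 \<le> j \<Longrightarrow> j \<le> w n - 1 \<Longrightarrow> real (a n j) < C"
  shows "moebius_orthogonal (rank_one_topology w a) shift"
  unfolding moebius_orthogonal_def topspace_rank_one_topology
proof (intro allI impI ballI)
  fix \<phi> :: "(nat \<Rightarrow> nat) \<Rightarrow> complex" and x
  assume \<phi>: "continuous_map (rank_one_topology w a) euclidean \<phi>" and x: "x \<in> rank_one_space w a"
  \<comment> \<open>The mere existence of the point x excludes the degenerate case.\<close>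
  have inf: "infinite {n. w n \<ge> 2}" using rank_one_space_empty[of w a] w_pos x by blast
  define e where "e = enumerate {n. w n \<ge> 2}"
  define G where "G = nat \<lceil>C\<rceil>"
  have G: "m \<le> G" if "real m < C" for m using that real_nat_ceiling_ge[of C] unfolding G_def by linarith
  interpret tower "\<lambda>k. w (e k)" "\<lambda>k. a (e k)" G
  proof
    show "w (e n) \<ge> 2" for n using enumerate_in_set[OF inf, of n] unfolding e_def by simp
    show "w (e n) \<le> G" for n by (rule G[OF w_bounded])
    show "a (e n) j \<le> G" if "1 \<le> j" "j < w (e n)" for n j by (rule G[OF a_bounded]) (use that in auto)
  qed
  have sub: "\<exists>m. sublist (map x [1..<Suc K]) (rank_one_word (\<lambda>k. w (e k)) (\<lambda>k. a (e k)) m)" for K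
  proof -
    \<comment> \<open>The space prescribes blocks with s < t, that is, of at least two letters; so K
      + 2 letters are requested and cut down to K.\<close>
    have "1 \<le> (1 :: nat)" "1 < K + 2" by simp_all
    then obtain n where n: "sublist (map x [1..<Suc (K + 2)]) (rank_one_word w a n)"
      using x unfolding rank_one_space_def by blast
    have "sublist (map x [1..<Suc K]) (map x [1..<Suc (K + 2)])"
      unfolding sublist_def using upt_add_eq_append[of 1 "Suc K" 2]
      by (intro exI[of _ "[]"] exI[of _ "map x [Suc K..<Suc K + 2]"]) (simp add: map_append[symmetric] del: upt_Suc map_append)
    then have "sublist (map x [1..<Suc K]) (rank_one_word w a n)" using n by (rule sublist_order.order_trans)
    then show ?thesis using rank_one_word_skip[OF inf w_pos, of a n] unfolding e_def by metis
  qed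
  have "moebius_null (\<lambda>n. \<phi> ((shift ^^ n) x))"
  proof (rule moebius_null_approx)
    fix \<epsilon> :: real assume "\<epsilon> > 0"
    then obtain L F B where F: "B > 0" "\<And>u. norm (F u) \<le> B"
      "\<And>z. z \<in> rank_one_space w a \<Longrightarrow> norm (\<phi> z - F (map z [1..<1 + L])) \<le> \<epsilon>"
      by (rule continuous_cylinder_approximation[OF \<phi>]) blast
    have "moebius_null (\<lambda>n. (\<lambda>u. F u / of_real B) (map x [n + 1..<n + 1 + L]))"
      by (rule moebius_null_cylinder[OF _ sub]) (use F(1,2) in \<open>simp add: norm_divide divide_le_eq\<close>)
    then have "moebius_null (\<lambda>n. of_real B * (F (map x [n + 1..<n + 1 + L]) / of_real B))"
      by (rule moebius_null_cmult)
    then have null: "moebius_null (\<lambda>n. F (map x [n + 1..<n + 1 + L]))" using F(1) by simp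
    have "norm (\<phi> ((shift ^^ n) x) - F (map x [n + 1..<n + 1 + L])) \<le> \<epsilon>" for n
    proof -
      have "map x [n + 1..<n + 1 + L] = map ((shift ^^ n) x) [1..<1 + L]"
        by (intro nth_equalityI) (auto simp: funpow_shift ac_simps simp del: upt_Suc)
      then show ?thesis using F(3)[OF funpow_shift_rank_one_space[OF x, of n]] by (simp only:)
    qed
    with null show "\<exists>g. moebius_null g \<and> (\<forall>n. norm (\<phi> ((shift ^^ n) x) - g n) \<le> \<epsilon>)" by blast
  qed
  then show "(\<lambda>N. 1 / of_nat N * (\<Sum>n=1..N. of_int (moebius_mu n) * \<phi> ((shift ^^ n) x))) \<longlonglongrightarrow> 0"
    unfolding moebius_null_def .
qed

end
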